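(* Let $n\geq 5$ be a natural number and let $\mathcal{C}$ be a fusion category over $k$. Suppose that $\mathcal{C}$ is Grothendieck equivalent to the category $\operatorname{Rep}\mathbb{S}_n$ of finite-dimensional representations over $k$ of the symmetric group $\mathbb{S}_n$. Then $\mathcal{C}$ is not solvable.
   Context: $k$ is an algebraically closed field of characteristic zero. A fusion category over $k$ is a semisimple rigid $k$-linear monoidal category with finitely many isomorphism classes of simple objects, finite-dimensional Hom spaces and simple unit object $\mathbf{1}$. $\operatorname{Irr}(\mathcal{C})$ is the set of isomorphism classes of simple objects, and the fusion rules are $N_{X,Y}^Z=\dim\operatorname{Hom}(Z,X\otimes Y)$ for $X,Y,Z\in\operatorname{Irr}(\mathcal{C})$. Grothendieck equivalence: $\mathcal{C}$ and $\tilde{\mathcal{C}}$ are Grothendieck equivalent if there is a bijection $f:\operatorname{Irr}(\mathcal{C})\to\operatorname{Irr}(\tilde{\mathcal{C}})$ with $f(\mathbf{1})=\mathbf{1}$ and $N_{f(X),f(Y)}^{f(Z)}=N_{X,Y}^Z$ for all $X,Y,Z\in\operatorname{Irr}(\mathcal{C})$. Solvability: for a finite group $G$, $\mathcal{C}$ is a $G$-extension of $\mathcal{D}$ if there is a decomposition $\mathcal{C}=\bigoplus_{g\in G}\mathcal{C}_g$ with all $\mathcal{C}_g\ne 0$, $\mathcal{C}_g\otimes\mathcal{C}_h\subseteq\mathcal{C}_{gh}$, $\mathcal{C}_g^*\subseteq \mathcal{C}_{g^{-1}}$ and $\mathcal{C}_e\cong\mathcal{D}$. If $G$ acts on $\mathcal{D}$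 by tensor autoequivalences $\rho$, the $G$-equivariantization $\mathcal{D}^G$ is the fusion category of pairs $(X,(\mu^g)_{g\in G})$ with isomorphisms $\mu^g:\rho^g(X)\to X$ compatible with the action. $\mathcal{C}$ is solvable if there are fusion categories $\mathrm{Vect}=\mathcal{C}_0,\dots,\mathcal{C}_n=\mathcal{C}$, $n\ge0$, and cyclic groups of prime order $G_1,\dots,G_n$ such that each $\mathcal{C}_i$ is a $G_i$-equivariantization or a $G_i$-extension of $\mathcal{C}_{i-1}$. *)

theory Defs
  imports
    "HOL-Algebra.Sym_Groups"
    "HOL-Algebra.Elementary_Groups"
    "HOL-Computational_Algebra.Polynomial"
    "HOL-Library.Function_Algebras"
    "HOL-Library.Nat_Bijection"
begin

section \<open>Linear categories with a tensor product\<close>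

text \<open>
  Raw data of a k-linear monoidal category, with k the type \<^typ>\<open>'k\<close>. All morphisms live in one
  ambient k-vector space \<^typ>\<open>'m\<close> (with scalar multiplication \<open>scl\<close>), of which the sets
  \<open>Hom C X Y\<close> are subspaces; distinct Hom spaces may overlap. Every small k-linear monoidal category
  has, up to isomorphism, this form: take for \<^typ>\<open>'m\<close> the direct sum of all its Hom spaces and
  extend composition and tensor product of morphisms bilinearly, by 0 where they are undefined.
  The operations are only constrained on \<open>Ob C\<close> and on the relevant Hom spaces. Composition
  \<open>g \<cdot> f\<close> is written in the order of functions; \<open>asc X Y Z\<close> goes from \<open>(X \<boxtimes> Y) \<boxtimes> Z\<close> to
  \<open>X \<boxtimes> (Y \<boxtimes> Z)\<close>.
\<close>

record ('k, 'o, 'm) moncat =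
  Ob :: "'o set"
  Hom :: "'o \<Rightarrow> 'o \<Rightarrow> 'm set"
  idm :: "'o \<Rightarrow> 'm"
  cmp :: "'m \<Rightarrow> 'm \<Rightarrow> 'm" (infixr "\<cdot>\<index>" 75)
  scl :: "'k \<Rightarrow> 'm \<Rightarrow> 'm"
  tenO :: "'o \<Rightarrow> 'o \<Rightarrow> 'o" (infixr "\<boxtimes>\<index>" 80)
  tenM :: "'m \<Rightarrow> 'm \<Rightarrow> 'm" (infixr "\<star>\<index>" 80)
  unitO :: "'o"
  asc :: "'o \<Rightarrow> 'o \<Rightarrow> 'o \<Rightarrow> 'm"
  lun :: "'o \<Rightarrow> 'm"
  run :: "'o \<Rightarrow> 'm"

locale linear_category =
  fixes C :: "('k::field, 'o, 'm::ab_group_add) moncat" (structure)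
  assumes vector_space: "vector_space (scl C)"
    and subspace_Hom: "\<lbrakk>X \<in> Ob C; Y \<in> Ob C\<rbrakk> \<Longrightarrow> module.subspace (scl C) (Hom C X Y)"
    and idm_Hom: "X \<in> Ob C \<Longrightarrow> idm C X \<in> Hom C X X"
    and cmp_Hom: "\<lbrakk>X \<in> Ob C; Y \<in> Ob C; Z \<in> Ob C; f \<in> Hom C X Y; g \<in> Hom C Y Z\<rbrakk>
      \<Longrightarrow> g \<cdot> f \<in> Hom C X Z"
    and cmp_idm_right: "\<lbrakk>X \<in> Ob C; Y \<in> Ob C; f \<in> Hom C X Y\<rbrakk> \<Longrightarrow> f \<cdot> idm C X = f"
    and cmp_idm_left: "\<lbrakk>X \<in> Ob C; Y \<in> Ob C; f \<in> Hom C X Y\<rbrakk> \<Longrightarrow> idm C Y \<cdot> f = f"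
    and cmp_assoc: "\<lbrakk>W \<in> Ob C; X \<in> Ob C; Y \<in> Ob C; Z \<in> Ob C;
        f \<in> Hom C W X; g \<in> Hom C X Y; h \<in> Hom C Y Z\<rbrakk> \<Longrightarrow> (h \<cdot> g) \<cdot> f = h \<cdot> (g \<cdot> f)"
    and cmp_add_left: "\<lbrakk>X \<in> Ob C; Y \<in> Ob C; Z \<in> Ob C;
        f \<in> Hom C X Y; g \<in> Hom C Y Z; g' \<in> Hom C Y Z\<rbrakk> \<Longrightarrow> (g + g') \<cdot> f = g \<cdot> f + g' \<cdot> f"
    and cmp_add_right: "\<lbrakk>X \<in> Ob C; Y \<in> Ob C; Z \<in> Ob C;
        f \<in> Hom C X Y; f' \<in> Hom C X Y; g \<in> Hom C Y Z\<rbrakk> \<Longrightarrow> g \<cdot> (f + f') = g \<cdot> f + g \<cdot> f'"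
    and cmp_scl_left: "\<lbrakk>X \<in> Ob C; Y \<in> Ob C; Z \<in> Ob C; f \<in> Hom C X Y; g \<in> Hom C Y Z\<rbrakk>
      \<Longrightarrow> scl C a g \<cdot> f = scl C a (g \<cdot> f)"
    and cmp_scl_right: "\<lbrakk>X \<in> Ob C; Y \<in> Ob C; Z \<in> Ob C; f \<in> Hom C X Y; g \<in> Hom C Y Z\<rbrakk>
      \<Longrightarrow> g \<cdot> scl C a f = scl C a (g \<cdot> f)"

definition hom_dim :: "('k::field, 'o, 'm::ab_group_add) moncat \<Rightarrow> 'o \<Rightarrow> 'o \<Rightarrow> nat"
  where "hom_dim C X Y = vector_space.dim (scl C) (Hom C X Y)"

definition mutually_inverse ::
    "('k, 'o, 'm) moncat \<Rightarrow> 'o \<Rightarrow> 'o \<Rightarrow> 'm \<Rightarrow> 'm \<Rightarrow> bool"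
  where "mutually_inverse C X Y f g \<longleftrightarrow> f \<in> Hom C X Y \<and> g \<in> Hom C Y X \<and>
    g \<cdot>\<^bsub>C\<^esub> f = idm C X \<and> f \<cdot>\<^bsub>C\<^esub> g = idm C Y"

definition isomorphism :: "('k, 'o, 'm) moncat \<Rightarrow> 'o \<Rightarrow> 'o \<Rightarrow> 'm \<Rightarrow> bool"
  where "isomorphism C X Y f \<longleftrightarrow> (\<exists>g. mutually_inverse C X Y f g)"

definition inverse_of :: "('k, 'o, 'm) moncat \<Rightarrow> 'o \<Rightarrow> 'o \<Rightarrow> 'm \<Rightarrow> 'm"
  where "inverse_of C X Y f = (THE g. mutually_inverse C X Y f g)"

definition isomorphic :: "('k, 'o, 'm) moncat \<Rightarrow> 'o \<Rightarrow> 'o \<Rightarrow> bool"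
  where "isomorphic C X Y \<longleftrightarrow> X \<in> Ob C \<and> Y \<in> Ob C \<and> (\<exists>f. isomorphism C X Y f)"

definition zero_object :: "('k, 'o, 'm::zero) moncat \<Rightarrow> 'o \<Rightarrow> bool"
  where "zero_object C Z \<longleftrightarrow> Z \<in> Ob C \<and> (\<forall>X\<in>Ob C. Hom C X Z = {0} \<and> Hom C Z X = {0})"

definition direct_sum ::
    "('k, 'o, 'm::comm_monoid_add) moncat \<Rightarrow> 'i set \<Rightarrow> ('i \<Rightarrow> 'o) \<Rightarrow> 'o \<Rightarrow>
     ('i \<Rightarrow> 'm) \<Rightarrow> ('i \<Rightarrow> 'm) \<Rightarrow> bool"
  where "direct_sum C I S X \<iota> \<pi> \<longleftrightarrow> finite I \<and> X \<in> Ob C \<and>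
    (\<forall>i\<in>I. S i \<in> Ob C \<and> \<iota> i \<in> Hom C (S i) X \<and> \<pi> i \<in> Hom C X (S i)) \<and>
    (\<forall>i\<in>I. \<forall>j\<in>I. \<pi> i \<cdot>\<^bsub>C\<^esub> \<iota> j = (if i = j then idm C (S i) else 0)) \<and>
    (\<Sum>i\<in>I. \<iota> i \<cdot>\<^bsub>C\<^esub> \<pi> i) = idm C X"

definition is_mono :: "('k, 'o, 'm) moncat \<Rightarrow> 'o \<Rightarrow> 'o \<Rightarrow> 'm \<Rightarrow> bool"
  where "is_mono C X Y f \<longleftrightarrow> f \<in> Hom C X Y \<and>
    (\<forall>W\<in>Ob C. \<forall>g\<in>Hom C W X. \<forall>h\<in>Hom C W X. f \<cdot>\<^bsub>C\<^esub> g = f \<cdot>\<^bsub>C\<^esub> h \<longrightarrow> g = h)"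

definition is_epi :: "('k, 'o, 'm) moncat \<Rightarrow> 'o \<Rightarrow> 'o \<Rightarrow> 'm \<Rightarrow> bool"
  where "is_epi C X Y f \<longleftrightarrow> f \<in> Hom C X Y \<and>
    (\<forall>W\<in>Ob C. \<forall>g\<in>Hom C Y W. \<forall>h\<in>Hom C Y W. g \<cdot>\<^bsub>C\<^esub> f = h \<cdot>\<^bsub>C\<^esub> f \<longrightarrow> g = h)"

definition is_kernel :: "('k, 'o, 'm::zero) moncat \<Rightarrow> 'o \<Rightarrow> 'o \<Rightarrow> 'm \<Rightarrow> 'o \<Rightarrow> 'm \<Rightarrow> bool"
  where "is_kernel C X Y f K \<kappa> \<longleftrightarrow> K \<in> Ob C \<and> \<kappa> \<in> Hom C K X \<and> f \<cdot>\<^bsub>C\<^esub> \<kappa> = 0 \<and>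
    (\<forall>W\<in>Ob C. \<forall>g\<in>Hom C W X. f \<cdot>\<^bsub>C\<^esub> g = 0 \<longrightarrow> (\<exists>!u. u \<in> Hom C W K \<and> \<kappa> \<cdot>\<^bsub>C\<^esub> u = g))"

definition is_cokernel :: "('k, 'o, 'm::zero) moncat \<Rightarrow> 'o \<Rightarrow> 'o \<Rightarrow> 'm \<Rightarrow> 'o \<Rightarrow> 'm \<Rightarrow> bool"
  where "is_cokernel C X Y f Q \<kappa> \<longleftrightarrow> Q \<in> Ob C \<and> \<kappa> \<in> Hom C Y Q \<and> \<kappa> \<cdot>\<^bsub>C\<^esub> f = 0 \<and>
    (\<forall>W\<in>Ob C. \<forall>g\<in>Hom C Y W. g \<cdot>\<^bsub>C\<^esub> f = 0 \<longrightarrow> (\<exists>!u. u \<in> Hom C Q W \<and> u \<cdot>\<^bsub>C\<^esub> \<kappa> = g))"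

locale abelian_category = linear_category +
  assumes zero: "\<exists>Z. zero_object C Z"
    and biproducts: "\<lbrakk>X \<in> Ob C; Y \<in> Ob C\<rbrakk>
      \<Longrightarrow> \<exists>P \<iota> \<pi>. direct_sum C (UNIV :: bool set) (\<lambda>b. if b then X else Y) P \<iota> \<pi>"
    and kernels: "\<lbrakk>X \<in> Ob C; Y \<in> Ob C; f \<in> Hom C X Y\<rbrakk> \<Longrightarrow> \<exists>K \<kappa>. is_kernel C X Y f K \<kappa>"
    and cokernels: "\<lbrakk>X \<in> Ob C; Y \<in> Ob C; f \<in> Hom C X Y\<rbrakk> \<Longrightarrow> \<exists>Q \<kappa>. is_cokernel C X Y f Q \<kappa>"
    and mono_is_kernel: "\<lbrakk>X \<in> Ob C; Y \<in> Ob C; is_mono C X Y f\<rbrakk>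
      \<Longrightarrow> \<exists>Z g. Z \<in> Ob C \<and> g \<in> Hom C Y Z \<and> is_kernel C Y Z g X f"
    and epi_is_cokernel: "\<lbrakk>X \<in> Ob C; Y \<in> Ob C; is_epi C X Y f\<rbrakk>
      \<Longrightarrow> \<exists>Z g. Z \<in> Ob C \<and> g \<in> Hom C Z X \<and> is_cokernel C Z X g Y f"

definition simple_object :: "('k, 'o, 'm::zero) moncat \<Rightarrow> 'o \<Rightarrow> bool"
  where "simple_object C X \<longleftrightarrow> X \<in> Ob C \<and> \<not> zero_object C X \<and>
    (\<forall>Y\<in>Ob C. \<forall>f. is_mono C Y X f \<longrightarrow> zero_object C Y \<or> isomorphism C Y X f)"

text \<open>Isomorphism classes of simple objects.\<close>

definition iso_class :: "('k, 'o, 'm) moncat \<Rightarrow> 'o \<Rightarrow> 'o set"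
  where "iso_class C X = {Y. isomorphic C X Y}"

definition Irr :: "('k, 'o, 'm::zero) moncat \<Rightarrow> 'o set set"
  where "Irr C = iso_class C ` {X. simple_object C X}"

locale semisimple_category = abelian_category +
  assumes semisimple: "X \<in> Ob C \<Longrightarrow>
    \<exists>(n::nat) S \<iota> \<pi>. (\<forall>i<n. simple_object C (S i)) \<and> direct_sum C {..<n} S X \<iota> \<pi>"

locale monoidal_category = linear_category +
  assumes unitO_Ob: "unitO C \<in> Ob C"
    and tenO_Ob: "\<lbrakk>X \<in> Ob C; Y \<in> Ob C\<rbrakk> \<Longrightarrow> X \<boxtimes> Y \<in> Ob C"
    and tenM_Hom: "\<lbrakk>X \<in> Ob C; X' \<in> Ob C; Y \<in> Ob C; Y' \<in> Ob C; f \<in> Hom C X X'; g \<in> Hom C Y Y'\<rbrakk>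
      \<Longrightarrow> f \<star> g \<in> Hom C (X \<boxtimes> Y) (X' \<boxtimes> Y')"
    and tenM_idm: "\<lbrakk>X \<in> Ob C; Y \<in> Ob C\<rbrakk> \<Longrightarrow> idm C X \<star> idm C Y = idm C (X \<boxtimes> Y)"
    and tenM_cmp: "\<lbrakk>X \<in> Ob C; X' \<in> Ob C; X'' \<in> Ob C; Y \<in> Ob C; Y' \<in> Ob C; Y'' \<in> Ob C;
        f \<in> Hom C X X'; f' \<in> Hom C X' X''; g \<in> Hom C Y Y'; g' \<in> Hom C Y' Y''\<rbrakk>
      \<Longrightarrow> (f' \<cdot> f) \<star> (g' \<cdot> g) = (f' \<star> g') \<cdot> (f \<star> g)"
    and tenM_add_left: "\<lbrakk>X \<in> Ob C; X' \<in> Ob C; Y \<in> Ob C; Y' \<in> Ob C;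
        f \<in> Hom C X X'; f' \<in> Hom C X X'; g \<in> Hom C Y Y'\<rbrakk> \<Longrightarrow> (f + f') \<star> g = f \<star> g + f' \<star> g"
    and tenM_add_right: "\<lbrakk>X \<in> Ob C; X' \<in> Ob C; Y \<in> Ob C; Y' \<in> Ob C;
        f \<in> Hom C X X'; g \<in> Hom C Y Y'; g' \<in> Hom C Y Y'\<rbrakk> \<Longrightarrow> f \<star> (g + g') = f \<star> g + f \<star> g'"
    and tenM_scl_left: "\<lbrakk>X \<in> Ob C; X' \<in> Ob C; Y \<in> Ob C; Y' \<in> Ob C;
        f \<in> Hom C X X'; g \<in> Hom C Y Y'\<rbrakk> \<Longrightarrow> scl C a f \<star> g = scl C a (f \<star> g)"
    and tenM_scl_right: "\<lbrakk>X \<in> Ob C; X' \<in> Ob C; Y \<in> Ob C; Y' \<in> Ob C;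
        f \<in> Hom C X X'; g \<in> Hom C Y Y'\<rbrakk> \<Longrightarrow> f \<star> scl C a g = scl C a (f \<star> g)"
    and asc_iso: "\<lbrakk>X \<in> Ob C; Y \<in> Ob C; Z \<in> Ob C\<rbrakk>
      \<Longrightarrow> isomorphism C ((X \<boxtimes> Y) \<boxtimes> Z) (X \<boxtimes> (Y \<boxtimes> Z)) (asc C X Y Z)"
    and asc_natural: "\<lbrakk>X \<in> Ob C; X' \<in> Ob C; Y \<in> Ob C; Y' \<in> Ob C; Z \<in> Ob C; Z' \<in> Ob C;
        f \<in> Hom C X X'; g \<in> Hom C Y Y'; h \<in> Hom C Z Z'\<rbrakk>
      \<Longrightarrow> asc C X' Y' Z' \<cdot> ((f \<star> g) \<star> h) = (f \<star> (g \<star> h)) \<cdot> asc C X Y Z"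
    and lun_iso: "X \<in> Ob C \<Longrightarrow> isomorphism C (unitO C \<boxtimes> X) X (lun C X)"
    and lun_natural: "\<lbrakk>X \<in> Ob C; Y \<in> Ob C; f \<in> Hom C X Y\<rbrakk>
      \<Longrightarrow> lun C Y \<cdot> (idm C (unitO C) \<star> f) = f \<cdot> lun C X"
    and run_iso: "X \<in> Ob C \<Longrightarrow> isomorphism C (X \<boxtimes> unitO C) X (run C X)"
    and run_natural: "\<lbrakk>X \<in> Ob C; Y \<in> Ob C; f \<in> Hom C X Y\<rbrakk>
      \<Longrightarrow> run C Y \<cdot> (f \<star> idm C (unitO C)) = f \<cdot> run C X"
    and pentagon: "\<lbrakk>W \<in> Ob C; X \<in> Ob C; Y \<in> Ob C; Z \<in> Ob C\<rbrakk>
      \<Longrightarrow> (idm C W \<star> asc C X Y Z) \<cdot> asc C W (X \<boxtimes> Y) Z \<cdot> (asc C W X Y \<star> idm C Z)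
        = asc C W X (Y \<boxtimes> Z) \<cdot> asc C (W \<boxtimes> X) Y Z"
    and triangle: "\<lbrakk>X \<in> Ob C; Y \<in> Ob C\<rbrakk>
      \<Longrightarrow> (idm C X \<star> lun C Y) \<cdot> asc C X (unitO C) Y = run C X \<star> idm C Y"

text \<open>\<open>left_dual C X Y\<close>: the object \<open>Y\<close> is a (left) dual of \<open>X\<close>, with evaluation \<open>Y \<boxtimes> X \<rightarrow> 1\<close> and
  coevaluation \<open>1 \<rightarrow> X \<boxtimes> Y\<close>. Equivalently, \<open>X\<close> is a right dual of \<open>Y\<close>.\<close>

definition left_dual :: "('k, 'o, 'm) moncat \<Rightarrow> 'o \<Rightarrow> 'o \<Rightarrow> bool"
  where "left_dual C X Y \<longleftrightarrow> X \<in> Ob C \<and> Y \<in> Ob C \<and>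
    (\<exists>ev \<in> Hom C (Y \<boxtimes>\<^bsub>C\<^esub> X) (unitO C). \<exists>coev \<in> Hom C (unitO C) (X \<boxtimes>\<^bsub>C\<^esub> Y).
      run C X \<cdot>\<^bsub>C\<^esub> (idm C X \<star>\<^bsub>C\<^esub> ev) \<cdot>\<^bsub>C\<^esub> asc C X Y X \<cdot>\<^bsub>C\<^esub> (coev \<star>\<^bsub>C\<^esub> idm C X) = lun C X \<and>
      lun C Y \<cdot>\<^bsub>C\<^esub> (ev \<star>\<^bsub>C\<^esub> idm C Y) \<cdot>\<^bsub>C\<^esub>
        inverse_of C ((Y \<boxtimes>\<^bsub>C\<^esub> X) \<boxtimes>\<^bsub>C\<^esub> Y) (Y \<boxtimes>\<^bsub>C\<^esub> (X \<boxtimes>\<^bsub>C\<^esub> Y)) (asc C Y X Y) \<cdot>\<^bsub>C\<^esub>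
        (idm C Y \<star>\<^bsub>C\<^esub> coev) = run C Y)"

locale fusion_category = semisimple_category + monoidal_category +
  assumes left_rigid: "X \<in> Ob C \<Longrightarrow> \<exists>Y. left_dual C X Y"
    and right_rigid: "X \<in> Ob C \<Longrightarrow> \<exists>Y. left_dual C Y X"
    and finite_Irr: "finite (Irr C)"
    and finite_dim_Hom: "\<lbrakk>X \<in> Ob C; Y \<in> Ob C\<rbrakk>
      \<Longrightarrow> \<exists>B. finite B \<and> B \<subseteq> Hom C X Y \<and> module.span (scl C) B = Hom C X Y"
    and simple_unit: "simple_object C (unitO C)"


section \<open>Grothendieck equivalence\<close>

definition class_rep :: "'o set \<Rightarrow> 'o"
  where "class_rep x = (SOME X. X \<in> x)"

definition fusion_rule ::
    "('k::field, 'o, 'm::ab_group_add) moncat \<Rightarrow> 'o set \<Rightarrow> 'o set \<Rightarrow> 'o set \<Rightarrow> nat"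
  where "fusion_rule C x y z = hom_dim C (class_rep z) (class_rep x \<boxtimes>\<^bsub>C\<^esub> class_rep y)"

definition Grothendieck_equivalent ::
    "('k::field, 'o, 'm::ab_group_add) moncat \<Rightarrow> ('k, 'p, 'w::ab_group_add) moncat \<Rightarrow> bool"
  where "Grothendieck_equivalent C D \<longleftrightarrow>
    (\<exists>f. bij_betw f (Irr C) (Irr D) \<and> f (iso_class C (unitO C)) = iso_class D (unitO D) \<and>
      (\<forall>x\<in>Irr C. \<forall>y\<in>Irr C. \<forall>z\<in>Irr C.
        fusion_rule D (f x) (f y) (f z) = fusion_rule C x y z))"


section \<open>Tensor functors and tensor equivalences\<close>

text \<open>
  A functor carries source and target objects as arguments of its action on morphisms, since Hom
  spaces may overlap. \<open>mulF F X Y\<close> goes from \<open>F X \<boxtimes> F Y\<close> to \<open>F (X \<boxtimes> Y)\<close> and \<open>unF F\<close> from \<open>1\<close> to \<open>F 1\<close>.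
\<close>

record ('o, 'm, 'p, 'w) monfun =
  obF :: "'o \<Rightarrow> 'p"
  morF :: "'o \<Rightarrow> 'o \<Rightarrow> 'm \<Rightarrow> 'w"
  mulF :: "'o \<Rightarrow> 'o \<Rightarrow> 'w"
  unF :: "'w"

locale tensor_functor =
  fixes C :: "('k::field, 'o, 'm::ab_group_add) moncat"
    and D :: "('k, 'p, 'w::ab_group_add) moncat"
    and F :: "('o, 'm, 'p, 'w) monfun"
  assumes obF_Ob: "X \<in> Ob C \<Longrightarrow> obF F X \<in> Ob D"
    and morF_Hom: "\<lbrakk>X \<in> Ob C; Y \<in> Ob C; f \<in> Hom C X Y\<rbrakk> \<Longrightarrow> morF F X Y f \<in> Hom D (obF F X) (obF F Y)"
    and morF_idm: "X \<in> Ob C \<Longrightarrow> morF F X X (idm C X) = idm D (obF F X)"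
    and morF_cmp: "\<lbrakk>X \<in> Ob C; Y \<in> Ob C; Z \<in> Ob C; f \<in> Hom C X Y; g \<in> Hom C Y Z\<rbrakk>
      \<Longrightarrow> morF F X Z (g \<cdot>\<^bsub>C\<^esub> f) = morF F Y Z g \<cdot>\<^bsub>D\<^esub> morF F X Y f"
    and morF_add: "\<lbrakk>X \<in> Ob C; Y \<in> Ob C; f \<in> Hom C X Y; g \<in> Hom C X Y\<rbrakk>
      \<Longrightarrow> morF F X Y (f + g) = morF F X Y f + morF F X Y g"
    and morF_scl: "\<lbrakk>X \<in> Ob C; Y \<in> Ob C; f \<in> Hom C X Y\<rbrakk>
      \<Longrightarrow> morF F X Y (scl C a f) = scl D a (morF F X Y f)"
    and mulF_iso: "\<lbrakk>X \<in> Ob C; Y \<in> Ob C\<rbrakk>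
      \<Longrightarrow> isomorphism D (obF F X \<boxtimes>\<^bsub>D\<^esub> obF F Y) (obF F (X \<boxtimes>\<^bsub>C\<^esub> Y)) (mulF F X Y)"
    and mulF_natural: "\<lbrakk>X \<in> Ob C; X' \<in> Ob C; Y \<in> Ob C; Y' \<in> Ob C; f \<in> Hom C X X'; g \<in> Hom C Y Y'\<rbrakk>
      \<Longrightarrow> mulF F X' Y' \<cdot>\<^bsub>D\<^esub> (morF F X X' f \<star>\<^bsub>D\<^esub> morF F Y Y' g)
        = morF F (X \<boxtimes>\<^bsub>C\<^esub> Y) (X' \<boxtimes>\<^bsub>C\<^esub> Y') (f \<star>\<^bsub>C\<^esub> g) \<cdot>\<^bsub>D\<^esub> mulF F X Y"
    and unF_iso: "isomorphism D (unitO D) (obF F (unitO C)) (unF F)"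
    and mulF_assoc: "\<lbrakk>X \<in> Ob C; Y \<in> Ob C; Z \<in> Ob C\<rbrakk>
      \<Longrightarrow> morF F ((X \<boxtimes>\<^bsub>C\<^esub> Y) \<boxtimes>\<^bsub>C\<^esub> Z) (X \<boxtimes>\<^bsub>C\<^esub> (Y \<boxtimes>\<^bsub>C\<^esub> Z)) (asc C X Y Z) \<cdot>\<^bsub>D\<^esub>
          mulF F (X \<boxtimes>\<^bsub>C\<^esub> Y) Z \<cdot>\<^bsub>D\<^esub> (mulF F X Y \<star>\<^bsub>D\<^esub> idm D (obF F Z))
        = mulF F X (Y \<boxtimes>\<^bsub>C\<^esub> Z) \<cdot>\<^bsub>D\<^esub> (idm D (obF F X) \<star>\<^bsub>D\<^esub> mulF F Y Z) \<cdot>\<^bsub>D\<^esub>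
          asc D (obF F X) (obF F Y) (obF F Z)"
    and unF_left: "X \<in> Ob C
      \<Longrightarrow> morF F (unitO C \<boxtimes>\<^bsub>C\<^esub> X) X (lun C X) \<cdot>\<^bsub>D\<^esub> mulF F (unitO C) X \<cdot>\<^bsub>D\<^esub>
          (unF F \<star>\<^bsub>D\<^esub> idm D (obF F X)) = lun D (obF F X)"
    and unF_right: "X \<in> Ob C
      \<Longrightarrow> morF F (X \<boxtimes>\<^bsub>C\<^esub> unitO C) X (run C X) \<cdot>\<^bsub>D\<^esub> mulF F X (unitO C) \<cdot>\<^bsub>D\<^esub>
          (idm D (obF F X) \<star>\<^bsub>D\<^esub> unF F) = run D (obF F X)"

locale tensor_equivalence = tensor_functor +
  assumes fully_faithful: "\<lbrakk>X \<in> Ob C; Y \<in> Ob C\<rbrakk>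
      \<Longrightarrow> bij_betw (morF F X Y) (Hom C X Y) (Hom D (obF F X) (obF F Y))"
    and essentially_surjective: "Z \<in> Ob D \<Longrightarrow> \<exists>X\<in>Ob C. isomorphic D (obF F X) Z"

definition tensor_equivalent ::
    "('k::field, 'o, 'm::ab_group_add) moncat \<Rightarrow> ('k, 'p, 'w::ab_group_add) moncat \<Rightarrow> bool"
  where "tensor_equivalent C D \<longleftrightarrow> (\<exists>F. tensor_equivalence C D F)"


section \<open>Group extensions\<close>

text \<open>
  A full subcategory is given by its set of objects. The sets \<open>E g\<close> are closed under isomorphism,
  mutually orthogonal, and every object is a direct sum of objects in them; this makes \<open>C\<close> the
  direct sum of the full subcategories on the \<open>E g\<close>.
\<close>

definition graded_decomposition ::
    "('k, 'o, 'm::ab_group_add) moncat \<Rightarrow> 'g set \<Rightarrow> ('g \<Rightarrow> 'o set) \<Rightarrow> bool"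
  where "graded_decomposition C I E \<longleftrightarrow>
    (\<forall>g\<in>I. E g \<subseteq> Ob C \<and> (\<forall>X\<in>E g. \<forall>Y. isomorphic C X Y \<longrightarrow> Y \<in> E g)) \<and>
    (\<forall>g\<in>I. \<forall>h\<in>I. g \<noteq> h \<longrightarrow> (\<forall>X\<in>E g. \<forall>Y\<in>E h. Hom C X Y = {0})) \<and>
    (\<forall>X\<in>Ob C. \<exists>S \<iota> \<pi>. (\<forall>g\<in>I. S g \<in> E g) \<and> direct_sum C I S X \<iota> \<pi>)"

definition is_extension ::
    "'g monoid \<Rightarrow> ('k::field, 'p, 'w::ab_group_add) moncat \<Rightarrow>
     ('k, 'o, 'm::ab_group_add) moncat \<Rightarrow> bool"
  where "is_extension G D C \<longleftrightarrow> group G \<and> finite (carrier G) \<and>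
    (\<exists>E. graded_decomposition C (carrier G) E \<and>
      (\<forall>g\<in>carrier G. \<exists>X\<in>E g. \<not> zero_object C X) \<and>
      (\<forall>g\<in>carrier G. \<forall>h\<in>carrier G. \<forall>X\<in>E g. \<forall>Y\<in>E h. X \<boxtimes>\<^bsub>C\<^esub> Y \<in> E (g \<otimes>\<^bsub>G\<^esub> h)) \<and>
      (\<forall>g\<in>carrier G. \<forall>X\<in>E g. \<forall>Y. left_dual C X Y \<longrightarrow> Y \<in> E (inv\<^bsub>G\<^esub> g)) \<and>
      tensor_equivalent (C\<lparr>Ob := E \<one>\<^bsub>G\<^esub>\<rparr>) D)"


section \<open>Group actions and equivariantization\<close>

text \<open>
  An action of \<open>G\<close> on \<open>D\<close> by tensor autoequivalences: a monoidal functor from \<open>G\<close> (as a discrete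
  monoidal category) to the tensor autoequivalences of \<open>D\<close> and monoidal natural isomorphisms.
  \<open>mulA g h X\<close> goes from \<open>\<rho>\<^sup>g (\<rho>\<^sup>h X)\<close> to \<open>\<rho>\<^sup>g\<^sup>h X\<close>, and \<open>unA X\<close> from \<open>X\<close> to \<open>\<rho>\<^sup>1 X\<close>.
\<close>

record ('g, 'o, 'm) tensor_action =
  rho :: "'g \<Rightarrow> ('o, 'm, 'o, 'm) monfun"
  mulA :: "'g \<Rightarrow> 'g \<Rightarrow> 'o \<Rightarrow> 'm"
  unA :: "'o \<Rightarrow> 'm"

locale group_action_on_category = group G
  for G :: "'g monoid" (structure)
    and D :: "('k::field, 'o, 'm::ab_group_add) moncat"
    and A :: "('g, 'o, 'm) tensor_action" +
  assumes rho: "g \<in> carrier G \<Longrightarrow> tensor_equivalence D D (rho A g)"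
    and mulA_iso: "\<lbrakk>g \<in> carrier G; h \<in> carrier G; X \<in> Ob D\<rbrakk>
      \<Longrightarrow> isomorphism D (obF (rho A g) (obF (rho A h) X)) (obF (rho A (g \<otimes> h)) X) (mulA A g h X)"
    and mulA_natural: "\<lbrakk>g \<in> carrier G; h \<in> carrier G; X \<in> Ob D; Y \<in> Ob D; f \<in> Hom D X Y\<rbrakk>
      \<Longrightarrow> mulA A g h Y \<cdot>\<^bsub>D\<^esub>
          morF (rho A g) (obF (rho A h) X) (obF (rho A h) Y) (morF (rho A h) X Y f)
        = morF (rho A (g \<otimes> h)) X Y f \<cdot>\<^bsub>D\<^esub> mulA A g h X"
    and mulA_tensor: "\<lbrakk>g \<in> carrier G; h \<in> carrier G; X \<in> Ob D; Y \<in> Ob D\<rbrakk>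
      \<Longrightarrow> mulA A g h (X \<boxtimes>\<^bsub>D\<^esub> Y) \<cdot>\<^bsub>D\<^esub>
          morF (rho A g) (obF (rho A h) X \<boxtimes>\<^bsub>D\<^esub> obF (rho A h) Y) (obF (rho A h) (X \<boxtimes>\<^bsub>D\<^esub> Y))
            (mulF (rho A h) X Y) \<cdot>\<^bsub>D\<^esub>
          mulF (rho A g) (obF (rho A h) X) (obF (rho A h) Y)
        = mulF (rho A (g \<otimes> h)) X Y \<cdot>\<^bsub>D\<^esub> (mulA A g h X \<star>\<^bsub>D\<^esub> mulA A g h Y)"
    and mulA_unit: "\<lbrakk>g \<in> carrier G; h \<in> carrier G\<rbrakk>
      \<Longrightarrow> mulA A g h (unitO D) \<cdot>\<^bsub>D\<^esub>
          morF (rho A g) (unitO D) (obF (rho A h) (unitO D)) (unF (rho A h)) \<cdot>\<^bsub>D\<^esub> unF (rho A g)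
        = unF (rho A (g \<otimes> h))"
    and unA_iso: "X \<in> Ob D \<Longrightarrow> isomorphism D X (obF (rho A \<one>) X) (unA A X)"
    and unA_natural: "\<lbrakk>X \<in> Ob D; Y \<in> Ob D; f \<in> Hom D X Y\<rbrakk>
      \<Longrightarrow> unA A Y \<cdot>\<^bsub>D\<^esub> f = morF (rho A \<one>) X Y f \<cdot>\<^bsub>D\<^esub> unA A X"
    and unA_tensor: "\<lbrakk>X \<in> Ob D; Y \<in> Ob D\<rbrakk>
      \<Longrightarrow> unA A (X \<boxtimes>\<^bsub>D\<^esub> Y) = mulF (rho A \<one>) X Y \<cdot>\<^bsub>D\<^esub> (unA A X \<star>\<^bsub>D\<^esub> unA A Y)"
    and unA_unit: "unA A (unitO D) = unF (rho A \<one>)"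
    and mulA_assoc: "\<lbrakk>g \<in> carrier G; h \<in> carrier G; l \<in> carrier G; X \<in> Ob D\<rbrakk>
      \<Longrightarrow> mulA A (g \<otimes> h) l X \<cdot>\<^bsub>D\<^esub> mulA A g h (obF (rho A l) X)
        = mulA A g (h \<otimes> l) X \<cdot>\<^bsub>D\<^esub>
          morF (rho A g) (obF (rho A h) (obF (rho A l) X)) (obF (rho A (h \<otimes> l)) X) (mulA A h l X)"
    and mulA_unA_left: "\<lbrakk>g \<in> carrier G; X \<in> Ob D\<rbrakk>
      \<Longrightarrow> mulA A \<one> g X \<cdot>\<^bsub>D\<^esub> unA A (obF (rho A g) X) = idm D (obF (rho A g) X)"
    and mulA_unA_right: "\<lbrakk>g \<in> carrier G; X \<in> Ob D\<rbrakk>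
      \<Longrightarrow> mulA A g \<one> X \<cdot>\<^bsub>D\<^esub> morF (rho A g) X (obF (rho A \<one>) X) (unA A X) = idm D (obF (rho A g) X)"

text \<open>Values of \<open>\<mu>\<close> outside the carrier of \<open>G\<close> are irrelevant: objects that differ only there are
  isomorphic via the identity.\<close>

definition equivariantization ::
    "'g monoid \<Rightarrow> ('k, 'o, 'm) moncat \<Rightarrow> ('g, 'o, 'm) tensor_action \<Rightarrow>
     ('k, 'o \<times> ('g \<Rightarrow> 'm), 'm) moncat"
  where "equivariantization G D A = \<lparr>
    Ob = {(X, \<mu>). X \<in> Ob D \<and>
      (\<forall>g\<in>carrier G. isomorphism D (obF (rho A g) X) X (\<mu> g)) \<and>
      (\<forall>g\<in>carrier G. \<forall>h\<in>carrier G.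
        \<mu> g \<cdot>\<^bsub>D\<^esub> morF (rho A g) (obF (rho A h) X) X (\<mu> h) = \<mu> (g \<otimes>\<^bsub>G\<^esub> h) \<cdot>\<^bsub>D\<^esub> mulA A g h X) \<and>
      \<mu> \<one>\<^bsub>G\<^esub> \<cdot>\<^bsub>D\<^esub> unA A X = idm D X},
    Hom = (\<lambda>(X, \<mu>) (Y, \<nu>). {f \<in> Hom D X Y.
      \<forall>g\<in>carrier G. f \<cdot>\<^bsub>D\<^esub> \<mu> g = \<nu> g \<cdot>\<^bsub>D\<^esub> morF (rho A g) X Y f}),
    idm = (\<lambda>(X, \<mu>). idm D X),
    cmp = cmp D,
    scl = scl D,
    tenO = (\<lambda>(X, \<mu>) (Y, \<nu>). (X \<boxtimes>\<^bsub>D\<^esub> Y, \<lambda>g. (\<mu> g \<star>\<^bsub>D\<^esub> \<nu> g) \<cdot>\<^bsub>D\<^esub>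
      inverse_of D (obF (rho A g) X \<boxtimes>\<^bsub>D\<^esub> obF (rho A g) Y) (obF (rho A g) (X \<boxtimes>\<^bsub>D\<^esub> Y))
        (mulF (rho A g) X Y))),
    tenM = tenM D,
    unitO = (unitO D, \<lambda>g. inverse_of D (unitO D) (obF (rho A g) (unitO D)) (unF (rho A g))),
    asc = (\<lambda>(X, _) (Y, _) (Z, _). asc D X Y Z),
    lun = (\<lambda>(X, _). lun D X),
    run = (\<lambda>(X, _). run D X)\<rparr>"

definition is_equivariantization ::
    "'g monoid \<Rightarrow> ('k::field, 'p, 'w::ab_group_add) moncat \<Rightarrow>
     ('k, 'o, 'm::ab_group_add) moncat \<Rightarrow> bool"
  where "is_equivariantization G D C \<longleftrightarrow> finite (carrier G) \<and>
    (\<exists>A. group_action_on_category G D A \<and> tensor_equivalent (equivariantization G D A) C)"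


section \<open>Vector spaces and representations\<close>

text \<open>
  Finite-dimensional vector spaces, up to isomorphism, are the spaces with basis a finite set \<open>B\<close>
  of natural numbers; a linear map from the space on \<open>B\<close> to the one on \<open>B'\<close> is a matrix with row
  indices in \<open>B'\<close> and column indices in \<open>B\<close>, extended by 0. A pair of basis vectors is encoded as a
  basis vector of the tensor product by \<^const>\<open>prod_encode\<close>.
\<close>

definition mat_cmp :: "(nat \<Rightarrow> nat \<Rightarrow> 'k) \<Rightarrow> (nat \<Rightarrow> nat \<Rightarrow> 'k::field) \<Rightarrow> nat \<Rightarrow> nat \<Rightarrow> 'k"
  where "mat_cmp g f = (\<lambda>i j. \<Sum>l | f l j \<noteq> 0. g i l * f l j)"

definition mat_ten :: "(nat \<Rightarrow> nat \<Rightarrow> 'k) \<Rightarrow> (nat \<Rightarrow> nat \<Rightarrow> 'k::field) \<Rightarrow> nat \<Rightarrow> nat \<Rightarrow> 'k"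
  where "mat_ten f g = (\<lambda>i j. f (fst (prod_decode i)) (fst (prod_decode j)) *
    g (snd (prod_decode i)) (snd (prod_decode j)))"

text \<open>The matrix of the linear map sending the basis vector \<open>j \<in> B\<close> to the basis vector \<open>s j\<close>.\<close>

definition mat_of_map :: "nat set \<Rightarrow> (nat \<Rightarrow> nat) \<Rightarrow> nat \<Rightarrow> nat \<Rightarrow> 'k::field"
  where "mat_of_map B s = (\<lambda>i j. if j \<in> B \<and> i = s j then 1 else 0)"

definition basis_ten :: "nat set \<Rightarrow> nat set \<Rightarrow> nat set"
  where "basis_ten B B' = prod_encode ` (B \<times> B')"

definition Vect :: "('k::field, nat set, nat \<Rightarrow> nat \<Rightarrow> 'k) moncat"
  where "Vect = \<lparr>
    Ob = {B. finite B},
    Hom = (\<lambda>B B'. {f. \<forall>i j. f i j \<noteq> 0 \<longrightarrow> i \<in> B' \<and> j \<in> B}),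
    idm = (\<lambda>B. mat_of_map B id),
    cmp = mat_cmp,
    scl = (\<lambda>a f i j. a * f i j),
    tenO = basis_ten,
    tenM = mat_ten,
    unitO = {0},
    asc = (\<lambda>A B C. mat_of_map (basis_ten (basis_ten A B) C)
      (\<lambda>j. let (ab, c) = prod_decode j; (a, b) = prod_decode ab
           in prod_encode (a, prod_encode (b, c)))),
    lun = (\<lambda>B. mat_of_map (basis_ten {0} B) (\<lambda>j. snd (prod_decode j))),
    run = (\<lambda>B. mat_of_map (basis_ten B {0}) (\<lambda>j. fst (prod_decode j)))\<rparr>"

definition Rep :: "'g monoid \<Rightarrow>
    ('k::field, nat set \<times> ('g \<Rightarrow> nat \<Rightarrow> nat \<Rightarrow> 'k), nat \<Rightarrow> nat \<Rightarrow> 'k) moncat"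
  where "Rep G = \<lparr>
    Ob = {(B, \<rho>). finite B \<and> (\<forall>g\<in>carrier G. \<rho> g \<in> Hom Vect B B) \<and>
      \<rho> \<one>\<^bsub>G\<^esub> = idm Vect B \<and>
      (\<forall>g\<in>carrier G. \<forall>h\<in>carrier G. \<rho> (g \<otimes>\<^bsub>G\<^esub> h) = \<rho> g \<cdot>\<^bsub>Vect\<^esub> \<rho> h)},
    Hom = (\<lambda>(B, \<rho>) (B', \<rho>'). {f \<in> Hom Vect B B'.
      \<forall>g\<in>carrier G. f \<cdot>\<^bsub>Vect\<^esub> \<rho> g = \<rho>' g \<cdot>\<^bsub>Vect\<^esub> f}),
    idm = (\<lambda>(B, _). idm Vect B),
    cmp = cmp Vect,
    scl = scl Vect,
    tenO = (\<lambda>(B, \<rho>) (B', \<rho>'). (basis_ten B B', \<lambda>g. \<rho> g \<star>\<^bsub>Vect\<^esub> \<rho>' g)),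
    tenM = tenM Vect,
    unitO = ({0}, \<lambda>g. idm Vect {0}),
    asc = (\<lambda>(A, _) (B, _) (C, _). asc Vect A B C),
    lun = (\<lambda>(B, _). lun Vect B),
    run = (\<lambda>(B, _). run Vect B)\<rparr>"


section \<open>Solvability\<close>

text \<open>
  The type argument says on which types of objects and morphisms the categories of the chain live;
  the notion is only meaningful for sufficiently large types, and non-solvability is
  to be asserted for all types. A chain of categories on different types can be moved to a common
  type, since all notions involved are invariant under tensor equivalence; for the same reason the
  chain is required to end in a category tensor equivalent to \<open>C\<close>.
\<close>

definition solvable_category ::
    "('p \<times> 'w::ab_group_add) itself \<Rightarrow> ('k::field, 'o, 'm::ab_group_add) moncat \<Rightarrow> bool"
  where "solvable_category _ C \<longleftrightarrow>
    (\<exists>(n::nat) (D :: nat \<Rightarrow> ('k, 'p, 'w) moncat).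
      (\<forall>i\<le>n. fusion_category (D i)) \<and>
      tensor_equivalent (D 0) (Vect :: ('k, nat set, nat \<Rightarrow> nat \<Rightarrow> 'k) moncat) \<and>
      (\<forall>i<n. \<exists>p::nat. prime p \<and>
        (is_equivariantization (integer_mod_group p) (D i) (D (Suc i)) \<or>
         is_extension (integer_mod_group p) (D i) (D (Suc i)))) \<and>
      tensor_equivalent (D n) C)"

end

theory Submission
  imports Defs
begin

text \<open>
  A category with the fusion rules of the symmetric group carries a multiplicative dimension \<open>d\<close> with
  at most two classes of objects of dimension 1, no indecomposable objects of dimension 2, and a
  generating object \<open>V\<close> (the standard representation) with scalar endomorphisms that embeds into its
  square and is not isomorphic to its twist by the sign. This structure is invariant under tensor
  equivalence. It excludes a nontrivial grading: \<open>V\<close>, embedding into its square, has degree \<open>g = g\<^sup>2\<close>, so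
  everything it generates is in neutral degree. If the category is an equivariantization by a group of
  prime order \<open>p\<close>, the twists of the unit by characters force \<open>p = 2\<close>, and since \<open>V\<close> does not map to its
  twist, the object underlying \<open>V\<close> still has scalar endomorphisms. Now look at the category \<open>D\<close> below. It
  is not \<open>Vect\<close>, since then \<open>V\<close> would have dimension 1; it is not graded, by the argument above; and
  if it is itself an equivariantization, it contains a nontrivial invertible object, the induced object
  of which has dimension at most 2 by comparing the growth of the endomorphism spaces of tensor powers,
  so that it is a sum of objects whose underlying object is the unit: a contradiction.
\<close>

section \<open>Linear categories\<close>

text \<open>The obstacle is that the structure has to be followed into categories of which little is
  known. The lower members of the chain are fusion categories that come without a dimension
  function, and an equivariantization is handled only as a linear category whose objects are closed
  under tensor products. Hence \<open>symmetric_like\<close> speaks of Hom spaces, isomorphisms and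
  factorizations of identities, \<open>scalar_end\<close> replaces simplicity, and a dimension in
  the upper category is compared with a number of invertible summands in the lower one through sizes
  of endomorphism spaces. The numbers \<open>d\<close> are vector space dimensions of
  representations, carried over by the bijection of simple classes; equality of the fusion rules
  makes them multiplicative. The bound n >= 5 is what excludes irreducible representations of
  dimension 2: it provides a transposition disjoint from three given points. For n = 3 and n = 4
  such representations exist, and these two symmetric groups are indeed solvable.\<close>

lemma (in vector_space) independent_family:
  assumes "finite I" and "inj_on b I"
    and "\<And>c i. (\<Sum>i\<in>I. scale (c i) (b i)) = 0 \<Longrightarrow> i \<in> I \<Longrightarrow> c i = 0"
  shows "independent (b ` I)"
proof
  assume "dependent (b ` I)"
  then obtain u v where u: "v \<in> b ` I" "u v \<noteq> 0" "(\<Sum>v\<in>b ` I. scale (u v) v) = 0"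
    using dependent_finite[of "b ` I"] assms(1) by auto
  then obtain i where i: "i \<in> I" "v = b i"
    by auto
  have "(\<Sum>i\<in>I. scale (u (b i)) (b i)) = 0"
    using u(3) assms(2) by (simp add: sum.reindex)
  then have "u (b i) = 0"
    using assms(3)[where c="\<lambda>i. u (b i)"] i by blast
  with u i show False
    by simp
qed

text \<open>More vectors than the size of a spanning set satisfy a relation. Applied to the powers
  of an endomorphism, this yields a polynomial that annihilates it.\<close>

lemma (in vector_space) nontrivial_relation:
  fixes x :: "nat \<Rightarrow> 'b"
  assumes "finite B" "\<And>i. x i \<in> span B"
  obtains N c where "\<exists>i\<le>N. c i \<noteq> 0" "(\<Sum>i\<le>N. scale (c i) (x i)) = 0"
proof -
  define N where "N = card B"
  show thesis
  proof (cases "\<exists>c. (\<exists>i\<le>N. c i \<noteq> 0) \<and> (\<Sum>i\<le>N. scale (c i) (x i)) = 0")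
    case True
    then show ?thesis using that by auto
  next
    case False
    then have no: "\<not> ((\<exists>i\<le>N. c i \<noteq> 0) \<and> (\<Sum>i\<le>N. scale (c i) (x i)) = 0)" for c
      by simp
    have inj: "inj_on x {..N}"
    proof (rule inj_onI, rule ccontr)
      fix i j assume ij: "i \<in> {..N}" "j \<in> {..N}" "x i = x j" "i \<noteq> j"
      \<comment> \<open>Two equal members already give a relation, with coefficients 1 and -1 at
        their indices.\<close>
      let ?c = "\<lambda>l. if l = i then (1::'a) else if l = j then - 1 else 0"
      have "(\<Sum>l\<le>N. scale (?c l) (x l)) = (\<Sum>l\<in>{i,j}. scale (?c l) (x l))"
        using ij by (intro sum.mono_neutral_right) auto
      also have "\<dots> = 0"
        using ij by simp
      finally have "(\<exists>l\<le>N. ?c l \<noteq> 0) \<and> (\<Sum>l\<le>N. scale (?c l) (x l)) = 0"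
        using ij(1) by (intro conjI exI[of _ i]) auto
      then show False
        using no[of ?c] by simp
    qed
    have "independent (x ` {..N})"
    proof (rule independent_family[OF _ inj])
      show "c i = 0" if "(\<Sum>i\<le>N. scale (c i) (x i)) = 0" "i \<in> {..N}" for c i
        using no[of c] that by auto
    qed simp
    then have "card (x ` {..N}) \<le> card B"
      using independent_span_bound[OF assms(1)] assms(2) by blast
    then show ?thesis
      using inj by (simp add: card_image N_def)
  qed
qed

text \<open>Bundling the two objects with the Hom membership leaves one premise per morphism, so
  that the axioms of the locales can be chained as rules.\<close>

definition arr :: "('k, 'o, 'm) moncat \<Rightarrow> 'o \<Rightarrow> 'o \<Rightarrow> 'm \<Rightarrow> bool"
  where "arr C X Y f \<longleftrightarrow> X \<in> Ob C \<and> Y \<in> Ob C \<and> f \<in> Hom C X Y"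

definition inverse_pair :: "('k, 'o, 'm) moncat \<Rightarrow> 'o \<Rightarrow> 'o \<Rightarrow> 'm \<Rightarrow> 'm \<Rightarrow> bool"
  where "inverse_pair C X Y f g \<longleftrightarrow> arr C X Y f \<and> arr C Y X g \<and>
    g \<cdot>\<^bsub>C\<^esub> f = idm C X \<and> f \<cdot>\<^bsub>C\<^esub> g = idm C Y"

lemma isomorphic_iff: "isomorphic C X Y \<longleftrightarrow> (\<exists>f g. inverse_pair C X Y f g)"
  by (auto simp: isomorphic_def isomorphism_def mutually_inverse_def inverse_pair_def arr_def)

text \<open>Replaces decompositions into direct sums where only the identity of \<open>X\<close> matters: it is a sum of
  morphisms that pass through objects with the property \<open>P\<close>.\<close>

definition factors_through :: "('k, 'o, 'm::comm_monoid_add) moncat \<Rightarrow> ('o \<Rightarrow> bool) \<Rightarrow> 'o \<Rightarrow> bool"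
  where "factors_through C P X \<longleftrightarrow> (\<exists>(N::nat) T a b.
    (\<forall>i<N. P (T i) \<and> arr C (T i) X (a i) \<and> arr C X (T i) (b i)) \<and>
    (\<Sum>i<N. a i \<cdot>\<^bsub>C\<^esub> b i) = idm C X)"

context linear_category
begin

sublocale V: vector_space "scl C"
  by (rule vector_space)

lemma arr_idm: "X \<in> Ob C \<Longrightarrow> arr C X X (idm C X)"
  by (simp add: arr_def idm_Hom)

lemma arr_cmp: "arr C X Y f \<Longrightarrow> arr C Y Z g \<Longrightarrow> arr C X Z (g \<cdot> f)"
  by (auto simp: arr_def intro: cmp_Hom)

lemma arr_zero: "X \<in> Ob C \<Longrightarrow> Y \<in> Ob C \<Longrightarrow> arr C X Y 0"
  by (simp add: arr_def V.subspace_0[OF subspace_Hom])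

lemma arr_add: "arr C X Y f \<Longrightarrow> arr C X Y g \<Longrightarrow> arr C X Y (f + g)"
  by (simp add: arr_def V.subspace_add[OF subspace_Hom])

lemma arr_diff: "arr C X Y f \<Longrightarrow> arr C X Y g \<Longrightarrow> arr C X Y (f - g)"
  by (simp add: arr_def V.subspace_diff[OF subspace_Hom])

lemma arr_scl: "arr C X Y f \<Longrightarrow> arr C X Y (scl C a f)"
  by (simp add: arr_def V.subspace_scale[OF subspace_Hom])

lemma arr_sum: "X \<in> Ob C \<Longrightarrow> Y \<in> Ob C \<Longrightarrow> (\<And>i. i \<in> I \<Longrightarrow> arr C X Y (f i)) \<Longrightarrow> arr C X Y (\<Sum>i\<in>I. f i)"
  by (simp add: arr_def V.subspace_sum[OF subspace_Hom])

lemma idl: "arr C X Y f \<Longrightarrow> idm C Y \<cdot> f = f"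
  by (auto simp: arr_def cmp_idm_left)

lemma idr: "arr C X Y f \<Longrightarrow> f \<cdot> idm C X = f"
  by (auto simp: arr_def cmp_idm_right)

lemma assoc: "arr C W X f \<Longrightarrow> arr C X Y g \<Longrightarrow> arr C Y Z h \<Longrightarrow> (h \<cdot> g) \<cdot> f = h \<cdot> g \<cdot> f"
  by (auto simp: arr_def intro: cmp_assoc)

text \<open>The bracketing in which a projection meets an inclusion in the middle and the two can be
  contracted.\<close>

lemma cmp4: "arr C A B d \<Longrightarrow> arr C B E c \<Longrightarrow> arr C E F b \<Longrightarrow> arr C F G a \<Longrightarrow>
    (a \<cdot> b) \<cdot> (c \<cdot> d) = a \<cdot> (b \<cdot> c) \<cdot> d"
  using arr_cmp[of A B d E c] by (simp add: assoc)

lemma cmp_add_l: "arr C X Y f \<Longrightarrow> arr C Y Z g \<Longrightarrow> arr C Y Z g' \<Longrightarrow> (g + g') \<cdot> f = g \<cdot> f + g' \<cdot> f"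
  by (auto simp: arr_def intro: cmp_add_left)

lemma cmp_add_r: "arr C X Y f \<Longrightarrow> arr C X Y f' \<Longrightarrow> arr C Y Z g \<Longrightarrow> g \<cdot> (f + f') = g \<cdot> f + g \<cdot> f'"
  by (auto simp: arr_def intro: cmp_add_right)

lemma cmp_zero_l: "arr C X Y f \<Longrightarrow> 0 \<cdot> f = 0"
proof -
  assume f: "arr C X Y f"
  then have "0 \<cdot> f + 0 \<cdot> f = 0 \<cdot> f"
    using cmp_add_l[of X Y f Y 0 0] arr_zero[of Y Y] by (auto simp: arr_def)
  then show ?thesis
    by simp
qed

lemma cmp_zero_r: "arr C X Y f \<Longrightarrow> f \<cdot> 0 = 0"
proof -
  assume f: "arr C X Y f"
  then have "f \<cdot> 0 + f \<cdot> 0 = f \<cdot> 0"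
    using cmp_add_r[of X X 0 0 Y f] arr_zero[of X X] by (auto simp: arr_def)
  then show ?thesis
    by simp
qed

lemma cmp_scl_l: "arr C X Y f \<Longrightarrow> arr C Y Z g \<Longrightarrow> scl C a g \<cdot> f = scl C a (g \<cdot> f)"
  by (auto simp: arr_def intro: cmp_scl_left)

lemma cmp_scl_r: "arr C X Y f \<Longrightarrow> arr C Y Z g \<Longrightarrow> g \<cdot> scl C a f = scl C a (g \<cdot> f)"
  by (auto simp: arr_def intro: cmp_scl_right)

lemma cmp_diff_l: "arr C X Y f \<Longrightarrow> arr C Y Z g \<Longrightarrow> arr C Y Z g' \<Longrightarrow> (g - g') \<cdot> f = g \<cdot> f - g' \<cdot> f"
  using cmp_add_l[of X Y f Z "g - g'" g'] by (simp add: arr_diff algebra_simps)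

lemma cmp_diff_r: "arr C X Y f \<Longrightarrow> arr C X Y f' \<Longrightarrow> arr C Y Z g \<Longrightarrow> g \<cdot> (f - f') = g \<cdot> f - g \<cdot> f'"
  using cmp_add_r[of X Y "f - f'" f' Z g] by (simp add: arr_diff algebra_simps)

lemma cmp_sum_l:
  assumes "arr C X Y f" "\<And>i. i \<in> I \<Longrightarrow> arr C Y Z (g i)"
  shows "(\<Sum>i\<in>I. g i) \<cdot> f = (\<Sum>i\<in>I. g i \<cdot> f)"
proof (cases "I = {}")
  case False
  then have Z: "Z \<in> Ob C" "Y \<in> Ob C"
    using assms by (auto simp: arr_def)
  show ?thesis
    using assms(2)
  proof (induction I rule: infinite_finite_induct)
    case (insert i I)
    then have "arr C Y Z (\<Sum>i\<in>I. g i)"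
      using Z by (intro arr_sum) auto
    then show ?case
      using insert cmp_add_l[OF assms(1), of Z "g i" "\<Sum>i\<in>I. g i"] by simp
  qed (auto simp: cmp_zero_l[OF assms(1)])
qed (simp add: cmp_zero_l[OF assms(1)])

lemma cmp_sum_r:
  assumes "arr C Y Z f" "\<And>i. i \<in> I \<Longrightarrow> arr C X Y (g i)"
  shows "f \<cdot> (\<Sum>i\<in>I. g i) = (\<Sum>i\<in>I. f \<cdot> g i)"
proof (cases "I = {}")
  case False
  then have Z: "X \<in> Ob C" "Y \<in> Ob C"
    using assms by (auto simp: arr_def)
  show ?thesis
    using assms(2)
  proof (induction I rule: infinite_finite_induct)
    case (insert i I)
    then have "arr C X Y (\<Sum>i\<in>I. g i)"
      using Z by (intro arr_sum) auto
    then show ?case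
      using insert cmp_add_r[OF _ _ assms(1), of X "g i" "\<Sum>i\<in>I. g i"] by simp
  qed (auto simp: cmp_zero_r[OF assms(1)])
qed (simp add: cmp_zero_r[OF assms(1)])

lemma inverse_pair_sym: "inverse_pair C X Y f g \<Longrightarrow> inverse_pair C Y X g f"
  by (auto simp: inverse_pair_def)

lemma inverse_pair_idm: "X \<in> Ob C \<Longrightarrow> inverse_pair C X X (idm C X) (idm C X)"
  by (simp add: inverse_pair_def arr_idm idl[OF arr_idm])

lemma inverse_pair_cmp:
  assumes "inverse_pair C X Y f f'" "inverse_pair C Y Z g g'"
  shows "inverse_pair C X Z (g \<cdot> f) (f' \<cdot> g')"
  using assms cmp4[of X Y f Z g Y g' X f'] cmp4[of Z Y g' X f' Y f Z g]
  by (auto simp: inverse_pair_def idl intro: arr_cmp)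

lemma isomorphic_refl: "X \<in> Ob C \<Longrightarrow> isomorphic C X X"
  unfolding isomorphic_iff by (blast intro: inverse_pair_idm)

lemma isomorphic_sym: "isomorphic C X Y \<Longrightarrow> isomorphic C Y X"
  unfolding isomorphic_iff by (blast intro: inverse_pair_sym)

lemma isomorphic_trans: "isomorphic C X Y \<Longrightarrow> isomorphic C Y Z \<Longrightarrow> isomorphic C X Z"
  unfolding isomorphic_iff by (elim exE) (rule exI, rule exI, rule inverse_pair_cmp)

lemma isomorphismE:
  assumes "isomorphism C X Y f" "X \<in> Ob C" "Y \<in> Ob C"
  obtains g where "inverse_pair C X Y f g"
  using assms by (auto simp: isomorphism_def mutually_inverse_def inverse_pair_def arr_def)

lemma isomorphism_iff: "X \<in> Ob C \<Longrightarrow> Y \<in> Ob C \<Longrightarrow> isomorphism C X Y f \<longleftrightarrow> (\<exists>g. inverse_pair C X Y f g)"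
  by (auto simp: isomorphism_def mutually_inverse_def inverse_pair_def arr_def)

lemma inverse_of_eq:
  assumes "inverse_pair C X Y f g"
  shows "inverse_of C X Y f = g"
  unfolding inverse_of_def
proof (rule the_equality)
  show "mutually_inverse C X Y f g"
    using assms by (auto simp: inverse_pair_def mutually_inverse_def arr_def)
  fix h assume "mutually_inverse C X Y f h"
  then have h: "arr C Y X h" "h \<cdot> f = idm C X"
    using assms by (auto simp: inverse_pair_def mutually_inverse_def arr_def)
  have "h = (h \<cdot> f) \<cdot> g"
    using assms h(1) unfolding inverse_pair_def by (simp add: assoc[of Y X g Y f X h] idr)
  then show "h = g"
    using assms h(2) unfolding inverse_pair_def by (simp add: idl[of Y X g])
qed

text \<open>Every morphism into or out of \<open>Z\<close> absorbs \<open>idm C Z\<close>, so it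
  vanishes once this identity does.\<close>

lemma zero_object_iff: "zero_object C Z \<longleftrightarrow> Z \<in> Ob C \<and> idm C Z = 0"
proof
  assume "zero_object C Z"
  then show "Z \<in> Ob C \<and> idm C Z = 0"
    using idm_Hom by (auto simp: zero_object_def)
next
  assume Z: "Z \<in> Ob C \<and> idm C Z = 0"
  have "Hom C X Z = {0} \<and> Hom C Z X = {0}" if "X \<in> Ob C" for X
  proof -
    have "f = 0" if "arr C X Z f" for f
      using idl[OF that] cmp_zero_l[OF that] Z by simp
    moreover have "f = 0" if "arr C Z X f" for f
      using idr[OF that] cmp_zero_r[OF that] Z by simp
    ultimately show ?thesis
      using Z that arr_zero unfolding arr_def by blast
  qed
  with Z show "zero_object C Z"
    by (auto simp: zero_object_def)
qed

lemma direct_sum_iff: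
  "direct_sum C I S X \<iota> \<pi> \<longleftrightarrow> finite I \<and> X \<in> Ob C \<and>
    (\<forall>i\<in>I. arr C (S i) X (\<iota> i) \<and> arr C X (S i) (\<pi> i)) \<and>
    (\<forall>i\<in>I. \<forall>j\<in>I. \<pi> i \<cdot> \<iota> j = (if i = j then idm C (S i) else 0)) \<and>
    (\<Sum>i\<in>I. \<iota> i \<cdot> \<pi> i) = idm C X"
  by (auto simp: direct_sum_def arr_def)

lemma direct_sum_iso:
  assumes "direct_sum C I S X \<iota> \<pi>" "inverse_pair C X Y f g"
  shows "direct_sum C I S Y (\<lambda>i. f \<cdot> \<iota> i) (\<lambda>i. \<pi> i \<cdot> g)"
proof -
  note d = assms(1)[unfolded direct_sum_iff] and p = assms(2)[unfolded inverse_pair_def]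
  have "(\<pi> i \<cdot> g) \<cdot> f \<cdot> \<iota> j = \<pi> i \<cdot> \<iota> j" if "i \<in> I" "j \<in> I" for i j
    using d p that cmp4[of "S j" X "\<iota> j" Y f X g "S i" "\<pi> i"] idl[of "S j" X "\<iota> j"] by auto
  moreover have "(\<Sum>i\<in>I. (f \<cdot> \<iota> i) \<cdot> \<pi> i \<cdot> g) = idm C Y"
  proof -
    have "(\<Sum>i\<in>I. (f \<cdot> \<iota> i) \<cdot> \<pi> i \<cdot> g) = (\<Sum>i\<in>I. f \<cdot> (\<iota> i \<cdot> \<pi> i) \<cdot> g)"
      using d p by (intro sum.cong refl cmp4) blast+
    also have "\<dots> = f \<cdot> (\<Sum>i\<in>I. \<iota> i \<cdot> \<pi> i) \<cdot> g"
      using d p by (subst cmp_sum_l[where Y=X and X=Y and Z=X], simp, blast intro: arr_cmp,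
          subst cmp_sum_r[where X=Y and Y=X and Z=Y]) (auto intro: arr_cmp)
    finally show ?thesis
      using d p idl[of Y X g] by auto
  qed
  ultimately show ?thesis
    using d p by (auto simp: direct_sum_iff arr_def intro: cmp_Hom)
qed

lemma direct_sum_reindex:
  assumes "direct_sum C I S X \<iota> \<pi>" "bij_betw h J I"
  shows "direct_sum C J (\<lambda>j. S (h j)) X (\<lambda>j. \<iota> (h j)) (\<lambda>j. \<pi> (h j))"
proof -
  note d = assms(1)[unfolded direct_sum_iff]
  have "(\<Sum>j\<in>J. \<iota> (h j) \<cdot> \<pi> (h j)) = idm C X"
    using d sum.reindex_bij_betw[OF assms(2), of "\<lambda>i. \<iota> i \<cdot> \<pi> i"] by simp
  moreover have "h j \<in> I" "h j = h j' \<longleftrightarrow> j = j'" if "j \<in> J" "j' \<in> J" for j j'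
    using that assms(2) by (auto simp: bij_betw_def inj_on_def)
  ultimately show ?thesis
    using d assms(2) bij_betw_finite[OF assms(2)] by (auto simp: direct_sum_iff)
qed

text \<open>Refinement of a decomposition; orthogonality survives because the outer projections
  already separate different summands. Decompositions into simple objects are assembled from those
  of the summands in this way.\<close>

lemma direct_sum_Sigma:
  assumes "direct_sum C I W X \<iota> \<pi>"
    and "\<And>i. i \<in> I \<Longrightarrow> direct_sum C (J i) (S i) (W i) (\<kappa> i) (\<rho> i)"
  shows "direct_sum C (Sigma I J) (\<lambda>(i, j). S i j) X
    (\<lambda>(i, j). \<iota> i \<cdot> \<kappa> i j) (\<lambda>(i, j). \<rho> i j \<cdot> \<pi> i)"
proof -
  note d = assms(1)[unfolded direct_sum_iff]
  note e = assms(2)[unfolded direct_sum_iff]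
  have ob: "W i \<in> Ob C" if "i \<in> I" for i
    using e that by blast
  have 1: "(\<rho> i j \<cdot> \<pi> i) \<cdot> \<iota> i' \<cdot> \<kappa> i' j' = (if i = i' \<and> j = j' then idm C (S i j) else 0)"
    if "i \<in> I" "i' \<in> I" "j \<in> J i" "j' \<in> J i'" for i j i' j'
  proof -
    have "(\<rho> i j \<cdot> \<pi> i) \<cdot> \<iota> i' \<cdot> \<kappa> i' j' = \<rho> i j \<cdot> (\<pi> i \<cdot> \<iota> i') \<cdot> \<kappa> i' j'"
      using d e that by (intro cmp4) blast+
    also have "\<dots> = (if i = i' then \<rho> i j \<cdot> \<kappa> i' j' else 0)"
    proof -
      have "arr C (S i' j') (W i') (\<kappa> i' j')" "arr C (W i) (S i j) (\<rho> i j)"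
        using e that by blast+
      then show ?thesis
        using d that by (auto simp: idl cmp_zero_l cmp_zero_r)
    qed
    finally show ?thesis
      using e[OF \<open>i \<in> I\<close>] that by auto
  qed
  have "(\<Sum>(i, j)\<in>Sigma I J. (\<iota> i \<cdot> \<kappa> i j) \<cdot> \<rho> i j \<cdot> \<pi> i) = (\<Sum>i\<in>I. \<Sum>j\<in>J i. (\<iota> i \<cdot> \<kappa> i j) \<cdot> \<rho> i j \<cdot> \<pi> i)"
    using d e by (subst sum.Sigma) auto
  also have "\<dots> = (\<Sum>i\<in>I. \<iota> i \<cdot> \<pi> i)"
  proof (intro sum.cong refl)
    fix i assume i: "i \<in> I"
    have "(\<Sum>j\<in>J i. (\<iota> i \<cdot> \<kappa> i j) \<cdot> \<rho> i j \<cdot> \<pi> i) = (\<Sum>j\<in>J i. \<iota> i \<cdot> (\<kappa> i j \<cdot> \<rho> i j) \<cdot> \<pi> i)"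
      using d e[OF i] i by (intro sum.cong refl cmp4) blast+
    also have "\<dots> = \<iota> i \<cdot> (\<Sum>j\<in>J i. \<kappa> i j \<cdot> \<rho> i j) \<cdot> \<pi> i"
      using d e[OF i] i by (subst cmp_sum_l[where Y="W i" and X=X and Z="W i"], simp, blast intro: arr_cmp,
          subst cmp_sum_r[where X=X and Y="W i" and Z=X]) (auto intro: arr_cmp)
    finally show "(\<Sum>j\<in>J i. (\<iota> i \<cdot> \<kappa> i j) \<cdot> \<rho> i j \<cdot> \<pi> i) = \<iota> i \<cdot> \<pi> i"
      using d e[OF i] i by (auto simp: idl)
  qed
  finally have 2: "(\<Sum>(i, j)\<in>Sigma I J. (\<iota> i \<cdot> \<kappa> i j) \<cdot> \<rho> i j \<cdot> \<pi> i) = idm C X"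
    using d by simp
  have 3: "arr C (S i j) X (\<iota> i \<cdot> \<kappa> i j)" "arr C X (S i j) (\<rho> i j \<cdot> \<pi> i)" if "i \<in> I" "j \<in> J i" for i j
    using d e that arr_cmp by blast+
  show ?thesis
    unfolding direct_sum_iff using d e 1 2 3 by (auto simp: case_prod_unfold)
qed

lemma is_mono_cmp_iso:
  assumes "is_mono C Y X f" "Y \<in> Ob C" "inverse_pair C X X' u v"
  shows "is_mono C Y X' (u \<cdot> f)"
proof -
  have f: "arr C Y X f" and u: "arr C X X' u" "arr C X' X v" "v \<cdot> u = idm C X"
    using assms by (auto simp: is_mono_def inverse_pair_def arr_def)
  have "f \<cdot> g = f \<cdot> h" if "arr C W Y g" "arr C W Y h" "(u \<cdot> f) \<cdot> g = (u \<cdot> f) \<cdot> h" for W g h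
  proof -
    have "v \<cdot> (u \<cdot> f) \<cdot> g = f \<cdot> g" if "arr C W Y g" for g
      using f u that arr_cmp[OF that f] by (simp add: assoc[of W Y g X f X' u] idl
          flip: assoc[of W X "f \<cdot> g" X' u X v])
    then show ?thesis
      using that by metis
  qed
  then show ?thesis
    using assms(1,2) arr_cmp[OF f u(1)] unfolding is_mono_def arr_def by blast
qed

text \<open>A monomorphism into \<open>X'\<close> followed by an isomorphism to \<open>X\<close> is
  a monomorphism into \<open>X\<close>, where simplicity applies.\<close>

lemma simple_object_iso:
  assumes "simple_object C X" "isomorphic C X X'"
  shows "simple_object C X'"
proof -
  obtain u v where uv: "inverse_pair C X X' u v"
    using assms unfolding isomorphic_iff by blast
  then have ob: "X \<in> Ob C" "X' \<in> Ob C"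
    by (auto simp: inverse_pair_def arr_def)
  have nz: "\<not> zero_object C X'"
  proof
    assume "zero_object C X'"
    then have "u = 0"
      using uv ob by (auto simp: zero_object_def inverse_pair_def arr_def)
    then have "idm C X = 0"
      using uv cmp_zero_r[of X' X v] unfolding inverse_pair_def by simp
    then show False
      using assms(1) ob zero_object_iff by (auto simp: simple_object_def)
  qed
  have "zero_object C Y \<or> isomorphism C Y X' f" if Y: "Y \<in> Ob C" "is_mono C Y X' f" for Y f
  proof -
    have f: "arr C Y X' f"
      using that ob by (auto simp: is_mono_def arr_def)
    have "is_mono C Y X (v \<cdot> f)"
      using is_mono_cmp_iso[OF that(2,1) inverse_pair_sym[OF uv]] .
    then consider "zero_object C Y" | "isomorphism C Y X (v \<cdot> f)"
      using assms(1) Y(1) by (auto simp: simple_object_def)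
    then show ?thesis
    proof cases
      case 2
      then obtain w where "inverse_pair C Y X (v \<cdot> f) w"
        using isomorphismE ob Y(1) by blast
      then have "inverse_pair C Y X' (u \<cdot> v \<cdot> f) (w \<cdot> v)"
        using inverse_pair_cmp uv by blast
      moreover have "u \<cdot> v \<cdot> f = f"
        using uv f unfolding inverse_pair_def by (simp add: idl flip: assoc[of Y X' f X v X' u])
      ultimately show ?thesis
        using isomorphism_iff ob that by auto
    qed simp
  qed
  with nz ob show ?thesis
    by (auto simp: simple_object_def)
qed

end

section \<open>Multiplicities of simple objects\<close>

text \<open>The finite spanning set matters: \<open>dim\<close> is the cardinality of a basis, and
  this is 0 for an infinite basis as well.\<close>

lemma (in linear_category) hom_dim_eq_0_iff:
  assumes "X \<in> Ob C" "Y \<in> Ob C" "finite B" "Hom C X Y \<subseteq> V.span B"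
  shows "hom_dim C X Y = 0 \<longleftrightarrow> (\<forall>f. arr C X Y f \<longrightarrow> f = 0)"
proof
  assume 0: "hom_dim C X Y = 0"
  obtain A where A: "A \<subseteq> Hom C X Y" "V.independent A" "Hom C X Y \<subseteq> V.span A" "card A = V.dim (Hom C X Y)"
    by (rule V.basis_exists)
  have "finite A"
    using V.independent_span_bound[OF assms(3) A(2)] A(1) assms(4) by blast
  with A 0 have "Hom C X Y \<subseteq> {0}"
    by (auto simp: hom_dim_def)
  then show "\<forall>f. arr C X Y f \<longrightarrow> f = 0"
    by (auto simp: arr_def)
next
  assume "\<forall>f. arr C X Y f \<longrightarrow> f = 0"
  then have "Hom C X Y \<subseteq> V.span {}"
    using assms by (auto simp: arr_def)
  then show "hom_dim C X Y = 0"
    using V.dim_le_card[of "Hom C X Y" "{}"] by (simp add: hom_dim_def)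
qed

section \<open>Polynomials in an endomorphism; representatives of classes of simple objects\<close>

context linear_category
begin

text \<open>Evaluation of a polynomial at an endomorphism by Horner's scheme. The endomorphisms of
  \<open>S\<close> form an algebra only inside the ambient type of morphisms, whose composition is
  not the multiplication of a type class, so \<open>poly\<close> does not apply.\<close>

definition peval :: "'o \<Rightarrow> 'm \<Rightarrow> 'k poly \<Rightarrow> 'm"
  where "peval S f p = fold_coeffs (\<lambda>a m. scl C a (idm C S) + f \<cdot> m) p 0"

lemma peval_0 [simp]: "peval S f 0 = 0"
  by (simp add: peval_def)

lemma peval_pCons:
  assumes "arr C S S f"
  shows "peval S f (pCons a p) = scl C a (idm C S) + f \<cdot> peval S f p"
proof (cases "a = 0 \<and> p = 0")
  case True
  then show ?thesis
    using cmp_zero_r[OF assms] by simp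
next
  case False
  then show ?thesis
    by (auto simp: peval_def)
qed

lemma arr_peval:
  assumes "arr C S S f"
  shows "arr C S S (peval S f p)"
proof -
  have S: "S \<in> Ob C"
    using assms by (simp add: arr_def)
  show ?thesis
    by (induction p) (auto simp: peval_pCons[OF assms] S intro!: arr_zero arr_add arr_scl arr_idm arr_cmp[OF _ assms])
qed

lemma peval_add:
  assumes "arr C S S f"
  shows "peval S f (p + q) = peval S f p + peval S f q"
proof (induction p arbitrary: q)
  case (pCons a p)
  then show ?case
    by (cases q) (simp add: peval_pCons[OF assms] V.scale_left_distrib algebra_simps
        cmp_add_r[OF arr_peval[OF assms] arr_peval[OF assms] assms])
qed simp

lemma peval_smult:
  assumes "arr C S S f"
  shows "peval S f (smult a p) = scl C a (peval S f p)"
  by (induction p) (simp_all add: peval_pCons[OF assms] V.scale_right_distrib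
        cmp_scl_r[OF arr_peval[OF assms] assms])

lemma peval_sum:
  assumes "arr C S S f"
  shows "peval S f (\<Sum>i\<in>I. p i) = (\<Sum>i\<in>I. peval S f (p i))"
  by (induction I rule: infinite_finite_induct) (auto simp: peval_add[OF assms])

lemma peval_monom:
  assumes "arr C S S f"
  shows "peval S f (monom a i) = scl C a (peval S f (monom 1 i))"
  using peval_smult[OF assms, of a "monom 1 i"] by (simp add: smult_monom)

lemma peval_linear_factor:
  assumes "arr C S S f"
  shows "peval S f ([:- c, 1:] * p) = (f - scl C c (idm C S)) \<cdot> peval S f p"
proof -
  have S: "S \<in> Ob C"
    using assms by (simp add: arr_def)
  have "[:- c, 1:] * p = smult (- c) p + pCons 0 p"
    by simp
  then have "peval S f ([:- c, 1:] * p) = scl C (- c) (peval S f p) + f \<cdot> peval S f p"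
    by (simp only: peval_add[OF assms] peval_smult[OF assms] peval_pCons[OF assms] V.scale_zero_left add_0)
  also have "\<dots> = f \<cdot> peval S f p - scl C c (idm C S) \<cdot> peval S f p"
    using cmp_scl_l[OF arr_peval[OF assms] arr_idm[OF S]] idl[OF arr_peval[OF assms]] by simp
  also have "\<dots> = (f - scl C c (idm C S)) \<cdot> peval S f p"
    using cmp_diff_l[OF arr_peval[OF assms] assms arr_scl[OF arr_idm[OF S]]] by simp
  finally show ?thesis .
qed

lemma iso_class_eq_iff: "X \<in> Ob C \<Longrightarrow> iso_class C X = iso_class C Y \<longleftrightarrow> isomorphic C X Y"
  unfolding iso_class_def
  by (auto intro: isomorphic_refl dest: isomorphic_sym isomorphic_trans)

text \<open>The object chosen from a class is isomorphic to any simple object that generates the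
  class.\<close>

lemma class_rep:
  assumes "z \<in> Irr C"
  shows "simple_object C (class_rep z)" "iso_class C (class_rep z) = z"
proof -
  obtain S where S: "simple_object C S" "z = iso_class C S"
    using assms by (auto simp: Irr_def)
  then have ob: "S \<in> Ob C"
    by (simp add: simple_object_def)
  then have "S \<in> z"
    by (simp add: S iso_class_def isomorphic_refl)
  then have "class_rep z \<in> z"
    unfolding class_rep_def by (rule someI)
  then have i: "isomorphic C S (class_rep z)"
    by (simp add: S iso_class_def)
  then show "simple_object C (class_rep z)"
    using S simple_object_iso by blast
  show "iso_class C (class_rep z) = z"
    using i S ob iso_class_eq_iff by auto
qed

lemma class_rep_iso:
  assumes "simple_object C S"
  shows "isomorphic C S (class_rep (iso_class C S))" "iso_class C S \<in> Irr C"
proof -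
  show i: "iso_class C S \<in> Irr C"
    using assms by (auto simp: Irr_def)
  show "isomorphic C S (class_rep (iso_class C S))"
    using class_rep(2)[OF i] iso_class_eq_iff[of S "class_rep (iso_class C S)"] assms
    by (simp add: simple_object_def)
qed

end

text \<open>The common ground of fusion categories and of representation categories. Multiplicities
  of simple objects are developed from these three properties, so that they can be compared on both
  sides of a Grothendieck equivalence.\<close>

locale schur_category = linear_category C
  for C :: "('k::alg_closed_field, 'o, 'm::ab_group_add) moncat" (structure) +
  assumes decomposition: "X \<in> Ob C \<Longrightarrow>
      \<exists>(n::nat) S \<iota> \<pi>. (\<forall>i<n. simple_object C (S i)) \<and> direct_sum C {..<n} S X \<iota> \<pi>"
    and schur_iso: "simple_object C S \<Longrightarrow> simple_object C T \<Longrightarrow> arr C S T f \<Longrightarrow> f \<noteq> 0 \<Longrightarrow>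
      \<exists>g. inverse_pair C S T f g"
    and finite_dim: "X \<in> Ob C \<Longrightarrow> Y \<in> Ob C \<Longrightarrow> \<exists>B. finite B \<and> Hom C X Y \<subseteq> V.span B"
begin

lemma simple_idm: "simple_object C S \<Longrightarrow> S \<in> Ob C \<and> idm C S \<noteq> 0"
  using zero_object_iff by (auto simp: simple_object_def)

text \<open>Finite dimension gives a nonzero polynomial annihilating \<open>f\<close>. By induction
  on its degree, take a root \<open>c\<close>: if \<open>f\<close> is not the scalar
  \<open>c\<close>, then \<open>f - c\<close> is invertible by \<open>schur_iso\<close> and cancels,
  which leaves an annihilating polynomial of smaller degree. Degree 0 is impossible because the
  identity of a simple object is nonzero.\<close>

lemma schur_scalar:
  assumes "simple_object C S" "arr C S S f"
  shows "\<exists>c. f = scl C c (idm C S)"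
proof -
  have S: "S \<in> Ob C" "idm C S \<noteq> 0"
    using simple_idm[OF assms(1)] by auto
  have *: "\<exists>c. f = scl C c (idm C S)" if "p \<noteq> 0" "peval S f p = 0" "degree p = n" for p n
    using that
  proof (induction n arbitrary: p)
    case 0
    then obtain a where "p = [:a:]"
      using degree_eq_zeroE by blast
    with 0 S show ?case
      using cmp_zero_r[OF assms(2)] by (auto simp: peval_pCons[OF assms(2)])
  next
    case (Suc n)
    then obtain c where "poly p c = 0"
      using alg_closed_imp_poly_has_root[of p] by auto
    then obtain q where q: "p = [:- c, 1:] * q"
      by (metis dvdE poly_eq_0_iff_dvd)
    show ?case
    proof (cases "f - scl C c (idm C S) = 0")
      case False
      have g: "arr C S S (f - scl C c (idm C S))"
        by (intro arr_diff arr_scl arr_idm assms S)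
      obtain h where h: "inverse_pair C S S (f - scl C c (idm C S)) h"
        using schur_iso[OF assms(1,1) g False] by blast
      have "(f - scl C c (idm C S)) \<cdot> peval S f q = 0"
        using Suc.prems(2) unfolding q peval_linear_factor[OF assms(2)] .
      then have "(h \<cdot> (f - scl C c (idm C S))) \<cdot> peval S f q = 0"
        using h cmp_zero_r[of S S h] assoc[OF arr_peval[OF assms(2)] g, of S h]
        by (simp add: inverse_pair_def)
      then have "peval S f q = 0"
        using h idl[OF arr_peval[OF assms(2)]] by (simp add: inverse_pair_def)
      moreover have "q \<noteq> 0" "degree q = n"
        using Suc.prems unfolding q by (auto simp: degree_mult_eq simp del: mult_pCons_left)
      ultimately show ?thesis
        using Suc.IH by blast
    qed auto
  qed
  obtain B where B: "finite B" "Hom C S S \<subseteq> V.span B"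
    using finite_dim S by blast
  have "peval S f (monom 1 i) \<in> V.span B" for i
    using arr_peval[OF assms(2)] B by (auto simp: arr_def)
  then obtain N c where c: "\<exists>i\<le>N. c i \<noteq> 0" "(\<Sum>i\<le>N. scl C (c i) (peval S f (monom 1 i))) = 0"
    by (rule V.nontrivial_relation[OF B(1)])
  define p where "p = (\<Sum>i\<le>N. monom (c i) i)"
  have "peval S f p = (\<Sum>i\<le>N. scl C (c i) (peval S f (monom 1 i)))"
    unfolding p_def peval_sum[OF assms(2)] by (intro sum.cong refl peval_monom assms)
  then have "peval S f p = 0"
    using c(2) by simp
  moreover have "p \<noteq> 0"
  proof -
    obtain i where i: "i \<le> N" "c i \<noteq> 0"
      using c by blast
    have "coeff p i = (\<Sum>j\<le>N. if j = i then c j else 0)"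
      by (auto simp: p_def coeff_sum intro!: sum.cong)
    then show ?thesis
      using i by auto
  qed
  ultimately show ?thesis
    using * by blast
qed

lemma hom_simple:
  assumes "simple_object C S" "simple_object C T" "inverse_pair C S T u v" "arr C S T f"
  shows "\<exists>c. f = scl C c u"
proof -
  have u: "arr C S T u" "arr C T S v" "u \<cdot> v = idm C T" "S \<in> Ob C"
    using assms by (auto simp: inverse_pair_def arr_def)
  obtain c where c: "v \<cdot> f = scl C c (idm C S)"
    using schur_scalar[OF assms(1) arr_cmp[OF assms(4) u(2)]] by blast
  have "f = u \<cdot> v \<cdot> f"
    using u assms by (simp add: idl flip: assoc[of S T f S v T u])
  also have "\<dots> = scl C c u"
    using u by (simp add: c cmp_scl_r[OF arr_idm u(1)] idr)
  finally show ?thesis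
    by blast
qed

text \<open>Semisimplicity makes composition a nondegenerate pairing between
  \<open>Hom C X Y\<close> and \<open>Hom C Y X\<close>: some component of \<open>u\<close> between
  simple summands is nonzero, hence invertible.\<close>

lemma nonzero_retract:
  assumes "arr C X Y u" "u \<noteq> 0"
  obtains v where "arr C Y X v" "v \<cdot> u \<noteq> 0"
proof -
  have XY: "X \<in> Ob C" "Y \<in> Ob C"
    using assms by (auto simp: arr_def)
  obtain n S \<iota> \<pi> where S: "\<forall>i<(n::nat). simple_object C (S i)" "direct_sum C {..<n} S X \<iota> \<pi>"
    using decomposition XY by metis
  obtain m T \<kappa> \<rho> where T: "\<forall>i<(m::nat). simple_object C (T i)" "direct_sum C {..<m} T Y \<kappa> \<rho>"
    using decomposition XY by metis
  note s = S(2)[unfolded direct_sum_iff] and t = T(2)[unfolded direct_sum_iff]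
  have "\<exists>i<n. u \<cdot> \<iota> i \<noteq> 0"
  proof (rule ccontr)
    assume *: "\<not> ?thesis"
    have "u = u \<cdot> (\<Sum>i<n. \<iota> i \<cdot> \<pi> i)"
      using s idr[OF assms(1)] by simp
    also have "\<dots> = (\<Sum>i<n. u \<cdot> \<iota> i \<cdot> \<pi> i)"
      using s by (intro cmp_sum_r[OF assms(1)]) (auto intro: arr_cmp)
    also have "\<dots> = (\<Sum>i<n. (u \<cdot> \<iota> i) \<cdot> \<pi> i)"
      using s assms by (intro sum.cong refl assoc[symmetric]) auto
    also have "\<dots> = 0"
    proof (rule sum.neutral, rule ballI)
      fix i assume "i \<in> {..<n}"
      then show "(u \<cdot> \<iota> i) \<cdot> \<pi> i = 0"
        using * s cmp_zero_l[of X "S i" "\<pi> i"] by auto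
    qed
    finally show False
      using assms by simp
  qed
  then obtain i where i: "i < n" "u \<cdot> \<iota> i \<noteq> 0"
    by blast
  have \<iota>: "arr C (S i) X (\<iota> i)" "arr C X (S i) (\<pi> i)" "\<pi> i \<cdot> \<iota> i = idm C (S i)"
    using s i by auto
  have w: "arr C (S i) Y (u \<cdot> \<iota> i)"
    using arr_cmp \<iota> assms by blast
  have "\<exists>j<m. \<rho> j \<cdot> u \<cdot> \<iota> i \<noteq> 0"
  proof (rule ccontr)
    assume *: "\<not> ?thesis"
    have "u \<cdot> \<iota> i = (\<Sum>j<m. \<kappa> j \<cdot> \<rho> j) \<cdot> u \<cdot> \<iota> i"
      using t idl[OF w] by simp
    also have "\<dots> = (\<Sum>j<m. (\<kappa> j \<cdot> \<rho> j) \<cdot> u \<cdot> \<iota> i)"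
      using t by (intro cmp_sum_l[OF w]) (auto intro: arr_cmp)
    also have "\<dots> = (\<Sum>j<m. \<kappa> j \<cdot> \<rho> j \<cdot> u \<cdot> \<iota> i)"
      using t w by (intro sum.cong refl assoc) auto
    also have "\<dots> = 0"
    proof (rule sum.neutral, rule ballI)
      fix j assume "j \<in> {..<m}"
      then show "\<kappa> j \<cdot> \<rho> j \<cdot> u \<cdot> \<iota> i = 0"
        using * t cmp_zero_r[of "T j" Y "\<kappa> j"] by auto
    qed
    finally show False
      using i by simp
  qed
  then obtain j where j: "j < m" "\<rho> j \<cdot> u \<cdot> \<iota> i \<noteq> 0"
    by blast
  have \<rho>: "arr C Y (T j) (\<rho> j)"
    using t j by auto
  obtain g where g: "inverse_pair C (S i) (T j) (\<rho> j \<cdot> u \<cdot> \<iota> i) g"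
    using schur_iso[OF _ _ arr_cmp[OF w \<rho>] j(2)] S T i j by blast
  then have ga: "arr C (T j) (S i) g" and gi: "g \<cdot> \<rho> j \<cdot> u \<cdot> \<iota> i = idm C (S i)"
    by (auto simp: inverse_pair_def)
  \<comment> \<open>The way back through the two chosen summands, with the inverse of the nonzero
    component in between, so that \<open>v \<cdot> u\<close> fixes \<open>\<iota> i\<close>.\<close>
  define v where "v = \<iota> i \<cdot> g \<cdot> \<rho> j"
  have gr: "arr C Y (S i) (g \<cdot> \<rho> j)"
    using arr_cmp \<rho> ga by blast
  have v: "arr C Y X v"
    unfolding v_def using arr_cmp gr \<iota> by blast
  have "(v \<cdot> u) \<cdot> \<iota> i = \<iota> i \<cdot> (g \<cdot> \<rho> j) \<cdot> u \<cdot> \<iota> i"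
    using assoc[OF \<iota>(1) assms(1) v] assoc[OF w gr \<iota>(1)] by (simp add: v_def)
  also have "\<dots> = \<iota> i"
    using assoc[OF w \<rho> ga] gi idr[OF \<iota>(1)] by simp
  finally have e: "(v \<cdot> u) \<cdot> \<iota> i = \<iota> i" .
  have "\<iota> i \<noteq> 0"
    using \<iota> simple_idm[of "S i"] S i cmp_zero_r[OF \<iota>(2)] by auto
  with e have "v \<cdot> u \<noteq> 0"
    using cmp_zero_l[OF \<iota>(1)] by auto
  with v show thesis
    by (rule that)
qed

lemma simple_retract:
  assumes "simple_object C S" "arr C S Y u" "u \<noteq> 0"
  obtains v where "arr C Y S v" "v \<cdot> u = idm C S"
proof -
  obtain v where v: "arr C Y S v" "v \<cdot> u \<noteq> 0"
    using nonzero_retract[OF assms(2,3)] .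
  obtain c where c: "v \<cdot> u = scl C c (idm C S)"
    using schur_scalar[OF assms(1) arr_cmp[OF assms(2) v(1)]] by blast
  with v have "c \<noteq> 0"
    by auto
  then have "scl C (1 / c) v \<cdot> u = idm C S"
    using cmp_scl_l[OF assms(2) v(1)] by (simp add: c)
  then show thesis
    using that arr_scl[OF v(1)] by blast
qed

text \<open>Isomorphisms from \<open>Z\<close> to summands, followed by the inclusions, form a
  basis: the projections isolate the coefficients, and each component of a morphism out of
  \<open>Z\<close> is zero or a multiple of the chosen isomorphism.\<close>

lemma hom_dim_simple:
  assumes "simple_object C Z" "direct_sum C I S X \<iota> \<pi>" "\<And>i. i \<in> I \<Longrightarrow> simple_object C (S i)"
  shows "hom_dim C Z X = card {i\<in>I. isomorphic C Z (S i)}"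
proof -
  let ?J = "{i\<in>I. isomorphic C Z (S i)}"
  note s = assms(2)[unfolded direct_sum_iff]
  have Z: "Z \<in> Ob C" "idm C Z \<noteq> 0"
    using simple_idm[OF assms(1)] by auto
  have "\<forall>i\<in>?J. \<exists>u v. inverse_pair C Z (S i) u v"
    by (auto simp: isomorphic_iff)
  then obtain u v where uv: "\<And>i. i \<in> ?J \<Longrightarrow> inverse_pair C Z (S i) (u i) (v i)"
    by metis
  then have u: "arr C Z (S i) (u i)" "arr C (S i) Z (v i)" "v i \<cdot> u i = idm C Z" if "i \<in> ?J" for i
    using that by (auto simp: inverse_pair_def)
  have u0: "u i \<noteq> 0" if "i \<in> ?J" for i
    using u[OF that] Z cmp_zero_r by force
  define b where "b i = \<iota> i \<cdot> u i" for i
  have b: "arr C Z X (b i)" if "i \<in> ?J" for i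
    unfolding b_def using s that by (intro arr_cmp[OF u(1)[OF that]]) auto
  have \<pi>b: "\<pi> j \<cdot> b i = (if i = j then u i else 0)" if "i \<in> ?J" "j \<in> I" for i j
  proof -
    have "\<pi> j \<cdot> b i = (\<pi> j \<cdot> \<iota> i) \<cdot> u i"
      unfolding b_def using s that u by (intro assoc[symmetric]) auto
    then show ?thesis
      using s that u(1)[OF that(1)] by (auto simp: idl cmp_zero_l)
  qed
  have c: "c i = 0" if c: "(\<Sum>i\<in>?J. scl C (c i) (b i)) = 0" "i \<in> ?J" for c i
  proof -
    have "0 = \<pi> i \<cdot> (\<Sum>j\<in>?J. scl C (c j) (b j))"
      using c s cmp_zero_r[of X "S i"] by auto
    also have "\<dots> = (\<Sum>j\<in>?J. \<pi> i \<cdot> scl C (c j) (b j))"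
      using s c b by (intro cmp_sum_r[where Z="S i"]) (auto intro: arr_scl)
    also have "\<dots> = (\<Sum>j\<in>?J. scl C (c j) (\<pi> i \<cdot> b j))"
      using s c b by (intro sum.cong refl cmp_scl_r) auto
    also have "\<dots> = (\<Sum>j\<in>?J. if j = i then scl C (c i) (u i) else 0)"
      using c \<pi>b by (intro sum.cong refl) auto
    also have "\<dots> = scl C (c i) (u i)"
      using c s by auto
    finally show ?thesis
      using u0 c by auto
  qed
  have inj: "inj_on b ?J"
  proof (rule inj_onI)
    fix i j assume ij: "i \<in> ?J" "j \<in> ?J" "b i = b j"
    show "i = j"
    proof (rule ccontr)
      assume "i \<noteq> j"
      then have "u i = 0"
        using \<pi>b[of i i] \<pi>b[of j i] ij by auto
      then show False
        using u0 ij by blast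
    qed
  qed
  have ind: "V.independent (b ` ?J)"
    using s c by (intro V.independent_family inj) auto
  have "f \<in> V.span (b ` ?J)" if f: "arr C Z X f" for f
  proof -
    have *: "\<iota> i \<cdot> \<pi> i \<cdot> f \<in> V.span (b ` ?J)" if i: "i \<in> I" for i
    proof (cases "\<pi> i \<cdot> f = 0")
      case True
      then show ?thesis
        using s i cmp_zero_r[of "S i" X "\<iota> i"] by (auto simp: V.span_zero)
    next
      case False
      have pf: "arr C Z (S i) (\<pi> i \<cdot> f)"
        using s i f by (auto intro: arr_cmp)
      have J: "i \<in> ?J"
        using schur_iso[OF assms(1) assms(3)[OF i] pf False] i by (auto simp: isomorphic_iff)
      obtain a where a: "\<pi> i \<cdot> f = scl C a (u i)"
        using hom_simple[OF assms(1) assms(3)[OF i] uv[OF J] pf] by blast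
      then have "\<iota> i \<cdot> \<pi> i \<cdot> f = scl C a (b i)"
        using s i u[OF J] by (simp add: cmp_scl_r[of Z "S i" "u i" X] b_def)
      then show ?thesis
        using J by (auto intro: V.span_scale V.span_base)
    qed
    have "f = (\<Sum>i\<in>I. \<iota> i \<cdot> \<pi> i) \<cdot> f"
      using s idl[OF f] by simp
    also have "\<dots> = (\<Sum>i\<in>I. (\<iota> i \<cdot> \<pi> i) \<cdot> f)"
      using s by (intro cmp_sum_l[OF f, where Z=X]) (auto intro: arr_cmp)
    also have "\<dots> = (\<Sum>i\<in>I. \<iota> i \<cdot> \<pi> i \<cdot> f)"
      using s f by (intro sum.cong refl assoc) auto
    finally show ?thesis
      using * by (metis (no_types, lifting) V.span_sum)
  qed
  moreover have "b ` ?J \<subseteq> Hom C Z X"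
    using b by (auto simp: arr_def)
  moreover have "X \<in> Ob C"
    using s by simp
  ultimately have "V.dim (Hom C Z X) = card (b ` ?J)"
    using Z by (intro V.dim_unique[OF _ _ ind]) (auto simp: arr_def)
  then show ?thesis
    using inj by (simp add: hom_dim_def card_image)
qed

text \<open>The additive extension of \<open>\<delta>\<close> from simple classes to all objects.
  With dimensions for \<open>\<delta>\<close> it is the dimension, with an indicator it is a
  multiplicity, and with fusion rules it gives multiplicities in a tensor product.\<close>

definition weight :: "('o set \<Rightarrow> nat) \<Rightarrow> 'o \<Rightarrow> nat"
  where "weight \<delta> X = (\<Sum>z\<in>Irr C. hom_dim C (class_rep z) X * \<delta> z)"

lemma hom_dim_class_rep:
  assumes "z \<in> Irr C" "direct_sum C I S X \<iota> \<pi>" "\<And>i. i \<in> I \<Longrightarrow> simple_object C (S i)"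
  shows "hom_dim C (class_rep z) X = card {i\<in>I. iso_class C (S i) = z}"
proof -
  have "isomorphic C (class_rep z) (S i) \<longleftrightarrow> iso_class C (S i) = z" for i
    using iso_class_eq_iff[of "class_rep z" "S i"] class_rep[OF assms(1)] by (auto simp: simple_object_def)
  then show ?thesis
    using hom_dim_simple[OF class_rep(1)[OF assms(1)] assms(2,3)] by simp
qed

text \<open>Exchange of two sums, since each summand counts for exactly one class. In particular the
  sum over the constituents is the same for every decomposition.\<close>

lemma weight_decomposition:
  assumes "finite (Irr C)" "direct_sum C I S X \<iota> \<pi>" "\<And>i. i \<in> I \<Longrightarrow> simple_object C (S i)"
  shows "weight \<delta> X = (\<Sum>i\<in>I. \<delta> (iso_class C (S i)))"
proof -
  have "finite I"
    using assms(2) by (simp add: direct_sum_def)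
  have "weight \<delta> X = (\<Sum>z\<in>Irr C. \<Sum>i\<in>I. if iso_class C (S i) = z then \<delta> z else 0)"
    unfolding weight_def using hom_dim_class_rep[OF _ assms(2,3)] \<open>finite I\<close>
    by (intro sum.cong refl) (simp add: sum.If_cases Int_def)
  also have "\<dots> = (\<Sum>i\<in>I. \<Sum>z\<in>Irr C. if iso_class C (S i) = z then \<delta> z else 0)"
    by (rule sum.swap)
  also have "\<dots> = (\<Sum>i\<in>I. \<delta> (iso_class C (S i)))"
    using assms(1,3) by (intro sum.cong refl) (simp add: Irr_def)
  finally show ?thesis .
qed

lemma weight_iso:
  assumes "finite (Irr C)" "isomorphic C X Y"
  shows "weight \<delta> X = weight \<delta> Y"
proof -
  obtain f g where fg: "inverse_pair C X Y f g"
    using assms by (auto simp: isomorphic_iff)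
  then have "X \<in> Ob C"
    by (simp add: inverse_pair_def arr_def)
  then obtain n S \<iota> \<pi> where S: "\<forall>i<(n::nat). simple_object C (S i)" "direct_sum C {..<n} S X \<iota> \<pi>"
    using decomposition by metis
  show ?thesis
    using weight_decomposition[OF assms(1) S(2)] weight_decomposition[OF assms(1) direct_sum_iso[OF S(2) fg]] S(1)
    by simp
qed

lemma weight_direct_sum:
  assumes "finite (Irr C)" "direct_sum C I W X \<iota> \<pi>"
  shows "weight \<delta> X = (\<Sum>i\<in>I. weight \<delta> (W i))"
proof -
  have I: "finite I" and "\<And>i. i \<in> I \<Longrightarrow> W i \<in> Ob C"
    using assms(2) by (auto simp: direct_sum_def)
  then have "\<forall>i\<in>I. \<exists>(n::nat) S \<iota> \<pi>. (\<forall>j<n. simple_object C (S j)) \<and> direct_sum C {..<n} S (W i) \<iota> \<pi>"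
    using decomposition by metis
  then obtain n S \<kappa> \<rho> where
    S: "\<And>i j. i \<in> I \<Longrightarrow> j < (n i::nat) \<Longrightarrow> simple_object C (S i j)"
      "\<And>i. i \<in> I \<Longrightarrow> direct_sum C {..<n i} (S i) (W i) (\<kappa> i) (\<rho> i)"
    by metis
  have "weight \<delta> X = (\<Sum>(i, j)\<in>Sigma I (\<lambda>i. {..<n i}). \<delta> (iso_class C (S i j)))"
    unfolding case_prod_unfold
    by (rule weight_decomposition[OF assms(1) direct_sum_Sigma[OF assms(2) S(2), unfolded case_prod_unfold]])
      (use S(1) in auto)
  also have "\<dots> = (\<Sum>i\<in>I. weight \<delta> (W i))"
    using I weight_decomposition[OF assms(1) S(2)] S(1) by (simp add: sum.Sigma[symmetric])
  finally show ?thesis .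
qed

lemma weight_simple:
  assumes "finite (Irr C)" "simple_object C S"
  shows "weight \<delta> S = \<delta> (iso_class C S)"
proof -
  have "S \<in> Ob C"
    using assms simple_idm by blast
  then have "direct_sum C {()} (\<lambda>_. S) S (\<lambda>_. idm C S) (\<lambda>_. idm C S)"
    by (simp add: direct_sum_iff arr_idm idl[OF arr_idm])
  from weight_decomposition[OF assms(1) this] show ?thesis
    using assms(2) by simp
qed

lemma weight_indicator:
  assumes "finite (Irr C)" "z \<in> Irr C"
  shows "weight (\<lambda>x. of_bool (x = z)) X = hom_dim C (class_rep z) X"
  using assms by (simp add: weight_def of_bool_def if_distrib cong: if_cong)

text \<open>The matrix units between isomorphic simple summands. There is one for each ordered pair
  of isomorphic summands, which makes a square for every class. Their number feeds the growth
  estimate.\<close>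

lemma endomorphisms_independent:
  assumes "finite (Irr C)" "X \<in> Ob C"
  obtains B where "B \<subseteq> Hom C X X" "finite B" "V.independent B"
    "card B = (\<Sum>z\<in>Irr C. (hom_dim C (class_rep z) X)\<^sup>2)"
proof -
  obtain n S \<iota> \<pi> where S: "\<forall>i<(n::nat). simple_object C (S i)" "direct_sum C {..<n} S X \<iota> \<pi>"
    using decomposition assms by metis
  note s = S(2)[unfolded direct_sum_iff]
  define J where "J = {(i, j). i < n \<and> j < n \<and> isomorphic C (S j) (S i)}"
  have fin: "finite J"
    by (rule finite_subset[of _ "{..<n} \<times> {..<n}"]) (auto simp: J_def)
  have "\<forall>i j. \<exists>u v. (i, j) \<in> J \<longrightarrow> inverse_pair C (S j) (S i) u v"
    by (auto simp: J_def isomorphic_iff)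
  then obtain u v where uv: "\<And>i j. (i, j) \<in> J \<Longrightarrow> inverse_pair C (S j) (S i) (u i j) (v i j)"
    by metis
  have u: "arr C (S j) (S i) (u i j)" "u i j \<noteq> 0" if "(i, j) \<in> J" for i j
  proof -
    have p: "arr C (S j) (S i) (u i j)" "arr C (S i) (S j) (v i j)" "v i j \<cdot> u i j = idm C (S j)"
      using uv[OF that] by (auto simp: inverse_pair_def)
    then show "arr C (S j) (S i) (u i j)" "u i j \<noteq> 0"
      using simple_idm[of "S j"] S(1) that cmp_zero_r[OF p(2)] by (auto simp: J_def)
  qed
  define b where "b = (\<lambda>(i, j). \<iota> i \<cdot> u i j \<cdot> \<pi> j)"
  have up: "arr C X (S i) (u i j \<cdot> \<pi> j)" and b: "arr C X X (b (i, j))" if "(i, j) \<in> J" for i j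
  proof -
    have a: "arr C X (S j) (\<pi> j)" "arr C (S i) X (\<iota> i)"
      using s that by (auto simp: J_def)
    show up: "arr C X (S i) (u i j \<cdot> \<pi> j)"
      using a(1) u(1)[OF that] by (rule arr_cmp)
    show "arr C X X (b (i, j))"
      using up a(2) by (auto simp: b_def intro: arr_cmp)
  qed
  \<comment> \<open>Sandwiching between a projection and an inclusion extracts the coefficient of a
    single matrix unit.\<close>
  have ext: "\<pi> i \<cdot> b (i', j') \<cdot> \<iota> j = (if i = i' \<and> j = j' then u i j else 0)"
    if "(i, j) \<in> J" "(i', j') \<in> J" for i j i' j'
  proof -
    have a: "arr C X (S i) (\<pi> i)" "arr C (S j) X (\<iota> j)" "arr C (S i') X (\<iota> i')" "arr C X (S j') (\<pi> j')"
      "\<pi> i \<cdot> \<iota> i' = (if i = i' then idm C (S i) else 0)" "\<pi> j' \<cdot> \<iota> j = (if j' = j then idm C (S j) else 0)"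
      using s that by (auto simp: J_def)
    note u' = u(1)[OF that(2)]
    have "b (i', j') \<cdot> \<iota> j = \<iota> i' \<cdot> u i' j' \<cdot> \<pi> j' \<cdot> \<iota> j"
      using assoc[OF a(2) up[OF that(2)] a(3)] assoc[OF a(2,4) u'] by (simp add: b_def)
    moreover have "arr C (S j) (S i') (u i' j' \<cdot> \<pi> j' \<cdot> \<iota> j)"
      using a u' by (blast intro: arr_cmp)
    ultimately have "\<pi> i \<cdot> b (i', j') \<cdot> \<iota> j = (\<pi> i \<cdot> \<iota> i') \<cdot> u i' j' \<cdot> \<pi> j' \<cdot> \<iota> j"
      using assoc[OF _ a(3) a(1)] by simp
    then show ?thesis
      using a u' \<open>arr C (S j) (S i') (u i' j' \<cdot> \<pi> j' \<cdot> \<iota> j)\<close>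
      by (auto simp: idl idr cmp_zero_l cmp_zero_r)
  qed
  have c: "c p = 0" if c: "(\<Sum>p\<in>J. scl C (c p) (b p)) = 0" "p \<in> J" for c p
  proof -
    obtain i j where p: "p = (i, j)"
      by force
    have a: "arr C X (S i) (\<pi> i)" "arr C (S j) X (\<iota> j)"
      using s c p by (auto simp: J_def)
    have bJ: "arr C X X (b q)" if "q \<in> J" for q
      using b that by (cases q) auto
    have "0 = \<pi> i \<cdot> (\<Sum>p\<in>J. scl C (c p) (b p)) \<cdot> \<iota> j"
      using c a cmp_zero_l cmp_zero_r by simp
    also have "\<dots> = \<pi> i \<cdot> (\<Sum>p\<in>J. scl C (c p) (b p \<cdot> \<iota> j))"
      using a bJ by (subst cmp_sum_l[OF a(2), where Z=X]) (auto intro!: arr_scl sum.cong cmp_scl_l arg_cong[of _ _ "\<lambda>f. \<pi> i \<cdot> f"])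
    also have "\<dots> = (\<Sum>p\<in>J. scl C (c p) (\<pi> i \<cdot> b p \<cdot> \<iota> j))"
      using a bJ by (subst cmp_sum_r[OF a(1), where X="S j"]) (auto intro!: arr_scl sum.cong cmp_scl_r arr_cmp)
    also have "\<dots> = (\<Sum>q\<in>J. if q = p then scl C (c p) (u i j) else 0)"
      using ext c by (intro sum.cong refl) (auto simp: p split: if_splits)
    also have "\<dots> = scl C (c p) (u i j)"
      using c fin by simp
    finally show ?thesis
      using u c p by simp
  qed
  have inj: "inj_on b J"
  proof (rule inj_onI, rule ccontr)
    fix p q assume pq: "p \<in> J" "q \<in> J" "b p = b q" "p \<noteq> q"
    obtain i j i' j' where "p = (i, j)" "q = (i', j')"
      by force
    then show False
      using ext[of i j i j] ext[of i j i' j'] u(2) pq by (auto split: if_splits)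
  qed
  have "card J = (\<Sum>z\<in>Irr C. (hom_dim C (class_rep z) X)\<^sup>2)"
  proof -
    let ?I = "\<lambda>z. {i\<in>{..<n}. iso_class C (S i) = z}"
    \<comment> \<open>Two summands are isomorphic iff their classes agree, so the index set is a
      disjoint union of squares.\<close>
    have "J = (\<Union>z\<in>Irr C. ?I z \<times> ?I z)"
      using S(1) simple_idm class_rep_iso(2) iso_class_eq_iff unfolding J_def by fastforce
    then have "card J = card (\<Union>z\<in>Irr C. ?I z \<times> ?I z)"
      by simp
    also have "\<dots> = (\<Sum>z\<in>Irr C. card (?I z \<times> ?I z))"
      using assms by (intro card_UN_disjoint) auto
    also have "\<dots> = (\<Sum>z\<in>Irr C. (hom_dim C (class_rep z) X)\<^sup>2)"
    proof (intro sum.cong refl)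
      fix z assume "z \<in> Irr C"
      then have "hom_dim C (class_rep z) X = card (?I z)"
        using S(1) by (intro hom_dim_class_rep[OF _ S(2)]) auto
      then show "card (?I z \<times> ?I z) = (hom_dim C (class_rep z) X)\<^sup>2"
        by (simp only: card_cartesian_product power2_eq_square)
    qed
    finally show ?thesis .
  qed
  moreover have "V.independent (b ` J)"
    by (rule V.independent_family[OF fin inj]) (rule c)
  moreover have "b ` J \<subseteq> Hom C X X"
    using b by (force simp: arr_def)
  ultimately show thesis
    using that[of "b ` J"] fin card_image[OF inj] by simp
qed

end

section \<open>Tensor products\<close>

primrec tensor_power :: "('k, 'o, 'm) moncat \<Rightarrow> 'o \<Rightarrow> nat \<Rightarrow> 'o"
  where "tensor_power C X 0 = unitO C"
  | "tensor_power C X (Suc k) = tensor_power C X k \<boxtimes>\<^bsub>C\<^esub> X"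

text \<open>A bilinear tensor product that is functorial in both variables, without constraint
  isomorphisms. It covers matrices and representations as well as monoidal categories.\<close>

locale linear_tensor = linear_category +
  assumes unit_Ob: "unitO C \<in> Ob C"
    and ten_Ob: "\<lbrakk>X \<in> Ob C; Y \<in> Ob C\<rbrakk> \<Longrightarrow> X \<boxtimes> Y \<in> Ob C"
    and arr_ten: "\<lbrakk>arr C X X' f; arr C Y Y' g\<rbrakk> \<Longrightarrow> arr C (X \<boxtimes> Y) (X' \<boxtimes> Y') (f \<star> g)"
    and ten_idm: "\<lbrakk>X \<in> Ob C; Y \<in> Ob C\<rbrakk> \<Longrightarrow> idm C X \<star> idm C Y = idm C (X \<boxtimes> Y)"
    and ten_cmp: "\<lbrakk>arr C X X' f; arr C X' X'' f'; arr C Y Y' g; arr C Y' Y'' g'\<rbrakk>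
      \<Longrightarrow> (f' \<star> g') \<cdot> (f \<star> g) = (f' \<cdot> f) \<star> (g' \<cdot> g)"
    and ten_add_l: "\<lbrakk>arr C X X' f; arr C X X' f'; arr C Y Y' g\<rbrakk> \<Longrightarrow> (f + f') \<star> g = f \<star> g + f' \<star> g"
    and ten_add_r: "\<lbrakk>arr C X X' f; arr C Y Y' g; arr C Y Y' g'\<rbrakk> \<Longrightarrow> f \<star> (g + g') = f \<star> g + f \<star> g'"
begin

lemma ten_zero_l:
  assumes "X \<in> Ob C" "arr C Y Y' g"
  shows "0 \<star> g = 0"
proof -
  have "0 \<star> g + 0 \<star> g = 0 \<star> g"
    using ten_add_l[OF arr_zero arr_zero assms(2), of X X] assms by simp
  then show ?thesis
    by simp
qed

lemma ten_zero_r: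
  assumes "Y \<in> Ob C" "arr C X X' f"
  shows "f \<star> 0 = 0"
proof -
  have "f \<star> 0 + f \<star> 0 = f \<star> 0"
    using ten_add_r[OF assms(2) arr_zero arr_zero, of Y Y] assms by simp
  then show ?thesis
    by simp
qed

lemma ten_sum_l:
  assumes "X \<in> Ob C" "X' \<in> Ob C" "arr C Y Y' g" "\<And>i. i \<in> I \<Longrightarrow> arr C X X' (f i)"
  shows "(\<Sum>i\<in>I. f i) \<star> g = (\<Sum>i\<in>I. f i \<star> g)"
  using assms(4)
proof (induction I rule: infinite_finite_induct)
  case (insert i I)
  then have "arr C X X' (\<Sum>i\<in>I. f i)"
    using assms by (intro arr_sum) auto
  then show ?case
    using insert ten_add_l[OF _ _ assms(3), of X X' "f i" "\<Sum>i\<in>I. f i"] by simp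
qed (auto simp: ten_zero_l[OF assms(1,3)])

lemma ten_sum_r:
  assumes "Y \<in> Ob C" "Y' \<in> Ob C" "arr C X X' f" "\<And>i. i \<in> I \<Longrightarrow> arr C Y Y' (g i)"
  shows "f \<star> (\<Sum>i\<in>I. g i) = (\<Sum>i\<in>I. f \<star> g i)"
  using assms(4)
proof (induction I rule: infinite_finite_induct)
  case (insert i I)
  then have "arr C Y Y' (\<Sum>i\<in>I. g i)"
    using assms by (intro arr_sum) auto
  then show ?case
    using insert ten_add_r[OF assms(3), of Y Y' "g i" "\<Sum>i\<in>I. g i"] by simp
qed (auto simp: ten_zero_r[OF assms(1,3)])

lemma inverse_pair_ten:
  assumes "inverse_pair C X X' f f'" "inverse_pair C Y Y' g g'"
  shows "inverse_pair C (X \<boxtimes> Y) (X' \<boxtimes> Y') (f \<star> g) (f' \<star> g')"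
proof -
  have a: "arr C X X' f" "arr C X' X f'" "arr C Y Y' g" "arr C Y' Y g'"
    "f' \<cdot> f = idm C X" "f \<cdot> f' = idm C X'" "g' \<cdot> g = idm C Y" "g \<cdot> g' = idm C Y'"
    using assms by (auto simp: inverse_pair_def)
  have "X \<in> Ob C" "X' \<in> Ob C" "Y \<in> Ob C" "Y' \<in> Ob C"
    using a by (auto simp: arr_def)
  then show ?thesis
    unfolding inverse_pair_def using a arr_ten[OF a(1,3)] arr_ten[OF a(2,4)]
    by (simp add: ten_cmp[OF a(1,2,3,4)] ten_cmp[OF a(2,1,4,3)] ten_idm)
qed

lemma isomorphic_ten: "isomorphic C X X' \<Longrightarrow> isomorphic C Y Y' \<Longrightarrow> isomorphic C (X \<boxtimes> Y) (X' \<boxtimes> Y')"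
  unfolding isomorphic_iff by (blast intro: inverse_pair_ten)

lemma direct_sum_ten:
  assumes "direct_sum C I S X \<iota> \<pi>" "direct_sum C J T Y \<kappa> \<rho>"
  shows "direct_sum C (I \<times> J) (\<lambda>(i, j). S i \<boxtimes> T j) (X \<boxtimes> Y)
    (\<lambda>(i, j). \<iota> i \<star> \<kappa> j) (\<lambda>(i, j). \<pi> i \<star> \<rho> j)"
proof -
  note s = assms(1)[unfolded direct_sum_iff] and t = assms(2)[unfolded direct_sum_iff]
  have XY: "X \<in> Ob C" "Y \<in> Ob C"
    using s t by auto
  have 1: "(\<pi> i \<star> \<rho> j) \<cdot> (\<iota> i' \<star> \<kappa> j') = (if i = i' \<and> j = j' then idm C (S i \<boxtimes> T j) else 0)"
    if "i \<in> I" "j \<in> J" "i' \<in> I" "j' \<in> J" for i j i' j'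
  proof -
    have a: "arr C (S i') X (\<iota> i')" "arr C X (S i) (\<pi> i)" "arr C (T j') Y (\<kappa> j')" "arr C Y (T j) (\<rho> j)"
      using s t that by auto
    then have b: "arr C (S i') (S i) (\<pi> i \<cdot> \<iota> i')" "arr C (T j') (T j) (\<rho> j \<cdot> \<kappa> j')"
        "S i' \<in> Ob C" "T j' \<in> Ob C"
      by (auto simp: arr_def intro: cmp_Hom)
    show ?thesis
      using s t that b ten_zero_l[OF b(3,2)] ten_zero_r[OF b(4,1)]
      by (auto simp: ten_cmp[OF a] ten_idm)
  qed
  have "(\<Sum>(i, j)\<in>I \<times> J. (\<iota> i \<star> \<kappa> j) \<cdot> (\<pi> i \<star> \<rho> j)) = (\<Sum>(i, j)\<in>I \<times> J. (\<iota> i \<cdot> \<pi> i) \<star> (\<kappa> j \<cdot> \<rho> j))"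
    using s t by (intro sum.cong refl) (auto intro!: ten_cmp)
  also have "\<dots> = (\<Sum>i\<in>I. \<Sum>j\<in>J. (\<iota> i \<cdot> \<pi> i) \<star> (\<kappa> j \<cdot> \<rho> j))"
    by (simp add: sum.cartesian_product)
  also have "\<dots> = (\<Sum>i\<in>I. (\<iota> i \<cdot> \<pi> i) \<star> (\<Sum>j\<in>J. \<kappa> j \<cdot> \<rho> j))"
  proof (intro sum.cong refl ten_sum_r[symmetric])
    show "arr C X X (\<iota> i \<cdot> \<pi> i)" if "i \<in> I" for i
      using s that by (blast intro: arr_cmp)
    show "arr C Y Y (\<kappa> j \<cdot> \<rho> j)" if "j \<in> J" for j
      using t that by (blast intro: arr_cmp)
  qed (use XY in auto)
  also have "\<dots> = (\<Sum>i\<in>I. \<iota> i \<cdot> \<pi> i) \<star> (\<Sum>j\<in>J. \<kappa> j \<cdot> \<rho> j)"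
  proof (rule ten_sum_l[symmetric])
    show "arr C X X (\<iota> i \<cdot> \<pi> i)" if "i \<in> I" for i
      using s that by (blast intro: arr_cmp)
    show "arr C Y Y (\<Sum>j\<in>J. \<kappa> j \<cdot> \<rho> j)"
      using t by (simp add: arr_idm)
  qed (use XY in auto)
  finally have "(\<Sum>(i, j)\<in>I \<times> J. (\<iota> i \<star> \<kappa> j) \<cdot> (\<pi> i \<star> \<rho> j)) = idm C (X \<boxtimes> Y)"
    using s t XY by (simp add: ten_idm)
  then show ?thesis
    unfolding direct_sum_iff using s t XY 1 by (auto simp: case_prod_unfold ten_Ob intro: arr_ten)
qed

lemma tensor_power_Ob: "X \<in> Ob C \<Longrightarrow> tensor_power C X k \<in> Ob C"
  by (induction k) (auto simp: unit_Ob ten_Ob)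

end

locale schur_tensor = schur_category + linear_tensor +
  assumes unit_simple: "simple_object C (unitO C)"
begin

text \<open>Replacing the simple constituents by the representatives of their classes brings the
  tensor product into the form in which fusion rules are defined.\<close>

lemma weight_ten:
  assumes "finite (Irr C)"
    and "direct_sum C I S X \<iota> \<pi>" "\<And>i. i \<in> I \<Longrightarrow> simple_object C (S i)"
    and "direct_sum C J T Y \<kappa> \<rho>" "\<And>j. j \<in> J \<Longrightarrow> simple_object C (T j)"
  shows "weight \<delta> (X \<boxtimes> Y) = (\<Sum>i\<in>I. \<Sum>j\<in>J.
    weight \<delta> (class_rep (iso_class C (S i)) \<boxtimes> class_rep (iso_class C (T j))))"
proof -
  have "weight \<delta> (X \<boxtimes> Y) = (\<Sum>(i, j)\<in>I \<times> J. weight \<delta> (S i \<boxtimes> T j))"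
    using weight_direct_sum[OF assms(1) direct_sum_ten[OF assms(2,4)]] by (simp add: case_prod_unfold)
  also have "\<dots> = (\<Sum>(i, j)\<in>I \<times> J. weight \<delta> (class_rep (iso_class C (S i)) \<boxtimes> class_rep (iso_class C (T j))))"
    using assms by (intro sum.cong refl) (auto intro!: weight_iso isomorphic_ten class_rep_iso)
  finally show ?thesis
    by (simp add: sum.cartesian_product)
qed

end

text \<open>Simplicity expressed by endomorphisms alone: it can be pulled back along an equivalence
  and tested on the object underlying an equivariant one, without any discussion of
  subobjects.\<close>

definition scalar_end :: "('k, 'o, 'm::zero) moncat \<Rightarrow> 'o \<Rightarrow> bool"
  where "scalar_end C X \<longleftrightarrow> X \<in> Ob C \<and> idm C X \<noteq> 0 \<and> (\<forall>f. arr C X X f \<longrightarrow> (\<exists>c. f = scl C c (idm C X)))"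

definition invertible_object :: "('k, 'o, 'm) moncat \<Rightarrow> 'o \<Rightarrow> bool"
  where "invertible_object C X \<longleftrightarrow> X \<in> Ob C \<and>
    (\<exists>Y\<in>Ob C. isomorphic C (X \<boxtimes>\<^bsub>C\<^esub> Y) (unitO C) \<and> isomorphic C (Y \<boxtimes>\<^bsub>C\<^esub> X) (unitO C))"

lemma (in schur_category) simple_scalar_end: "simple_object C S \<Longrightarrow> scalar_end C S"
  using simple_idm schur_scalar by (auto simp: scalar_end_def)

text \<open>The Hom space is at most one-dimensional. If it is zero, \<open>u = 0\<close> spans it;
  otherwise a nonzero \<open>u\<close> is invertible up to a scalar.\<close>

lemma (in schur_category) hom_scalar_end:
  assumes "scalar_end C L" "scalar_end C M"
  obtains u where "arr C L M u" "\<And>f. arr C L M f \<Longrightarrow> \<exists>c. f = scl C c u"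
proof (cases "\<forall>f. arr C L M f \<longrightarrow> f = 0")
  case True
  then show ?thesis
    using assms that[of 0] arr_zero by (auto simp: scalar_end_def)
next
  case False
  then obtain u where u: "arr C L M u" "u \<noteq> 0"
    by blast
  then obtain v where v: "arr C M L v" "v \<cdot> u \<noteq> 0"
    by (rule nonzero_retract)
  obtain a where a: "v \<cdot> u = scl C a (idm C L)"
    using assms(1) arr_cmp[OF u(1) v(1)] by (auto simp: scalar_end_def)
  obtain b where b: "u \<cdot> v = scl C b (idm C M)"
    using assms(2) arr_cmp[OF v(1) u(1)] by (auto simp: scalar_end_def)
  \<comment> \<open>Bracketing \<open>u \<cdot> v \<cdot> u\<close> in two ways shows that both
    composites are the same scalar.\<close>
  have "scl C a u = u \<cdot> v \<cdot> u"
    using u a cmp_scl_r[OF arr_idm u(1)] assms(1) by (simp add: scalar_end_def idr)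
  also have "\<dots> = scl C b u"
    using u b cmp_scl_l[OF u(1) arr_idm] assms(2) by (simp add: scalar_end_def idl flip: assoc[OF u(1) v(1) u(1)])
  finally have "b = a"
    using u(2) by simp
  have "a \<noteq> 0"
    using v a by auto
  show ?thesis
  proof (rule that[OF u(1)])
    fix f assume f: "arr C L M f"
    obtain c where c: "v \<cdot> f = scl C c (idm C L)"
      using assms(1) arr_cmp[OF f v(1)] by (auto simp: scalar_end_def)
    have "scl C a f = (u \<cdot> v) \<cdot> f"
      using f b \<open>b = a\<close> cmp_scl_l[OF f arr_idm] assms(2) by (simp add: scalar_end_def idl)
    also have "\<dots> = scl C c u"
      using u c cmp_scl_r[OF arr_idm u(1)] assms(1) by (simp add: scalar_end_def idr assoc[OF f v(1) u(1)])
    finally have "scl C (1 / a) (scl C a f) = scl C (1 / a) (scl C c u)"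
      by simp
    then have "f = scl C (1 / a * c) u"
      using \<open>a \<noteq> 0\<close> by simp
    then show "\<exists>c. f = scl C c u"
      by blast
  qed
qed

sublocale monoidal_category \<subseteq> linear_tensor C
  by unfold_locales (auto simp: arr_def unitO_Ob tenO_Ob tenM_Hom tenM_idm tenM_cmp tenM_add_left tenM_add_right)

context monoidal_category
begin

lemma isomorphic_asc: "X \<in> Ob C \<Longrightarrow> Y \<in> Ob C \<Longrightarrow> Z \<in> Ob C \<Longrightarrow> isomorphic C ((X \<boxtimes> Y) \<boxtimes> Z) (X \<boxtimes> (Y \<boxtimes> Z))"
  using asc_iso by (auto simp: isomorphic_def ten_Ob)

lemma isomorphic_lun: "X \<in> Ob C \<Longrightarrow> isomorphic C (unitO C \<boxtimes> X) X"
  using lun_iso by (auto simp: isomorphic_def ten_Ob unit_Ob)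

text \<open>The inverse of a product is the product of the inverses in reverse order; the inner pair
  contracts to the unit.\<close>

lemma isomorphic_ten4:
  assumes "X \<in> Ob C" "X' \<in> Ob C" "Y' \<in> Ob C" "Y \<in> Ob C"
    and "isomorphic C (X' \<boxtimes> Y') (unitO C)" "isomorphic C (X \<boxtimes> Y) (unitO C)"
  shows "isomorphic C ((X \<boxtimes> X') \<boxtimes> (Y' \<boxtimes> Y)) (unitO C)"
proof -
  note tr [trans] = isomorphic_trans
  have "isomorphic C ((X \<boxtimes> X') \<boxtimes> (Y' \<boxtimes> Y)) (X \<boxtimes> (X' \<boxtimes> (Y' \<boxtimes> Y)))"
    using assms by (intro isomorphic_asc ten_Ob)
  also have "isomorphic C \<dots> (X \<boxtimes> ((X' \<boxtimes> Y') \<boxtimes> Y))"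
    using assms by (intro isomorphic_ten isomorphic_refl isomorphic_sym[OF isomorphic_asc])
  also have "isomorphic C \<dots> (X \<boxtimes> (unitO C \<boxtimes> Y))"
    using assms by (intro isomorphic_ten isomorphic_refl)
  also have "isomorphic C \<dots> (X \<boxtimes> Y)"
    using assms by (intro isomorphic_ten isomorphic_refl isomorphic_lun)
  also have "isomorphic C \<dots> (unitO C)"
    by fact
  finally show ?thesis .
qed

lemma invertible_ten:
  assumes "invertible_object C X" "invertible_object C X'"
  shows "invertible_object C (X \<boxtimes> X')"
proof -
  obtain Y where Y: "X \<in> Ob C" "Y \<in> Ob C" "isomorphic C (X \<boxtimes> Y) (unitO C)" "isomorphic C (Y \<boxtimes> X) (unitO C)"
    using assms(1) by (auto simp: invertible_object_def)
  obtain Y' where Y': "X' \<in> Ob C" "Y' \<in> Ob C" "isomorphic C (X' \<boxtimes> Y') (unitO C)" "isomorphic C (Y' \<boxtimes> X') (unitO C)"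
    using assms(2) by (auto simp: invertible_object_def)
  show ?thesis
    unfolding invertible_object_def
    using isomorphic_ten4[OF Y(1) Y'(1,2) Y(2) Y'(3) Y(3)] isomorphic_ten4[OF Y'(2) Y(2,1) Y'(1) Y(4) Y'(4)]
      Y Y' ten_Ob by blast
qed

lemma invertible_unit: "invertible_object C (unitO C)"
  using isomorphic_lun[OF unit_Ob] unit_Ob by (auto simp: invertible_object_def)

lemma invertible_iso:
  assumes "invertible_object C X" "isomorphic C X X'"
  shows "invertible_object C X'"
proof -
  obtain Y where Y: "Y \<in> Ob C" "isomorphic C (X \<boxtimes> Y) (unitO C)" "isomorphic C (Y \<boxtimes> X) (unitO C)"
    using assms(1) by (auto simp: invertible_object_def)
  have "isomorphic C (X' \<boxtimes> Y) (X \<boxtimes> Y)" "isomorphic C (Y \<boxtimes> X') (Y \<boxtimes> X)"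
    using Y assms by (auto intro: isomorphic_ten isomorphic_refl isomorphic_sym)
  then have "isomorphic C (X' \<boxtimes> Y) (unitO C)" "isomorphic C (Y \<boxtimes> X') (unitO C)"
    using Y isomorphic_trans by blast+
  then show ?thesis
    using Y assms(2) by (auto simp: invertible_object_def isomorphic_def)
qed

text \<open>Tensoring with \<open>Y\<close> is undone, up to natural isomorphism, by tensoring with its inverse.\<close>

lemma ten_faithful:
  assumes "arr C X X g" "Y \<in> Ob C" "Y' \<in> Ob C" "isomorphic C (Y \<boxtimes> Y') (unitO C)" "g \<star> idm C Y = 0"
  shows "g = 0"
proof -
  have X: "X \<in> Ob C"
    using assms by (simp add: arr_def)
  note iY = arr_idm[OF assms(2)] and iY' = arr_idm[OF assms(3)] and i1 = arr_idm[OF unit_Ob]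
  let ?P = "Y \<boxtimes> Y'"
  have P: "?P \<in> Ob C"
    using assms by (simp add: ten_Ob)
  obtain b where b: "inverse_pair C ((X \<boxtimes> Y) \<boxtimes> Y') (X \<boxtimes> ?P) (asc C X Y Y') b"
    by (rule isomorphismE[OF asc_iso[OF X assms(2,3)]]) (use X assms in \<open>auto simp: ten_Ob\<close>)
  have gP: "arr C (X \<boxtimes> ?P) (X \<boxtimes> ?P) (g \<star> idm C ?P)"
    by (intro arr_ten assms arr_idm P)
  \<comment> \<open>Naturality of the associator turns tensoring with \<open>Y\<close> and then with
    \<open>Y'\<close> into tensoring with their product, which is isomorphic to the unit.\<close>
  have "asc C X Y Y' \<cdot> ((g \<star> idm C Y) \<star> idm C Y') = (g \<star> (idm C Y \<star> idm C Y')) \<cdot> asc C X Y Y'"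
    using assms X by (intro asc_natural) (auto simp: arr_def idm_Hom)
  then have 1: "(g \<star> idm C ?P) \<cdot> asc C X Y Y' = 0"
    using assms X b by (simp add: ten_idm ten_zero_l[OF X iY'] cmp_zero_r[of "(X \<boxtimes> Y) \<boxtimes> Y'" "X \<boxtimes> ?P"] inverse_pair_def)
  have "g \<star> idm C ?P = ((g \<star> idm C ?P) \<cdot> asc C X Y Y') \<cdot> b"
    using b gP by (simp add: inverse_pair_def idr assoc[of "X \<boxtimes> ?P" "(X \<boxtimes> Y) \<boxtimes> Y'" b "X \<boxtimes> ?P" _ "X \<boxtimes> ?P"])
  then have 2: "g \<star> idm C ?P = 0"
    using 1 b cmp_zero_l[of "X \<boxtimes> ?P" "(X \<boxtimes> Y) \<boxtimes> Y'" b] by (simp add: inverse_pair_def)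
  obtain p q where pq: "inverse_pair C ?P (unitO C) p q"
    using assms(4) by (auto simp: isomorphic_iff)
  then have p: "arr C ?P (unitO C) p" "arr C (unitO C) ?P q" "p \<cdot> q = idm C (unitO C)"
    by (auto simp: inverse_pair_def)
  have "(g \<star> p) \<cdot> (idm C X \<star> q) = g \<star> idm C (unitO C)"
    using ten_cmp[OF arr_idm[OF X] assms(1) p(2,1)] p by (simp add: idr[OF assms(1)])
  moreover have "(idm C X \<star> p) \<cdot> (g \<star> idm C ?P) = g \<star> p"
    using ten_cmp[OF assms(1) arr_idm[OF X] arr_idm[OF P] p(1)] p by (simp add: idr[OF p(1)] idl[OF assms(1)])
  ultimately have 3: "g \<star> idm C (unitO C) = 0"
    using 2 cmp_zero_r[OF arr_ten[OF arr_idm[OF X] p(1)]] cmp_zero_l[OF arr_ten[OF arr_idm[OF X] p(2)]] by simp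
  obtain r where r: "inverse_pair C (X \<boxtimes> unitO C) X (run C X) r"
    by (rule isomorphismE[OF run_iso[OF X]]) (use X in \<open>auto simp: ten_Ob unit_Ob\<close>)
  have "run C X \<cdot> (g \<star> idm C (unitO C)) = g \<cdot> run C X"
    using assms by (intro run_natural) (auto simp: arr_def)
  then have "g \<cdot> run C X = 0"
    using 3 r by (simp add: inverse_pair_def cmp_zero_r[of "X \<boxtimes> unitO C" X])
  moreover have "g = (g \<cdot> run C X) \<cdot> r"
    using r assms(1) by (simp add: inverse_pair_def idr assoc[of X "X \<boxtimes> unitO C" r X _ X])
  ultimately show ?thesis
    using r cmp_zero_l[of X "X \<boxtimes> unitO C" r] by (simp add: inverse_pair_def)
qed

text \<open>Tensoring an endomorphism of \<open>X\<close> with the inverse \<open>Y\<close> gives an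
  endomorphism of an object isomorphic to the unit, hence a scalar; by \<open>ten_faithful\<close>
  the endomorphism itself was this scalar.\<close>

lemma invertible_scalar_end:
  assumes "scalar_end C (unitO C)" "invertible_object C X"
  shows "scalar_end C X"
proof -
  obtain Y where Y: "X \<in> Ob C" "Y \<in> Ob C" "isomorphic C (X \<boxtimes> Y) (unitO C)" "isomorphic C (Y \<boxtimes> X) (unitO C)"
    using assms(2) by (auto simp: invertible_object_def)
  obtain p q where pq: "inverse_pair C (X \<boxtimes> Y) (unitO C) p q"
    using Y by (auto simp: isomorphic_iff)
  then have p: "arr C (X \<boxtimes> Y) (unitO C) p" "arr C (unitO C) (X \<boxtimes> Y) q" "p \<cdot> q = idm C (unitO C)"
      "q \<cdot> p = idm C (X \<boxtimes> Y)"
    by (auto simp: inverse_pair_def)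
  note iX = arr_idm[OF Y(1)] and iY = arr_idm[OF Y(2)]
  have "idm C X \<noteq> 0"
  proof
    assume "idm C X = 0"
    then have "idm C (X \<boxtimes> Y) = 0"
      using ten_idm[OF Y(1,2)] ten_zero_l[OF Y(1) iY] by simp
    then have "idm C (unitO C) = 0"
      using p idl[OF p(2)] cmp_zero_r[OF p(1)] cmp_zero_l[OF p(2)] by simp
    then show False
      using assms(1) by (simp add: scalar_end_def)
  qed
  moreover have "\<exists>c. f = scl C c (idm C X)" if f: "arr C X X f" for f
  proof -
    let ?f = "f \<star> idm C Y"
    have F: "arr C (X \<boxtimes> Y) (X \<boxtimes> Y) ?f"
      by (intro arr_ten f iY)
    have Fq: "arr C (unitO C) (X \<boxtimes> Y) (?f \<cdot> q)"
      using p F by (blast intro: arr_cmp)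
    obtain c where c: "p \<cdot> ?f \<cdot> q = scl C c (idm C (unitO C))"
      using assms(1) arr_cmp[OF Fq p(1)] by (auto simp: scalar_end_def)
    have "?f = (q \<cdot> p) \<cdot> ?f \<cdot> (q \<cdot> p)"
      using p F by (simp add: idl idr)
    also have "\<dots> = q \<cdot> (p \<cdot> ?f \<cdot> q) \<cdot> p"
      using arr_cmp[OF Fq p(1)] assoc[OF p(1,2) F] assoc[OF p(1) Fq p(1)] arr_cmp[OF p(1) Fq]
        assoc[OF arr_cmp[OF p(1) Fq] p(1,2)] by simp
    also have "\<dots> = scl C c (idm C (X \<boxtimes> Y))"
      unfolding c using p cmp_scl_l[OF p(1) arr_idm[OF unit_Ob]] cmp_scl_r[OF p(1,2)] by (simp add: idl)
    also have "\<dots> = scl C c (idm C X) \<star> idm C Y"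
      using iX iY ten_idm[OF Y(1,2)] Y by (simp add: tenM_scl_left[of X X Y Y] arr_def)
    finally have e: "?f = scl C c (idm C X) \<star> idm C Y" .
    have a: "arr C X X (f - scl C c (idm C X))"
      by (intro arr_diff arr_scl f iX)
    have "(f - scl C c (idm C X)) \<star> idm C Y + scl C c (idm C X) \<star> idm C Y = ?f"
      using ten_add_l[OF a arr_scl[OF iX, of c] iY] by simp
    then have "(f - scl C c (idm C X)) \<star> idm C Y = 0"
      using e by simp
    then have "f - scl C c (idm C X) = 0"
      using ten_faithful[OF a Y(2,1,4)] by blast
    then show ?thesis
      by auto
  qed
  ultimately show ?thesis
    using Y by (simp add: scalar_end_def)
qed

end

text \<open>The kernel of \<open>f\<close> is a monomorphism into the simple object
  \<open>S\<close>, so it is zero or everything, and the latter would give \<open>f = 0\<close>.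
  With zero kernel \<open>f\<close> is a monomorphism, and simplicity of \<open>T\<close> makes it
  an isomorphism.\<close>

lemma (in abelian_category) schur:
  assumes "simple_object C S" "simple_object C T" "arr C S T f" "f \<noteq> 0"
  shows "\<exists>g. inverse_pair C S T f g"
proof -
  have ST: "S \<in> Ob C" "T \<in> Ob C"
    using assms by (auto simp: arr_def)
  obtain K \<kappa> where k: "is_kernel C S T f K \<kappa>"
    using kernels[OF ST] assms(3) unfolding arr_def by blast
  then have K: "arr C K S \<kappa>" "f \<cdot> \<kappa> = 0" "K \<in> Ob C"
    using ST by (auto simp: is_kernel_def arr_def)
  have lift: "\<exists>!u. u \<in> Hom C W K \<and> \<kappa> \<cdot> u = g" if "arr C W S g" "f \<cdot> g = 0" for W g
    using k that by (auto simp: is_kernel_def arr_def)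
  have "is_mono C K S \<kappa>"
    unfolding is_mono_def
  proof (intro conjI ballI impI)
    show "\<kappa> \<in> Hom C K S"
      using K by (simp add: arr_def)
    fix W g h assume W: "W \<in> Ob C" "g \<in> Hom C W K" "h \<in> Hom C W K" "\<kappa> \<cdot> g = \<kappa> \<cdot> h"
    have g: "arr C W K g"
      using W K by (simp add: arr_def)
    have "f \<cdot> \<kappa> \<cdot> g = 0"
      using assoc[OF g K(1) assms(3)] K cmp_zero_l[OF g] by simp
    then have "\<exists>!u. u \<in> Hom C W K \<and> \<kappa> \<cdot> u = \<kappa> \<cdot> g"
      by (rule lift[OF arr_cmp[OF g K(1)]])
    then show "g = h"
      by (rule ex1E) (use W(2-4) in metis)
  qed
  then consider "zero_object C K" | "isomorphism C K S \<kappa>"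
    using assms(1) K(3) by (auto simp: simple_object_def)
  then have "zero_object C K"
  proof cases
    case 2
    then obtain l where l: "inverse_pair C K S \<kappa> l"
      using isomorphismE K ST by blast
    then have l: "arr C S K l" "\<kappa> \<cdot> l = idm C S"
      by (auto simp: inverse_pair_def)
    have "f = (f \<cdot> \<kappa>) \<cdot> l"
      using assoc[OF l(1) K(1) assms(3)] l idr[OF assms(3)] by simp
    then show ?thesis
      using K(2) cmp_zero_l[OF l(1)] assms(4) by simp
  qed
  have "is_mono C S T f"
    unfolding is_mono_def
  proof (intro conjI ballI impI)
    show "f \<in> Hom C S T"
      using assms by (simp add: arr_def)
    fix W g h assume W: "W \<in> Ob C" "g \<in> Hom C W S" "h \<in> Hom C W S" "f \<cdot> g = f \<cdot> h"
    have gh: "arr C W S g" "arr C W S h"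
      using W ST by (auto simp: arr_def)
    have "f \<cdot> (g - h) = 0"
      using cmp_diff_r[OF gh assms(3)] W by simp
    from lift[OF arr_diff[OF gh] this] obtain u where u: "u \<in> Hom C W K" "\<kappa> \<cdot> u = g - h"
      by (elim ex1E conjE)
    then have "u = 0"
      using \<open>zero_object C K\<close> W by (auto simp: zero_object_def)
    then show "g = h"
      using u cmp_zero_r[OF K(1)] by simp
  qed
  then have "zero_object C S \<or> isomorphism C S T f"
    using assms(2) ST by (auto simp: simple_object_def)
  then have "isomorphism C S T f"
    using assms(1) by (simp add: simple_object_def)
  then show ?thesis
    using isomorphism_iff ST by simp
qed

lemma fusion_schur_tensor:
  fixes C :: "('k::alg_closed_field, 'o, 'm::ab_group_add) moncat"
  assumes "fusion_category C"
  shows "schur_tensor C"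
proof -
  interpret fusion_category C
    by fact
  show ?thesis
  proof unfold_locales
    show "\<exists>g. inverse_pair C S T f g"
      if "simple_object C S" "simple_object C T" "arr C S T f" "f \<noteq> 0" for S T f
      using schur that .
    show "\<exists>B. finite B \<and> Hom C X Y \<subseteq> V.span B" if "X \<in> Ob C" "Y \<in> Ob C" for X Y
      using finite_dim_Hom[OF that] by (metis order_refl)
  qed (use semisimple simple_unit in auto)
qed

section \<open>Representations of a finite group\<close>

lemma sum_fun_apply: "(\<Sum>i\<in>I. F i) x = (\<Sum>i\<in>I. F i x)"
  by (induction I rule: infinite_finite_induct) auto

section \<open>Matrices as a linear tensor category\<close>

lemma arr_Vect_iff: "arr Vect A B f \<longleftrightarrow> finite A \<and> finite B \<and> (\<forall>i j. f i j \<noteq> 0 \<longrightarrow> i \<in> B \<and> j \<in> A)"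
  by (auto simp: arr_def Vect_def)

lemma cmp_Vect: "arr Vect A B f \<Longrightarrow> (g \<cdot>\<^bsub>Vect\<^esub> f) i j = (\<Sum>l\<in>B. g i l * f l j)"
  unfolding arr_Vect_iff by (auto simp: Vect_def mat_cmp_def intro!: sum.mono_neutral_left)

lemma idm_Vect: "idm Vect B i j = (if i = j \<and> j \<in> B then 1 else 0)"
  by (auto simp: Vect_def mat_of_map_def)

lemma Ob_Vect [simp]: "B \<in> Ob Vect \<longleftrightarrow> finite B"
  by (simp add: Vect_def)

lemma scl_Vect [simp]: "scl Vect a f i j = a * f i j"
  by (simp add: Vect_def)

lemma ten_Vect: "(f \<star>\<^bsub>Vect\<^esub> g) i j =
    f (fst (prod_decode i)) (fst (prod_decode j)) * g (snd (prod_decode i)) (snd (prod_decode j))"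
  by (simp add: Vect_def mat_ten_def)

lemma tenO_Vect: "A \<boxtimes>\<^bsub>Vect\<^esub> B = prod_encode ` (A \<times> B)"
  by (simp add: Vect_def basis_ten_def)

lemma mem_tenO_Vect: "i \<in> A \<boxtimes>\<^bsub>Vect\<^esub> B \<longleftrightarrow> fst (prod_decode i) \<in> A \<and> snd (prod_decode i) \<in> B"
proof -
  obtain a b where "i = prod_encode (a, b)"
    by (metis prod_decode_inverse surj_pair)
  then show ?thesis
    by (auto simp: tenO_Vect)
qed

lemma Hom_Vect_arr: "finite A \<Longrightarrow> finite B \<Longrightarrow> f \<in> Hom Vect A B \<longleftrightarrow> arr Vect A B f"
  by (auto simp: arr_def)

text \<open>For matrices with finitely many nonzero entries in each column the product is associative
  without reference to sources and targets.\<close>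

definition finite_columns :: "(nat \<Rightarrow> nat \<Rightarrow> 'k::field) \<Rightarrow> bool"
  where "finite_columns f \<longleftrightarrow> (\<forall>j. finite {i. f i j \<noteq> 0})"

lemma finite_columns_arr: "arr Vect A B f \<Longrightarrow> finite_columns f"
  unfolding arr_Vect_iff finite_columns_def by (auto intro: finite_subset[of _ B])

lemma cmp_Vect_sum: "finite S \<Longrightarrow> {l. f l j \<noteq> 0} \<subseteq> S \<Longrightarrow> (g \<cdot>\<^bsub>Vect\<^esub> f) i j = (\<Sum>l\<in>S. g i l * f l j)"
  by (auto simp: Vect_def mat_cmp_def intro!: sum.mono_neutral_left)

lemma cmp_Vect_support:
  "{i. (g \<cdot>\<^bsub>Vect\<^esub> f) i j \<noteq> 0} \<subseteq> (\<Union>l\<in>{l. f l j \<noteq> 0}. {m. g m l \<noteq> 0})"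
proof
  fix i assume "i \<in> {i. (g \<cdot>\<^bsub>Vect\<^esub> f) i j \<noteq> 0}"
  then have "(\<Sum>l\<in>{l. f l j \<noteq> 0}. g i l * f l j) \<noteq> 0"
    by (simp add: Vect_def mat_cmp_def)
  then obtain l where "l \<in> {l. f l j \<noteq> 0}" "g i l * f l j \<noteq> 0"
    by (rule sum.not_neutral_contains_not_neutral)
  then show "i \<in> (\<Union>l\<in>{l. f l j \<noteq> 0}. {m. g m l \<noteq> 0})"
    by auto
qed

lemma finite_columns_cmp: "finite_columns g \<Longrightarrow> finite_columns f \<Longrightarrow> finite_columns (g \<cdot>\<^bsub>Vect\<^esub> f)"
  by (auto simp: finite_columns_def intro!: finite_subset[OF cmp_Vect_support])

lemma assoc_Vect:
  assumes "finite_columns g" "finite_columns f"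
  shows "(h \<cdot>\<^bsub>Vect\<^esub> g) \<cdot>\<^bsub>Vect\<^esub> f = h \<cdot>\<^bsub>Vect\<^esub> g \<cdot>\<^bsub>Vect\<^esub> f"
proof (intro ext)
  fix i j
  define S where "S = {l. f l j \<noteq> 0}"
  define T where "T = (\<Union>l\<in>S. {m. g m l \<noteq> 0})"
  have fin: "finite S" "finite T"
    using assms by (auto simp: S_def T_def finite_columns_def)
  have "((h \<cdot>\<^bsub>Vect\<^esub> g) \<cdot>\<^bsub>Vect\<^esub> f) i j = (\<Sum>l\<in>S. (h \<cdot>\<^bsub>Vect\<^esub> g) i l * f l j)"
    by (rule cmp_Vect_sum[OF fin(1)]) (simp add: S_def)
  also have "\<dots> = (\<Sum>l\<in>S. (\<Sum>m\<in>T. h i m * g m l) * f l j)"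
    using fin by (intro sum.cong refl arg_cong2[of _ _ _ _ "(*)"] cmp_Vect_sum) (auto simp: T_def)
  also have "\<dots> = (\<Sum>m\<in>T. h i m * (\<Sum>l\<in>S. g m l * f l j))"
    by (simp add: sum_distrib_left sum_distrib_right mult.assoc sum.swap[of _ T S])
  also have "\<dots> = (\<Sum>m\<in>T. h i m * (g \<cdot>\<^bsub>Vect\<^esub> f) m j)"
    using fin by (intro sum.cong refl arg_cong2[of _ _ _ _ "(*)"] cmp_Vect_sum[symmetric]) (auto simp: S_def)
  also have "\<dots> = (h \<cdot>\<^bsub>Vect\<^esub> g \<cdot>\<^bsub>Vect\<^esub> f) i j"
    using cmp_Vect_support[of g f j] fin
    by (intro cmp_Vect_sum[symmetric]) (auto simp: T_def S_def)
  finally show "((h \<cdot>\<^bsub>Vect\<^esub> g) \<cdot>\<^bsub>Vect\<^esub> f) i j = (h \<cdot>\<^bsub>Vect\<^esub> g \<cdot>\<^bsub>Vect\<^esub> f) i j" .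
qed

lemma linear_category_Vect: "linear_category (Vect :: ('k::field, nat set, nat \<Rightarrow> nat \<Rightarrow> 'k) moncat)"
proof -
  let ?V = "Vect :: ('k, nat set, nat \<Rightarrow> nat \<Rightarrow> 'k) moncat"
  have vs: "vector_space (scl ?V)"
    by unfold_locales (auto simp: fun_eq_iff algebra_simps)
  then interpret vector_space "scl ?V" .
  have cmp: "arr ?V X Z (g \<cdot>\<^bsub>?V\<^esub> f)" if f: "arr ?V X Y f" and g: "arr ?V Y Z g" for X Y Z f g
  proof -
    have "i \<in> Z \<and> j \<in> X" if nz: "(g \<cdot>\<^bsub>?V\<^esub> f) i j \<noteq> 0" for i j
    proof -
      obtain l where "g i l * f l j \<noteq> 0"
        using nz unfolding cmp_Vect[OF f] by (rule sum.not_neutral_contains_not_neutral)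
      then show ?thesis
        using f g by (auto simp: arr_Vect_iff)
    qed
    then show ?thesis
      using f g by (auto simp: arr_Vect_iff)
  qed
  have id: "arr ?V X X (idm ?V X)" if "finite X" for X
    using that by (auto simp: arr_Vect_iff idm_Vect split: if_splits)
  show ?thesis
  proof (rule linear_category.intro[OF vs]; (unfold Ob_Vect)?)
    show "subspace (Hom ?V X Y)" for X Y
      unfolding subspace_def by (auto simp: Vect_def) (metis add_0)+
    show "idm ?V X \<in> Hom ?V X X" if "finite X" for X
      using id that by (auto simp: arr_def)
    show "g \<cdot>\<^bsub>?V\<^esub> f \<in> Hom ?V X Z" if "finite X" "finite Y" "finite Z" "f \<in> Hom ?V X Y" "g \<in> Hom ?V Y Z" for X Y Z f g
      using cmp that unfolding Hom_Vect_arr[OF that(1,2)] Hom_Vect_arr[OF that(2,3)] Hom_Vect_arr[OF that(1,3)] by blast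
    show "f \<cdot>\<^bsub>?V\<^esub> idm ?V X = f" if "finite X" "finite Y" "f \<in> Hom ?V X Y" for X Y f
    proof (intro ext)
      fix i j
      show "(f \<cdot>\<^bsub>?V\<^esub> idm ?V X) i j = f i j"
        using that unfolding Hom_Vect_arr[OF that(1,2)] cmp_Vect[OF id[OF that(1)]]
        by (cases "j \<in> X") (auto simp: idm_Vect arr_Vect_iff if_distrib[of "(*) _"] cong: if_cong)
    qed
    show "idm ?V Y \<cdot>\<^bsub>?V\<^esub> f = f" if "finite X" "finite Y" "f \<in> Hom ?V X Y" for X Y f
    proof -
      have "arr ?V X Y f"
        using that by (simp add: Hom_Vect_arr)
      show ?thesis
      proof (intro ext)
        fix i j
        show "(idm ?V Y \<cdot>\<^bsub>?V\<^esub> f) i j = f i j"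
          using \<open>arr ?V X Y f\<close> unfolding cmp_Vect[OF \<open>arr ?V X Y f\<close>]
          by (cases "i \<in> Y") (auto simp: idm_Vect arr_Vect_iff if_distrib[of "\<lambda>x. x * _"] cong: if_cong)
      qed
    qed
    show "(h \<cdot>\<^bsub>?V\<^esub> g) \<cdot>\<^bsub>?V\<^esub> f = h \<cdot>\<^bsub>?V\<^esub> g \<cdot>\<^bsub>?V\<^esub> f"
      if "finite W" "finite X" "finite Y" "f \<in> Hom ?V W X" "g \<in> Hom ?V X Y" for W X Y f g h
    proof (rule assoc_Vect)
      show "finite_columns f"
        using that(1,2,4) by (simp add: Hom_Vect_arr finite_columns_arr)
      show "finite_columns g"
        using that(2,3,5) by (simp add: Hom_Vect_arr finite_columns_arr)
    qed
    show "(g + g') \<cdot>\<^bsub>?V\<^esub> f = g \<cdot>\<^bsub>?V\<^esub> f + g' \<cdot>\<^bsub>?V\<^esub> f"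
      if "finite X" "finite Y" "f \<in> Hom ?V X Y" for X Y f g g'
    proof -
      have f: "arr ?V X Y f"
        using that by (auto simp: Hom_Vect_arr)
      show ?thesis
        by (simp add: fun_eq_iff cmp_Vect[OF f] algebra_simps sum.distrib)
    qed
    show "g \<cdot>\<^bsub>?V\<^esub> (f + f') = g \<cdot>\<^bsub>?V\<^esub> f + g \<cdot>\<^bsub>?V\<^esub> f'"
      if "finite X" "finite Y" "f \<in> Hom ?V X Y" "f' \<in> Hom ?V X Y" for X Y f f' g
    proof -
      have f: "arr ?V X Y f" "arr ?V X Y f'"
        using that by (auto simp: Hom_Vect_arr)
      then have "arr ?V X Y (f + f')"
        by (auto simp: arr_Vect_iff) (metis add.right_neutral)+
      then show ?thesis
        by (simp add: fun_eq_iff cmp_Vect[OF f(1)] cmp_Vect[OF f(2)] cmp_Vect[OF \<open>arr ?V X Y (f + f')\<close>] distrib_left sum.distrib)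
    qed
    show "scl ?V a g \<cdot>\<^bsub>?V\<^esub> f = scl ?V a (g \<cdot>\<^bsub>?V\<^esub> f)"
      if "finite X" "finite Y" "f \<in> Hom ?V X Y" for X Y f g a
    proof -
      have f: "arr ?V X Y f"
        using that by (auto simp: Hom_Vect_arr)
      show ?thesis
        by (simp add: fun_eq_iff cmp_Vect[OF f] sum_distrib_left mult.assoc)
    qed
    show "g \<cdot>\<^bsub>?V\<^esub> scl ?V a f = scl ?V a (g \<cdot>\<^bsub>?V\<^esub> f)"
      if "finite X" "finite Y" "f \<in> Hom ?V X Y" for X Y f g a
    proof -
      have f: "arr ?V X Y f"
        using that by (auto simp: Hom_Vect_arr)
      then have "arr ?V X Y (scl ?V a f)"
        by (auto simp: arr_Vect_iff)
      then show ?thesis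
        by (simp add: fun_eq_iff cmp_Vect[OF f] cmp_Vect[OF \<open>arr ?V X Y (scl ?V a f)\<close>] sum_distrib_left mult.left_commute)
    qed
  qed
qed

interpretation Vect: linear_category "Vect :: ('k::field, nat set, nat \<Rightarrow> nat \<Rightarrow> 'k) moncat"
  by (rule linear_category_Vect)

lemma arr_ten_Vect: "arr Vect X X' f \<Longrightarrow> arr Vect Y Y' g \<Longrightarrow> arr Vect (X \<boxtimes>\<^bsub>Vect\<^esub> Y) (X' \<boxtimes>\<^bsub>Vect\<^esub> Y') (f \<star>\<^bsub>Vect\<^esub> g)"
  unfolding arr_Vect_iff mem_tenO_Vect by (auto simp: ten_Vect tenO_Vect)

lemma linear_tensor_Vect: "linear_tensor (Vect :: ('k::field, nat set, nat \<Rightarrow> nat \<Rightarrow> 'k) moncat)"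
proof
  let ?V = "Vect :: ('k, nat set, nat \<Rightarrow> nat \<Rightarrow> 'k) moncat"
  show "unitO ?V \<in> Ob ?V"
    by (simp add: Vect_def)
  show "X \<boxtimes>\<^bsub>?V\<^esub> Y \<in> Ob ?V" if "X \<in> Ob ?V" "Y \<in> Ob ?V" for X Y
    using that by (simp add: tenO_Vect)
  show "arr ?V (X \<boxtimes>\<^bsub>?V\<^esub> Y) (X' \<boxtimes>\<^bsub>?V\<^esub> Y') (f \<star>\<^bsub>?V\<^esub> g)" if "arr ?V X X' f" "arr ?V Y Y' g" for X X' Y Y' f g
    using that by (rule arr_ten_Vect)
  show "idm ?V X \<star>\<^bsub>?V\<^esub> idm ?V Y = idm ?V (X \<boxtimes>\<^bsub>?V\<^esub> Y)" for X Y
  proof -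
    have "fst (prod_decode i) = fst (prod_decode j) \<and> snd (prod_decode i) = snd (prod_decode j) \<longleftrightarrow> i = j" for i j
      by (metis prod.expand prod_decode_inverse)
    then show ?thesis
      by (auto simp: fun_eq_iff ten_Vect idm_Vect mem_tenO_Vect)
  qed
  show "(f' \<star>\<^bsub>?V\<^esub> g') \<cdot>\<^bsub>?V\<^esub> (f \<star>\<^bsub>?V\<^esub> g) = (f' \<cdot>\<^bsub>?V\<^esub> f) \<star>\<^bsub>?V\<^esub> (g' \<cdot>\<^bsub>?V\<^esub> g)"
    if "arr ?V X X' f" "arr ?V Y Y' g" for X X' Y Y' f f' g g'
  proof -
    have inj: "inj_on prod_encode (X' \<times> Y')"
      by (rule inj_prod_encode)
    show ?thesis
    proof (intro ext)
      fix i j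
      have "((f' \<star>\<^bsub>?V\<^esub> g') \<cdot>\<^bsub>?V\<^esub> (f \<star>\<^bsub>?V\<^esub> g)) i j
          = (\<Sum>l\<in>prod_encode ` (X' \<times> Y'). (f' \<star>\<^bsub>?V\<^esub> g') i l * (f \<star>\<^bsub>?V\<^esub> g) l j)"
        by (rule trans[OF cmp_Vect[OF arr_ten_Vect[OF that]]]) (simp only: tenO_Vect)
      also have "\<dots> = ((f' \<cdot>\<^bsub>?V\<^esub> f) \<star>\<^bsub>?V\<^esub> (g' \<cdot>\<^bsub>?V\<^esub> g)) i j"
        by (simp add: ten_Vect cmp_Vect[OF that(1)] cmp_Vect[OF that(2)] sum.reindex[OF inj]
            sum_product sum.cartesian_product case_prod_unfold mult_ac)
      finally show "((f' \<star>\<^bsub>?V\<^esub> g') \<cdot>\<^bsub>?V\<^esub> (f \<star>\<^bsub>?V\<^esub> g)) i j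
          = ((f' \<cdot>\<^bsub>?V\<^esub> f) \<star>\<^bsub>?V\<^esub> (g' \<cdot>\<^bsub>?V\<^esub> g)) i j" .
    qed
  qed
qed (auto simp: fun_eq_iff ten_Vect algebra_simps)

interpretation Vect: linear_tensor "Vect :: ('k::field, nat set, nat \<Rightarrow> nat \<Rightarrow> 'k) moncat"
  by (rule linear_tensor_Vect)

section \<open>Generalized inverses, splitting of idempotents and traces of matrices\<close>

definition scale_vec :: "'k::field \<Rightarrow> (nat \<Rightarrow> 'k) \<Rightarrow> nat \<Rightarrow> 'k"
  where "scale_vec a v = (\<lambda>i. a * v i)"

interpretation vec: vector_space "scale_vec :: 'k::field \<Rightarrow> _"
  by unfold_locales (auto simp: scale_vec_def fun_eq_iff algebra_simps)

interpretation vec: vector_space_pair "scale_vec :: 'k::field \<Rightarrow> _" "scale_vec :: 'k::field \<Rightarrow> _"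
  ..

text \<open>The matrix acts on sequences as a linear map \<open>T\<close>, which has a linear right
  inverse on the image of the vectors supported on \<open>A\<close>. The values of this inverse at
  the unit vectors are the columns of the quasi-inverse.\<close>

lemma Vect_quasi_inverse:
  assumes f: "arr Vect A B f"
  obtains g where "arr Vect B A g" "f \<cdot>\<^bsub>Vect\<^esub> g \<cdot>\<^bsub>Vect\<^esub> f = f"
proof -
  have fin: "finite A" "finite B"
    using f by (auto simp: arr_Vect_iff)
  define T where "T v = (\<lambda>i. \<Sum>j\<in>A. f i j * v j)" for v
  define \<delta> where "\<delta> j = (\<lambda>i. if i = j then 1 else 0 :: 'a)" for j :: nat
  have lT: "Vector_Spaces.linear scale_vec scale_vec T"
    by unfold_locales
      (auto simp: T_def scale_vec_def fun_eq_iff algebra_simps sum.distrib sum_distrib_left)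
  have "vec.subspace {v. \<forall>i. v i \<noteq> 0 \<longrightarrow> i \<in> A}"
    by (auto simp: vec.subspace_def scale_vec_def) (metis add.right_neutral)
  from vec.linear_exists_right_inverse_on[OF lT this]
  obtain g where g: "range g \<subseteq> {v. \<forall>i. v i \<noteq> 0 \<longrightarrow> i \<in> A}" "Vector_Spaces.linear scale_vec scale_vec g"
    "\<And>v. (\<forall>i. v i \<noteq> 0 \<longrightarrow> i \<in> A) \<Longrightarrow> T (g (T v)) = T v"
    by auto
  define G where "G l i = (if i \<in> B then g (\<delta> i) l else 0)" for l i
  have G: "arr Vect B A G"
    using fin g(1) by (auto simp: arr_Vect_iff G_def split: if_splits)
  have "(f \<cdot>\<^bsub>Vect\<^esub> G \<cdot>\<^bsub>Vect\<^esub> f) i j = f i j" for i j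
  proof (cases "j \<in> A")
    case True
    have Tj: "T (\<delta> j) i = f i j" for i
      using True fin by (simp add: T_def \<delta>_def if_distrib[of "(*) _"] cong: if_cong)
    have "T (\<delta> j) = (\<Sum>i\<in>B. scale_vec (f i j) (\<delta> i))"
    proof (intro ext)
      fix i
      have "(\<Sum>l\<in>B. scale_vec (f l j) (\<delta> l)) i = (\<Sum>l\<in>B. if l = i then f i j else 0)"
        unfolding sum_fun_apply by (intro sum.cong refl) (auto simp: scale_vec_def \<delta>_def)
      also have "\<dots> = f i j"
        using f fin by (auto simp: arr_Vect_iff)
      finally show "T (\<delta> j) i = (\<Sum>l\<in>B. scale_vec (f l j) (\<delta> l)) i"
        by (simp add: Tj)
    qed
    then have "g (T (\<delta> j)) = (\<Sum>i\<in>B. g (scale_vec (f i j) (\<delta> i)))"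
      by (simp add: vec.linear_sum[OF g(2)])
    then have "g (T (\<delta> j)) = (\<Sum>i\<in>B. scale_vec (f i j) (g (\<delta> i)))"
      by (simp add: vec.linear_scale[OF g(2)])
    then have e: "(G \<cdot>\<^bsub>Vect\<^esub> f) l j = g (T (\<delta> j)) l" for l
      by (simp add: cmp_Vect[OF f] sum_fun_apply scale_vec_def G_def mult.commute)
    have "(f \<cdot>\<^bsub>Vect\<^esub> G \<cdot>\<^bsub>Vect\<^esub> f) i j = T (g (T (\<delta> j))) i"
      by (simp add: cmp_Vect[OF Vect.arr_cmp[OF f G]] e T_def)
    also have "\<dots> = f i j"
      using g(3)[of "\<delta> j"] True Tj by (simp add: \<delta>_def)
    finally show ?thesis .
  next
    case False
    moreover have "arr Vect A B (f \<cdot>\<^bsub>Vect\<^esub> G \<cdot>\<^bsub>Vect\<^esub> f)"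
      by (rule Vect.arr_cmp[OF Vect.arr_cmp[OF f G] f])
    ultimately show ?thesis
      using f unfolding arr_Vect_iff by metis
  qed
  then have "f \<cdot>\<^bsub>Vect\<^esub> G \<cdot>\<^bsub>Vect\<^esub> f = f"
    by (simp add: fun_eq_iff)
  with G show thesis
    by (rule that)
qed

text \<open>Rank factorization: \<open>\<iota>\<close> has as columns a basis of the column space
  chosen among the columns of \<open>e\<close>, and \<open>\<pi>\<close> consists of the coordinates
  of all columns in this basis. Since \<open>e\<close> fixes its own columns, \<open>\<iota>\<close>
  annihilates the difference of \<open>\<pi> \<iota>\<close> and the identity, and independence of
  the columns makes this difference zero.\<close>

lemma Vect_split_idempotent:
  fixes e :: "nat \<Rightarrow> nat \<Rightarrow> 'k::field"
  assumes e: "arr Vect B B e" "e \<cdot>\<^bsub>Vect\<^esub> e = e"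
  obtains A \<iota> \<pi> where "arr Vect A B \<iota>" "arr Vect B A \<pi>" "\<pi> \<cdot>\<^bsub>Vect\<^esub> \<iota> = idm Vect A" "\<iota> \<cdot>\<^bsub>Vect\<^esub> \<pi> = e"
proof -
  have fin: "finite B"
    using e by (simp add: arr_Vect_iff)
  define col where "col j = (\<lambda>i. e i j)" for j
  obtain U where U: "U \<subseteq> col ` B" "vec.independent U" "col ` B \<subseteq> vec.span U"
    by (rule vec.maximal_independent_subset)
  have finU: "finite U"
    using U(1) fin finite_surj by blast
  then obtain h where h: "bij_betw h {0..<card U} U"
    using ex_bij_betw_nat_finite by blast
  define r where "r = {0..<card U}"
  define \<iota> where "\<iota> i l = (if l \<in> r then h l i else 0)" for i l
  define \<pi> where "\<pi> l j = (if l \<in> r \<and> j \<in> B then vec.representation U (col j) (h l) else 0)" for l j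
  have hU: "h l \<in> U" if "l \<in> r" for l
    using h that by (auto simp: r_def bij_betw_def)
  have \<iota>: "arr Vect r B \<iota>"
    unfolding arr_Vect_iff
  proof (intro conjI allI impI)
    fix i l assume nz: "\<iota> i l \<noteq> 0"
    then have l: "l \<in> r" "h l i \<noteq> 0"
      by (auto simp: \<iota>_def split: if_splits)
    then obtain j where "h l = col j"
      using hU U(1) by blast
    then show "i \<in> B" "l \<in> r"
      using l e by (auto simp: col_def arr_Vect_iff)
  qed (auto simp: r_def fin)
  have \<pi>: "arr Vect B r \<pi>"
    using fin by (auto simp: arr_Vect_iff \<pi>_def r_def split: if_splits)
  have \<iota>\<pi>: "\<iota> \<cdot>\<^bsub>Vect\<^esub> \<pi> = e"
  proof (intro ext)
    fix i j
    show "(\<iota> \<cdot>\<^bsub>Vect\<^esub> \<pi>) i j = e i j"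
    proof (cases "j \<in> B")
      case True
      have "(\<iota> \<cdot>\<^bsub>Vect\<^esub> \<pi>) i j = (\<Sum>l\<in>r. vec.representation U (col j) (h l) * h l i)"
        unfolding cmp_Vect[OF \<pi>] using True by (intro sum.cong) (auto simp: \<iota>_def \<pi>_def)
      also have "\<dots> = (\<Sum>b\<in>U. vec.representation U (col j) b * b i)"
        using sum.reindex_bij_betw[OF h, of "\<lambda>b. vec.representation U (col j) b * b i"] by (simp add: r_def)
      also have "\<dots> = (\<Sum>b\<in>U. scale_vec (vec.representation U (col j) b) b) i"
        by (simp add: sum_fun_apply scale_vec_def)
      also have "\<dots> = col j i"
        using U True finU by (subst vec.sum_representation_eq) auto
      finally show ?thesis
        by (simp add: col_def)
    next
      case False
      moreover have "arr Vect B B (\<iota> \<cdot>\<^bsub>Vect\<^esub> \<pi>)"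
        by (rule Vect.arr_cmp[OF \<pi> \<iota>])
      ultimately show ?thesis
        using e unfolding arr_Vect_iff by metis
    qed
  qed
  have e\<iota>: "e \<cdot>\<^bsub>Vect\<^esub> \<iota> = \<iota>"
  proof (intro ext)
    fix i l
    show "(e \<cdot>\<^bsub>Vect\<^esub> \<iota>) i l = \<iota> i l"
    proof (cases "l \<in> r")
      case True
      then obtain j where j: "h l = col j" "j \<in> B"
        using hU U(1) by blast
      have "(e \<cdot>\<^bsub>Vect\<^esub> \<iota>) i l = (e \<cdot>\<^bsub>Vect\<^esub> e) i j"
        using True by (simp add: cmp_Vect[OF \<iota>] cmp_Vect[OF e(1)] \<iota>_def j col_def)
      then show ?thesis
        using True by (simp add: e \<iota>_def j col_def)
    next
      case False
      then show ?thesis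
        by (simp add: cmp_Vect[OF \<iota>] \<iota>_def)
    qed
  qed
  define d where "d = \<pi> \<cdot>\<^bsub>Vect\<^esub> \<iota> - idm Vect r"
  have d: "arr Vect r r d"
    unfolding d_def by (intro Vect.arr_diff Vect.arr_cmp[OF \<iota> \<pi>] Vect.arr_idm) (simp add: r_def)
  have "\<iota> \<cdot>\<^bsub>Vect\<^esub> d = \<iota> \<cdot>\<^bsub>Vect\<^esub> \<pi> \<cdot>\<^bsub>Vect\<^esub> \<iota> - \<iota> \<cdot>\<^bsub>Vect\<^esub> idm Vect r"
    unfolding d_def by (intro Vect.cmp_diff_r[OF Vect.arr_cmp[OF \<iota> \<pi>] Vect.arr_idm \<iota>]) (simp add: r_def)
  also have "\<dots> = 0"
    using \<iota>\<pi> e\<iota> Vect.assoc[OF \<iota> \<pi> \<iota>] Vect.idr[OF \<iota>] by simp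
  finally have \<iota>d: "\<iota> \<cdot>\<^bsub>Vect\<^esub> d = 0" .
  have "d l m = 0" for l m
  proof (cases "l \<in> r")
    case True
    \<comment> \<open>\<open>k\<close> inverts the enumeration of the basis, which lets a column of
      \<open>\<iota> d = 0\<close> be read as a linear relation among the basis vectors.\<close>
    obtain k where k: "\<And>l. l \<in> r \<Longrightarrow> k (h l) = l"
      using h bij_betw_inv_into_left unfolding r_def by metis
    have "(\<Sum>b\<in>U. scale_vec (d (k b) m) b) = (\<Sum>l\<in>r. scale_vec (d (k (h l)) m) (h l))"
      using sum.reindex_bij_betw[OF h, of "\<lambda>b. scale_vec (d (k b) m) b"] by (simp add: r_def)
    also have "\<dots> = (\<Sum>l\<in>r. scale_vec (d l m) (h l))"
      by (simp add: k)
    also have "\<dots> = (\<lambda>i. (\<iota> \<cdot>\<^bsub>Vect\<^esub> d) i m)"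
      by (auto simp: fun_eq_iff cmp_Vect[OF d] sum_fun_apply scale_vec_def \<iota>_def intro!: sum.cong)
    finally have "(\<Sum>b\<in>U. scale_vec (d (k b) m) b) = 0"
      by (simp add: \<iota>d fun_eq_iff)
    from vec.independentD[OF U(2) finU order_refl this hU[OF True]] show ?thesis
      by (simp add: k[OF True])
  next
    case False
    then show ?thesis
      using d by (auto simp: arr_Vect_iff)
  qed
  then have "d = 0"
    by (simp add: fun_eq_iff)
  then show thesis
    using that[OF \<iota> \<pi> _ \<iota>\<pi>] by (simp add: d_def)
qed

definition trace :: "nat set \<Rightarrow> (nat \<Rightarrow> nat \<Rightarrow> 'k::field) \<Rightarrow> 'k"
  where "trace B f = (\<Sum>i\<in>B. f i i)"

lemma trace_cmp:
  assumes "arr Vect A B f" "arr Vect B A g"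
  shows "trace A (g \<cdot>\<^bsub>Vect\<^esub> f) = trace B (f \<cdot>\<^bsub>Vect\<^esub> g)"
  unfolding trace_def cmp_Vect[OF assms(1)] cmp_Vect[OF assms(2)]
  by (subst sum.swap) (simp add: mult.commute)

lemma trace_idm: "trace B (idm Vect B) = of_nat (card B)"
  by (simp add: trace_def idm_Vect)

text \<open>The trace of the identity is the dimension as an element of the field, and traces add up
  because the trace of a product is independent of the order of the factors. Characteristic 0 allows
  the natural number to be recovered.\<close>

lemma direct_sum_Vect_card:
  assumes "direct_sum (Vect :: ('k::field_char_0, _, _) moncat) I S X \<iota> \<pi>"
  shows "card X = (\<Sum>i\<in>I. card (S i))"
proof -
  note s = assms[unfolded Vect.direct_sum_iff]
  have "of_nat (card X) = trace X (\<Sum>i\<in>I. \<iota> i \<cdot>\<^bsub>Vect\<^esub> \<pi> i)"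
    using s by (simp add: trace_idm)
  also have "\<dots> = (\<Sum>i\<in>I. trace X (\<iota> i \<cdot>\<^bsub>Vect\<^esub> \<pi> i))"
    unfolding trace_def sum_fun_apply by (rule sum.swap)
  also have "\<dots> = (\<Sum>i\<in>I. trace (S i) (\<pi> i \<cdot>\<^bsub>Vect\<^esub> \<iota> i))"
    using s by (intro sum.cong refl trace_cmp) auto
  also have "\<dots> = of_nat (\<Sum>i\<in>I. card (S i))"
    using s by (simp add: trace_idm)
  finally show ?thesis
    by (simp only: of_nat_eq_iff)
qed

lemma Vect_finite_dim:
  assumes "finite A" "finite B"
  shows "\<exists>F. finite F \<and> Hom Vect A B \<subseteq> Vect.V.span F"
proof -
  define E where "E = (\<lambda>(i::nat, j::nat). (\<lambda>i' j'. if i = i' \<and> j = j' then 1 else 0 :: 'a))"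
  have "f \<in> Vect.V.span (E ` (B \<times> A))" if "f \<in> Hom Vect A B" for f :: "nat \<Rightarrow> nat \<Rightarrow> 'a"
  proof -
    have f: "arr Vect A B f"
      using that assms by (simp add: Hom_Vect_arr)
    have e: "f = (\<Sum>p\<in>B \<times> A. scl Vect (f (fst p) (snd p)) (E p))"
    proof (intro ext)
      fix i j
      have "(\<Sum>p\<in>B \<times> A. scl Vect (f (fst p) (snd p)) (E p)) i j
          = (\<Sum>p\<in>B \<times> A. if p = (i, j) then f i j else 0)"
        unfolding sum_fun_apply by (intro sum.cong refl) (auto simp: E_def split: if_splits)
      also have "\<dots> = f i j"
        using f assms by (auto simp: arr_Vect_iff)
      finally show "f i j = (\<Sum>p\<in>B \<times> A. scl Vect (f (fst p) (snd p)) (E p)) i j" ..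
    qed
    have "(\<Sum>p\<in>B \<times> A. scl Vect (f (fst p) (snd p)) (E p)) \<in> Vect.V.span (E ` (B \<times> A))"
      by (intro Vect.V.span_sum Vect.V.span_scale Vect.V.span_base imageI)
    then show ?thesis
      unfolding e[symmetric] .
  qed
  then show ?thesis
    using assms by (intro exI[of _ "E ` (B \<times> A)"]) auto
qed

section \<open>Representations of a finite group as a semisimple tensor category\<close>

locale finite_group_rep = group G for G :: "'g monoid" (structure) +
  fixes R :: "('k::{alg_closed_field, field_char_0},
    nat set \<times> ('g \<Rightarrow> nat \<Rightarrow> nat \<Rightarrow> 'k), nat \<Rightarrow> nat \<Rightarrow> 'k) moncat"
  assumes finite_carrier: "finite (carrier G)"
    and R_def: "R = Rep G"
begin

abbreviation cmp_vect :: "(nat \<Rightarrow> nat \<Rightarrow> 'k) \<Rightarrow> (nat \<Rightarrow> nat \<Rightarrow> 'k) \<Rightarrow> nat \<Rightarrow> nat \<Rightarrow> 'k" (infixr "\<bullet>" 75)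
  where "g \<bullet> f \<equiv> g \<cdot>\<^bsub>Vect\<^esub> f"

lemma R_simps [simp]:
  "cmp R = cmp Vect" "scl R = scl Vect" "tenM R = tenM Vect" "idm R X = idm Vect (fst X)"
  "X \<boxtimes>\<^bsub>R\<^esub> Y = (tenO (Vect :: ('k, nat set, nat \<Rightarrow> nat \<Rightarrow> 'k) moncat) (fst X) (fst Y), \<lambda>g. snd X g \<star>\<^bsub>Vect\<^esub> snd Y g)" "unitO R = ({0}, \<lambda>g. idm Vect {0})"
  by (simp_all add: R_def Rep_def case_prod_unfold Vect_def)

lemma Ob_R: "X \<in> Ob R \<longleftrightarrow> finite (fst X) \<and> (\<forall>g\<in>carrier G. arr Vect (fst X) (fst X) (snd X g)) \<and>
    snd X \<one> = idm Vect (fst X) \<and>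
    (\<forall>g\<in>carrier G. \<forall>h\<in>carrier G. snd X (g \<otimes> h) = snd X g \<bullet> snd X h)"
  by (auto simp: R_def Rep_def case_prod_unfold Hom_Vect_arr)

lemma arr_R: "arr R X Y f \<longleftrightarrow> X \<in> Ob R \<and> Y \<in> Ob R \<and> arr Vect (fst X) (fst Y) f \<and>
    (\<forall>g\<in>carrier G. f \<bullet> snd X g = snd Y g \<bullet> f)"
  by (auto simp: arr_def R_def Rep_def case_prod_unfold Hom_Vect_arr)

lemma Ob_RD:
  assumes "X \<in> Ob R"
  shows "finite (fst X)" "g \<in> carrier G \<Longrightarrow> arr Vect (fst X) (fst X) (snd X g)"
    "g \<in> carrier G \<Longrightarrow> finite_columns (snd X g)"
    "snd X \<one> = idm Vect (fst X)" "g \<in> carrier G \<Longrightarrow> h \<in> carrier G \<Longrightarrow> snd X (g \<otimes> h) = snd X g \<bullet> snd X h"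
  using assms finite_columns_arr unfolding Ob_R by blast+

lemma arr_RD:
  assumes "arr R X Y f"
  shows "X \<in> Ob R" "Y \<in> Ob R" "arr Vect (fst X) (fst Y) f" "finite_columns f"
    "g \<in> carrier G \<Longrightarrow> f \<bullet> snd X g = snd Y g \<bullet> f"
  using assms finite_columns_arr unfolding arr_R by blast+

lemma arr_R_I:
  assumes "X \<in> Ob R" "Y \<in> Ob R" "arr Vect (fst X) (fst Y) f"
    "\<And>g. g \<in> carrier G \<Longrightarrow> f \<bullet> snd X g = snd Y g \<bullet> f"
  shows "arr R X Y f"
  using assms unfolding arr_R by blast

sublocale R: linear_category R
proof (rule linear_category.intro)
  show "vector_space (scl R)"
    by (simp add: Vect.vector_space)
  then interpret V: vector_space "scl R" .
  have H: "f \<in> Hom R X Y \<longleftrightarrow> arr R X Y f" if "X \<in> Ob R" "Y \<in> Ob R" for X Y f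
    using that by (simp add: arr_def)
  have cmp: "arr R X Z (g \<bullet> f)" if f: "arr R X Y f" and g: "arr R Y Z g" for X Y Z f g
  proof (rule arr_R_I)
    note f' = arr_RD[OF f] and g' = arr_RD[OF g]
    show "arr Vect (fst X) (fst Z) (g \<bullet> f)"
      using f' g' by (blast intro: Vect.arr_cmp)
    fix x assume x: "x \<in> carrier G"
    have "(g \<bullet> f) \<bullet> snd X x = g \<bullet> snd Y x \<bullet> f"
      using f' Ob_RD[OF f'(1)] x by (simp add: assoc_Vect)
    also have "\<dots> = (g \<bullet> snd Y x) \<bullet> f"
      using f' Ob_RD[OF f'(2)] x by (simp add: assoc_Vect)
    also have "\<dots> = snd Z x \<bullet> g \<bullet> f"
      using f' g' x by (simp add: assoc_Vect)
    finally show "(g \<bullet> f) \<bullet> snd X x = snd Z x \<bullet> g \<bullet> f" .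
  qed (use f g in \<open>auto simp: arr_def\<close>)
  show "V.subspace (Hom R X Y)" if "X \<in> Ob R" "Y \<in> Ob R" for X Y
    unfolding V.subspace_def H[OF that]
  proof (intro conjI ballI allI; (unfold H[OF that])?)
    note X = Ob_RD[OF that(1)] and Y = Ob_RD[OF that(2)]
    show "arr R X Y 0"
      using that X Y by (intro arr_R_I) (auto simp: Vect.arr_zero Vect.cmp_zero_l[OF X(2)] Vect.cmp_zero_r[OF Y(2)])
    show "arr R X Y (f + g)" if "arr R X Y f" "arr R X Y g" for f g
    proof (rule arr_R_I)
      note f' = arr_RD[OF that(1)] and g' = arr_RD[OF that(2)]
      show "arr Vect (fst X) (fst Y) (f + g)"
        using f' g' by (blast intro: Vect.arr_add)
      show "(f + g) \<bullet> snd X x = snd Y x \<bullet> (f + g)" if x: "x \<in> carrier G" for x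
        using Vect.cmp_add_l[OF X(2)[OF x] f'(3) g'(3)] Vect.cmp_add_r[OF f'(3) g'(3) Y(2)[OF x]] f'(5)[OF x] g'(5)[OF x]
        by simp
    qed fact+
    show "arr R X Y (scl R c f)" if "arr R X Y f" for c f
    proof (rule arr_R_I)
      note f' = arr_RD[OF that(1)]
      show "arr Vect (fst X) (fst Y) (scl R c f)"
        using f' by (simp add: Vect.arr_scl)
      show "scl R c f \<bullet> snd X x = snd Y x \<bullet> scl R c f" if x: "x \<in> carrier G" for x
        using Vect.cmp_scl_l[OF X(2)[OF x] f'(3)] Vect.cmp_scl_r[OF f'(3) Y(2)[OF x]] f'(5)[OF x]
        by simp
    qed fact+
  qed
  show "idm R X \<in> Hom R X X" if "X \<in> Ob R" for X
    unfolding H[OF that that] using that Ob_RD(1)[OF that]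
    by (intro arr_R_I) (auto simp: Vect.arr_idm Vect.idl[OF Ob_RD(2)[OF that]] Vect.idr[OF Ob_RD(2)[OF that]])
  show "g \<cdot>\<^bsub>R\<^esub> f \<in> Hom R X Z" if "X \<in> Ob R" "Y \<in> Ob R" "Z \<in> Ob R" "f \<in> Hom R X Y" "g \<in> Hom R Y Z" for X Y Z f g
    using that cmp[of X Y f Z g] by (simp add: arr_def)
  show "f \<cdot>\<^bsub>R\<^esub> idm R X = f" if "X \<in> Ob R" "Y \<in> Ob R" "f \<in> Hom R X Y" for X Y f
    using that by (simp add: H Vect.idr[OF arr_RD(3)])
  show "idm R Y \<cdot>\<^bsub>R\<^esub> f = f" if "X \<in> Ob R" "Y \<in> Ob R" "f \<in> Hom R X Y" for X Y f
    using that by (simp add: H Vect.idl[OF arr_RD(3)])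
  show "(h \<cdot>\<^bsub>R\<^esub> g) \<cdot>\<^bsub>R\<^esub> f = h \<cdot>\<^bsub>R\<^esub> g \<cdot>\<^bsub>R\<^esub> f"
    if "W \<in> Ob R" "X \<in> Ob R" "Y \<in> Ob R" "f \<in> Hom R W X" "g \<in> Hom R X Y" for W X Y f g h
    using that by (simp add: H assoc_Vect[OF arr_RD(4) arr_RD(4)])
  show "(g + g') \<cdot>\<^bsub>R\<^esub> f = g \<cdot>\<^bsub>R\<^esub> f + g' \<cdot>\<^bsub>R\<^esub> f"
    if "X \<in> Ob R" "Y \<in> Ob R" "Z \<in> Ob R" "f \<in> Hom R X Y" "g \<in> Hom R Y Z" "g' \<in> Hom R Y Z" for X Y Z f g g'
    using that by (simp add: H Vect.cmp_add_l[OF arr_RD(3) arr_RD(3) arr_RD(3)])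
  show "g \<cdot>\<^bsub>R\<^esub> (f + f') = g \<cdot>\<^bsub>R\<^esub> f + g \<cdot>\<^bsub>R\<^esub> f'"
    if "X \<in> Ob R" "Y \<in> Ob R" "Z \<in> Ob R" "f \<in> Hom R X Y" "f' \<in> Hom R X Y" "g \<in> Hom R Y Z" for X Y Z f f' g
    using that by (simp add: H Vect.cmp_add_r[OF arr_RD(3) arr_RD(3) arr_RD(3)])
  show "scl R a g \<cdot>\<^bsub>R\<^esub> f = scl R a (g \<cdot>\<^bsub>R\<^esub> f)"
    if "X \<in> Ob R" "Y \<in> Ob R" "Z \<in> Ob R" "f \<in> Hom R X Y" "g \<in> Hom R Y Z" for X Y Z f g a
    using that by (simp add: H Vect.cmp_scl_l[OF arr_RD(3) arr_RD(3)])
  show "g \<cdot>\<^bsub>R\<^esub> scl R a f = scl R a (g \<cdot>\<^bsub>R\<^esub> f)"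
    if "X \<in> Ob R" "Y \<in> Ob R" "Z \<in> Ob R" "f \<in> Hom R X Y" "g \<in> Hom R Y Z" for X Y Z f g a
    using that by (simp add: H Vect.cmp_scl_r[OF arr_RD(3) arr_RD(3)])
qed

sublocale R: linear_tensor R
proof
  show "unitO R \<in> Ob R"
    unfolding Ob_R by (auto simp: Vect.arr_idm Vect.idl[OF Vect.arr_idm])
  show ob: "X \<boxtimes>\<^bsub>R\<^esub> Y \<in> Ob R" if "X \<in> Ob R" "Y \<in> Ob R" for X Y
  proof -
    note X = Ob_RD[OF that(1)] and Y = Ob_RD[OF that(2)]
    show ?thesis
      unfolding Ob_R R_simps fst_conv snd_conv using X Y
      by (auto simp: Vect.ten_idm Vect.ten_cmp[OF X(2) X(2) Y(2) Y(2)] Vect.arr_ten Vect.ten_Ob[unfolded Ob_Vect])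
  qed
  show "arr R (X \<boxtimes>\<^bsub>R\<^esub> Y) (X' \<boxtimes>\<^bsub>R\<^esub> Y') (f \<star>\<^bsub>R\<^esub> g)" if "arr R X X' f" "arr R Y Y' g" for X X' Y Y' f g
  proof (rule arr_R_I)
    note f = arr_RD[OF that(1)] and g = arr_RD[OF that(2)]
    show "X \<boxtimes>\<^bsub>R\<^esub> Y \<in> Ob R" "X' \<boxtimes>\<^bsub>R\<^esub> Y' \<in> Ob R"
      using ob f g by blast+
    show "arr Vect (fst (X \<boxtimes>\<^bsub>R\<^esub> Y)) (fst (X' \<boxtimes>\<^bsub>R\<^esub> Y')) (f \<star>\<^bsub>R\<^esub> g)"
      using f g by (simp add: Vect.arr_ten)
    show "(f \<star>\<^bsub>R\<^esub> g) \<bullet> snd (X \<boxtimes>\<^bsub>R\<^esub> Y) x = snd (X' \<boxtimes>\<^bsub>R\<^esub> Y') x \<bullet> (f \<star>\<^bsub>R\<^esub> g)" if x: "x \<in> carrier G" for x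
      using Vect.ten_cmp[OF Ob_RD(2)[OF f(1) x] f(3) Ob_RD(2)[OF g(1) x] g(3)]
        Vect.ten_cmp[OF f(3) Ob_RD(2)[OF f(2) x] g(3) Ob_RD(2)[OF g(2) x]] f(5)[OF x] g(5)[OF x]
      by simp
  qed
  show "idm R X \<star>\<^bsub>R\<^esub> idm R Y = idm R (X \<boxtimes>\<^bsub>R\<^esub> Y)" if "X \<in> Ob R" "Y \<in> Ob R" for X Y
    using Ob_RD(1)[OF that(1)] Ob_RD(1)[OF that(2)] by (simp add: Vect.ten_idm)
  show "(f' \<star>\<^bsub>R\<^esub> g') \<cdot>\<^bsub>R\<^esub> (f \<star>\<^bsub>R\<^esub> g) = (f' \<cdot>\<^bsub>R\<^esub> f) \<star>\<^bsub>R\<^esub> (g' \<cdot>\<^bsub>R\<^esub> g)"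
    if "arr R X X' f" "arr R X' X'' f'" "arr R Y Y' g" "arr R Y' Y'' g'" for X X' X'' Y Y' Y'' f f' g g'
    using Vect.ten_cmp[OF that[THEN arr_RD(3)]] by simp
  show "(f + f') \<star>\<^bsub>R\<^esub> g = f \<star>\<^bsub>R\<^esub> g + f' \<star>\<^bsub>R\<^esub> g"
    if "arr R X X' f" "arr R X X' f'" "arr R Y Y' g" for X X' Y Y' f f' g
    using Vect.ten_add_l[OF that[THEN arr_RD(3)]] by simp
  show "f \<star>\<^bsub>R\<^esub> (g + g') = f \<star>\<^bsub>R\<^esub> g + f \<star>\<^bsub>R\<^esub> g'"
    if "arr R X X' f" "arr R Y Y' g" "arr R Y Y' g'" for X X' Y Y' f g g'
    using Vect.ten_add_r[OF that[THEN arr_RD(3)]] by simp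
qed

text \<open>Maschke's theorem: averaging a linear quasi-inverse over the group makes it equivariant.\<close>

lemma R_quasi_inverse:
  assumes f: "arr R X Y f"
  obtains h where "arr R Y X h" "f \<bullet> h \<bullet> f = f"
proof -
  note f' = arr_RD[OF f]
  note X = Ob_RD[OF f'(1)] and Y = Ob_RD[OF f'(2)]
  obtain g where g: "arr Vect (fst Y) (fst X) g" "f \<bullet> g \<bullet> f = f"
    using Vect_quasi_inverse[OF f'(3)] by blast
  have fc: "finite_columns g" "finite_columns f"
    using g f' finite_columns_arr by blast+
  define t where "t x = snd X x \<bullet> g \<bullet> snd Y (inv x)" for x
  have tx: "arr Vect (fst Y) (fst X) (t x)" if "x \<in> carrier G" for x
    unfolding t_def using that by (intro Vect.arr_cmp[OF Vect.arr_cmp[OF Y(2) g(1)] X(2)]) auto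
  \<comment> \<open>Since \<open>f\<close> commutes with the group, every conjugate of a
    quasi-inverse is again one.\<close>
  have t1: "f \<bullet> t x \<bullet> f = f" if x: "x \<in> carrier G" for x
  proof -
    note fx = X(3)[OF x] Y(3)[OF x] X(3)[OF inv_closed[OF x]] Y(3)[OF inv_closed[OF x]] fc finite_columns_cmp
    have "f \<bullet> t x \<bullet> f = f \<bullet> snd X x \<bullet> g \<bullet> snd Y (inv x) \<bullet> f"
      by (simp add: t_def assoc_Vect fx)
    also have "\<dots> = (f \<bullet> snd X x) \<bullet> g \<bullet> f \<bullet> snd X (inv x)"
      using f'(5)[OF inv_closed[OF x]] by (simp add: assoc_Vect fx)
    also have "\<dots> = snd Y x \<bullet> (f \<bullet> g \<bullet> f) \<bullet> snd X (inv x)"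
      unfolding f'(5)[OF x] by (simp add: assoc_Vect fx)
    also have "\<dots> = (snd Y x \<bullet> f) \<bullet> snd X (inv x)"
      unfolding g(2) by (simp add: assoc_Vect fx)
    also have "\<dots> = f \<bullet> snd X x \<bullet> snd X (inv x)"
      unfolding f'(5)[OF x, symmetric] by (simp add: assoc_Vect fx)
    also have "snd X x \<bullet> snd X (inv x) = idm Vect (fst X)"
      using X(5)[OF x inv_closed[OF x]] x X(4) by (simp add: r_inv)
    finally show ?thesis
      using Vect.idr[OF f'(3)] by simp
  qed
  \<comment> \<open>Acting by \<open>y\<close> only permutes the conjugates, so that their sum
    commutes with the group.\<close>
  have t2: "snd X y \<bullet> t x = t (y \<otimes> x) \<bullet> snd Y y" if x: "x \<in> carrier G" "y \<in> carrier G" for x y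
  proof -
    note fx = X(3) Y(3) fc finite_columns_cmp
    have "t (y \<otimes> x) \<bullet> snd Y y = snd X (y \<otimes> x) \<bullet> g \<bullet> snd Y (inv (y \<otimes> x)) \<bullet> snd Y y"
      using x by (simp add: t_def assoc_Vect fx)
    also have "snd Y (inv (y \<otimes> x)) \<bullet> snd Y y = snd Y (inv x)"
    proof -
      have "inv (y \<otimes> x) \<otimes> y = inv x"
        using x by (simp add: inv_mult_group m_assoc)
      then show ?thesis
        using Y(5)[of "inv (y \<otimes> x)" y] x by simp
    qed
    finally show ?thesis
      using x by (simp add: t_def assoc_Vect fx X(5))
  qed
  define N where "N = of_nat (card (carrier G)) * (1::'k)"
  \<comment> \<open>Characteristic 0 makes the order of the group invertible.\<close>
  have N: "N \<noteq> 0"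
    using finite_carrier by (auto simp: N_def)
  define s where "s = (\<Sum>x\<in>carrier G. t x)"
  have s: "arr Vect (fst Y) (fst X) s"
    unfolding s_def using tx X(1) Y(1) by (intro Vect.arr_sum) auto
  define h where "h = scl Vect (1 / N) s"
  have hV: "arr Vect (fst Y) (fst X) h"
    unfolding h_def using s by (rule Vect.arr_scl)
  have "snd X y \<bullet> s = s \<bullet> snd Y y" if y: "y \<in> carrier G" for y
  proof -
    have "snd X y \<bullet> s = (\<Sum>x\<in>carrier G. snd X y \<bullet> t x)"
      unfolding s_def using tx by (rule Vect.cmp_sum_r[OF X(2)[OF y]])
    also have "\<dots> = (\<Sum>x\<in>carrier G. t (y \<otimes> x) \<bullet> snd Y y)"
      using t2 y by simp
    also have "\<dots> = (\<Sum>x\<in>carrier G. t x \<bullet> snd Y y)"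
    proof (rule sum.reindex_bij_betw)
      show "bij_betw ((\<otimes>) y) (carrier G) (carrier G)"
        using y inj_on_multc surj_const_mult[OF y] inj_on_cmult by (simp add: bij_betw_def)
    qed
    also have "\<dots> = s \<bullet> snd Y y"
      unfolding s_def using tx by (rule Vect.cmp_sum_l[OF Y(2)[OF y], symmetric])
    finally show ?thesis .
  qed
  then have h: "arr R Y X h"
    using hV f' Vect.cmp_scl_l[OF Y(2) s] Vect.cmp_scl_r[OF s X(2)] by (intro arr_R_I) (auto simp: h_def)
  have "f \<bullet> s \<bullet> f = (\<Sum>x\<in>carrier G. f \<bullet> t x \<bullet> f)"
    unfolding s_def
    by (subst Vect.cmp_sum_l[OF f'(3) tx], simp, subst Vect.cmp_sum_r[OF f'(3)]) (auto intro: Vect.arr_cmp[OF f'(3) tx])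
  also have "\<dots> = (\<Sum>x\<in>carrier G. f)"
    using t1 by simp
  also have "\<dots> = scl Vect N f"
    by (simp add: fun_eq_iff sum_fun_apply N_def)
  finally have "f \<bullet> h \<bullet> f = scl Vect (1 / N) (scl Vect N f)"
    using Vect.cmp_scl_l[OF f'(3) s] Vect.cmp_scl_r[OF Vect.arr_cmp[OF f'(3) s] f'(3)] by (simp add: h_def)
  then have "f \<bullet> h \<bullet> f = f"
    using N by (simp add: fun_eq_iff)
  with h show thesis
    by (rule that)
qed

text \<open>Split \<open>e\<close> as a matrix and compress the action to the image. As
  \<open>e\<close> commutes with the action, the compression is multiplicative and both halves of
  the splitting are equivariant.\<close>

lemma R_split_idempotent:
  assumes e: "arr R X X e" "e \<bullet> e = e"
  obtains Y \<iota> \<pi> where "arr R Y X \<iota>" "arr R X Y \<pi>" "\<pi> \<bullet> \<iota> = idm R Y" "\<iota> \<bullet> \<pi> = e"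
proof -
  note e' = arr_RD[OF e(1)]
  note X = Ob_RD[OF e'(1)]
  obtain A \<iota> \<pi> where A: "arr Vect A (fst X) \<iota>" "arr Vect (fst X) A \<pi>" "\<pi> \<bullet> \<iota> = idm Vect A" "\<iota> \<bullet> \<pi> = e"
    using Vect_split_idempotent[OF e'(3) e(2)] by blast
  have fc: "finite_columns \<iota>" "finite_columns \<pi>" "finite_columns e"
    using A e' finite_columns_arr by blast+
  have e\<iota>: "e \<bullet> \<iota> = \<iota>" and \<pi>e: "\<pi> \<bullet> e = \<pi>"
    using A Vect.idr[OF A(1)] Vect.idl[OF A(2)] by (auto simp: assoc_Vect fc A(4)[symmetric] simp flip: assoc_Vect[OF fc(1,2), of \<pi>])
  have red: "\<pi> \<bullet> \<iota> \<bullet> f = idm Vect A \<bullet> f" "\<iota> \<bullet> \<pi> \<bullet> f = e \<bullet> f" if "finite_columns f" for f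
    using that A fc by (simp_all flip: assoc_Vect)
  define \<rho> where "\<rho> g = \<pi> \<bullet> snd X g \<bullet> \<iota>" for g
  note fx = X(3) fc finite_columns_cmp
  have \<iota>\<rho>: "\<iota> \<bullet> \<rho> g = snd X g \<bullet> \<iota>" if g: "g \<in> carrier G" for g
  proof -
    have "\<iota> \<bullet> \<rho> g = (e \<bullet> snd X g) \<bullet> \<iota>"
      using g by (simp add: \<rho>_def assoc_Vect fx red)
    also have "\<dots> = snd X g \<bullet> \<iota>"
      unfolding e'(5)[OF g] using g by (simp add: assoc_Vect fx e\<iota>)
    finally show ?thesis .
  qed
  have \<rho>\<pi>: "\<rho> g \<bullet> \<pi> = \<pi> \<bullet> snd X g" if g: "g \<in> carrier G" for g
  proof -
    have "\<rho> g \<bullet> \<pi> = \<pi> \<bullet> snd X g \<bullet> e"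
      using g by (simp add: \<rho>_def assoc_Vect fx A(4))
    also have "\<dots> = (\<pi> \<bullet> e) \<bullet> snd X g"
      using g e'(5)[OF g] by (simp add: assoc_Vect fx)
    finally show ?thesis
      by (simp add: \<pi>e)
  qed
  have Y: "(A, \<rho>) \<in> Ob R"
    unfolding Ob_R
  proof (intro conjI ballI; (simp only: fst_conv snd_conv)?)
    show "finite A"
      using A by (simp add: arr_Vect_iff)
    show "arr Vect A A (\<rho> g)" if "g \<in> carrier G" for g
      unfolding \<rho>_def using that by (intro Vect.arr_cmp[OF Vect.arr_cmp[OF A(1) X(2)] A(2)])
    show "\<rho> \<one> = idm Vect A"
      using A(3) Vect.idl[OF A(1)] by (simp add: \<rho>_def X(4))
    show "\<rho> (g \<otimes> h) = \<rho> g \<bullet> \<rho> h" if g: "g \<in> carrier G" "h \<in> carrier G" for g h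
    proof -
      have "finite_columns (\<rho> h)"
        using g by (simp add: \<rho>_def fx)
      then have "\<rho> g \<bullet> \<rho> h = \<pi> \<bullet> snd X g \<bullet> \<iota> \<bullet> \<rho> h"
        unfolding \<rho>_def[of g] using g by (simp add: assoc_Vect fx)
      then show ?thesis
        unfolding \<iota>\<rho>[OF g(2)] using g by (simp add: \<rho>_def X(5) assoc_Vect fx)
    qed
  qed
  show thesis
  proof (rule that)
    show "arr R (A, \<rho>) X \<iota>" "arr R X (A, \<rho>) \<pi>"
      using Y A e' \<iota>\<rho> \<rho>\<pi> by (auto intro!: arr_R_I)
  qed (use A in auto)
qed

text \<open>A quasi-inverse \<open>h\<close> of a monomorphism \<open>f\<close> is a left inverse,
  so the subobject is cut out by the idempotent \<open>f \<bullet> h\<close>; if this is 0 or the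
  identity, the subobject is zero or everything.\<close>

lemma R_simpleI:
  assumes "X \<in> Ob R" "idm R X \<noteq> 0" "\<And>e. arr R X X e \<Longrightarrow> e \<bullet> e = e \<Longrightarrow> e = 0 \<or> e = idm R X"
  shows "simple_object R X"
  unfolding simple_object_def
proof (intro conjI ballI allI impI)
  show "\<not> zero_object R X"
    using assms R.zero_object_iff by blast
  fix Y f assume Y: "Y \<in> Ob R" "is_mono R Y X f"
  then have f: "arr R Y X f"
    using assms(1) by (simp add: is_mono_def arr_def)
  obtain h where h: "arr R X Y h" "f \<bullet> h \<bullet> f = f"
    using R_quasi_inverse[OF f] .
  note f' = arr_RD[OF f] and h' = arr_RD[OF h(1)]
  have "f \<bullet> h \<bullet> f = f \<bullet> idm R Y"
    using h f' by (simp add: Vect.idr)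
  moreover have "h \<bullet> f \<in> Hom R Y Y"
    using R.arr_cmp[OF f h(1)] by (simp add: arr_def)
  ultimately have hf: "h \<bullet> f = idm R Y"
    using Y R.idm_Hom[OF Y(1)] unfolding is_mono_def by simp
  have "(f \<bullet> h) \<bullet> (f \<bullet> h) = (f \<bullet> h \<bullet> f) \<bullet> h"
    using f' h' by (simp add: assoc_Vect finite_columns_cmp)
  then have "(f \<bullet> h) \<bullet> (f \<bullet> h) = f \<bullet> h"
    using h by simp
  then consider "f \<bullet> h = 0" | "f \<bullet> h = idm R X"
    using assms(3) R.arr_cmp[OF h(1) f] by auto
  then show "zero_object R Y \<or> isomorphism R Y X f"
  proof cases
    case 1
    then have "f = 0"
      using h f' h' Vect.cmp_zero_l[OF f'(3)] by (simp flip: assoc_Vect[of h f f])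
    then have "idm R Y = 0"
      using hf Vect.cmp_zero_r[OF h'(3)] by simp
    then show ?thesis
      using Y R.zero_object_iff by blast
  next
    case 2
    then have "inverse_pair R Y X f h"
      using f h hf by (simp add: inverse_pair_def)
    then show ?thesis
      using Y assms(1) R.isomorphism_iff by blast
  qed
qed (fact assms)

text \<open>Converse of \<open>R_simpleI\<close>: the image of an idempotent is a subobject by
  splitting, to which simplicity applies.\<close>

lemma R_simple_idempotent:
  assumes X: "simple_object R X" and e: "arr R X X e" "e \<bullet> e = e"
  shows "e = 0 \<or> e = idm R X"
proof -
  obtain Y \<iota> \<pi> where Y: "arr R Y X \<iota>" "arr R X Y \<pi>" "\<pi> \<bullet> \<iota> = idm R Y" "\<iota> \<bullet> \<pi> = e"
    using R_split_idempotent[OF e] .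
  note \<iota> = arr_RD[OF Y(1)] and \<pi> = arr_RD[OF Y(2)]
  have "is_mono R Y X \<iota>"
    unfolding is_mono_def
  proof (intro conjI ballI impI)
    show "\<iota> \<in> Hom R Y X"
      using Y by (simp add: arr_def)
    fix W g h assume gh: "W \<in> Ob R" "g \<in> Hom R W Y" "h \<in> Hom R W Y" "\<iota> \<cdot>\<^bsub>R\<^esub> g = \<iota> \<cdot>\<^bsub>R\<^esub> h"
    have "\<pi> \<bullet> \<iota> \<bullet> k = k" if "k \<in> Hom R W Y" for k
    proof -
      have k: "arr R W Y k"
        using that gh \<iota> by (simp add: arr_def)
      have "(\<pi> \<bullet> \<iota>) \<bullet> k = k"
        using Y(3) Vect.idl[OF arr_RD(3)[OF k]] by simp
      then show ?thesis
        using arr_RD(4)[OF k] \<iota> by (simp add: assoc_Vect)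
    qed
    then show "g = h"
      using gh by (metis R_simps(1))
  qed
  then consider "zero_object R Y" | "isomorphism R Y X \<iota>"
    using X \<iota> by (auto simp: simple_object_def)
  then show ?thesis
  proof cases
    case 1
    then have "\<iota> = 0"
      using Y \<iota> by (auto simp: zero_object_def arr_def)
    then show ?thesis
      using Y(4) Vect.cmp_zero_l[OF \<pi>(3)] by simp
  next
    case 2
    then obtain j where "inverse_pair R Y X \<iota> j"
      using R.isomorphism_iff \<iota> by blast
    then have j: "arr R X Y j" "\<iota> \<bullet> j = idm R X"
      by (auto simp: inverse_pair_def)
    note j' = arr_RD[OF j(1)]
    have "e = e \<bullet> \<iota> \<bullet> j"
      using j Vect.idr[OF arr_RD(3)[OF e(1)]] by simp
    also have "\<dots> = \<iota> \<bullet> (\<pi> \<bullet> \<iota>) \<bullet> j"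
      using \<iota> \<pi> j' by (simp add: assoc_Vect finite_columns_cmp flip: Y(4))
    also have "\<dots> = idm R X"
      using Y(3) Vect.idl[OF j'(3)] j by simp
    finally show ?thesis
      by simp
  qed
qed

lemma direct_sum_R_Vect:
  assumes "direct_sum R I S X \<iota> \<pi>"
  shows "direct_sum Vect I (\<lambda>i. fst (S i)) (fst X) \<iota> \<pi>"
  using assms arr_RD(3) Ob_RD(1) unfolding R.direct_sum_iff Vect.direct_sum_iff by simp

lemma direct_sum_R_card:
  assumes "direct_sum R I S X \<iota> \<pi>"
  shows "card (fst X) = (\<Sum>i\<in>I. card (fst (S i)))"
  using direct_sum_Vect_card[OF direct_sum_R_Vect[OF assms]] .

lemma idm_R_eq_0_iff: "X \<in> Ob R \<Longrightarrow> idm R X = 0 \<longleftrightarrow> card (fst X) = 0"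
  using Ob_RD(1)[of X] by (auto simp: fun_eq_iff idm_Vect split: if_splits)

text \<open>Induction on the dimension. A nontrivial idempotent and its complement split
  \<open>X\<close> into two objects of smaller dimension; if there is none, then \<open>X\<close> is
  zero or simple.\<close>

lemma R_decomposition:
  assumes "X \<in> Ob R"
  shows "\<exists>(n::nat) S \<iota> \<pi>. (\<forall>i<n. simple_object R (S i)) \<and> direct_sum R {..<n} S X \<iota> \<pi>"
  using assms
proof (induction "card (fst X)" arbitrary: X rule: less_induct)
  case less
  note iX = R.arr_idm[OF less.prems] 
  show ?case
  proof (cases "\<forall>e. arr R X X e \<and> e \<bullet> e = e \<longrightarrow> e = 0 \<or> e = idm R X")
    case True
    show ?thesis
    proof (cases "idm R X = 0")
      case z: True
      \<comment> \<open>A zero object is the empty sum.\<close>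
      have "direct_sum R {..<0::nat} (\<lambda>_. X) X (\<lambda>_. 0) (\<lambda>_. 0)"
        using less.prems z by (simp add: R.direct_sum_iff)
      then show ?thesis
        by (metis less_nat_zero_code)
    next
      case False
      then have "simple_object R X"
        using True less.prems by (intro R_simpleI) auto
      moreover have "direct_sum R {..<Suc 0} (\<lambda>_. X) X (\<lambda>_. idm R X) (\<lambda>_. idm R X)"
        using less.prems iX Vect.idl[OF arr_RD(3)[OF iX]] by (simp add: R.direct_sum_iff)
      ultimately show ?thesis
        by metis
    qed
  next
    case False
    then obtain e where e: "arr R X X e" "e \<bullet> e = e" "e \<noteq> 0" "e \<noteq> idm R X"
      by blast
    note e' = arr_RD[OF e(1)]
    define e2 where "e2 = idm R X - e"
    have e2: "arr R X X e2"
      unfolding e2_def by (rule R.arr_diff[OF iX e(1)])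
    have ee2: "e \<bullet> e2 = 0"
      using R.cmp_diff_r[OF iX e(1,1)] R.idr[OF e(1)] e(2) by (simp add: e2_def)
    have e2e: "e2 \<bullet> e = 0"
      using R.cmp_diff_l[OF e(1) iX e(1)] R.idl[OF e(1)] e(2) by (simp add: e2_def)
    have "e2 \<bullet> e2 = e2"
      using R.cmp_diff_l[OF e2 iX e(1)] R.idl[OF e2] ee2 by (simp add: e2_def[symmetric]) (simp add: e2_def)
    obtain Y1 \<iota>1 \<pi>1 where Y1: "arr R Y1 X \<iota>1" "arr R X Y1 \<pi>1" "\<pi>1 \<bullet> \<iota>1 = idm R Y1" "\<iota>1 \<bullet> \<pi>1 = e"
      using R_split_idempotent[OF e(1,2)] .
    obtain Y2 \<iota>2 \<pi>2 where Y2: "arr R Y2 X \<iota>2" "arr R X Y2 \<pi>2" "\<pi>2 \<bullet> \<iota>2 = idm R Y2" "\<iota>2 \<bullet> \<pi>2 = e2"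
      using R_split_idempotent[OF e2 \<open>e2 \<bullet> e2 = e2\<close>] .
    note d = arr_RD[OF Y1(1)] arr_RD[OF Y1(2)] arr_RD[OF Y2(1)] arr_RD[OF Y2(2)]
    \<comment> \<open>Orthogonality of the idempotents passes to the halves of their splittings,
      after inserting the identities of both images.\<close>
    have orth: "\<pi> \<bullet> \<iota>' = 0"
      if "arr R X Y \<pi>" "arr R Y X \<iota>" "arr R Y' X \<iota>'" "arr R X Y' \<pi>'" "\<pi> \<bullet> \<iota> = idm R Y" "\<pi>' \<bullet> \<iota>' = idm R Y'"
        "(\<iota> \<bullet> \<pi>) \<bullet> (\<iota>' \<bullet> \<pi>') = 0" for Y Y' \<pi> \<iota> \<pi>' \<iota>'
    proof -
      have m: "arr R Y' Y (\<pi> \<bullet> \<iota>')"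
        using R.arr_cmp[OF that(3,1)] by simp
      note fcs = arr_RD(4)[OF that(1)] arr_RD(4)[OF that(2)] arr_RD(4)[OF that(3)] arr_RD(4)[OF that(4)] finite_columns_cmp
      have "\<pi> \<bullet> \<iota>' = (\<pi> \<bullet> \<iota>) \<bullet> (\<pi> \<bullet> \<iota>') \<bullet> (\<pi>' \<bullet> \<iota>')"
        using R.idl[OF m] R.idr[OF m] that by simp
      also have "\<dots> = \<pi> \<bullet> ((\<iota> \<bullet> \<pi>) \<bullet> (\<iota>' \<bullet> \<pi>')) \<bullet> \<iota>'"
        by (simp add: assoc_Vect fcs)
      also have "\<dots> = 0"
        using that Vect.cmp_zero_l[OF arr_RD(3)[OF that(3)]] Vect.cmp_zero_r[OF arr_RD(3)[OF that(1)]] by simp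
      finally show ?thesis .
    qed
    have o: "\<pi>1 \<bullet> \<iota>2 = 0" "\<pi>2 \<bullet> \<iota>1 = 0"
      using orth[OF Y1(2,1) Y2(1,2) Y1(3) Y2(3)] orth[OF Y2(2,1) Y1(1,2) Y2(3) Y1(3)] Y1(4) Y2(4) ee2 e2e by auto
    define Y where "Y = (\<lambda>b. if b then Y1 else Y2)"
    define \<iota> where "\<iota> = (\<lambda>b. if b then \<iota>1 else \<iota>2)"
    define \<pi> where "\<pi> = (\<lambda>b. if b then \<pi>1 else \<pi>2)"
    have ds: "direct_sum R (UNIV :: bool set) Y X \<iota> \<pi>"
      unfolding R.direct_sum_iff using less.prems Y1 Y2 o
      by (auto simp: Y_def \<iota>_def \<pi>_def UNIV_bool e2_def)
    have card: "card (fst X) = card (fst Y1) + card (fst Y2)"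
      using direct_sum_R_card[OF ds] by (simp add: Y_def UNIV_bool)
    have "idm R Y1 \<noteq> 0"
      using Y1(1,4) e(3) Vect.cmp_zero_l[OF d(8)] R.idr[OF Y1(1)] R.cmp_zero_r[OF Y1(1)] by auto
    moreover have "idm R Y2 \<noteq> 0"
      using Y2(1,4) e(4) Vect.cmp_zero_l[OF d(18)] R.idr[OF Y2(1)] R.cmp_zero_r[OF Y2(1)] by (auto simp: e2_def)
    ultimately have small: "card (fst (Y b)) < card (fst X)" for b
      using idm_R_eq_0_iff[OF d(1)] idm_R_eq_0_iff[OF d(11)] card by (simp add: Y_def del: R_simps)
    have "Y b \<in> Ob R" for b
      using d by (simp add: Y_def)
    then have "\<forall>b. \<exists>(n::nat) S \<iota> \<pi>. (\<forall>i<n. simple_object R (S i)) \<and> direct_sum R {..<n} S (Y b) \<iota> \<pi>"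
      using less.hyps small by blast
    then obtain n S \<kappa> \<rho> where S: "\<And>b i. i < (n b :: nat) \<Longrightarrow> simple_object R (S b i)"
      "\<And>b. direct_sum R {..<n b} (S b) (Y b) (\<kappa> b) (\<rho> b)"
      by metis
    let ?I = "Sigma (UNIV :: bool set) (\<lambda>b. {..<n b})"
    obtain h where h: "bij_betw h {0..<card ?I} ?I"
      using ex_bij_betw_nat_finite[of ?I] by auto
    then have h: "bij_betw h {..<card ?I} ?I"
      by (simp add: atLeast0LessThan)
    from R.direct_sum_reindex[OF R.direct_sum_Sigma[OF ds S(2)] h]
    show ?thesis
    proof (intro exI conjI allI impI)
      fix i assume "i < card ?I"
      then have "h i \<in> ?I"
        using h by (auto simp: bij_betw_def)
      then show "simple_object R (case h i of (i, j) \<Rightarrow> S i j)"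
        using S(1) by auto
    qed
  qed
qed

text \<open>An idempotent that is a scalar \<open>c\<close> satisfies \<open>c * c = c\<close>, so
  it is trivial.\<close>

lemma R_scalar_simple:
  assumes "scalar_end R X"
  shows "simple_object R X"
proof (rule R_simpleI)
  show X: "X \<in> Ob R" "idm R X \<noteq> 0"
    using assms by (auto simp: scalar_end_def)
  fix e assume e: "arr R X X e" "e \<bullet> e = e"
  then obtain c where c: "e = scl R c (idm R X)"
    using assms by (auto simp: scalar_end_def)
  have "e \<bullet> e = scl R c e"
    using R.cmp_scl_l[OF e(1) R.arr_idm[OF X(1)], of c] R.idl[OF e(1)] by (simp add: c[symmetric] del: R_simps(4)) (simp add: c)
  then have "scl R (c * c) (idm R X) = scl R c (idm R X)"
    using e c by (simp del: R_simps(4))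
  then have "c = 0 \<or> c = 1"
    using X by (simp del: R_simps)
  then show "e = 0 \<or> e = idm R X"
    by (auto simp: c)
qed

sublocale R: schur_tensor R
proof
  show "\<exists>(n::nat) S \<iota> \<pi>. (\<forall>i<n. simple_object R (S i)) \<and> direct_sum R {..<n} S X \<iota> \<pi>" if "X \<in> Ob R" for X
    using R_decomposition[OF that] .
  \<comment> \<open>With a quasi-inverse \<open>h\<close> of \<open>f\<close>, both
    \<open>h \<bullet> f\<close> and \<open>f \<bullet> h\<close> are nonzero idempotents of simple
    objects, hence identities.\<close>
  show "\<exists>g. inverse_pair R S T f g" if S: "simple_object R S" "simple_object R T" and f: "arr R S T f" "f \<noteq> 0" for S T f
  proof -
    obtain h where h: "arr R T S h" "f \<bullet> h \<bullet> f = f"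
      using R_quasi_inverse[OF f(1)] .
    note f' = arr_RD[OF f(1)] and h' = arr_RD[OF h(1)]
    have "h \<bullet> f \<noteq> 0"
      using h(2) f(2) Vect.cmp_zero_r[OF f'(3)] by auto
    moreover have "f \<bullet> h \<noteq> 0"
      using h(2) f(2) Vect.cmp_zero_l[OF f'(3)] f' h' by (auto simp flip: assoc_Vect)
    moreover have "(h \<bullet> f) \<bullet> (h \<bullet> f) = h \<bullet> f" "(f \<bullet> h) \<bullet> (f \<bullet> h) = f \<bullet> h"
    proof -
      show "(h \<bullet> f) \<bullet> (h \<bullet> f) = h \<bullet> f"
        using h f' h' by (simp add: assoc_Vect finite_columns_cmp)
      have "(f \<bullet> h) \<bullet> (f \<bullet> h) = (f \<bullet> h \<bullet> f) \<bullet> h"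
        using f' h' by (simp add: assoc_Vect finite_columns_cmp)
      then show "(f \<bullet> h) \<bullet> (f \<bullet> h) = f \<bullet> h"
        using h by simp
    qed
    ultimately have "h \<bullet> f = idm R S" "f \<bullet> h = idm R T"
      using R_simple_idempotent[OF S(1)] R_simple_idempotent[OF S(2)] R.arr_cmp[OF f(1) h(1)] R.arr_cmp[OF h(1) f(1)] by auto
    then show ?thesis
      using f h by (auto simp: inverse_pair_def)
  qed
  show "\<exists>B. finite B \<and> Hom R X Y \<subseteq> R.V.span B" if "X \<in> Ob R" "Y \<in> Ob R" for X Y
  proof -
    have "Hom R X Y \<subseteq> Hom Vect (fst X) (fst Y)"
      using that arr_RD(3)[of X Y] by (auto simp: arr_def)
    then show ?thesis
      using Vect_finite_dim[OF Ob_RD(1)[OF that(1)] Ob_RD(1)[OF that(2)], where 'a='k] by auto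
  qed
  show "simple_object R (unitO R)"
  proof (rule R_scalar_simple)
    have "\<exists>c. f = scl R c (idm R (unitO R))" if "arr R (unitO R) (unitO R) f" for f
      using arr_RD(3)[OF that] by (intro exI[of _ "f 0 0"]) (auto simp: fun_eq_iff idm_Vect arr_Vect_iff)
    moreover have "idm R (unitO R) \<noteq> 0"
      using idm_R_eq_0_iff[OF R.unit_Ob] by simp
    ultimately show "scalar_end R (unitO R)"
      using R.unit_Ob by (simp add: scalar_end_def del: R_simps)
  qed
qed

end

section \<open>Small representations of the symmetric group\<close>

text \<open>Any two transpositions are linked by transpositions sharing a point: from (a b) to (a c)
  to (c d).\<close>

lemma transpositions_constant:
  assumes overlap: "\<And>a b c. {a, b, c} \<subseteq> S \<Longrightarrow> distinct [a, b, c] \<Longrightarrow> F (transpose a b) = F (transpose a c)"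
    and "{a, b, c, d} \<subseteq> S" "a \<noteq> b" "c \<noteq> d"
  shows "F (transpose a b) = F (transpose c d)"
proof -
  have step: "F (transpose x y) = F (transpose x z)" if "{x, y, z} \<subseteq> S" "x \<noteq> y" "x \<noteq> z" for x y z
    using overlap[of x y z] that by (cases "y = z") auto
  show ?thesis
  proof (cases "a = c")
    case True
    then show ?thesis
      using step[of a b d] assms by auto
  next
    case False
    have "F (transpose a b) = F (transpose a c)"
      using step[of a b c] False assms by auto
    also have "\<dots> = F (transpose c a)"
      by (simp add: transpose_commute)
    also have "\<dots> = F (transpose c d)"
      using step[of c a d] False assms by auto
    finally show ?thesis .
  qed
qed

text \<open>An involution that is not a scalar has trace 0. A second such involution commuting with
  the first lies in its centralizer, spanned by the identity and the first one, and having trace 0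
  it is a multiple of the first; the factor squares to 1.\<close>

lemma involution_2x2:
  fixes p q r s p' q' r' s' :: "'k::field_char_0"
  assumes "p * p + q * r = 1" "p * q + q * s = 0" "r * p + s * r = 0" "r * q + s * s = 1"
    and "p' * p' + q' * r' = 1" "p' * q' + q' * s' = 0" "r' * p' + s' * r' = 0" "r' * q' + s' * s' = 1"
    and "p * p' + q * r' = p' * p + q' * r" "p * q' + q * s' = p' * q + q' * s"
      "r * p' + s * r' = r' * p + s' * r" "r * q' + s * s' = r' * q + s' * s"
    and "\<not> (q = 0 \<and> r = 0 \<and> p = s)" "\<not> (q' = 0 \<and> r' = 0 \<and> p' = s')"
  shows "(p' = p \<and> q' = q \<and> r' = r \<and> s' = s) \<or> (p' = - p \<and> q' = - q \<and> r' = - r \<and> s' = - s)"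
proof -
  \<comment> \<open>If the trace is nonzero, the mixed equations make the matrix diagonal; its two
    entries have equal squares and nonzero sum, so they agree and the matrix is a scalar.\<close>
  have s: "s = - p" if "p * p + q * r = 1" "p * q + q * s = 0" "r * p + s * r = 0" "r * q + s * s = 1"
    "\<not> (q = 0 \<and> r = 0 \<and> p = s)" for p q r s :: 'k
  proof (rule ccontr)
    assume "s \<noteq> - p"
    then have ps: "p + s \<noteq> 0"
      by (metis add.inverse_unique)
    have "q * (p + s) = p * q + q * s" "r * (p + s) = r * p + s * r"
      by (simp_all add: algebra_simps)
    then have "q * (p + s) = 0" "r * (p + s) = 0"
      using that(2,3) by simp_all
    then have qr: "q = 0" "r = 0"
      using ps by auto
    have "(p - s) * (p + s) = p * p - s * s"
      by (simp add: algebra_simps)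
    also have "\<dots> = 0"
      using that(1,4) qr by simp
    finally show False
      using ps qr that(5) by simp
  qed
  have s1: "s = - p" and s2: "s' = - p'"
    using s[OF assms(1-4,13)] s[OF assms(5-8,14)] .
  have e1: "q * r' = q' * r"
    using assms(9) by (simp add: mult.commute)
  have e2: "p * q' = p' * q"
  proof -
    have "2 * (p * q' - p' * q) = (p * q' + q * (- p')) - (p' * q + q' * (- p))"
      by (simp add: algebra_simps)
    then show ?thesis
      using assms(10) unfolding s1 s2 by simp
  qed
  have e3: "p * r' = p' * r"
  proof -
    have "2 * (p * r' - p' * r) = (r' * p + (- p') * r) - (r * p' + (- p) * r')"
      by (simp add: algebra_simps)
    then show ?thesis
      using assms(11) unfolding s1 s2 by simp
  qed
  \<comment> \<open>Half the trace of the product of the two matrices: the only possible factor,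
    because the first matrix squares to the identity and has trace 0.\<close>
  define c where "c = p * p' + q * r'"
  have c1: "p' = c * p"
  proof -
    have "c * p = p' * (p * p) + q * (p * r')"
      by (simp add: c_def algebra_simps)
    also have "\<dots> = p' * (p * p + q * r)"
      unfolding e3 by (simp add: algebra_simps)
    finally show ?thesis
      using assms by simp
  qed
  have c2: "q' = c * q"
  proof -
    have "c * q = p * (p' * q) + q * (q * r')"
      by (simp add: c_def algebra_simps)
    also have "\<dots> = q' * (p * p + q * r)"
      unfolding e1 e2[symmetric] by (simp add: algebra_simps)
    finally show ?thesis
      using assms by simp
  qed
  have c3: "r' = c * r"
  proof -
    have "c * r = p * (p' * r) + r' * (q * r)"
      by (simp add: c_def algebra_simps)
    also have "\<dots> = r' * (p * p + q * r)"
      unfolding e3[symmetric] by (simp add: algebra_simps)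
    finally show ?thesis
      using assms by simp
  qed
  have "c * c = 1"
  proof -
    have "c * c * (p * p + q * r) = (c * p) * (c * p) + (c * q) * (c * r)"
      by (simp add: algebra_simps)
    also have "\<dots> = p' * p' + q' * r'"
      by (simp add: c1 c2 c3)
    finally have "c * c * (p * p + q * r) = p' * p' + q' * r'" .
    then show ?thesis
      using assms by simp
  qed
  then have "c = 1 \<or> c = - 1"
    by (simp add: square_eq_1_iff)
  then show ?thesis
    using s1 s2 c1 c2 c3 by auto
qed

locale symmetric_group_rep =
  fixes n :: nat
    and R :: "('k::{alg_closed_field, field_char_0},
      nat set \<times> ((nat \<Rightarrow> nat) \<Rightarrow> nat \<Rightarrow> nat \<Rightarrow> 'k), nat \<Rightarrow> nat \<Rightarrow> 'k) moncat"
  assumes n5: "n \<ge> 5" and R_eq: "R = Rep (sym_group n)"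
begin

lemma carrier: "\<sigma> \<in> carrier (sym_group n) \<longleftrightarrow> \<sigma> permutes {1..n}"
  by (rule sym_group_carrier)

sublocale finite_group_rep "sym_group n" R
proof (intro finite_group_rep.intro finite_group_rep_axioms.intro)
  show "group (sym_group n)"
    by (rule sym_group_is_group)
  show "finite (carrier (sym_group n))"
    by (simp add: sym_group_def finite_permutations)
qed (rule R_eq)

lemma transpose_carrier: "a \<in> {1..n} \<Longrightarrow> b \<in> {1..n} \<Longrightarrow> transpose a b \<in> carrier (sym_group n)"
  unfolding carrier by (rule permutes_swap_id)

lemma rep_comp:
  assumes "X \<in> Ob R" "\<sigma> permutes {1..n}" "\<tau> permutes {1..n}"
  shows "snd X (\<sigma> \<circ> \<tau>) = snd X \<sigma> \<bullet> snd X \<tau>"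
  using Ob_RD(5)[OF assms(1)] assms unfolding carrier by (simp add: sym_group_mult)

lemma rep_id: "X \<in> Ob R \<Longrightarrow> snd X id = idm Vect (fst X)"
  using Ob_RD(4) by (simp add: sym_group_one)

lemma rep_transpose_square:
  assumes "X \<in> Ob R" "a \<in> {1..n}" "b \<in> {1..n}"
  shows "snd X (transpose a b) \<bullet> snd X (transpose a b) = idm Vect (fst X)"
  using rep_comp[OF assms(1) permutes_swap_id permutes_swap_id, OF assms(2,3,2,3)] rep_id[OF assms(1)]
  by (simp add: transpose_comp_involutory)

lemma rep_transpose_conj:
  assumes "X \<in> Ob R" "{a, b, c} \<subseteq> {1..n}" "distinct [a, b, c]"
  shows "snd X (transpose a c) = snd X (transpose b c) \<bullet> snd X (transpose a b) \<bullet> snd X (transpose b c)"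
proof -
  have p: "transpose a b permutes {1..n}" "transpose b c permutes {1..n}"
    using assms by (auto intro: permutes_swap_id)
  have "transpose c b \<circ> transpose b a \<circ> transpose c b = transpose c a"
    using assms by (intro transpose_comp_triple) auto
  then have "transpose a c = transpose b c \<circ> (transpose a b \<circ> transpose b c)"
    by (simp add: transpose_commute comp_assoc)
  then show ?thesis
    using rep_comp[OF assms(1) p(1,2)] rep_comp[OF assms(1) p(2) permutes_compose[OF p(2,1)]] by simp
qed

section \<open>One-dimensional representations of the symmetric group\<close>

lemma one_dim_comp:
  assumes "X \<in> Ob R" "fst X = {b}" "\<sigma> permutes {1..n}" "\<tau> permutes {1..n}"
  shows "snd X (\<sigma> \<circ> \<tau>) b b = snd X \<sigma> b b * snd X \<tau> b b"
proof -
  have "arr Vect {b} {b} (snd X \<tau>)"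
    using Ob_RD(2)[OF assms(1), of \<tau>] assms by (simp add: carrier)
  then show ?thesis
    by (simp add: rep_comp[OF assms(1,3,4)] cmp_Vect)
qed

text \<open>Overlapping transpositions are conjugate, and conjugation does not change a number; each
  transposition squares to the identity, so the common value is a sign.\<close>

lemma one_dim_transposition:
  assumes X: "X \<in> Ob R" "fst X = {b}"
  obtains c where "c = 1 \<or> c = - 1"
    "\<And>i j. i \<in> {1..n} \<Longrightarrow> j \<in> {1..n} \<Longrightarrow> i \<noteq> j \<Longrightarrow> snd X (transpose i j) b b = c"
proof -
  let ?F = "\<lambda>\<sigma>. snd X \<sigma> b b"
  have sq: "?F (transpose i j) * ?F (transpose i j) = 1" if "i \<in> {1..n}" "j \<in> {1..n}" for i j
  proof -
    have "transpose i j permutes {1..n}"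
      using that by (rule permutes_swap_id)
    from one_dim_comp[OF X this this] show ?thesis
      using rep_id[OF X(1)] X(2) by (simp add: transpose_comp_involutory idm_Vect)
  qed
  have const: "?F (transpose i j) = ?F (transpose i k)" if "{i, j, k} \<subseteq> {1..n}" "distinct [i, j, k]" for i j k
  proof -
    have p: "transpose i j permutes {1..n}" "transpose j k permutes {1..n}"
      using that by (auto intro: permutes_swap_id)
    have "transpose k j \<circ> transpose j i \<circ> transpose k j = transpose k i"
      using that by (intro transpose_comp_triple) auto
    then have "transpose i k = transpose j k \<circ> (transpose i j \<circ> transpose j k)"
      by (simp add: transpose_commute comp_assoc)
    then have "?F (transpose i k) = ?F (transpose j k) * (?F (transpose i j) * ?F (transpose j k))"
      using one_dim_comp[OF X p(1,2)] one_dim_comp[OF X p(2) permutes_compose[OF p(2,1)]] by simp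
    then show ?thesis
      using sq[of j k] that by (simp add: mult.left_commute)
  qed
  show thesis
  proof (rule that[of "?F (transpose 1 2)"])
    show "?F (transpose 1 2) = 1 \<or> ?F (transpose 1 2) = - 1"
      using sq[of 1 2] n5 by (simp add: square_eq_1_iff)
    show "?F (transpose i j) = ?F (transpose 1 2)" if "i \<in> {1..n}" "j \<in> {1..n}" "i \<noteq> j" for i j
      using that n5
      by (intro transpositions_constant[where S="{1..n}" and F="\<lambda>\<sigma>. snd X \<sigma> b b", OF const]) auto
  qed
qed

text \<open>Transpositions generate the group, so agreement on them extends to all permutations; a
  matrix with a single entry 1 then intertwines both actions.\<close>

lemma one_dim_iso:
  assumes X: "X \<in> Ob R" "fst X = {b}" and Y: "Y \<in> Ob R" "fst Y = {b'}"
    and eq: "\<And>i j. i \<in> {1..n} \<Longrightarrow> j \<in> {1..n} \<Longrightarrow> i \<noteq> j \<Longrightarrow>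
      snd X (transpose i j) b b = snd Y (transpose i j) b' b'"
  shows "isomorphic R X Y"
proof -
  have eq': "snd X \<sigma> b b = snd Y \<sigma> b' b'" if "\<sigma> permutes {1..n}" for \<sigma>
    using that finite_atLeastAtMost
  proof (induction rule: permutes_induct)
    case id
    then show ?case
      using rep_id[OF X(1)] rep_id[OF Y(1)] X(2) Y(2) by (simp add: idm_Vect id_def)
  next
    case (swap i j p)
    have pp: "p permutes {1..n}"
      using swap by simp
    show ?case
    proof (cases "i = j")
      case True
      then show ?thesis
        using swap by simp
    next
      case False
      have p: "transpose i j permutes {1..n}"
        using swap by (intro permutes_swap_id) auto
      show ?thesis
        using one_dim_comp[OF X p pp] one_dim_comp[OF Y p pp] eq[of i j] swap False by (simp add: comp_def)
    qed
  qed
  have E: "arr R X' Y' (\<lambda>i j. if i = y \<and> j = x then 1 else 0)" (is "arr R X' Y' ?E")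
    if X': "X' \<in> Ob R" "fst X' = {x}" and Y': "Y' \<in> Ob R" "fst Y' = {y}"
      and e: "\<And>\<sigma>. \<sigma> permutes {1..n} \<Longrightarrow> snd X' \<sigma> x x = snd Y' \<sigma> y y" for X' Y' x y
  proof (rule arr_R_I)
    show a: "arr Vect (fst X') (fst Y') ?E"
      using X' Y' by (auto simp: arr_Vect_iff)
    fix \<sigma> assume s: "\<sigma> \<in> carrier (sym_group n)"
    show "?E \<bullet> snd X' \<sigma> = snd Y' \<sigma> \<bullet> ?E"
    proof (intro ext)
      fix i j
      have X'': "arr Vect {x} {x} (snd X' \<sigma>)" and Y'': "arr Vect {y} {y} (snd Y' \<sigma>)"
        using Ob_RD(2)[OF X'(1) s] Ob_RD(2)[OF Y'(1) s] X'(2) Y'(2) by auto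
      have "snd X' \<sigma> x j = 0" if "j \<noteq> x"
        using X'' that unfolding arr_Vect_iff by blast
      moreover have "snd Y' \<sigma> i y = 0" if "i \<noteq> y"
        using Y'' that unfolding arr_Vect_iff by blast
      ultimately show "(?E \<bullet> snd X' \<sigma>) i j = (snd Y' \<sigma> \<bullet> ?E) i j"
        using e[of \<sigma>] s Y'(2) by (simp add: cmp_Vect[OF X''] cmp_Vect[OF a] carrier)
    qed
  qed fact+
  have "inverse_pair R X Y (\<lambda>i j. if i = b' \<and> j = b then 1 else 0) (\<lambda>i j. if i = b \<and> j = b' then 1 else 0)"
    unfolding inverse_pair_def
  proof (intro conjI)
    show a: "arr R X Y (\<lambda>i j. if i = b' \<and> j = b then 1 else 0)" "arr R Y X (\<lambda>i j. if i = b \<and> j = b' then 1 else 0)"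
      using E X Y eq' by simp_all
    show "(\<lambda>i j. if i = b \<and> j = b' then 1 else 0) \<cdot>\<^bsub>R\<^esub> (\<lambda>i j. if i = b' \<and> j = b then 1 else 0) = idm R X"
      "(\<lambda>i j. if i = b' \<and> j = b then 1 else 0) \<cdot>\<^bsub>R\<^esub> (\<lambda>i j. if i = b \<and> j = b' then 1 else 0) = idm R Y"
      unfolding R_simps
      by (intro ext; simp only: cmp_Vect[OF arr_RD(3)[OF a(1)]] cmp_Vect[OF arr_RD(3)[OF a(2)]] X(2) Y(2) idm_Vect; simp)+
  qed
  then show ?thesis
    by (auto simp: isomorphic_iff)
qed

text \<open>Only the two signs are possible as values on transpositions, so two of the three objects
  share theirs.\<close>

lemma one_dim_three:
  assumes "X \<in> Ob R" "Y \<in> Ob R" "Z \<in> Ob R" "card (fst X) = 1" "card (fst Y) = 1" "card (fst Z) = 1"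
  shows "isomorphic R X Y \<or> isomorphic R X Z \<or> isomorphic R Y Z"
proof -
  obtain x y z where xyz: "fst X = {x}" "fst Y = {y}" "fst Z = {z}"
    using assms(4-6) by (auto simp: card_1_singleton_iff)
  obtain a where a: "a = 1 \<or> a = - 1" "\<And>i j. i \<in> {1..n} \<Longrightarrow> j \<in> {1..n} \<Longrightarrow> i \<noteq> j \<Longrightarrow> snd X (transpose i j) x x = a"
    using one_dim_transposition[OF assms(1) xyz(1)] by blast
  obtain b where b: "b = 1 \<or> b = - 1" "\<And>i j. i \<in> {1..n} \<Longrightarrow> j \<in> {1..n} \<Longrightarrow> i \<noteq> j \<Longrightarrow> snd Y (transpose i j) y y = b"
    using one_dim_transposition[OF assms(2) xyz(2)] by blast
  obtain c where c: "c = 1 \<or> c = - 1" "\<And>i j. i \<in> {1..n} \<Longrightarrow> j \<in> {1..n} \<Longrightarrow> i \<noteq> j \<Longrightarrow> snd Z (transpose i j) z z = c"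
    using one_dim_transposition[OF assms(3) xyz(3)] by blast
  consider "a = b" | "a = c" | "b = c"
    using a b c by auto
  then show ?thesis
  proof cases
    case 1
    then show ?thesis
      using one_dim_iso[OF assms(1) xyz(1) assms(2) xyz(2)] a b by simp
  next
    case 2
    then show ?thesis
      using one_dim_iso[OF assms(1) xyz(1) assms(3) xyz(3)] a c by simp
  next
    case 3
    then show ?thesis
      using one_dim_iso[OF assms(2) xyz(2) assms(3) xyz(3)] b c by simp
  qed
qed

lemma one_dim_sign:
  assumes X: "X \<in> Ob R" "fst X = {b}" and "\<not> isomorphic R (unitO R) X"
    and "i \<in> {1..n}" "j \<in> {1..n}" "i \<noteq> j"
  shows "snd X (transpose i j) b b = - 1"
proof -
  obtain c where c: "c = 1 \<or> c = - 1" "\<And>i j. i \<in> {1..n} \<Longrightarrow> j \<in> {1..n} \<Longrightarrow> i \<noteq> j \<Longrightarrow> snd X (transpose i j) b b = c"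
    using one_dim_transposition[OF X] by blast
  have "c \<noteq> 1"
  proof
    assume "c = 1"
    then have "isomorphic R (unitO R) X"
      using c by (intro one_dim_iso[OF R.unit_Ob _ X, of 0]) (auto simp: idm_Vect)
    then show False
      using assms by simp
  qed
  then show ?thesis
    using c assms by auto
qed

text \<open>A transposition (e d) disjoint from the three points commutes with both given ones. If
  one of these acts by a scalar there is nothing to do; otherwise none of the three acts by a
  scalar, and \<open>involution_2x2\<close> makes both given matrices equal up to sign to that of (e
  d).\<close>

lemma two_dim_commute:
  assumes X: "X \<in> Ob R" "fst X = {u, v}" "u \<noteq> v"
    and abc: "{a, b, c} \<subseteq> {1..n}" "distinct [a, b, c]"
  shows "snd X (transpose a b) \<bullet> snd X (transpose b c) = snd X (transpose b c) \<bullet> snd X (transpose a b)"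
proof -
  define T where "T i j = snd X (transpose i j)" for i j
  define scalar where "scalar A \<longleftrightarrow> A u v = 0 \<and> A v u = 0 \<and> A u u = A v v" for A :: "nat \<Rightarrow> nat \<Rightarrow> 'k"
  have T: "arr Vect {u, v} {u, v} (T i j)" if "i \<in> {1..n}" "j \<in> {1..n}" for i j
    unfolding T_def using Ob_RD(2)[OF X(1) transpose_carrier[OF that]] X(2) by simp
  have ent: "A \<bullet> B = A' \<bullet> B' \<longleftrightarrow>
      (\<forall>i\<in>{u,v}. \<forall>j\<in>{u,v}. A i u * B u j + A i v * B v j = A' i u * B' u j + A' i v * B' v j)"
    if "arr Vect {u, v} {u, v} A" "arr Vect {u, v} {u, v} B" "arr Vect {u, v} {u, v} A'" "arr Vect {u, v} {u, v} B'"
    for A B A' B' :: "nat \<Rightarrow> nat \<Rightarrow> 'k"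
  proof
    assume e: "A \<bullet> B = A' \<bullet> B'"
    then have "(A \<bullet> B) i j = (A' \<bullet> B') i j" for i j
      by simp
    then show "\<forall>i\<in>{u,v}. \<forall>j\<in>{u,v}. A i u * B u j + A i v * B v j = A' i u * B' u j + A' i v * B' v j"
      using X(3) by (simp add: cmp_Vect[OF that(2)] cmp_Vect[OF that(4)])
  next
    assume r: "\<forall>i\<in>{u,v}. \<forall>j\<in>{u,v}. A i u * B u j + A i v * B v j = A' i u * B' u j + A' i v * B' v j"
    show "A \<bullet> B = A' \<bullet> B'"
    proof (intro ext)
      fix i j
      show "(A \<bullet> B) i j = (A' \<bullet> B') i j"
      proof (cases "i \<in> {u, v} \<and> j \<in> {u, v}")
        case True
        then show ?thesis
          using X(3) r by (auto simp: cmp_Vect[OF that(2)] cmp_Vect[OF that(4)])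
      next
        case False
        then show ?thesis
          using Vect.arr_cmp[OF that(2,1)] Vect.arr_cmp[OF that(4,3)] unfolding arr_Vect_iff by metis
      qed
    qed
  qed
  have idm: "arr Vect {u, v} {u, v} (idm Vect {u, v} :: nat \<Rightarrow> nat \<Rightarrow> 'k)"
    by (rule Vect.arr_idm) simp
  have commute_scalar: "A \<bullet> B = B \<bullet> A" if "arr Vect {u, v} {u, v} A" "arr Vect {u, v} {u, v} B" "scalar A" for A B
    using that X(3) by (subst ent) (auto simp: scalar_def mult.commute)
  have sq: "T i j \<bullet> T i j = idm Vect {u, v}" if "i \<in> {1..n}" "j \<in> {1..n}" for i j
    using rep_transpose_square[OF X(1) that] X(2) by (simp add: T_def)
  have sqe: "T i j u u * T i j u u + T i j u v * T i j v u = 1" "T i j u u * T i j u v + T i j u v * T i j v v = 0"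
    "T i j v u * T i j u u + T i j v v * T i j v u = 0" "T i j v u * T i j u v + T i j v v * T i j v v = 1"
    if "i \<in> {1..n}" "j \<in> {1..n}" for i j
  proof -
    have "(T i j \<bullet> T i j) x y = idm Vect {u, v} x y" for x y
      using sq[OF that] by simp
    then have *: "T i j x u * T i j u y + T i j x v * T i j v y = (if x = y \<and> y \<in> {u, v} then 1 else 0)" for x y
      using X(3) by (simp add: cmp_Vect[OF T[OF that]] idm_Vect)
    show "T i j u u * T i j u u + T i j u v * T i j v u = 1" "T i j u u * T i j u v + T i j u v * T i j v v = 0"
      "T i j v u * T i j u u + T i j v v * T i j v u = 0" "T i j v u * T i j u v + T i j v v * T i j v v = 1"
      using *[of u u] *[of u v] *[of v u] *[of v v] X(3) by auto
  qed
  \<comment> \<open>A scalar matrix is unchanged by conjugation, so the property passes to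
    overlapping transpositions.\<close>
  have scalar_step: "scalar (T x z)" if "{x, y, z} \<subseteq> {1..n}" "distinct [x, y, z]" "scalar (T x y)" for x y z
  proof -
    note ar = T[of x y] T[of y z]
    have xyz: "x \<in> {1..n}" "y \<in> {1..n}" "z \<in> {1..n}"
      using that by auto
    have "T x z = T y z \<bullet> T x y \<bullet> T y z"
      using rep_transpose_conj[OF X(1) that(1,2)] by (simp add: T_def)
    also have "\<dots> = T y z \<bullet> T y z \<bullet> T x y"
      using commute_scalar[OF T T that(3), of y z] xyz by simp
    also have "\<dots> = (T y z \<bullet> T y z) \<bullet> T x y"
      using T[OF xyz(2,3)] T[OF xyz(1,2)] by (simp add: assoc_Vect finite_columns_arr)
    also have "\<dots> = T x y"
      unfolding sq[OF xyz(2,3)] using T[OF xyz(1,2)] by (rule Vect.idl)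
    finally show ?thesis
      using that by simp
  qed
  have abc': "a \<in> {1..n}" "b \<in> {1..n}" "c \<in> {1..n}" "a \<noteq> b" "a \<noteq> c" "b \<noteq> c"
    using abc by auto
  \<comment> \<open>Two points besides the three given ones are available since n is at least
    5.\<close>
  have "\<exists>d\<in>{1..n}. d \<notin> {a, b, c}"
  proof (rule ccontr)
    assume "\<not> ?thesis"
    then have "card {1..n} \<le> card {a, b, c}"
      by (intro card_mono) auto
    then show False
      using n5 card_insert_le_m1[of 3 "{b, c}" a] card_insert_le_m1[of 2 "{c}" b] by (simp add: card_insert_if split: if_splits)
  qed
  then obtain d where d: "d \<in> {1..n}" "d \<notin> {a, b, c}"
    by blast
  have "\<exists>e\<in>{1..n}. e \<notin> {a, b, c, d}"
  proof (rule ccontr)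
    assume "\<not> ?thesis"
    then have "card {1..n} \<le> card {a, b, c, d}"
      by (intro card_mono) auto
    then show False
      using n5 by (simp add: card_insert_if split: if_splits)
  qed
  then obtain e where e: "e \<in> {1..n}" "e \<notin> {a, b, c, d}"
    by blast
  show ?thesis
    unfolding T_def[symmetric]
  proof (cases "scalar (T a b) \<or> scalar (T b c)")
    case True
    then show "T a b \<bullet> T b c = T b c \<bullet> T a b"
      using commute_scalar[OF T T, of a b b c] commute_scalar[OF T T, of b c a b] abc' by auto
  next
    case False
    \<comment> \<open>A scalar would spread along the overlapping pairs (e d), (e a), (a b).\<close>
    have nD: "\<not> scalar (T e d)"
    proof
      assume "scalar (T e d)"
      then have "scalar (T e a)"
        using d e abc' by (intro scalar_step[of e d a]) auto
      then have "scalar (T a e)"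
        by (simp add: T_def transpose_commute)
      then have "scalar (T a b)"
        using e abc' by (intro scalar_step[of a e b]) auto
      then show False
        using False by blast
    qed
    have cD: "T e d \<bullet> T i j = T i j \<bullet> T e d" if "i \<in> {a, b, c}" "j \<in> {a, b, c}" for i j
    proof -
      have p: "transpose e d permutes {1..n}" "transpose i j permutes {1..n}"
        using d e that abc' by (auto intro: permutes_swap_id)
      have "e \<noteq> i" "e \<noteq> j" "d \<noteq> i" "d \<noteq> j"
        using d e that by auto
      then have comm: "transpose e d \<circ> transpose i j = transpose i j \<circ> transpose e d"
        by (simp add: fun_eq_iff transpose_def)
      show ?thesis
        unfolding T_def rep_comp[OF X(1) p, symmetric] rep_comp[OF X(1) p(2,1), symmetric] comm ..
    qed
    have pm: "T i j = T e d \<or> T i j = - T e d" if ij: "i \<in> {a, b, c}" "j \<in> {a, b, c}" "\<not> scalar (T i j)" for i j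
    proof -
      have i: "i \<in> {1..n}" "j \<in> {1..n}"
        using ij abc' by auto
      have "\<forall>x\<in>{u,v}. \<forall>y\<in>{u,v}. T e d x u * T i j u y + T e d x v * T i j v y = T i j x u * T e d u y + T i j x v * T e d v y"
        using cD[OF ij(1,2)] ent[OF T[OF e(1) d(1)] T[OF i] T[OF i] T[OF e(1) d(1)]] by simp
      then have ents: "(T i j u u = T e d u u \<and> T i j u v = T e d u v \<and> T i j v u = T e d v u \<and> T i j v v = T e d v v) \<or>
          (T i j u u = - T e d u u \<and> T i j u v = - T e d u v \<and> T i j v u = - T e d v u \<and> T i j v v = - T e d v v)"
        using ij(3) nD unfolding scalar_def
        by (intro involution_2x2 sqe[OF e(1) d(1)] sqe[OF i]) (auto simp: add.commute)
      have z: "T i j x y = 0" "T e d x y = 0" if "x \<notin> {u, v} \<or> y \<notin> {u, v}" for x y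
        using T[OF i] T[OF e(1) d(1)] that unfolding arr_Vect_iff by blast+
      from ents show ?thesis
      proof (elim disjE)
        assume "T i j u u = T e d u u \<and> T i j u v = T e d u v \<and> T i j v u = T e d v u \<and> T i j v v = T e d v v"
        then have "T i j x y = T e d x y" for x y
          using z[of x y] by (cases "x \<in> {u, v} \<and> y \<in> {u, v}") auto
        then show ?thesis
          by (simp add: fun_eq_iff)
      next
        assume "T i j u u = - T e d u u \<and> T i j u v = - T e d u v \<and> T i j v u = - T e d v u \<and> T i j v v = - T e d v v"
        then have "T i j x y = - T e d x y" for x y
          using z[of x y] by (cases "x \<in> {u, v} \<and> y \<in> {u, v}") auto
        then show ?thesis
          by (simp add: fun_eq_iff)
      qed
    qed
    have "T a b = T b c \<or> T a b = - T b c"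
      using pm[of a b] pm[of b c] False by auto
    then show "T a b \<bullet> T b c = T b c \<bullet> T a b"
    proof
      assume "T a b = - T b c"
      then show ?thesis
        using X(3) by (subst ent[OF T[OF abc'(1,2)] T[OF abc'(2,3)] T[OF abc'(2,3)] T[OF abc'(1,2)]]) auto
    qed simp
  qed
qed

text \<open>Overlapping transpositions commute and are conjugate by each other, so they act equally.
  Hence all transpositions act by one matrix \<open>t\<close> and the group by the identity and
  \<open>t\<close> alone. Then \<open>t\<close> is an endomorphism, so a scalar by Schur's lemma;
  now every matrix is an endomorphism, which contradicts Schur's lemma in dimension 2.\<close>

lemma no_two_dim_simple:
  assumes "simple_object R X"
  shows "card (fst X) \<noteq> 2"
proof
  assume "card (fst X) = 2"
  then obtain u v where uv: "fst X = {u, v}" "u \<noteq> v"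
    by (auto simp: card_2_iff)
  have X: "X \<in> Ob R"
    using assms by (simp add: simple_object_def)
  define t where "t = snd X (transpose 1 2)"
  have overlap: "snd X (transpose a b) = snd X (transpose a c)" if "{a, b, c} \<subseteq> {1..n}" "distinct [a, b, c]" for a b c
  proof -
    have p: "transpose a b \<in> carrier (sym_group n)" "transpose b c \<in> carrier (sym_group n)"
      using that by (auto intro: transpose_carrier)
    note fc = Ob_RD(3)[OF X p(1)] Ob_RD(3)[OF X p(2)]
    have "snd X (transpose a c) = (snd X (transpose b c) \<bullet> snd X (transpose b c)) \<bullet> snd X (transpose a b)"
      unfolding rep_transpose_conj[OF X that] two_dim_commute[OF X uv that] using fc by (simp add: assoc_Vect)
    also have "\<dots> = snd X (transpose a b)"
      using rep_transpose_square[OF X, of b c] that Vect.idl[OF Ob_RD(2)[OF X p(1)]] by simp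
    finally show ?thesis ..
  qed
  have all: "snd X (transpose a b) = t" if "a \<in> {1..n}" "b \<in> {1..n}" "a \<noteq> b" for a b
    unfolding t_def using that n5
    by (intro transpositions_constant[where S="{1..n}" and F="snd X", OF overlap]) auto
  have ttc: "transpose 1 2 \<in> carrier (sym_group n)"
    using n5 by (intro transpose_carrier) auto
  have t: "arr Vect (fst X) (fst X) t" "t \<bullet> t = idm Vect (fst X)"
    using Ob_RD(2)[OF X ttc] rep_transpose_square[OF X, of 1 2] n5 by (auto simp: t_def)
  have cases: "snd X \<sigma> = idm Vect (fst X) \<or> snd X \<sigma> = t" if "\<sigma> permutes {1..n}" for \<sigma>
    using that finite_atLeastAtMost
  proof (induction rule: permutes_induct)
    case (swap i j p)
    have p: "transpose i j permutes {1..n}"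
      using swap by (intro permutes_swap_id) auto
    show ?case
    proof (cases "i = j")
      case False
      have pp: "p permutes {1..n}" and IH: "snd X p = idm Vect (fst X) \<or> snd X p = t"
        using swap by auto
      have "snd X (transpose i j \<circ> p) = t \<bullet> snd X p"
        using rep_comp[OF X p pp] all[of i j] swap False by simp
      moreover have "t \<bullet> snd X p = idm Vect (fst X) \<or> t \<bullet> snd X p = t"
        using IH t Vect.idr[OF t(1)] by auto
      ultimately show ?thesis
        by (simp add: comp_def)
    qed (use swap in simp)
  qed (use rep_id[OF X] in \<open>simp add: id_def\<close>)
  have "arr R X X t"
    using X t(1)
  proof (intro arr_R_I)
    fix \<sigma> assume "\<sigma> \<in> carrier (sym_group n)"
    then show "t \<bullet> snd X \<sigma> = snd X \<sigma> \<bullet> t"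
      using cases[of \<sigma>] Vect.idl[OF t(1)] Vect.idr[OF t(1)] unfolding carrier by auto
  qed
  then obtain c where c: "t = scl Vect c (idm Vect (fst X))"
    using R.schur_scalar[OF assms] by auto
  \<comment> \<open>A matrix unit: equivariant since the group acts by scalars, but not a scalar
    itself.\<close>
  define E where "E = (\<lambda>i j. if i = u \<and> j = u then 1 else 0 :: 'k)"
  have Ev: "arr Vect (fst X) (fst X) E"
    using uv by (auto simp: arr_Vect_iff E_def)
  have iX: "arr Vect (fst X) (fst X) (idm Vect (fst X) :: nat \<Rightarrow> nat \<Rightarrow> 'k)"
    using Ob_RD(1)[OF X] by (intro Vect.arr_idm) simp
  have "arr R X X E"
    using X Ev
  proof (intro arr_R_I)
    fix \<sigma> assume "\<sigma> \<in> carrier (sym_group n)"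
    then show "E \<bullet> snd X \<sigma> = snd X \<sigma> \<bullet> E"
      using cases[of \<sigma>] Vect.idl[OF Ev] Vect.idr[OF Ev] Vect.cmp_scl_l[OF Ev iX] Vect.cmp_scl_r[OF iX Ev]
      unfolding carrier by (auto simp: c)
  qed
  then obtain d where "E = scl Vect d (idm Vect (fst X))"
    using R.schur_scalar[OF assms] by auto
  then have "E u u = d" "E v v = d"
    using uv by (simp_all add: idm_Vect)
  then show False
    using uv by (simp add: E_def)
qed

end

section \<open>Factorizations of identities\<close>

context linear_category
begin

lemma factors_throughI:
  assumes "finite I" "\<And>i. i \<in> I \<Longrightarrow> P (T i)" "\<And>i. i \<in> I \<Longrightarrow> arr C (T i) X (a i)"
    "\<And>i. i \<in> I \<Longrightarrow> arr C X (T i) (b i)" "(\<Sum>i\<in>I. a i \<cdot> b i) = idm C X"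
  shows "factors_through C P X"
proof -
  obtain h where "bij_betw h {0..<card I} I"
    using ex_bij_betw_nat_finite assms(1) by blast
  then have h: "bij_betw h {..<card I} I"
    by (simp add: atLeast0LessThan)
  then have "h i \<in> I" if "i < card I" for i
    using that by (auto simp: bij_betw_def)
  moreover have "(\<Sum>i<card I. a (h i) \<cdot> b (h i)) = idm C X"
    using sum.reindex_bij_betw[OF h, of "\<lambda>i. a i \<cdot> b i"] assms(5) by simp
  ultimately show ?thesis
    unfolding factors_through_def using assms(2-4)
    by (intro exI[of _ "card I"] exI[of _ "\<lambda>i. T (h i)"] exI[of _ "\<lambda>i. a (h i)"] exI[of _ "\<lambda>i. b (h i)"]) simp
qed

lemma factors_through_inverse_pair:
  assumes "inverse_pair C X T f g" "P T"
  shows "factors_through C P X"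
  using assms by (intro factors_throughI[of "{()}" P "\<lambda>_. T" X "\<lambda>_. g" "\<lambda>_. f"]) (auto simp: inverse_pair_def)

lemma factors_through_self: "X \<in> Ob C \<Longrightarrow> P X \<Longrightarrow> factors_through C P X"
  using factors_through_inverse_pair[OF inverse_pair_idm] .

lemma factors_through_trans:
  assumes "factors_through C P X" "\<And>T. P T \<Longrightarrow> T \<in> Ob C \<Longrightarrow> factors_through C Q T"
  shows "factors_through C Q X"
proof -
  obtain N T a b where T: "\<And>i. i < (N::nat) \<Longrightarrow> P (T i)" "\<And>i. i < N \<Longrightarrow> arr C (T i) X (a i)"
    "\<And>i. i < N \<Longrightarrow> arr C X (T i) (b i)" "(\<Sum>i<N. a i \<cdot> b i) = idm C X"
    using assms(1) unfolding factors_through_def by blast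
  have "\<forall>i. \<exists>(M::nat) U a' b'. i < N \<longrightarrow> (\<forall>j<M. Q (U j) \<and> arr C (U j) (T i) (a' j) \<and> arr C (T i) (U j) (b' j)) \<and>
      (\<Sum>j<M. a' j \<cdot> b' j) = idm C (T i)"
  proof
    fix i
    have "factors_through C Q (T i)" if "i < N"
      using assms(2)[OF T(1)[OF that]] T(2)[OF that] by (simp add: arr_def)
    then show "\<exists>(M::nat) U a' b'. i < N \<longrightarrow> (\<forall>j<M. Q (U j) \<and> arr C (U j) (T i) (a' j) \<and> arr C (T i) (U j) (b' j)) \<and>
      (\<Sum>j<M. a' j \<cdot> b' j) = idm C (T i)"
      unfolding factors_through_def by blast
  qed
  then obtain M U a' b' where "\<forall>i. i < N \<longrightarrow> (\<forall>j<(M i::nat). Q (U i j) \<and> arr C (U i j) (T i) (a' i j) \<and> arr C (T i) (U i j) (b' i j)) \<and>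
      (\<Sum>j<M i. a' i j \<cdot> b' i j) = idm C (T i)"
    unfolding choice_iff by blast
  then have U: "(\<forall>j<M i. Q (U i j) \<and> arr C (U i j) (T i) (a' i j) \<and> arr C (T i) (U i j) (b' i j)) \<and>
      (\<Sum>j<M i. a' i j \<cdot> b' i j) = idm C (T i)" if "i < N" for i
    using that by blast
  have tm: "a i \<cdot> b i = (\<Sum>j<M i. (a i \<cdot> a' i j) \<cdot> (b' i j \<cdot> b i))" if i: "i < N" for i
  proof -
    have u: "arr C (U i j) (T i) (a' i j)" "arr C (T i) (U i j) (b' i j)" if "j < M i" for j
      using U[OF i] that by auto
    have "a i \<cdot> b i = a i \<cdot> (\<Sum>j<M i. a' i j \<cdot> b' i j) \<cdot> b i"
      using U[OF i] idl[OF T(3)[OF i]] by simp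
    also have "\<dots> = a i \<cdot> (\<Sum>j<M i. (a' i j \<cdot> b' i j) \<cdot> b i)"
      using arr_cmp[OF u(2) u(1)] by (subst cmp_sum_l[OF T(3)[OF i]]) auto
    also have "\<dots> = (\<Sum>j<M i. a i \<cdot> (a' i j \<cdot> b' i j) \<cdot> b i)"
      using arr_cmp[OF T(3)[OF i] arr_cmp[OF u(2) u(1)]] by (subst cmp_sum_r[OF T(2)[OF i]]) auto
    also have "\<dots> = (\<Sum>j<M i. (a i \<cdot> a' i j) \<cdot> (b' i j \<cdot> b i))"
      using T(2,3)[OF i] u by (intro sum.cong refl cmp4[symmetric]) auto
    finally show ?thesis .
  qed
  show ?thesis
  proof (rule factors_throughI[where I="Sigma {..<N} (\<lambda>i. {..<M i})" and T="\<lambda>(i, j). U i j" and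
        a="\<lambda>(i, j). a i \<cdot> a' i j" and b="\<lambda>(i, j). b' i j \<cdot> b i"])
    show "(\<Sum>p\<in>Sigma {..<N} (\<lambda>i. {..<M i}). (case p of (i, j) \<Rightarrow> a i \<cdot> a' i j) \<cdot> (case p of (i, j) \<Rightarrow> b' i j \<cdot> b i)) = idm C X"
      using T(4) tm by (simp add: case_prod_unfold sum.Sigma[symmetric, of "{..<N}" "\<lambda>i. {..<M i}" "\<lambda>i j. (a i \<cdot> a' i j) \<cdot> b' i j \<cdot> b i", unfolded case_prod_unfold])
    show "arr C (case p of (i, j) \<Rightarrow> U i j) X (case p of (i, j) \<Rightarrow> a i \<cdot> a' i j)"
      "arr C X (case p of (i, j) \<Rightarrow> U i j) (case p of (i, j) \<Rightarrow> b' i j \<cdot> b i)"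
      if "p \<in> Sigma {..<N} (\<lambda>i. {..<M i})" for p
    proof -
      obtain i j where p: "p = (i, j)" "i < N" "j < M i"
        using \<open>p \<in> _\<close> by auto
      have "arr C (U i j) (T i) (a' i j)" "arr C (T i) (U i j) (b' i j)"
        using U[OF p(2)] p(3) by auto
      then show "arr C (case p of (i, j) \<Rightarrow> U i j) X (case p of (i, j) \<Rightarrow> a i \<cdot> a' i j)"
        "arr C X (case p of (i, j) \<Rightarrow> U i j) (case p of (i, j) \<Rightarrow> b' i j \<cdot> b i)"
        using p T(2,3)[OF p(2)] by (simp_all add: arr_cmp[of _ "T i"])
    qed
  qed (use U in auto)
qed

text \<open>Composing the identity, written as a sum, with \<open>u\<close> leaves a nonzero term.
  This stands in for the choice of a constituent of \<open>X\<close> that is met by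
  \<open>u\<close>.\<close>

lemma factors_through_nonzero:
  assumes "factors_through C P X" "arr C Z X u" "u \<noteq> 0"
  obtains T b where "P T" "arr C X T b" "b \<cdot> u \<noteq> 0"
proof -
  obtain N T a b where T: "\<And>i. i < (N::nat) \<Longrightarrow> P (T i)" "\<And>i. i < N \<Longrightarrow> arr C (T i) X (a i)"
    "\<And>i. i < N \<Longrightarrow> arr C X (T i) (b i)" "(\<Sum>i<N. a i \<cdot> b i) = idm C X"
    using assms(1) unfolding factors_through_def by blast
  have "\<exists>i<N. b i \<cdot> u \<noteq> 0"
  proof (rule ccontr)
    assume "\<not> ?thesis"
    then have z: "a i \<cdot> b i \<cdot> u = 0" if "i < N" for i
      using that cmp_zero_r[OF T(2)] by simp
    have "u = (\<Sum>i<N. a i \<cdot> b i) \<cdot> u"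
      using T(4) idl[OF assms(2)] by simp
    also have "\<dots> = (\<Sum>i<N. (a i \<cdot> b i) \<cdot> u)"
      using arr_cmp[OF T(3) T(2)] by (intro cmp_sum_l[OF assms(2)]) auto
    also have "\<dots> = (\<Sum>i<N. a i \<cdot> b i \<cdot> u)"
      using T by (intro sum.cong refl assoc[OF assms(2)]) auto
    also have "\<dots> = 0"
      using z by simp
    finally show False
      using assms(3) by simp
  qed
  then show thesis
    using that T by blast
qed

end

lemma (in linear_tensor) factors_through_ten:
  assumes "factors_through C P X" "factors_through C Q Y" "X \<in> Ob C" "Y \<in> Ob C"
  shows "factors_through C (\<lambda>W. \<exists>T U. P T \<and> Q U \<and> T \<in> Ob C \<and> U \<in> Ob C \<and> W = T \<boxtimes> U) (X \<boxtimes> Y)"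
proof -
  obtain N T a b where T: "\<And>i. i < (N::nat) \<Longrightarrow> P (T i)" "\<And>i. i < N \<Longrightarrow> arr C (T i) X (a i)"
    "\<And>i. i < N \<Longrightarrow> arr C X (T i) (b i)" "(\<Sum>i<N. a i \<cdot> b i) = idm C X"
    using assms(1) unfolding factors_through_def by blast
  obtain M U c d where U: "\<And>i. i < (M::nat) \<Longrightarrow> Q (U i)" "\<And>i. i < M \<Longrightarrow> arr C (U i) Y (c i)"
    "\<And>i. i < M \<Longrightarrow> arr C Y (U i) (d i)" "(\<Sum>i<M. c i \<cdot> d i) = idm C Y"
    using assms(2) unfolding factors_through_def by blast
  show ?thesis
  proof (rule factors_throughI[where I="{..<N} \<times> {..<M}" and T="\<lambda>(i, j). T i \<boxtimes> U j" and
        a="\<lambda>(i, j). a i \<star> c j" and b="\<lambda>(i, j). b i \<star> d j"])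
    have "(\<Sum>p\<in>{..<N} \<times> {..<M}. (case p of (i, j) \<Rightarrow> a i \<star> c j) \<cdot> (case p of (i, j) \<Rightarrow> b i \<star> d j))
        = (\<Sum>i<N. \<Sum>j<M. (a i \<cdot> b i) \<star> (c j \<cdot> d j))"
      unfolding sum.cartesian_product
      using T U by (intro sum.cong refl) (auto intro!: ten_cmp)
    also have "\<dots> = (\<Sum>i<N. (a i \<cdot> b i) \<star> (\<Sum>j<M. c j \<cdot> d j))"
      using arr_cmp[OF T(3) T(2)] arr_cmp[OF U(3) U(2)]
      by (intro sum.cong refl ten_sum_r[OF assms(4,4), symmetric]) auto
    also have "\<dots> = (\<Sum>i<N. a i \<cdot> b i) \<star> (\<Sum>j<M. c j \<cdot> d j)"
      unfolding U(4) using T arr_cmp[OF T(3) T(2)] by (intro ten_sum_l[OF assms(3,3) arr_idm[OF assms(4)], symmetric]) auto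
    finally show "(\<Sum>p\<in>{..<N} \<times> {..<M}. (case p of (i, j) \<Rightarrow> a i \<star> c j) \<cdot> (case p of (i, j) \<Rightarrow> b i \<star> d j)) = idm C (X \<boxtimes> Y)"
      using T U assms by (simp add: ten_idm)
    show "\<exists>T' U'. P T' \<and> Q U' \<and> T' \<in> Ob C \<and> U' \<in> Ob C \<and> (case p of (i, j) \<Rightarrow> T i \<boxtimes> U j) = T' \<boxtimes> U'"
      if p: "p \<in> {..<N} \<times> {..<M}" for p
    proof -
      obtain i j where "p = (i, j)" "i < N" "j < M"
        using p by auto
      then show ?thesis
        using T(1,2)[of i] U(1,2)[of j] by (auto simp: arr_def)
    qed
    show "arr C (case p of (i, j) \<Rightarrow> T i \<boxtimes> U j) (X \<boxtimes> Y) (case p of (i, j) \<Rightarrow> a i \<star> c j)"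
      "arr C (X \<boxtimes> Y) (case p of (i, j) \<Rightarrow> T i \<boxtimes> U j) (case p of (i, j) \<Rightarrow> b i \<star> d j)"
      if "p \<in> {..<N} \<times> {..<M}" for p
      using that T U by (auto intro: arr_ten)
  qed simp
qed

section \<open>Equivariance of inverses and the right unit isomorphism for representations\<close>

lemma (in finite_group_rep) R_inverse:
  assumes f: "arr R X Y f" and g: "arr Vect (fst Y) (fst X) g" "g \<bullet> f = idm Vect (fst X)" "f \<bullet> g = idm Vect (fst Y)"
  shows "arr R Y X g"
proof (rule arr_R_I)
  note f' = arr_RD[OF f]
  fix x assume x: "x \<in> carrier G"
  note X = Ob_RD[OF f'(1)] and Y = Ob_RD[OF f'(2)]
  note fc = X(3)[OF x] Y(3)[OF x] f'(4) finite_columns_arr[OF g(1)] finite_columns_cmp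
  have "g \<bullet> snd Y x = g \<bullet> snd Y x \<bullet> f \<bullet> g"
    using g Vect.idr[OF Y(2)[OF x]] by simp
  also have "\<dots> = g \<bullet> (snd Y x \<bullet> f) \<bullet> g"
    by (simp add: assoc_Vect fc)
  also have "\<dots> = (g \<bullet> f) \<bullet> snd X x \<bullet> g"
    unfolding f'(5)[OF x, symmetric] by (simp add: assoc_Vect fc)
  also have "\<dots> = snd X x \<bullet> g"
    unfolding g(2) using Vect.idl[OF Vect.arr_cmp[OF g(1) X(2)[OF x]]] .
  finally show "g \<bullet> snd Y x = snd X x \<bullet> g" .
qed (use arr_RD[OF f] g in auto)

lemma (in finite_group_rep) R_unit_right:
  assumes "X \<in> Ob R"
  shows "isomorphic R (X \<boxtimes>\<^bsub>R\<^esub> unitO R) X"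
proof -
  note X = Ob_RD[OF assms]
  let ?Y = "X \<boxtimes>\<^bsub>R\<^esub> unitO R"
  define r where "r = (\<lambda>i j. if i \<in> fst X \<and> j = prod_encode (i, 0) then 1 else 0 :: 'k)"
  define s where "s = (\<lambda>i j. if j \<in> fst X \<and> i = prod_encode (j, 0) then 1 else 0 :: 'k)"
  have fY: "fst ?Y = prod_encode ` (fst X \<times> {0})"
    by (simp add: tenO_Vect)
  have rv: "arr Vect (fst ?Y) (fst X) r" and sv: "arr Vect (fst X) (fst ?Y) s"
    unfolding fY using X(1) by (auto simp: arr_Vect_iff r_def s_def)
  have sumY: "(\<Sum>l\<in>fst ?Y. h l) = (\<Sum>a\<in>fst X. h (prod_encode (a, 0)))" for h :: "nat \<Rightarrow> 'k"
  proof -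
    have "fst ?Y = (\<lambda>a. prod_encode (a, 0)) ` fst X"
      unfolding fY by auto
    then show ?thesis
      by (simp add: sum.reindex inj_on_def del: R_simps)
  qed
  have rs: "r \<bullet> s = idm Vect (fst X)"
    unfolding fun_eq_iff cmp_Vect[OF sv] sumY
    using X(1) by (auto simp: r_def s_def idm_Vect if_distrib[of "\<lambda>x. x * _"] cong: if_cong)
  have sr: "s \<bullet> r = idm Vect (fst ?Y)"
  proof (intro ext)
    fix i j
    have "(s \<bullet> r) i j = (\<Sum>l\<in>fst X. if prod_encode (l, 0) = j then (if i = j then 1 else 0) else 0)"
      unfolding cmp_Vect[OF rv] by (intro sum.cong refl) (auto simp: r_def s_def)
    also have "\<dots> = (\<Sum>l\<in>fst ?Y. if l = j then (if i = j then 1 else 0) else 0)"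
      unfolding sumY ..
    also have "\<dots> = idm Vect (fst ?Y) i j"
      using X(1) unfolding fY by (auto simp: idm_Vect)
    finally show "(s \<bullet> r) i j = idm Vect (fst ?Y) i j" .
  qed
  have r: "arr R ?Y X r"
  proof (rule arr_R_I)
    fix x assume x: "x \<in> carrier G"
    have a: "arr Vect (fst ?Y) (fst ?Y) (snd ?Y x)"
      using Ob_RD(2)[OF R.ten_Ob[OF assms R.unit_Ob] x] .
    show "r \<bullet> snd ?Y x = snd X x \<bullet> r"
    proof (intro ext)
      fix i j
      show "(r \<bullet> snd ?Y x) i j = (snd X x \<bullet> r) i j"
      proof (cases "i \<in> fst X \<and> j \<in> fst ?Y")
        case False
        then show ?thesis
          using Vect.arr_cmp[OF a rv] Vect.arr_cmp[OF rv X(2)[OF x]] unfolding arr_Vect_iff by metis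
      next
        case True
        then obtain c where c: "j = prod_encode (c, 0)" "c \<in> fst X"
          unfolding fY by auto
        have "(r \<bullet> snd ?Y x) i j = (\<Sum>l\<in>fst X. if l = i then snd X x i c else 0)"
          unfolding cmp_Vect[OF a] sumY using True
          by (intro sum.cong refl) (auto simp: r_def c ten_Vect idm_Vect)
        also have "\<dots> = snd X x i c"
          using True X(1) by simp
        also have "\<dots> = (\<Sum>l\<in>fst X. if l = c then snd X x i c else 0)"
          using c X(1) by simp
        also have "\<dots> = (snd X x \<bullet> r) i j"
          unfolding cmp_Vect[OF rv] by (intro sum.cong refl) (auto simp: r_def c)
        finally show ?thesis .
      qed
    qed
  qed (use assms rv R.ten_Ob R.unit_Ob in blast)+
  have "inverse_pair R ?Y X r s"
    unfolding inverse_pair_def using r R_inverse[OF r sv sr rs] rs sr by simp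
  then show ?thesis
    by (auto simp: isomorphic_iff)
qed

section \<open>The standard representation of the symmetric group\<close>

text \<open>The index of a pure tensor of basis vectors in a tensor power: the nesting of pairs
  follows the bracketing of \<open>tensor_power\<close> to the left, and 0 is the basis vector of
  the unit object.\<close>

primrec code :: "(nat \<Rightarrow> nat) \<Rightarrow> nat \<Rightarrow> nat"
  where "code x 0 = 0"
  | "code x (Suc k) = prod_encode (code x k, x k)"

lemma code_inj: "code x k = code y k \<Longrightarrow> l < k \<Longrightarrow> x l = y l"
  by (induction k) (auto simp: less_Suc_eq)

context symmetric_group_rep
begin

section \<open>The permutation representation and its endomorphisms\<close>

definition "\<Omega> = {1..n}"

definition perm_mat :: "(nat \<Rightarrow> nat) \<Rightarrow> nat \<Rightarrow> nat \<Rightarrow> 'k"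
  where "perm_mat \<sigma> i j = (if j \<in> \<Omega> \<and> i = \<sigma> j then 1 else 0)"

definition "M = (\<Omega>, perm_mat)"

lemma fst_M [simp]: "fst M = \<Omega>" and snd_M [simp]: "snd M = perm_mat"
  by (simp_all add: M_def)

lemma finite_\<Omega> [simp]: "finite \<Omega>" and card_\<Omega>: "card \<Omega> = n"
  by (simp_all add: \<Omega>_def)

lemma carrier_\<Omega>: "\<sigma> \<in> carrier (sym_group n) \<longleftrightarrow> \<sigma> permutes \<Omega>"
  by (simp add: carrier \<Omega>_def)

lemma arr_perm_mat: "\<sigma> permutes \<Omega> \<Longrightarrow> arr Vect \<Omega> \<Omega> (perm_mat \<sigma>)"
  by (auto simp: arr_Vect_iff perm_mat_def permutes_in_image split: if_splits)

lemma cmp_perm_mat: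
  assumes "\<sigma> permutes \<Omega>"
  shows "(A \<bullet> perm_mat \<sigma>) i j = (if j \<in> \<Omega> then A i (\<sigma> j) else 0)"
proof -
  have "(A \<bullet> perm_mat \<sigma>) i j = (\<Sum>l\<in>\<Omega>. if l = \<sigma> j \<and> j \<in> \<Omega> then A i (\<sigma> j) else 0)"
    unfolding cmp_Vect[OF arr_perm_mat[OF assms]] by (intro sum.cong refl) (auto simp: perm_mat_def)
  also have "\<dots> = (if j \<in> \<Omega> then A i (\<sigma> j) else 0)"
    using permutes_in_image[OF assms, of j] by auto
  finally show ?thesis .
qed

lemma perm_mat_cmp:
  assumes "\<sigma> permutes \<Omega>" "arr Vect B \<Omega> A" "i \<in> \<Omega>"
  shows "(perm_mat \<sigma> \<bullet> A) (\<sigma> i) j = A i j"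
proof -
  have "(perm_mat \<sigma> \<bullet> A) (\<sigma> i) j = (\<Sum>l\<in>\<Omega>. if l = i then A i j else 0)"
    unfolding cmp_Vect[OF assms(2)]
    using permutes_inj[OF assms(1)] by (intro sum.cong refl) (auto simp: perm_mat_def inj_eq)
  then show ?thesis
    using assms(3) by simp
qed

lemma M_Ob: "M \<in> Ob R"
  unfolding Ob_R
proof (intro conjI ballI)
  show "arr Vect (fst M) (fst M) (snd M \<sigma>)" if "\<sigma> \<in> carrier (sym_group n)" for \<sigma>
    using arr_perm_mat that by (simp add: carrier_\<Omega>)
  show "snd M \<one>\<^bsub>sym_group n\<^esub> = idm Vect (fst M)"
    by (auto simp: sym_group_one fun_eq_iff perm_mat_def idm_Vect)
  show "snd M (\<sigma> \<otimes>\<^bsub>sym_group n\<^esub> \<tau>) = snd M \<sigma> \<bullet> snd M \<tau>"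
    if "\<sigma> \<in> carrier (sym_group n)" "\<tau> \<in> carrier (sym_group n)" for \<sigma> \<tau>
    using that by (auto simp: carrier_\<Omega> sym_group_mult fun_eq_iff cmp_perm_mat permutes_in_image)
      (auto simp: perm_mat_def permutes_in_image)
qed simp

definition "J = (\<lambda>i j. if i \<in> \<Omega> \<and> j \<in> \<Omega> then 1 else 0 :: 'k)"

definition "\<nu> = (1 / of_nat n :: 'k)"

lemma \<nu>: "of_nat n * \<nu> = 1" "\<nu> \<noteq> 0"
  using n5 by (auto simp: \<nu>_def)

text \<open>With \<open>\<nu> = 1 / n\<close>, the matrix \<open>\<nu> J\<close> averages the
  coordinates, so \<open>e\<close> is the projection onto the vectors of coordinate sum 0. Its image
  is the standard representation.\<close>

definition "e = idm R M - scl R \<nu> J"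

lemma e_entry: "e i j = (if i \<in> \<Omega> \<and> j \<in> \<Omega> then (if i = j then 1 else 0) - \<nu> else 0)"
  by (simp add: e_def idm_Vect J_def)

lemma arr_J: "arr R M M J"
proof (rule arr_R_I[OF M_Ob M_Ob])
  show J: "arr Vect (fst M) (fst M) J"
    by (auto simp: arr_Vect_iff J_def)
  fix \<sigma> assume "\<sigma> \<in> carrier (sym_group n)"
  then have s: "\<sigma> permutes \<Omega>"
    by (simp add: carrier_\<Omega>)
  have "(perm_mat \<sigma> \<bullet> J) i j = J i j" for i j
  proof (cases "i \<in> \<Omega>")
    case True
    then obtain i' where i': "i = \<sigma> i'" "i' \<in> \<Omega>"
      using permutes_image[OF s] by blast
    then show ?thesis
      using perm_mat_cmp[OF s J[unfolded fst_M] i'(2)] True by (simp add: J_def)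
  next
    case False
    then have "(perm_mat \<sigma> \<bullet> J) i j = 0"
      using Vect.arr_cmp[OF J[unfolded fst_M] arr_perm_mat[OF s]] unfolding arr_Vect_iff by blast
    then show ?thesis
      using False by (simp add: J_def)
  qed
  moreover have "(J \<bullet> perm_mat \<sigma>) i j = J i j" for i j
    using s by (simp add: cmp_perm_mat J_def permutes_in_image)
  ultimately show "J \<bullet> snd M \<sigma> = snd M \<sigma> \<bullet> J"
    by (simp add: fun_eq_iff)
qed

lemma arr_e: "arr R M M e"
  unfolding e_def by (intro R.arr_diff R.arr_scl arr_J R.arr_idm M_Ob)

lemma e_J: "e \<bullet> J = 0"
proof -
  have "(J \<bullet> J) = scl R (of_nat n) J"
  proof (intro ext)
    show "(J \<bullet> J) i j = scl R (of_nat n) J i j" for i j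
      unfolding cmp_Vect[OF arr_RD(3)[OF arr_J]] fst_M by (auto simp: J_def card_\<Omega>)
  qed
  moreover have "e \<bullet> J = J - scl R \<nu> (J \<bullet> J)"
    unfolding e_def
    using R.cmp_diff_l[OF arr_J R.arr_idm[OF M_Ob] R.arr_scl[OF arr_J]] R.cmp_scl_l[OF arr_J arr_J] R.idl[OF arr_J]
    by simp
  ultimately show ?thesis
    using \<nu> by (simp add: fun_eq_iff mult.assoc[symmetric] mult.commute[of \<nu>])
qed

lemma e_idem: "e \<bullet> e = e"
proof -
  have "e \<bullet> (idm R M - scl R \<nu> J) = e - scl R \<nu> (e \<bullet> J)"
    using R.cmp_diff_r[OF R.arr_idm[OF M_Ob] R.arr_scl[OF arr_J] arr_e] R.cmp_scl_r[OF arr_J arr_e] R.idr[OF arr_e]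
    by simp
  then show ?thesis
    by (simp add: e_J e_def[symmetric] fun_eq_iff del: R_simps)
qed

text \<open>Commuting with all permutation matrices means that the entries are constant on orbits of
  pairs of points.\<close>

lemma arr_M_invariant:
  assumes "arr R M M A" "\<sigma> permutes \<Omega>" "i \<in> \<Omega>" "j \<in> \<Omega>"
  shows "A (\<sigma> i) (\<sigma> j) = A i j"
proof -
  have "A \<bullet> perm_mat \<sigma> = perm_mat \<sigma> \<bullet> A"
    using arr_RD(5)[OF assms(1), of \<sigma>] assms(2) by (simp add: carrier_\<Omega>)
  then have "(A \<bullet> perm_mat \<sigma>) (\<sigma> i) j = (perm_mat \<sigma> \<bullet> A) (\<sigma> i) j"
    by simp
  then show ?thesis
    using perm_mat_cmp[OF assms(2) arr_RD(3)[OF assms(1), unfolded fst_M] assms(3)] assms(4)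
    by (simp add: cmp_perm_mat[OF assms(2)])
qed

lemma ex_avoiding:
  assumes "finite A" "card A < 5"
  obtains m where "m \<in> \<Omega>" "m \<notin> A"
proof -
  have "\<not> \<Omega> \<subseteq> A"
    using card_mono[OF assms(1), of \<Omega>] assms(2) n5 card_\<Omega> by auto
  then show thesis
    using that by blast
qed

text \<open>The action on points is doubly transitive: pairs form two orbits, diagonal and
  off-diagonal, so the endomorphisms are spanned by the identity and \<open>J\<close>.\<close>

lemma End_M:
  assumes A: "arr R M M A"
  shows "A = scl R (A 1 1 - A 1 2) (idm R M) + scl R (A 1 2) J"
proof (intro ext)
  fix i j
  have \<Omega>12: "1 \<in> \<Omega>" "2 \<in> \<Omega>"
    using n5 by (auto simp: \<Omega>_def)
  have diag: "A i i = A 1 1" if "i \<in> \<Omega>" for i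
    using arr_M_invariant[OF A permutes_swap_id[of 1 \<Omega> i] \<Omega>12(1,1)] that \<Omega>12 by simp
  have row: "A i j = A i k" if "i \<in> \<Omega>" "j \<in> \<Omega>" "k \<in> \<Omega>" "i \<noteq> j" "i \<noteq> k" for i j k
    using arr_M_invariant[OF A permutes_swap_id[of j \<Omega> k] that(1,2)] that by simp
  have col: "A i j = A k j" if "i \<in> \<Omega>" "j \<in> \<Omega>" "k \<in> \<Omega>" "i \<noteq> j" "k \<noteq> j" for i j k
    using arr_M_invariant[OF A permutes_swap_id[of i \<Omega> k] that(1,2)] that by simp
  have off: "A i j = A 1 2" if ij: "i \<in> \<Omega>" "j \<in> \<Omega>" "i \<noteq> j" for i j
  proof -
    \<comment> \<open>Moving one index at a time could make the row and column indices coincide on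
      the way; a detour over a fifth point avoids this.\<close>
    obtain m where m: "m \<in> \<Omega>" "m \<notin> {i, j, 1, 2}"
      by (rule ex_avoiding[of "{i, j, 1, 2}"]) (auto simp: card_insert_if)
    have "A i j = A i m"
      using row[of i j m] ij m by auto
    also have "\<dots> = A 1 m"
      using col[of i m 1] ij m \<Omega>12 by auto
    also have "\<dots> = A 1 2"
      using row[of 1 m 2] m \<Omega>12 by auto
    finally show ?thesis .
  qed
  show "A i j = (scl R (A 1 1 - A 1 2) (idm R M) + scl R (A 1 2) J) i j"
  proof (cases "i \<in> \<Omega> \<and> j \<in> \<Omega>")
    case True
    then show ?thesis
      using diag[of i] off[of i j] by (auto simp: idm_Vect J_def)
  next
    case False
    moreover have "A i j = 0"
      using arr_RD(3)[OF A] False unfolding arr_Vect_iff by auto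
    ultimately show ?thesis
      by (auto simp: idm_Vect J_def)
  qed
qed

section \<open>Tensor powers of the permutation representation\<close>

lemma code_mem: "(\<And>l. l < k \<Longrightarrow> x l \<in> \<Omega>) \<Longrightarrow> code x k \<in> fst (tensor_power R M k)"
  by (induction k) (auto simp: tenO_Vect)

lemma tensor_power_code:
  assumes "\<sigma> permutes \<Omega>" "\<And>l. l < k \<Longrightarrow> x l \<in> \<Omega>"
  shows "snd (tensor_power R M k) \<sigma> i (code x k) = (if i = code (\<sigma> \<circ> x) k then 1 else 0)"
  using assms(2)
proof (induction k arbitrary: i)
  case (Suc k)
  obtain a c where i: "i = prod_encode (a, c)"
    by (metis prod_decode_inverse surj_pair)
  have "snd (tensor_power R M k) \<sigma> a (code x k) = (if a = code (\<sigma> \<circ> x) k then 1 else 0)"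
    using Suc by (simp add: comp_def)
  then show ?case
    using Suc(2)[of k] by (simp add: i ten_Vect perm_mat_def comp_def)
qed (auto simp: idm_Vect)

text \<open>The basis vector of the tuple (1, ..., n) has trivial stabilizer, so its orbit spans a
  copy of the regular representation, into which every nonzero representation has a nonzero map.
  Concretely, the rank-one map from a basis vector \<open>b\<close> of \<open>Z\<close> to that
  vector is summed over its translates by the group.\<close>

lemma nonzero_to_tensor_power:
  assumes Z: "Z \<in> Ob R" "idm R Z \<noteq> 0"
  obtains u where "arr R Z (tensor_power R M n) u" "u \<noteq> 0"
proof -
  let ?G = "sym_group n"
  let ?T = "tensor_power R M n"
  obtain b where b: "b \<in> fst Z"
    using Z idm_R_eq_0_iff[OF Z(1)] by fastforce
  have T: "?T \<in> Ob R"
    by (intro R.tensor_power_Ob M_Ob)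
  \<comment> \<open>The translate of the tuple (1, ..., n) by a permutation; \<open>Suc\<close>
    shifts the positions 0, ..., n - 1 used by \<open>code\<close> to points.\<close>
  define cd where "cd \<sigma> = code (\<sigma> \<circ> Suc) n" for \<sigma>
  have S: "(\<sigma> \<circ> Suc) l \<in> \<Omega>" if "\<sigma> permutes \<Omega>" "l < n" for \<sigma> l
    using that permutes_in_image[of \<sigma> \<Omega> "Suc l"] by (simp add: \<Omega>_def)
  define K where "K \<sigma> = (\<lambda>i j. if i = cd \<sigma> \<and> j = b then 1 else 0 :: 'k)" for \<sigma>
  have cdT: "cd \<sigma> \<in> fst ?T" if "\<sigma> permutes \<Omega>" for \<sigma>
    unfolding cd_def using S[OF that] by (intro code_mem)
  have K: "arr Vect (fst Z) (fst ?T) (K \<sigma>)" if "\<sigma> permutes \<Omega>" for \<sigma>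
    using b cdT[OF that] Ob_RD(1)[OF Z(1)] Ob_RD(1)[OF T] by (auto simp: arr_Vect_iff K_def)
  have act: "snd ?T \<gamma> \<bullet> K \<sigma> = K (\<gamma> \<circ> \<sigma>)" if "\<gamma> permutes \<Omega>" "\<sigma> permutes \<Omega>" for \<gamma> \<sigma>
  proof (intro ext)
    fix i j
    have "(snd ?T \<gamma> \<bullet> K \<sigma>) i j = (\<Sum>l\<in>fst ?T. if l = cd \<sigma> then (if j = b then snd ?T \<gamma> i (cd \<sigma>) else 0) else 0)"
      unfolding cmp_Vect[OF K[OF that(2)]] by (intro sum.cong refl) (auto simp: K_def)
    also have "\<dots> = (if j = b then snd ?T \<gamma> i (cd \<sigma>) else 0)"
      using cdT[OF that(2)] Ob_RD(1)[OF T] by simp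
    also have "snd ?T \<gamma> i (cd \<sigma>) = (if i = cd (\<gamma> \<circ> \<sigma>) then 1 else 0)"
      unfolding cd_def using tensor_power_code[OF that(1), where k=n and x="\<sigma> \<circ> Suc" and i=i, OF S[OF that(2)]] by (simp add: comp_assoc)
    finally show "(snd ?T \<gamma> \<bullet> K \<sigma>) i j = K (\<gamma> \<circ> \<sigma>) i j"
      by (auto simp: K_def)
  qed
  note Zr = Ob_RD[OF Z(1)]
  define t where "t \<sigma> = K \<sigma> \<bullet> snd Z (inv\<^bsub>?G\<^esub> \<sigma>)" for \<sigma>
  have t: "arr Vect (fst Z) (fst ?T) (t \<sigma>)" if "\<sigma> \<in> carrier ?G" for \<sigma>
    unfolding t_def using that by (intro Vect.arr_cmp[OF Zr(2) K]) (auto simp: carrier_\<Omega>[symmetric] sym_group_inv_closed)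
  define u where "u = (\<Sum>\<sigma>\<in>carrier ?G. t \<sigma>)"
  have uV: "arr Vect (fst Z) (fst ?T) u"
    unfolding u_def using t Zr(1) Ob_RD(1)[OF T] by (intro Vect.arr_sum) auto
  have u: "arr R Z ?T u"
  proof (rule arr_R_I[OF Z(1) T uV])
    fix \<gamma> assume g: "\<gamma> \<in> carrier ?G"
    have step: "t (\<gamma> \<otimes>\<^bsub>?G\<^esub> \<sigma>) \<bullet> snd Z \<gamma> = snd ?T \<gamma> \<bullet> t \<sigma>" if s: "\<sigma> \<in> carrier ?G" for \<sigma>
    proof -
      have gs: "\<gamma> \<otimes>\<^bsub>?G\<^esub> \<sigma> \<in> carrier ?G" "\<gamma> permutes \<Omega>" "\<sigma> permutes \<Omega>"
        using g s by (auto simp: carrier_\<Omega>[symmetric])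
      note fc = Zr(3) finite_columns_arr[OF K[OF gs(3)]] finite_columns_arr[OF K[OF gs(1)[unfolded carrier_\<Omega>]]]
      have "t (\<gamma> \<otimes>\<^bsub>?G\<^esub> \<sigma>) \<bullet> snd Z \<gamma> = K (\<gamma> \<otimes>\<^bsub>?G\<^esub> \<sigma>) \<bullet> snd Z (inv\<^bsub>?G\<^esub> (\<gamma> \<otimes>\<^bsub>?G\<^esub> \<sigma>)) \<bullet> snd Z \<gamma>"
        unfolding t_def using g gs(1) fc by (intro assoc_Vect) (auto simp: sym_group_inv_closed)
      also have "snd Z (inv\<^bsub>?G\<^esub> (\<gamma> \<otimes>\<^bsub>?G\<^esub> \<sigma>)) \<bullet> snd Z \<gamma> = snd Z (inv\<^bsub>?G\<^esub> \<sigma>)"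
      proof -
        have "inv\<^bsub>?G\<^esub> (\<gamma> \<otimes>\<^bsub>?G\<^esub> \<sigma>) \<otimes>\<^bsub>?G\<^esub> \<gamma> = inv\<^bsub>?G\<^esub> \<sigma>"
          using g s by (simp add: inv_mult_group m_assoc del: sym_group_inv_equality)
        then show ?thesis
          using Zr(5)[OF inv_closed[OF gs(1)] g] by simp
      qed
      also have "K (\<gamma> \<otimes>\<^bsub>?G\<^esub> \<sigma>) = snd ?T \<gamma> \<bullet> K \<sigma>"
        using act[OF gs(2,3)] by (simp add: sym_group_mult)
      also have "(snd ?T \<gamma> \<bullet> K \<sigma>) \<bullet> snd Z (inv\<^bsub>?G\<^esub> \<sigma>) = snd ?T \<gamma> \<bullet> t \<sigma>"
        unfolding t_def using s fc by (intro assoc_Vect) (auto simp: sym_group_inv_closed)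
      finally show ?thesis .
    qed
    have "u \<bullet> snd Z \<gamma> = (\<Sum>\<sigma>\<in>carrier ?G. t \<sigma> \<bullet> snd Z \<gamma>)"
      unfolding u_def using t by (rule Vect.cmp_sum_l[OF Zr(2)[OF g]])
    also have "\<dots> = (\<Sum>\<sigma>\<in>carrier ?G. t (\<gamma> \<otimes>\<^bsub>?G\<^esub> \<sigma>) \<bullet> snd Z \<gamma>)"
    proof (rule sum.reindex_bij_betw[symmetric])
      show "bij_betw ((\<otimes>\<^bsub>?G\<^esub>) \<gamma>) (carrier ?G) (carrier ?G)"
        using g surj_const_mult[OF g] inj_on_cmult by (simp add: bij_betw_def)
    qed
    also have "\<dots> = (\<Sum>\<sigma>\<in>carrier ?G. snd ?T \<gamma> \<bullet> t \<sigma>)"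
      using step by simp
    also have "\<dots> = snd ?T \<gamma> \<bullet> u"
      unfolding u_def using t by (rule Vect.cmp_sum_r[OF Ob_RD(2)[OF T g], symmetric])
    finally show "u \<bullet> snd Z \<gamma> = snd ?T \<gamma> \<bullet> u" .
  qed
  \<comment> \<open>The stabilizer is trivial: a permutation is determined by the tuple of its
    values.\<close>
  have cd_inj: "\<sigma> = id" if "\<sigma> permutes \<Omega>" "cd \<sigma> = cd id" for \<sigma>
  proof
    fix i
    show "\<sigma> i = id i"
    proof (cases "i \<in> \<Omega>")
      case True
      then obtain l where "i = Suc l" "l < n"
        by (cases i) (auto simp: \<Omega>_def)
      then show ?thesis
        using code_inj[of "\<sigma> \<circ> Suc" n "id \<circ> Suc" l] that(2) by (simp add: cd_def)
    next
      case False
      then show ?thesis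
        using permutes_not_in[OF that(1)] by simp
    qed
  qed
  have id: "id \<in> carrier ?G"
    using one_closed by (simp add: sym_group_one)
  \<comment> \<open>At this entry only the neutral term of the sum survives, with value 1, so the
    sum is nonzero.\<close>
  have "u (cd id) b = (\<Sum>\<sigma>\<in>carrier ?G. if \<sigma> = id then 1 else 0)"
    unfolding u_def sum_fun_apply
  proof (intro sum.cong refl)
    fix \<sigma> assume s: "\<sigma> \<in> carrier ?G"
    have "t \<sigma> (cd id) b = (\<Sum>l\<in>fst Z. if l = b then (if cd id = cd \<sigma> then snd Z (inv\<^bsub>?G\<^esub> \<sigma>) b b else 0) else 0)"
      unfolding t_def cmp_Vect[OF Zr(2)[OF inv_closed[OF s]]] by (intro sum.cong refl) (auto simp: K_def)
    also have "\<dots> = (if cd id = cd \<sigma> then snd Z (inv\<^bsub>?G\<^esub> \<sigma>) b b else 0)"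
      using b Zr(1) by simp
    also have "\<dots> = (if \<sigma> = id then 1 else 0)"
    proof (cases "\<sigma> = id")
      case True
      have "inv\<^bsub>?G\<^esub> id = id"
        using inv_one by (simp add: sym_group_one)
      then show ?thesis
        using True rep_id[OF Z(1)] b by (simp add: idm_Vect del: sym_group_inv_equality)
    next
      case False
      then show ?thesis
        using cd_inj[of \<sigma>] s by (auto simp: carrier_\<Omega>)
    qed
    finally show "t \<sigma> (cd id) b = (if \<sigma> = id then 1 else 0)" .
  qed
  also have "\<dots> = 1"
    using id finite_carrier by simp
  finally have "u \<noteq> 0"
    by auto
  with u show thesis
    by (rule that)
qed

lemma standard_rep_split:
  obtains V \<iota> \<pi> where "arr R V M \<iota>" "arr R M V \<pi>" "\<pi> \<bullet> \<iota> = idm R V" "\<iota> \<bullet> \<pi> = e"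
  using R_split_idempotent[OF arr_e e_idem] .

section \<open>The standard representation as a splitting of the averaging idempotent\<close>

context
  fixes V \<iota> \<pi>
  assumes \<iota>: "arr R V M \<iota>" and \<pi>: "arr R M V \<pi>" and \<pi>\<iota>: "\<pi> \<bullet> \<iota> = idm R V" and \<iota>\<pi>: "\<iota> \<bullet> \<pi> = e"
begin

lemma V_Ob: "V \<in> Ob R"
  using arr_RD(1)[OF \<iota>] .

lemma e_\<iota>: "e \<bullet> \<iota> = \<iota>"
  using R.assoc[OF \<iota> \<pi> \<iota>] R.idr[OF \<iota>] \<iota>\<pi> \<pi>\<iota> by simp

text \<open>The dimension is the trace of \<open>e\<close>, which is n times 1 - 1/n.\<close>

lemma card_V: "card (fst V) = n - 1"
proof -
  have "of_nat (card (fst V)) = trace (fst V) (\<pi> \<bullet> \<iota>)"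
    using \<pi>\<iota> by (simp add: trace_idm)
  also have "\<dots> = trace \<Omega> e"
    using trace_cmp[OF arr_RD(3)[OF \<iota>] arr_RD(3)[OF \<pi>]] \<iota>\<pi> by simp
  also have "\<dots> = of_nat n - 1"
    using \<nu> by (simp add: trace_def e_entry card_\<Omega> algebra_simps)
  finally have "(of_nat (card (fst V) + 1) :: 'k) = of_nat n"
    by simp
  then show ?thesis
    by (simp only: of_nat_eq_iff)
qed

text \<open>An endomorphism of \<open>V\<close>, extended to \<open>M\<close> through
  \<open>\<iota>\<close> and \<open>\<pi>\<close>, is a combination of the identity and
  \<open>J\<close>; composing with \<open>e\<close>, which kills \<open>J\<close>, leaves a multiple
  of \<open>e\<close>.\<close>

lemma V_scalar_end: "scalar_end R V"
  unfolding scalar_end_def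
proof (intro conjI allI impI)
  show "idm R V \<noteq> 0"
    using idm_R_eq_0_iff[OF V_Ob] card_V n5 by simp
  fix f assume f: "arr R V V f"
  define A where "A = \<iota> \<bullet> f \<bullet> \<pi>"
  have fp: "arr R M V (f \<bullet> \<pi>)"
    using R.arr_cmp[OF \<pi> f] by simp
  have A: "arr R M M A"
    using R.arr_cmp[OF fp \<iota>] by (simp add: A_def)
  define c where "c = A 1 1 - A 1 2"
  have eA: "e \<bullet> A = A"
    using R.assoc[OF fp \<iota> arr_e] e_\<iota> by (simp add: A_def)
  have "e \<bullet> A = e \<bullet> (scl R c (idm R M) + scl R (A 1 2) J)"
    using End_M[OF A] by (simp add: c_def)
  also have "\<dots> = scl R c e + scl R (A 1 2) (e \<bullet> J)"
    using R.cmp_add_r[OF R.arr_scl[OF R.arr_idm[OF M_Ob]] R.arr_scl[OF arr_J] arr_e]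
      R.cmp_scl_r[OF R.arr_idm[OF M_Ob] arr_e] R.cmp_scl_r[OF arr_J arr_e] R.idr[OF arr_e] by simp
  also have "\<dots> = scl R c e"
    using e_J by (simp add: fun_eq_iff)
  finally have Ae: "A = scl R c e"
    using eA by simp
  have "f = (\<pi> \<bullet> \<iota>) \<bullet> f \<bullet> (\<pi> \<bullet> \<iota>)"
    using R.idl[OF f] R.idr[OF f] \<pi>\<iota> by simp
  also have "\<dots> = \<pi> \<bullet> A \<bullet> \<iota>"
    using arr_RD(4)[OF \<iota>] arr_RD(4)[OF \<pi>] arr_RD(4)[OF f] by (simp add: A_def assoc_Vect finite_columns_cmp)
  also have "\<dots> = scl R c (\<pi> \<bullet> e \<bullet> \<iota>)"
    using R.cmp_scl_l[OF \<iota> arr_e, of c] R.cmp_scl_r[OF R.arr_cmp[OF \<iota> arr_e] \<pi>, of c] by (simp add: Ae)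
  also have "\<dots> = scl R c (idm R V)"
    using e_\<iota> \<pi>\<iota> by simp
  finally show "\<exists>c. f = scl R c (idm R V)"
    by blast
qed (rule V_Ob)

text \<open>The diagonal map sending each basis vector to its tensor square. It commutes with
  permutations because they permute the basis.\<close>

definition "\<Delta> = (\<lambda>i j. if j \<in> \<Omega> \<and> i = prod_encode (j, j) then 1 else 0 :: 'k)"

lemma cmp_\<Delta>: "(A \<bullet> \<Delta>) i j = (if j \<in> \<Omega> then A i (prod_encode (j, j)) else 0)"
proof -
  have "arr Vect \<Omega> (prod_encode ` (\<Omega> \<times> \<Omega>)) \<Delta>"
    by (auto simp: arr_Vect_iff \<Delta>_def)
  from cmp_Vect[OF this] have "(A \<bullet> \<Delta>) i j = (\<Sum>l\<in>prod_encode ` (\<Omega> \<times> \<Omega>). A i l * \<Delta> l j)" .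
  also have "\<dots> = (\<Sum>l\<in>prod_encode ` (\<Omega> \<times> \<Omega>). if l = prod_encode (j, j) then (if j \<in> \<Omega> then A i (prod_encode (j, j)) else 0) else 0)"
    by (intro sum.cong refl) (auto simp: \<Delta>_def)
  also have "\<dots> = (if j \<in> \<Omega> then A i (prod_encode (j, j)) else 0)"
    by auto
  finally show ?thesis .
qed

lemma arr_\<Delta>: "arr R M (M \<boxtimes>\<^bsub>R\<^esub> M) \<Delta>"
proof (rule arr_R_I[OF M_Ob R.ten_Ob[OF M_Ob M_Ob]])
  show "arr Vect (fst M) (fst (M \<boxtimes>\<^bsub>R\<^esub> M)) \<Delta>"
    by (auto simp: arr_Vect_iff \<Delta>_def tenO_Vect)
  fix \<sigma> assume "\<sigma> \<in> carrier (sym_group n)"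
  then have s: "\<sigma> permutes \<Omega>"
    by (simp add: carrier_\<Omega>)
  have "(\<Delta> \<bullet> perm_mat \<sigma>) i j = ((perm_mat \<sigma> \<star>\<^bsub>Vect\<^esub> perm_mat \<sigma>) \<bullet> \<Delta>) i j" for i j
  proof -
    obtain a c where i: "i = prod_encode (a, c)"
      by (metis prod_decode_inverse surj_pair)
    show ?thesis
      using permutes_in_image[OF s, of j]
      by (auto simp: cmp_perm_mat[OF s] cmp_\<Delta> i ten_Vect) (auto simp: \<Delta>_def perm_mat_def)
  qed
  then show "\<Delta> \<bullet> snd M \<sigma> = snd (M \<boxtimes>\<^bsub>R\<^esub> M) \<sigma> \<bullet> \<Delta>"
    by (simp add: fun_eq_iff)
qed

text \<open>The diagonal map of \<open>M\<close>, restricted to \<open>V\<close> and projected to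
  the square of \<open>V\<close>. Seen on \<open>M\<close> it is \<open>\<Delta>\<close> surrounded
  by copies of \<open>e\<close>, so a single nonzero entry suffices.\<close>

lemma V_in_V_ten_V: "\<exists>w. arr R V (V \<boxtimes>\<^bsub>R\<^esub> V) w \<and> w \<noteq> 0"
proof -
  define w where "w = (\<pi> \<star>\<^bsub>R\<^esub> \<pi>) \<bullet> \<Delta> \<bullet> \<iota>"
  have \<pi>\<pi>: "arr R (M \<boxtimes>\<^bsub>R\<^esub> M) (V \<boxtimes>\<^bsub>R\<^esub> V) (\<pi> \<star>\<^bsub>R\<^esub> \<pi>)" and \<iota>\<iota>: "arr R (V \<boxtimes>\<^bsub>R\<^esub> V) (M \<boxtimes>\<^bsub>R\<^esub> M) (\<iota> \<star>\<^bsub>R\<^esub> \<iota>)"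
    by (rule R.arr_ten[OF \<pi> \<pi>], rule R.arr_ten[OF \<iota> \<iota>])
  have \<Delta>\<iota>: "arr R V (M \<boxtimes>\<^bsub>R\<^esub> M) (\<Delta> \<bullet> \<iota>)"
    using R.arr_cmp[OF \<iota> arr_\<Delta>] by simp
  have w: "arr R V (V \<boxtimes>\<^bsub>R\<^esub> V) w"
    using R.arr_cmp[OF \<Delta>\<iota> \<pi>\<pi>] by (simp add: w_def)
  have "w \<noteq> 0"
  proof
    assume "w = 0"
    have "(\<iota> \<star>\<^bsub>R\<^esub> \<iota>) \<bullet> w \<bullet> \<pi> = (((\<iota> \<star>\<^bsub>R\<^esub> \<iota>) \<bullet> (\<pi> \<star>\<^bsub>R\<^esub> \<pi>)) \<bullet> \<Delta>) \<bullet> (\<iota> \<bullet> \<pi>)"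
      using arr_RD(4)[OF \<iota>] arr_RD(4)[OF \<pi>] arr_RD(4)[OF arr_\<Delta>] arr_RD(4)[OF \<pi>\<pi>] arr_RD(4)[OF \<iota>\<iota>]
      by (simp add: w_def assoc_Vect finite_columns_cmp)
    also have "(\<iota> \<star>\<^bsub>R\<^esub> \<iota>) \<bullet> (\<pi> \<star>\<^bsub>R\<^esub> \<pi>) = e \<star>\<^bsub>R\<^esub> e"
      using R.ten_cmp[OF \<pi> \<iota> \<pi> \<iota>] \<iota>\<pi> by simp
    finally have "(((e \<star>\<^bsub>R\<^esub> e) \<bullet> \<Delta>) \<bullet> e) = (\<iota> \<star>\<^bsub>R\<^esub> \<iota>) \<bullet> w \<bullet> \<pi>"
      unfolding \<iota>\<pi> by (rule sym)
    also have "\<dots> = 0"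
      unfolding \<open>w = 0\<close> Vect.cmp_zero_l[OF arr_RD(3)[OF \<pi>]] by (rule Vect.cmp_zero_r[OF arr_RD(3)[OF \<iota>\<iota>]])
    finally have z: "(((e \<star>\<^bsub>R\<^esub> e) \<bullet> \<Delta>) \<bullet> e) = 0" .
    have \<Omega>: "1 \<in> \<Omega>" "2 \<in> \<Omega>" "3 \<in> \<Omega>" "{1, 2, 3} \<subseteq> \<Omega>"
      using n5 by (auto simp: \<Omega>_def)
    \<comment> \<open>The entry at row (1, 2) and column 3. Each of the n - 3 other points
      contributes -\<nu>^3 and each of the points 1, 2, 3 contributes \<nu>^2 - \<nu>^3, which makes
      3\<nu>^2 - n\<nu>^3 = 2\<nu>^2.\<close>
    let ?g = "\<lambda>l. e 1 l * e 2 l * e l 3"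
    have "0 = (((e \<star>\<^bsub>R\<^esub> e) \<bullet> \<Delta>) \<bullet> e) (prod_encode (1, 2)) 3"
      using z by simp
    also have "\<dots> = (\<Sum>l\<in>\<Omega>. ?g l)"
      using cmp_Vect[OF arr_RD(3)[OF arr_e], of "(e \<star>\<^bsub>R\<^esub> e) \<bullet> \<Delta>" "prod_encode (1, 2)" 3]
      by (simp add: cmp_\<Delta> ten_Vect)
    also have "\<dots> = (\<Sum>l\<in>\<Omega> - {1, 2, 3}. ?g l) + (\<Sum>l\<in>{1, 2, 3}. ?g l)"
      using sum.subset_diff[OF \<Omega>(4), of ?g] by simp
    also have "(\<Sum>l\<in>\<Omega> - {1, 2, 3}. ?g l) = (\<Sum>l\<in>\<Omega> - {1, 2, 3}. - (\<nu> * \<nu> * \<nu>))"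
      using \<Omega> by (intro sum.cong refl) (auto simp: e_entry)
    also have "\<dots> = - (of_nat (n - 3) * (\<nu> * \<nu> * \<nu>))"
      using card_Diff_subset[OF _ \<Omega>(4)] card_\<Omega> by (simp add: numeral_3_eq_3)
    also have "(\<Sum>l\<in>{1, 2, 3}. ?g l) = 3 * (\<nu> * \<nu>) - 3 * (\<nu> * \<nu> * \<nu>)"
      using \<Omega> by (simp add: e_entry algebra_simps)
    also have "- (of_nat (n - 3) * (\<nu> * \<nu> * \<nu>)) + (3 * (\<nu> * \<nu>) - 3 * (\<nu> * \<nu> * \<nu>)) = 3 * (\<nu> * \<nu>) - (of_nat (n - 3) + 3) * (\<nu> * \<nu> * \<nu>)"
      by (simp add: algebra_simps)
    also have "(of_nat (n - 3) + 3 :: 'k) = of_nat n"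
      using n5 by (simp add: of_nat_diff)
    also have "3 * (\<nu> * \<nu>) - of_nat n * (\<nu> * \<nu> * \<nu>) = 3 * (\<nu> * \<nu>) - (of_nat n * \<nu>) * (\<nu> * \<nu>)"
      by (simp add: algebra_simps)
    also have "\<dots> = 2 * (\<nu> * \<nu>)"
      unfolding \<nu>(1) by (simp add: algebra_simps)
    finally show False
      using \<nu>(2) by simp
  qed
  with w show ?thesis
    by blast
qed

text \<open>Extended to \<open>M\<close>, such a map is a matrix with rows and columns indexed by
  points. A transposition of two points different from the row and the column preserves the entry up
  to its action on \<open>X\<close>, which is -1; so the entry equals its negative.\<close>

lemma V_not_in_sign_ten_V:
  assumes X: "X \<in> Ob R" "card (fst X) = 1" "\<not> isomorphic R (unitO R) X" and f: "arr R V (X \<boxtimes>\<^bsub>R\<^esub> V) f"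
  shows "f = 0"
proof -
  obtain b where b: "fst X = {b}"
    using X(2) by (auto simp: card_1_singleton_iff)
  note iX = R.arr_idm[OF X(1)]
  have X\<iota>: "arr R (X \<boxtimes>\<^bsub>R\<^esub> V) (X \<boxtimes>\<^bsub>R\<^esub> M) (idm R X \<star>\<^bsub>R\<^esub> \<iota>)" and X\<pi>: "arr R (X \<boxtimes>\<^bsub>R\<^esub> M) (X \<boxtimes>\<^bsub>R\<^esub> V) (idm R X \<star>\<^bsub>R\<^esub> \<pi>)"
    by (rule R.arr_ten[OF iX \<iota>], rule R.arr_ten[OF iX \<pi>])
  define A where "A = (idm R X \<star>\<^bsub>R\<^esub> \<iota>) \<bullet> f \<bullet> \<pi>"
  have A: "arr R M (X \<boxtimes>\<^bsub>R\<^esub> M) A"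
    using R.arr_cmp[OF R.arr_cmp[OF \<pi> f] X\<iota>] by (simp add: A_def)
  have AV: "arr Vect \<Omega> (prod_encode ` ({b} \<times> \<Omega>)) A"
    using arr_RD(3)[OF A] by (simp add: tenO_Vect b)
  have "A k j = 0" for k j
  proof (cases "k \<in> prod_encode ` ({b} \<times> \<Omega>) \<and> j \<in> \<Omega>")
    case False
    then show ?thesis
      using AV unfolding arr_Vect_iff by blast
  next
    case True
    then obtain i where i: "k = prod_encode (b, i)" "i \<in> \<Omega>" and j: "j \<in> \<Omega>"
      by auto
    \<comment> \<open>Two further points, on which the transposition will act.\<close>
    obtain a where a: "a \<in> \<Omega>" "a \<notin> {i, j}"
      by (rule ex_avoiding[of "{i, j}"]) (auto simp: card_insert_if)
    obtain c where c: "c \<in> \<Omega>" "c \<notin> {i, j, a}"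
      by (rule ex_avoiding[of "{i, j, a}"]) (auto simp: card_insert_if)
    define \<tau> where "\<tau> = transpose a c"
    have t: "\<tau> permutes \<Omega>"
      unfolding \<tau>_def using a c by (intro permutes_swap_id)
    have fx: "\<tau> i = i" "\<tau> j = j"
      using a c by (auto simp: \<tau>_def transpose_def)
    have sgn: "snd X \<tau> b b = - 1"
      unfolding \<tau>_def using a c by (intro one_dim_sign[OF X(1) b X(3)]) (auto simp: \<Omega>_def)
    have "A \<bullet> perm_mat \<tau> = (snd X \<tau> \<star>\<^bsub>Vect\<^esub> perm_mat \<tau>) \<bullet> A"
      using arr_RD(5)[OF A, of \<tau>] t by (simp add: carrier_\<Omega>)
    then have "(A \<bullet> perm_mat \<tau>) k j = ((snd X \<tau> \<star>\<^bsub>Vect\<^esub> perm_mat \<tau>) \<bullet> A) k j"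
      by simp
    then have "A k j = ((snd X \<tau> \<star>\<^bsub>Vect\<^esub> perm_mat \<tau>) \<bullet> A) k j"
      using j fx by (simp add: cmp_perm_mat[OF t])
    also have "\<dots> = (\<Sum>l\<in>prod_encode ` ({b} \<times> \<Omega>). if l = k then - A k j else 0)"
      unfolding cmp_Vect[OF AV]
    proof (intro sum.cong refl)
      fix l assume "l \<in> prod_encode ` ({b} \<times> \<Omega>)"
      then obtain m where m: "l = prod_encode (b, m)" "m \<in> \<Omega>"
        by auto
      have "i = \<tau> m \<longleftrightarrow> m = i"
        using fx(1) permutes_inj[OF t] by (metis injD)
      then show "(snd X \<tau> \<star>\<^bsub>Vect\<^esub> perm_mat \<tau>) k l * A l j = (if l = k then - A k j else 0)"
        using m i sgn by (auto simp: ten_Vect perm_mat_def)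
    qed
    also have "\<dots> = - A k j"
      using True by simp
    finally have "2 * A k j = 0"
      by (simp add: algebra_simps)
    then show ?thesis
      by simp
  qed
  then have A0: "A = 0"
    by (simp add: fun_eq_iff)
  have "f = ((idm R X \<star>\<^bsub>R\<^esub> \<pi>) \<bullet> (idm R X \<star>\<^bsub>R\<^esub> \<iota>)) \<bullet> f \<bullet> (\<pi> \<bullet> \<iota>)"
    using R.ten_cmp[OF iX iX \<iota> \<pi>] R.idl[OF iX] \<pi>\<iota> R.ten_idm[OF X(1) V_Ob] R.idl[OF f] R.idr[OF f] by simp
  also have "\<dots> = (idm R X \<star>\<^bsub>R\<^esub> \<pi>) \<bullet> A \<bullet> \<iota>"
    using arr_RD(4)[OF \<iota>] arr_RD(4)[OF \<pi>] arr_RD(4)[OF f] arr_RD(4)[OF X\<iota>] arr_RD(4)[OF X\<pi>]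
    by (simp add: A_def assoc_Vect finite_columns_cmp)
  also have "\<dots> = 0"
    using A0 R.cmp_zero_l[OF \<iota>] R.cmp_zero_r[OF X\<pi>] by simp
  finally show ?thesis .
qed

text \<open>The complement of \<open>e\<close> is \<open>\<nu> J\<close>, of rank one: it factors
  through the unit as the average of the coordinates followed by the constant vectors.\<close>

lemma M_factors: "factors_through R (\<lambda>T. T = V \<or> T = unitO R) M"
proof -
  define a where "a = (\<lambda>(i::nat) (j::nat). if i \<in> \<Omega> \<and> j = 0 then 1 else 0 :: 'k)"
  define b where "b = (\<lambda>(i::nat) (j::nat). if i = 0 \<and> j \<in> \<Omega> then \<nu> else 0)"
  have aV: "arr Vect {0} \<Omega> a" and bV: "arr Vect \<Omega> {0} b"
    by (auto simp: a_def b_def arr_Vect_iff)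
  have perm_sum: "(\<Sum>l\<in>\<Omega>. perm_mat \<sigma> i l) = (if i \<in> \<Omega> then 1 else 0)" if s: "\<sigma> permutes \<Omega>" for \<sigma> i
  proof (cases "i \<in> \<Omega>")
    case True
    then obtain i' where i': "i = \<sigma> i'" "i' \<in> \<Omega>"
      using permutes_image[OF s] by blast
    then have "(\<Sum>l\<in>\<Omega>. perm_mat \<sigma> i l) = (\<Sum>l\<in>\<Omega>. if l = i' then 1 else 0)"
      using permutes_inj[OF that] by (intro sum.cong refl) (auto simp: perm_mat_def inj_eq)
    then show ?thesis
      using i' True by simp
  next
    case False
    have "perm_mat \<sigma> i l = 0" if "l \<in> \<Omega>" for l
      using permutes_in_image[OF s, of l] that False by (auto simp: perm_mat_def)
    then show ?thesis
      using False by simp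
  qed
  have a: "arr R (unitO R) M a"
  proof (rule arr_R_I[OF R.unit_Ob M_Ob])
    fix \<sigma> assume "\<sigma> \<in> carrier (sym_group n)"
    then have s: "\<sigma> permutes \<Omega>"
      by (simp add: carrier_\<Omega>)
    have "(perm_mat \<sigma> \<bullet> a) i j = a i j" for i j
      unfolding cmp_Vect[OF aV] using perm_sum[OF s, of i] by (cases "j = 0") (auto simp: a_def)
    then have "perm_mat \<sigma> \<bullet> a = a"
      by (simp add: fun_eq_iff)
    then show "a \<bullet> snd (unitO R) \<sigma> = snd M \<sigma> \<bullet> a"
      using Vect.idr[OF aV] by simp
  qed (use aV in simp)
  have b: "arr R M (unitO R) b"
  proof (rule arr_R_I[OF M_Ob R.unit_Ob])
    fix \<sigma> assume "\<sigma> \<in> carrier (sym_group n)"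
    then have s: "\<sigma> permutes \<Omega>"
      by (simp add: carrier_\<Omega>)
    have "b \<bullet> perm_mat \<sigma> = b"
      using permutes_in_image[OF s] by (auto simp: fun_eq_iff cmp_perm_mat[OF s] b_def)
    then show "b \<bullet> snd M \<sigma> = snd (unitO R) \<sigma> \<bullet> b"
      using Vect.idl[OF bV] by simp
  qed (use bV in simp)
  have ab: "a \<bullet> b = scl R \<nu> J"
  proof (intro ext)
    show "(a \<bullet> b) i j = scl R \<nu> J i j" for i j
      unfolding cmp_Vect[OF bV] by (auto simp: a_def b_def J_def)
  qed
  show ?thesis
  proof (rule R.factors_throughI[where I="UNIV :: bool set" and T="\<lambda>x. if x then V else unitO R" and
        a="\<lambda>x. if x then \<iota> else a" and b="\<lambda>x. if x then \<pi> else b"])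
    show "(\<Sum>x\<in>UNIV. (if x then \<iota> else a) \<cdot>\<^bsub>R\<^esub> (if x then \<pi> else b)) = idm R M"
      by (simp add: UNIV_bool ab \<iota>\<pi> e_def)
  qed (use a b \<iota> \<pi> in \<open>auto simp del: R_simps\<close>)
qed

text \<open>Each factor \<open>M\<close> is replaced by \<open>V\<close> or by the unit, and unit
  factors are absorbed, so only powers of \<open>V\<close> remain.\<close>

lemma tensor_power_factors: "factors_through R (\<lambda>T. \<exists>j. T = tensor_power R V j) (tensor_power R M k)"
proof (induction k)
  case 0
  show ?case
  proof (rule R.factors_through_self)
    show "tensor_power R M 0 \<in> Ob R"
      unfolding tensor_power.simps(1) by (rule R.unit_Ob)
    show "\<exists>j. tensor_power R M 0 = tensor_power R V j"
      by (rule exI[of _ 0]) (simp only: tensor_power.simps(1))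
  qed
next
  case (Suc k)
  show ?case
    unfolding tensor_power.simps(2)
  proof (rule R.factors_through_trans[OF R.factors_through_ten[OF Suc M_factors R.tensor_power_Ob[OF M_Ob] M_Ob]])
    fix W assume "\<exists>T U. (\<exists>j. T = tensor_power R V j) \<and> (U = V \<or> U = unitO R) \<and> T \<in> Ob R \<and> U \<in> Ob R \<and> W = T \<boxtimes>\<^bsub>R\<^esub> U"
      and W: "W \<in> Ob R"
    then consider j where "W = tensor_power R V (Suc j)" | j where "W = tensor_power R V j \<boxtimes>\<^bsub>R\<^esub> unitO R"
      unfolding tensor_power.simps(2) by blast
    then show "factors_through R (\<lambda>T. \<exists>j. T = tensor_power R V j) W"
    proof cases
      case 1
      then show ?thesis
        using W by (blast intro: R.factors_through_self)
    next
      case 2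
      have "isomorphic R W (tensor_power R V j)"
        unfolding 2 by (intro R_unit_right R.tensor_power_Ob V_Ob)
      then obtain f g where "inverse_pair R W (tensor_power R V j) f g"
        unfolding isomorphic_iff by blast
      then show ?thesis
        by (rule R.factors_through_inverse_pair) (rule exI, rule refl)
    qed
  qed
qed

text \<open>A nonzero map into a power of \<open>M\<close> stays nonzero after one of the
  projections to a power of \<open>V\<close>.\<close>

lemma V_generates:
  assumes "simple_object R Z"
  shows "\<exists>k u. arr R Z (tensor_power R V k) u \<and> u \<noteq> 0"
proof -
  obtain u where u: "arr R Z (tensor_power R M n) u" "u \<noteq> 0"
    using nonzero_to_tensor_power R.simple_idm[OF assms] by blast
  obtain T b where T: "\<exists>j. T = tensor_power R V j" "arr R (tensor_power R M n) T b" "b \<cdot>\<^bsub>R\<^esub> u \<noteq> 0"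
    using R.factors_through_nonzero[OF tensor_power_factors u] by blast
  then show ?thesis
    using R.arr_cmp[OF u(1) T(2)] by blast
qed

end

lemma standard_rep:
  obtains V where "simple_object R V" "card (fst V) = n - 1" "\<exists>w. arr R V (V \<boxtimes>\<^bsub>R\<^esub> V) w \<and> w \<noteq> 0"
    "\<And>X f. X \<in> Ob R \<Longrightarrow> card (fst X) = 1 \<Longrightarrow> \<not> isomorphic R (unitO R) X \<Longrightarrow> arr R V (X \<boxtimes>\<^bsub>R\<^esub> V) f \<Longrightarrow> f = 0"
    "\<And>Z. simple_object R Z \<Longrightarrow> \<exists>k u. arr R Z (tensor_power R V k) u \<and> u \<noteq> 0"
proof -
  obtain V \<iota> \<pi> where V: "arr R V M \<iota>" "arr R M V \<pi>" "\<pi> \<bullet> \<iota> = idm R V" "\<iota> \<bullet> \<pi> = e"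
    by (rule standard_rep_split)
  show thesis
  proof (rule that)
    show "simple_object R V"
      by (rule R_scalar_simple[OF V_scalar_end[OF V]])
    show "f = 0" if "X \<in> Ob R" "card (fst X) = 1" "\<not> isomorphic R (unitO R) X" "arr R V (X \<boxtimes>\<^bsub>R\<^esub> V) f" for X f
      using V_not_in_sign_ten_V[OF V that] .
  qed (use card_V[OF V] V_in_V_ten_V[OF V] V_generates[OF V] in blast)+
qed

end

section \<open>Categories with the fusion rules of the symmetric group\<close>

definition connected :: "('k, 'o, 'm::zero) moncat \<Rightarrow> 'o \<Rightarrow> 'o \<Rightarrow> bool"
  where "connected C X Y \<longleftrightarrow> (\<exists>f. arr C X Y f \<and> f \<noteq> 0)"

context linear_category
begin

lemma connected_iso:
  assumes "connected C X Y" "isomorphic C X X'" "isomorphic C Y Y'"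
  shows "connected C X' Y'"
proof -
  obtain f where f: "arr C X Y f" "f \<noteq> 0"
    using assms by (auto simp: connected_def)
  obtain p q where p: "arr C X X' p" "arr C X' X q" "q \<cdot> p = idm C X"
    using assms(2) by (auto simp: isomorphic_iff inverse_pair_def)
  obtain r s where r: "arr C Y Y' r" "arr C Y' Y s" "s \<cdot> r = idm C Y"
    using assms(3) by (auto simp: isomorphic_iff inverse_pair_def)
  define g where "g = r \<cdot> f \<cdot> q"
  have fq: "arr C X' Y (f \<cdot> q)"
    using arr_cmp[OF p(2) f(1)] .
  have g: "arr C X' Y' g"
    unfolding g_def using arr_cmp[OF fq r(1)] .
  have "s \<cdot> g \<cdot> p = (s \<cdot> r) \<cdot> (f \<cdot> q) \<cdot> p"
    using assoc[OF p(1) fq r(1)] assoc[OF arr_cmp[OF p(1) fq] r(1,2)] by (simp add: g_def)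
  also have "\<dots> = f"
    using assoc[OF p(1,2) f(1)] p r idr[OF f(1)] idl[OF f(1)] by simp
  finally have "g \<noteq> 0"
    using f(2) cmp_zero_l[OF p(1)] cmp_zero_r[OF r(2)] by auto
  with g show ?thesis
    by (auto simp: connected_def)
qed

lemma scalar_end_iso:
  assumes "scalar_end C X" "isomorphic C X Y"
  shows "scalar_end C Y"
proof -
  obtain p q where p: "arr C X Y p" "arr C Y X q" "q \<cdot> p = idm C X" "p \<cdot> q = idm C Y"
    using assms(2) by (auto simp: isomorphic_iff inverse_pair_def)
  have "idm C Y \<noteq> 0"
  proof
    assume "idm C Y = 0"
    then have "p = 0"
      using idl[OF p(1)] cmp_zero_l[OF p(1)] by simp
    then show False
      using assms(1) p(3) cmp_zero_r[OF p(2)] by (simp add: scalar_end_def)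
  qed
  moreover have "\<exists>c. f = scl C c (idm C Y)" if f: "arr C Y Y f" for f
  proof -
    have fp: "arr C X Y (f \<cdot> p)"
      using arr_cmp[OF p(1) f] .
    obtain c where c: "q \<cdot> f \<cdot> p = scl C c (idm C X)"
      using assms(1) arr_cmp[OF fp p(2)] by (auto simp: scalar_end_def)
    have "f = (p \<cdot> q) \<cdot> f \<cdot> (p \<cdot> q)"
      using p f by (simp add: idl idr)
    also have "\<dots> = p \<cdot> (q \<cdot> f \<cdot> p) \<cdot> q"
      using assoc[OF p(2,1) f] assoc[OF arr_cmp[OF p(2) fp] p(2,1)] assoc[OF p(2) fp p(2)] by simp
    also have "\<dots> = scl C c (idm C Y)"
      unfolding c using cmp_scl_l[OF p(2) arr_idm] cmp_scl_r[OF p(2,1)] p assms(1)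
      by (simp add: scalar_end_def idl)
    finally show ?thesis
      by blast
  qed
  ultimately show ?thesis
    using p by (simp add: scalar_end_def arr_def)
qed

lemma scalar_end_connected: "scalar_end C X \<Longrightarrow> connected C X X"
  using arr_idm by (auto simp: connected_def scalar_end_def)

end

text \<open>The interface between fusion rules and the argument about solvability.
  \<open>growth\<close> bounds \<open>d X\<close> by the size of an independent set of endomorphisms
  up to the constant factor \<open>bound\<close>, which becomes irrelevant for high tensor powers.
  In \<open>V_sign\<close>, \<open>S\<close> plays the role of the sign representation. Occurrence
  and generation are expressed by nonzero morphisms and factorizations, which remain meaningful in a
  category not known to be semisimple.\<close>

locale symmetric_like =
  fixes C :: "('k::field, 'o, 'm::ab_group_add) moncat" and d :: "'o \<Rightarrow> nat" and V :: 'o and bound :: nat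
  assumes d_iso: "isomorphic C X Y \<Longrightarrow> d X = d Y"
    and d_ten: "X \<in> Ob C \<Longrightarrow> Y \<in> Ob C \<Longrightarrow> d (X \<boxtimes>\<^bsub>C\<^esub> Y) = d X * d Y"
    and d_unit: "d (unitO C) = 1"
    and growth: "X \<in> Ob C \<Longrightarrow> \<exists>B \<subseteq> Hom C X X. finite B \<and> \<not> module.dependent (scl C) B \<and>
      (d X)\<^sup>2 \<le> bound * card B"
    and one_dim: "\<lbrakk>X \<in> Ob C; Y \<in> Ob C; Z \<in> Ob C; d X = 1; d Y = 1; d Z = 1\<rbrakk>
      \<Longrightarrow> isomorphic C X Y \<or> isomorphic C X Z \<or> isomorphic C Y Z"
    and two_dim: "X \<in> Ob C \<Longrightarrow> d X \<le> 2 \<Longrightarrow> factors_through C (\<lambda>T. d T = 1) X"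
    and V_scalar_end: "scalar_end C V"
    and V_ten: "connected C V (V \<boxtimes>\<^bsub>C\<^esub> V)"
    and V_sign: "S \<in> Ob C \<Longrightarrow> d S = 1 \<Longrightarrow> \<not> connected C (unitO C) S \<Longrightarrow> \<not> connected C V (S \<boxtimes>\<^bsub>C\<^esub> V)"
    and V_dim: "d V > 1"
    and V_generates: "X \<in> Ob C \<Longrightarrow> factors_through C (\<lambda>T. \<exists>k. T = tensor_power C V k) X"

text \<open>Expresses the existence of a nonzero morphism by a multiplicity, which the fusion rules
  control.\<close>

lemma (in schur_category) connected_class_rep:
  assumes "simple_object C Z" "W \<in> Ob C"
  shows "connected C Z W \<longleftrightarrow> hom_dim C (class_rep (iso_class C Z)) W \<noteq> 0"
proof -
  let ?Z = "class_rep (iso_class C Z)"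
  have i: "isomorphic C Z ?Z"
    using class_rep_iso[OF assms(1)] by simp
  then have Z: "?Z \<in> Ob C"
    by (simp add: isomorphic_def)
  obtain B where "finite B" "Hom C ?Z W \<subseteq> V.span B"
    using finite_dim Z assms by blast
  then have "hom_dim C ?Z W \<noteq> 0 \<longleftrightarrow> connected C ?Z W"
    using hom_dim_eq_0_iff[OF Z assms(2)] by (auto simp: connected_def)
  also have "\<dots> \<longleftrightarrow> connected C Z W"
    using connected_iso[of Z W ?Z W] connected_iso[of ?Z W Z W] i isomorphic_sym[OF i] isomorphic_refl[OF assms(2)] by blast
  finally show ?thesis
    by simp
qed

text \<open>Multiplicities after tensoring with a simple object depend only on the multiplicities
  before and on fusion rules. Iterated, this determines the tensor powers.\<close>

lemma (in schur_tensor) hom_dim_ten_simple: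
  assumes "finite (Irr C)" "X \<in> Ob C" "simple_object C W" "z \<in> Irr C"
  shows "hom_dim C (class_rep z) (X \<boxtimes> W) = weight (\<lambda>x. fusion_rule C x (iso_class C W) z) X"
proof -
  obtain n S \<iota> \<pi> where S: "\<forall>i<(n::nat). simple_object C (S i)" "direct_sum C {..<n} S X \<iota> \<pi>"
    using decomposition[OF assms(2)] by blast
  have W: "W \<in> Ob C"
    using simple_idm[OF assms(3)] by simp
  have ds: "direct_sum C {()} (\<lambda>_. W) W (\<lambda>_. idm C W) (\<lambda>_. idm C W)"
    using W by (simp add: direct_sum_iff arr_idm idl[OF arr_idm])
  have "hom_dim C (class_rep z) (X \<boxtimes> W) = weight (\<lambda>x. of_bool (x = z)) (X \<boxtimes> W)"
    using weight_indicator[OF assms(1,4)] by simp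
  also have "\<dots> = (\<Sum>i<n. weight (\<lambda>x. of_bool (x = z)) (class_rep (iso_class C (S i)) \<boxtimes> class_rep (iso_class C W)))"
    using weight_ten[OF assms(1) S(2) _ ds] S(1) assms(3) by simp
  also have "\<dots> = (\<Sum>i<n. fusion_rule C (iso_class C (S i)) (iso_class C W) z)"
    by (simp add: weight_indicator[OF assms(1,4)] fusion_rule_def)
  also have "\<dots> = weight (\<lambda>x. fusion_rule C x (iso_class C W) z) X"
    using weight_decomposition[OF assms(1) S(2)] S(1) by simp
  finally show ?thesis .
qed

text \<open>The Cauchy-Schwarz inequality for natural numbers, obtained by summing 2xy <= x^2 + y^2
  over all pairs of indices.\<close>

lemma sum_square_le:
  fixes m \<delta> :: "'a \<Rightarrow> nat"
  assumes "finite I"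
  shows "(\<Sum>i\<in>I. m i * \<delta> i)\<^sup>2 \<le> (\<Sum>i\<in>I. (\<delta> i)\<^sup>2) * (\<Sum>i\<in>I. (m i)\<^sup>2)"
proof -
  have am: "2 * (x * y) \<le> x * x + y * y" for x y :: nat
  proof -
    have "0 \<le> (int x - int y) * (int x - int y)"
      by simp
    then have "2 * (int x * int y) \<le> int x * int x + int y * int y"
      by (simp add: algebra_simps)
    then have "int (2 * (x * y)) \<le> int (x * x + y * y)"
      by simp
    then show ?thesis
      by (simp only: of_nat_le_iff)
  qed
  have "2 * (\<Sum>i\<in>I. m i * \<delta> i)\<^sup>2 = (\<Sum>i\<in>I. \<Sum>j\<in>I. 2 * ((m i * \<delta> j) * (m j * \<delta> i)))"
    by (simp add: power2_eq_square sum_product sum_distrib_left mult_ac)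
  also have "\<dots> \<le> (\<Sum>i\<in>I. \<Sum>j\<in>I. (m i * \<delta> j) * (m i * \<delta> j) + (m j * \<delta> i) * (m j * \<delta> i))"
    by (intro sum_mono am)
  also have "\<dots> = (\<Sum>i\<in>I. \<Sum>j\<in>I. (m i * \<delta> j) * (m i * \<delta> j)) + (\<Sum>i\<in>I. \<Sum>j\<in>I. (m j * \<delta> i) * (m j * \<delta> i))"
    by (simp add: sum.distrib)
  also have "(\<Sum>i\<in>I. \<Sum>j\<in>I. (m j * \<delta> i) * (m j * \<delta> i)) = (\<Sum>i\<in>I. \<Sum>j\<in>I. (m i * \<delta> j) * (m i * \<delta> j))"
    by (rule sum.swap)
  also have "(\<Sum>i\<in>I. \<Sum>j\<in>I. (m i * \<delta> j) * (m i * \<delta> j)) = (\<Sum>i\<in>I. (m i)\<^sup>2) * (\<Sum>i\<in>I. (\<delta> i)\<^sup>2)"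
    unfolding sum_product by (simp add: power2_eq_square mult_ac)
  finally show ?thesis
    by (simp add: mult.commute)
qed

text \<open>The dimension \<open>d\<close> assigns to a simple object the dimension of the
  representation corresponding to it, and \<open>V\<close> corresponds to the standard
  representation. Every clause is reduced to multiplicities or fusion rules and then read in the
  representation category.\<close>

lemma Grothendieck_symmetric_like:
  fixes C :: "('k::{alg_closed_field, field_char_0}, 'o, 'm::ab_group_add) moncat"
  assumes "n \<ge> 5" and "fusion_category C"
    and "Grothendieck_equivalent C (Rep (sym_group n) ::
      ('k, nat set \<times> ((nat \<Rightarrow> nat) \<Rightarrow> nat \<Rightarrow> nat \<Rightarrow> 'k), nat \<Rightarrow> nat \<Rightarrow> 'k) moncat)"
  shows "\<exists>d V b. symmetric_like C d V b"
proof -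
  interpret C: schur_tensor C
    using assms(2) by (rule fusion_schur_tensor)
  define R where "R = (Rep (sym_group n) ::
      ('k, nat set \<times> ((nat \<Rightarrow> nat) \<Rightarrow> nat \<Rightarrow> nat \<Rightarrow> 'k), nat \<Rightarrow> nat \<Rightarrow> 'k) moncat)"
  interpret R: symmetric_group_rep n R
    by unfold_locales (auto simp: assms R_def)
  obtain f where f: "bij_betw f (Irr C) (Irr R)" "f (iso_class C (unitO C)) = iso_class R (unitO R)"
    "\<And>x y z. x \<in> Irr C \<Longrightarrow> y \<in> Irr C \<Longrightarrow> z \<in> Irr C \<Longrightarrow> fusion_rule R (f x) (f y) (f z) = fusion_rule C x y z"
    using assms(3) unfolding Grothendieck_equivalent_def R_def[symmetric] by blast
  have finC: "finite (Irr C)"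
    using assms(2) by (rule fusion_category.finite_Irr)
  have finR: "finite (Irr R)"
    using finC f(1) bij_betw_finite by blast
  have fI: "f x \<in> Irr R" if "x \<in> Irr C" for x
    using that f(1) by (auto simp: bij_betw_def)
  have finj: "x = y" if "x \<in> Irr C" "y \<in> Irr C" "f x = f y" for x y
    using that f(1) by (auto simp: bij_betw_def inj_on_def)
  define \<delta> where "\<delta> w = card (fst (class_rep w))" for w :: "(nat set \<times> ((nat \<Rightarrow> nat) \<Rightarrow> nat \<Rightarrow> nat \<Rightarrow> 'k)) set"
  have card_iso: "card (fst X) = card (fst Y)" if iso: "isomorphic R X Y" for X Y
  proof -
    obtain p q where pq: "inverse_pair R X Y p q"
      using iso by (auto simp: isomorphic_iff)
    then have "X \<in> Ob R"
      by (simp add: inverse_pair_def arr_def)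
    then have "direct_sum R {()} (\<lambda>_. X) X (\<lambda>_. idm R X) (\<lambda>_. idm R X)"
      using R.R.idl[OF R.R.arr_idm] by (simp add: R.R.direct_sum_iff R.R.arr_idm del: R.R_simps)
    from R.R.direct_sum_iso[OF this pq] show ?thesis
      using R.direct_sum_R_card by fastforce
  qed
  have \<delta>: "\<delta> (iso_class R S) = card (fst S)" if "simple_object R S" for S
    using card_iso[OF R.R.class_rep_iso(1)[OF that]] by (simp add: \<delta>_def)
  have weight_R: "R.R.weight \<delta> X = card (fst X)" if X: "X \<in> Ob R" for X
  proof -
    obtain n S \<iota> \<pi> where S: "\<forall>i<(n::nat). simple_object R (S i)" "direct_sum R {..<n} S X \<iota> \<pi>"
      using R.R_decomposition[OF X] by blast
    show ?thesis
      using R.R.weight_decomposition[OF finR S(2)] S(1) R.direct_sum_R_card[OF S(2)] \<delta> by simp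
  qed
  have \<delta>_pos: "\<delta> w \<ge> 1" if "w \<in> Irr R" for w
    using R.R.class_rep(1)[OF that] R.R.simple_idm R.idm_R_eq_0_iff unfolding \<delta>_def
    by (metis One_nat_def Suc_leI neq0_conv)
  have \<delta>_not_2: "\<delta> w \<noteq> 2" if "w \<in> Irr R" for w
    using R.no_two_dim_simple[OF R.R.class_rep(1)[OF that]] by (simp add: \<delta>_def)
  define d where "d = C.weight (\<lambda>x. \<delta> (f x))"
  have d_simple: "d S = \<delta> (f (iso_class C S))" if "simple_object C S" for S
    unfolding d_def using C.weight_simple[OF finC that] .
  have d_iso: "d X = d Y" if "isomorphic C X Y" for X Y
    unfolding d_def using C.weight_iso[OF finC that] .
  have d_dec: "d X = (\<Sum>i\<in>I. \<delta> (f (iso_class C (S i))))"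
    if "direct_sum C I S X \<iota> \<pi>" "\<And>i. i \<in> I \<Longrightarrow> simple_object C (S i)" for I :: "nat set" and S X \<iota> \<pi>
    unfolding d_def using C.weight_decomposition[OF finC that] .
  \<comment> \<open>Equal fusion rules turn the sum into the one for representations, where it is
    the dimension of a tensor product of vector spaces.\<close>
  have d_rep_ten: "d (class_rep x \<boxtimes>\<^bsub>C\<^esub> class_rep y) = \<delta> (f x) * \<delta> (f y)" if "x \<in> Irr C" "y \<in> Irr C" for x y
  proof -
    have ob: "class_rep (f x) \<in> Ob R" "class_rep (f y) \<in> Ob R"
      using R.R.simple_idm[OF R.R.class_rep(1)[OF fI]] that by blast+
    have "d (class_rep x \<boxtimes>\<^bsub>C\<^esub> class_rep y) = (\<Sum>z\<in>Irr C. fusion_rule R (f x) (f y) (f z) * \<delta> (f z))"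
      unfolding d_def C.weight_def using f(3) that by (intro sum.cong refl) (simp add: fusion_rule_def)
    also have "\<dots> = (\<Sum>w\<in>Irr R. fusion_rule R (f x) (f y) w * \<delta> w)"
      by (rule sum.reindex_bij_betw[OF f(1)])
    also have "\<dots> = R.R.weight \<delta> (class_rep (f x) \<boxtimes>\<^bsub>R\<^esub> class_rep (f y))"
      by (simp add: R.R.weight_def fusion_rule_def)
    also have "\<dots> = card (fst (class_rep (f x) \<boxtimes>\<^bsub>R\<^esub> class_rep (f y)))"
      using ob by (intro weight_R R.R.ten_Ob)
    also have "\<dots> = \<delta> (f x) * \<delta> (f y)"
      using inj_prod_encode by (simp add: \<delta>_def tenO_Vect card_image card_cartesian_product)
    finally show ?thesis .
  qed
  \<comment> \<open>Every constituent contributes at least 1, so there is exactly one.\<close>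
  have one: "\<exists>S. simple_object C S \<and> isomorphic C X S \<and> \<delta> (f (iso_class C S)) = 1"
    if X: "X \<in> Ob C" "d X = 1" for X
  proof -
    obtain m S \<iota> \<pi> where S: "\<forall>i<(m::nat). simple_object C (S i)" "direct_sum C {..<m} S X \<iota> \<pi>"
      using C.decomposition[OF X(1)] by blast
    have sum: "(\<Sum>i<m. \<delta> (f (iso_class C (S i)))) = 1"
      using d_dec[OF S(2)] S(1) X(2) by simp
    have "(\<Sum>i<m. 1) \<le> (\<Sum>i<m. \<delta> (f (iso_class C (S i))))"
      using S(1) \<delta>_pos fI C.class_rep_iso(2) by (intro sum_mono) auto
    then have "m \<le> 1"
      using sum by simp
    moreover have "m \<noteq> 0"
      using sum by (cases m) auto
    ultimately have m: "m = 1"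
      by simp
    have "inverse_pair C X (S 0) (\<pi> 0) (\<iota> 0)"
      using S(2)[unfolded C.direct_sum_iff] by (simp add: m inverse_pair_def)
    then show ?thesis
      using S(1) sum m by (auto simp: isomorphic_iff)
  qed
  obtain W where W: "simple_object R W" "card (fst W) = n - 1" "\<exists>w. arr R W (W \<boxtimes>\<^bsub>R\<^esub> W) w \<and> w \<noteq> 0"
    "\<And>X f. X \<in> Ob R \<Longrightarrow> card (fst X) = 1 \<Longrightarrow> \<not> isomorphic R (unitO R) X \<Longrightarrow> arr R W (X \<boxtimes>\<^bsub>R\<^esub> W) f \<Longrightarrow> f = 0"
    "\<And>Z. simple_object R Z \<Longrightarrow> \<exists>k u. arr R Z (tensor_power R W k) u \<and> u \<noteq> 0"
    using R.standard_rep by blast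
  have W_Ob: "W \<in> Ob R"
    using R.R.simple_idm[OF W(1)] by simp
  define w where "w = iso_class R W"
  have w: "w \<in> Irr R" "isomorphic R W (class_rep w)"
    unfolding w_def using R.R.class_rep_iso[OF W(1)] by auto
  have "w \<in> f ` Irr C"
    using f(1) w(1) by (simp add: bij_betw_def)
  then obtain v where v: "v \<in> Irr C" "f v = w"
    by blast
  define V where "V = class_rep v"
  have V: "simple_object C V" "iso_class C V = v"
    using C.class_rep[OF v(1)] by (auto simp: V_def)
  have V_Ob: "V \<in> Ob C"
    using C.simple_idm[OF V(1)] by simp
  \<comment> \<open>Whether \<open>V\<close> occurs in its product with a simple object is the
    nonvanishing of one fusion rule, the same on both sides.\<close>
  have fusion_v: "connected C V (class_rep x \<boxtimes>\<^bsub>C\<^esub> V) \<longleftrightarrow> connected R W (class_rep (f x) \<boxtimes>\<^bsub>R\<^esub> W)"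
    if x: "x \<in> Irr C" for x
  proof -
    have ob: "class_rep x \<in> Ob C" "class_rep (f x) \<in> Ob R"
      using C.simple_idm[OF C.class_rep(1)[OF x]] R.R.simple_idm[OF R.R.class_rep(1)[OF fI[OF x]]] by auto
    have "connected C V (class_rep x \<boxtimes>\<^bsub>C\<^esub> V) \<longleftrightarrow> fusion_rule C x v v \<noteq> 0"
      using C.connected_class_rep[OF V(1) C.ten_Ob[OF ob(1) V_Ob]] V(2) by (simp add: fusion_rule_def V_def)
    also have "\<dots> \<longleftrightarrow> fusion_rule R (f x) w w \<noteq> 0"
      using f(3)[OF x v(1) v(1)] v(2) by simp
    also have "\<dots> \<longleftrightarrow> connected R W (class_rep (f x) \<boxtimes>\<^bsub>R\<^esub> class_rep w)"
      using R.R.connected_class_rep[OF W(1) R.R.ten_Ob[OF ob(2)]] w(2)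
      by (simp add: fusion_rule_def isomorphic_def w_def del: R.R_simps)
    also have "\<dots> \<longleftrightarrow> connected R W (class_rep (f x) \<boxtimes>\<^bsub>R\<^esub> W)"
    proof -
      have i: "isomorphic R (class_rep (f x) \<boxtimes>\<^bsub>R\<^esub> W) (class_rep (f x) \<boxtimes>\<^bsub>R\<^esub> class_rep w)"
        by (rule R.R.isomorphic_ten[OF R.R.isomorphic_refl[OF ob(2)] w(2)])
      show ?thesis
        using R.R.connected_iso[OF _ R.R.isomorphic_refl[OF W_Ob] i] R.R.connected_iso[OF _ R.R.isomorphic_refl[OF W_Ob] R.R.isomorphic_sym[OF i]]
        by blast
    qed
    finally show ?thesis .
  qed
  have unit_class: "iso_class C (unitO C) \<in> Irr C"
    using C.class_rep_iso(2)[OF C.unit_simple] .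
  \<comment> \<open>Recursion through the fusion rules matches the multiplicities in the powers of
    \<open>V\<close> with those in the powers of \<open>W\<close>.\<close>
  have power: "hom_dim C (class_rep z) (tensor_power C V k) = hom_dim R (class_rep (f z)) (tensor_power R W k)"
    if "z \<in> Irr C" for z k
    using that
  proof (induction k arbitrary: z)
    case 0
    have "hom_dim C (class_rep z) (unitO C) = of_bool (iso_class C (unitO C) = z)"
      unfolding C.weight_indicator[OF finC 0, symmetric] using C.weight_simple[OF finC C.unit_simple] by simp
    also have "\<dots> = of_bool (iso_class R (unitO R) = f z)"
      using f(2) finj[OF unit_class 0] by auto
    also have "\<dots> = hom_dim R (class_rep (f z)) (unitO R)"
      unfolding R.R.weight_indicator[OF finR fI[OF 0], symmetric] using R.R.weight_simple[OF finR R.R.unit_simple] by simp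
    finally show ?case
      by (simp del: R.R_simps)
  next
    case (Suc k)
    have "hom_dim C (class_rep z) (tensor_power C V k \<boxtimes>\<^bsub>C\<^esub> V) =
        (\<Sum>x\<in>Irr C. hom_dim C (class_rep x) (tensor_power C V k) * fusion_rule C x v z)"
      using C.hom_dim_ten_simple[OF finC C.tensor_power_Ob[OF V_Ob] V(1) Suc.prems] V(2) by (simp add: C.weight_def)
    also have "\<dots> = (\<Sum>x\<in>Irr C. hom_dim R (class_rep (f x)) (tensor_power R W k) * fusion_rule R (f x) w (f z))"
      using Suc f(3)[OF _ v(1) Suc.prems] v(2) by (intro sum.cong refl) simp
    also have "\<dots> = (\<Sum>x\<in>Irr R. hom_dim R (class_rep x) (tensor_power R W k) * fusion_rule R x w (f z))"
      by (rule sum.reindex_bij_betw[OF f(1)])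
    also have "\<dots> = hom_dim R (class_rep (f z)) (tensor_power R W k \<boxtimes>\<^bsub>R\<^esub> W)"
      using R.R.hom_dim_ten_simple[OF finR R.R.tensor_power_Ob[OF W_Ob] W(1) fI[OF Suc.prems]]
      by (simp add: R.R.weight_def w_def del: R.R_simps)
    finally show ?case
      by (simp del: R.R_simps)
  qed
  \<comment> \<open>The constant is the sum of the squares of the dimensions, as it comes out of the
    Cauchy-Schwarz inequality.\<close>
  have "symmetric_like C d V (\<Sum>z\<in>Irr C. (\<delta> (f z))\<^sup>2)"
  proof
    show "d X = d Y" if "isomorphic C X Y" for X Y
      using d_iso[OF that] .
    show "d (X \<boxtimes>\<^bsub>C\<^esub> Y) = d X * d Y" if XY: "X \<in> Ob C" "Y \<in> Ob C" for X Y
    proof -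
      obtain a S \<iota> \<pi> where S: "\<forall>i<(a::nat). simple_object C (S i)" "direct_sum C {..<a} S X \<iota> \<pi>"
        using C.decomposition[OF XY(1)] by blast
      obtain b T \<kappa> \<rho> where T: "\<forall>i<(b::nat). simple_object C (T i)" "direct_sum C {..<b} T Y \<kappa> \<rho>"
        using C.decomposition[OF XY(2)] by blast
      have "d (X \<boxtimes>\<^bsub>C\<^esub> Y) = (\<Sum>i<a. \<Sum>j<b. d (class_rep (iso_class C (S i)) \<boxtimes>\<^bsub>C\<^esub> class_rep (iso_class C (T j))))"
        unfolding d_def using S(1) T(1) by (intro C.weight_ten[OF finC S(2) _ T(2)]) auto
      also have "\<dots> = (\<Sum>i<a. \<Sum>j<b. \<delta> (f (iso_class C (S i))) * \<delta> (f (iso_class C (T j))))"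
        using S(1) T(1) by (intro sum.cong refl d_rep_ten C.class_rep_iso(2)) auto
      also have "\<dots> = d X * d Y"
        using d_dec[OF S(2)] d_dec[OF T(2)] S(1) T(1) by (simp add: sum_product)
      finally show ?thesis .
    qed
    show "d (unitO C) = 1"
      using d_simple[OF C.unit_simple] f(2) \<delta>[OF R.R.unit_simple] by simp
    show "\<exists>B\<subseteq>Hom C X X. finite B \<and> C.V.independent B \<and> (d X)\<^sup>2 \<le> (\<Sum>z\<in>Irr C. (\<delta> (f z))\<^sup>2) * card B"
      if X: "X \<in> Ob C" for X
    proof -
      obtain B where B: "B \<subseteq> Hom C X X" "finite B" "C.V.independent B"
        "card B = (\<Sum>z\<in>Irr C. (hom_dim C (class_rep z) X)\<^sup>2)"
        by (rule C.endomorphisms_independent[OF finC X])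
      have "(d X)\<^sup>2 \<le> (\<Sum>z\<in>Irr C. (\<delta> (f z))\<^sup>2) * card B"
        unfolding d_def C.weight_def B(4) by (rule sum_square_le[OF finC])
      with B show ?thesis
        by blast
    qed
    show "isomorphic C X Y \<or> isomorphic C X Z \<or> isomorphic C Y Z"
      if "X \<in> Ob C" "Y \<in> Ob C" "Z \<in> Ob C" "d X = 1" "d Y = 1" "d Z = 1" for X Y Z
    proof -
      have *: "isomorphic C X Y"
        if S: "simple_object C S" "isomorphic C X S" and T: "simple_object C T" "isomorphic C Y T"
          and i: "isomorphic R (class_rep (f (iso_class C S))) (class_rep (f (iso_class C T)))" for X Y S T
      proof -
        have I: "iso_class C S \<in> Irr C" "iso_class C T \<in> Irr C"
          using S T C.class_rep_iso(2) by auto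
        have "class_rep (f (iso_class C S)) \<in> Ob R"
          using i by (simp add: isomorphic_def)
        then have "iso_class R (class_rep (f (iso_class C S))) = iso_class R (class_rep (f (iso_class C T)))"
          using R.R.iso_class_eq_iff i by blast
        then have "f (iso_class C S) = f (iso_class C T)"
          using R.R.class_rep(2)[OF fI] I by simp
        then have "iso_class C S = iso_class C T"
          using finj I by blast
        then have "isomorphic C S T"
          using C.iso_class_eq_iff S by (simp add: isomorphic_def)
        then show ?thesis
          using S(2) T(2) C.isomorphic_trans C.isomorphic_sym by blast
      qed
      obtain S where S: "simple_object C S" "isomorphic C X S" "\<delta> (f (iso_class C S)) = 1"
        using one[OF \<open>X \<in> Ob C\<close> \<open>d X = 1\<close>] by blast
      obtain T where T: "simple_object C T" "isomorphic C Y T" "\<delta> (f (iso_class C T)) = 1"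
        using one[OF \<open>Y \<in> Ob C\<close> \<open>d Y = 1\<close>] by blast
      obtain U where U: "simple_object C U" "isomorphic C Z U" "\<delta> (f (iso_class C U)) = 1"
        using one[OF \<open>Z \<in> Ob C\<close> \<open>d Z = 1\<close>] by blast
      have ob: "class_rep (f (iso_class C P)) \<in> Ob R" if "simple_object C P" for P
        using R.R.simple_idm[OF R.R.class_rep(1)[OF fI[OF C.class_rep_iso(2)[OF that]]]] by simp
      show ?thesis
        using R.one_dim_three[OF ob[OF S(1)] ob[OF T(1)] ob[OF U(1)]] S(3) T(3) U(3)
          *[OF S(1,2) T(1,2)] *[OF S(1,2) U(1,2)] *[OF T(1,2) U(1,2)] unfolding \<delta>_def by blast
    qed
    show "factors_through C (\<lambda>T. d T = 1) X" if X: "X \<in> Ob C" "d X \<le> 2" for X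
    proof -
      obtain m S \<iota> \<pi> where S: "\<forall>i<(m::nat). simple_object C (S i)" "direct_sum C {..<m} S X \<iota> \<pi>"
        using C.decomposition[OF X(1)] by blast
      have sum: "(\<Sum>i<m. \<delta> (f (iso_class C (S i)))) \<le> 2"
        using d_dec[OF S(2)] S(1) X(2) by simp
      \<comment> \<open>Constituents have dimension at least 1 and never exactly 2; a total of at
        most 2 leaves only 1.\<close>
      have "d (S i) = 1" if i: "i < m" for i
      proof -
        have Si: "iso_class C (S i) \<in> Irr C"
          using S(1) i C.class_rep_iso(2) by blast
        have "\<delta> (f (iso_class C (S i))) \<le> (\<Sum>i<m. \<delta> (f (iso_class C (S i))))"
          using i by (intro member_le_sum) auto
        then show ?thesis
          using sum \<delta>_pos[OF fI[OF Si]] \<delta>_not_2[OF fI[OF Si]] d_simple[of "S i"] S(1) i by simp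
      qed
      then show ?thesis
        using S(2)[unfolded C.direct_sum_iff] by (intro C.factors_throughI[where I="{..<m}" and T=S and a=\<iota> and b=\<pi>]) auto
    qed
    show "scalar_end C V"
      using C.simple_scalar_end[OF V(1)] .
    show "connected C V (V \<boxtimes>\<^bsub>C\<^esub> V)"
    proof -
      have "connected R W (W \<boxtimes>\<^bsub>R\<^esub> W)"
        using W(3) unfolding connected_def .
      then have "connected R W (class_rep w \<boxtimes>\<^bsub>R\<^esub> W)"
        using R.R.connected_iso[OF _ R.R.isomorphic_refl[OF W_Ob] R.R.isomorphic_ten[OF w(2) R.R.isomorphic_refl[OF W_Ob]]] by blast
      then show ?thesis
        using fusion_v[OF v(1)] v(2) by (simp add: V_def)
    qed
    show "\<not> connected C V (S \<boxtimes>\<^bsub>C\<^esub> V)" if S: "S \<in> Ob C" "d S = 1" "\<not> connected C (unitO C) S" for S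
    proof
      assume "connected C V (S \<boxtimes>\<^bsub>C\<^esub> V)"
      obtain T where T: "simple_object C T" "isomorphic C S T" "\<delta> (f (iso_class C T)) = 1"
        using one[OF S(1,2)] by blast
      define x where "x = iso_class C T"
      have x: "x \<in> Irr C" "isomorphic C T (class_rep x)"
        unfolding x_def using C.class_rep_iso[OF T(1)] by auto
      have Sx: "isomorphic C S (class_rep x)"
        using C.isomorphic_trans T(2) x(2) by blast
      have "connected C V (class_rep x \<boxtimes>\<^bsub>C\<^esub> V)"
        by (rule C.connected_iso[OF \<open>connected C V (S \<boxtimes>\<^bsub>C\<^esub> V)\<close> C.isomorphic_refl[OF V_Ob]
            C.isomorphic_ten[OF Sx C.isomorphic_refl[OF V_Ob]]])
      then have "connected R W (class_rep (f x) \<boxtimes>\<^bsub>R\<^esub> W)"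
        using fusion_v[OF x(1)] by simp
      moreover have ob: "class_rep (f x) \<in> Ob R"
        using R.R.simple_idm[OF R.R.class_rep(1)[OF fI[OF x(1)]]] by simp
      ultimately have "isomorphic R (unitO R) (class_rep (f x))"
        using W(4)[OF ob] T(3) unfolding connected_def \<delta>_def x_def[symmetric] by blast
      then have "iso_class R (unitO R) = f x"
        using R.R.iso_class_eq_iff[OF R.R.unit_Ob] R.R.class_rep(2)[OF fI[OF x(1)]] by metis
      then have "iso_class C (unitO C) = x"
        using f(2) finj[OF unit_class x(1)] by simp
      then have "isomorphic C (unitO C) (class_rep x)"
        using C.class_rep_iso(1)[OF C.unit_simple] by simp
      then have "isomorphic C (unitO C) S"
        using Sx C.isomorphic_sym C.isomorphic_trans by blast
      then have "connected C (unitO C) S"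
        using C.connected_iso[OF C.scalar_end_connected[OF C.simple_scalar_end[OF C.unit_simple]] C.isomorphic_refl[OF C.unit_Ob]] by blast
      then show False
        using S(3) by simp
    qed
    show "1 < d V"
      using d_simple[OF V(1)] V(2) v(2) \<delta>[OF W(1)] W(2) assms(1) by (simp add: w_def)
    show "factors_through C (\<lambda>T. \<exists>k. T = tensor_power C V k) X" if X: "X \<in> Ob C" for X
    proof -
      obtain m S \<iota> \<pi> where S: "\<forall>i<(m::nat). simple_object C (S i)" "direct_sum C {..<m} S X \<iota> \<pi>"
        using C.decomposition[OF X] by blast
      have "factors_through C (\<lambda>T. simple_object C T) X"
        using S(1) S(2)[unfolded C.direct_sum_iff] by (intro C.factors_throughI[where I="{..<m}" and T=S and a=\<iota> and b=\<pi>]) auto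
      then show ?thesis
      proof (rule C.factors_through_trans)
        fix T assume T: "simple_object C T" "T \<in> Ob C"
        have I: "iso_class C T \<in> Irr C"
          using C.class_rep_iso(2)[OF T(1)] .
        obtain k u where u: "arr R (class_rep (f (iso_class C T))) (tensor_power R W k) u" "u \<noteq> 0"
          using W(5)[OF R.R.class_rep(1)[OF fI[OF I]]] by blast
        then have "hom_dim R (class_rep (f (iso_class C T))) (tensor_power R W k) \<noteq> 0"
          using R.R.connected_class_rep[OF R.R.class_rep(1)[OF fI[OF I]] R.R.tensor_power_Ob[OF W_Ob]] R.R.class_rep(2)[OF fI[OF I]]
          by (auto simp: connected_def)
        then have "connected C T (tensor_power C V k)"
          using C.connected_class_rep[OF T(1) C.tensor_power_Ob[OF V_Ob]] power[OF I] by simp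
        then obtain a where a: "arr C T (tensor_power C V k) a" "a \<noteq> 0"
          by (auto simp: connected_def)
        \<comment> \<open>A simple object with a nonzero map to the power is a retract of it, which
          is a factorization with one term.\<close>
        obtain b where "arr C (tensor_power C V k) T b" "b \<cdot>\<^bsub>C\<^esub> a = idm C T"
          by (rule C.simple_retract[OF T(1) a])
        then show "factors_through C (\<lambda>T. \<exists>k. T = tensor_power C V k) T"
          using a by (intro C.factors_throughI[where I="{()}" and T="\<lambda>_. tensor_power C V k" and a="\<lambda>_. b" and b="\<lambda>_. a"]) auto
      qed
    qed
  qed
  then show ?thesis
    by blast
qed

section \<open>Transport along tensor equivalences\<close>

context linear_category
begin

lemma direct_sum_joint_epi:
  assumes "direct_sum C I S X \<iota> \<pi>" "arr C X Y f" "arr C X Y g" "\<And>i. i \<in> I \<Longrightarrow> f \<cdot> \<iota> i = g \<cdot> \<iota> i"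
  shows "f = g"
proof -
  note s = assms(1)[unfolded direct_sum_iff]
  have exp: "h = (\<Sum>i\<in>I. (h \<cdot> \<iota> i) \<cdot> \<pi> i)" if h: "arr C X Y h" for h
  proof -
    have "h = h \<cdot> (\<Sum>i\<in>I. \<iota> i \<cdot> \<pi> i)"
      using s idr[OF h] by simp
    also have "\<dots> = (\<Sum>i\<in>I. h \<cdot> \<iota> i \<cdot> \<pi> i)"
      using s by (intro cmp_sum_r[OF h]) (blast intro: arr_cmp)
    also have "\<dots> = (\<Sum>i\<in>I. (h \<cdot> \<iota> i) \<cdot> \<pi> i)"
      using s h by (intro sum.cong refl assoc[symmetric]) auto
    finally show ?thesis .
  qed
  have "(\<Sum>i\<in>I. (f \<cdot> \<iota> i) \<cdot> \<pi> i) = (\<Sum>i\<in>I. (g \<cdot> \<iota> i) \<cdot> \<pi> i)"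
    using assms(4) by (intro sum.cong refl) simp
  then show ?thesis
    using exp[OF assms(2)] exp[OF assms(3)] by simp
qed

text \<open>The universal property of the direct sum, by which equivariant structures on induced
  objects are defined summand by summand.\<close>

lemma direct_sum_copair:
  assumes "direct_sum C I S X \<iota> \<pi>" "Y \<in> Ob C" "\<And>i. i \<in> I \<Longrightarrow> arr C (S i) Y (a i)"
  shows "\<exists>f. arr C X Y f \<and> (\<forall>i\<in>I. f \<cdot> \<iota> i = a i)"
proof -
  note s = assms(1)[unfolded direct_sum_iff]
  define f where "f = (\<Sum>i\<in>I. a i \<cdot> \<pi> i)"
  have t: "arr C X Y (a i \<cdot> \<pi> i)" if "i \<in> I" for i
    using s assms(3) that by (blast intro: arr_cmp)
  have "arr C X Y f"
    unfolding f_def using s assms(2) t by (intro arr_sum) auto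
  moreover have "f \<cdot> \<iota> j = a j" if j: "j \<in> I" for j
  proof -
    have ij: "arr C (S j) X (\<iota> j)"
      using s j by blast
    have "f \<cdot> \<iota> j = (\<Sum>i\<in>I. (a i \<cdot> \<pi> i) \<cdot> \<iota> j)"
      unfolding f_def using t by (rule cmp_sum_l[OF ij])
    also have "\<dots> = (\<Sum>i\<in>I. if i = j then a j else 0)"
    proof (intro sum.cong refl)
      fix i assume i: "i \<in> I"
      have "(a i \<cdot> \<pi> i) \<cdot> \<iota> j = a i \<cdot> \<pi> i \<cdot> \<iota> j"
        using s i assms(3) by (intro assoc[OF ij]) auto
      then show "(a i \<cdot> \<pi> i) \<cdot> \<iota> j = (if i = j then a j else 0)"
        using s i j idr[OF assms(3)[OF j]] cmp_zero_r[OF assms(3)[OF i]] by auto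
    qed
    also have "\<dots> = a j"
      using s j by simp
    finally show ?thesis .
  qed
  ultimately show ?thesis
    by blast
qed

end

locale linear_equivalence = C: linear_category C + D: linear_category D + tensor_equivalence C D F
  for C :: "('k::field, 'o, 'm::ab_group_add) moncat" and D :: "('k, 'p, 'w::ab_group_add) moncat" and F
begin

lemma F_arr: "arr C X Y f \<Longrightarrow> arr D (obF F X) (obF F Y) (morF F X Y f)"
  by (auto simp: arr_def obF_Ob morF_Hom)

lemma F_cmp: "arr C X Y f \<Longrightarrow> arr C Y Z g \<Longrightarrow> morF F X Z (g \<cdot>\<^bsub>C\<^esub> f) = morF F Y Z g \<cdot>\<^bsub>D\<^esub> morF F X Y f"
  by (auto simp: arr_def morF_cmp)

lemma F_zero: "X \<in> Ob C \<Longrightarrow> Y \<in> Ob C \<Longrightarrow> morF F X Y 0 = 0"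
  using morF_scl[of X Y 0 0] C.arr_zero[of X Y] by (simp add: arr_def)

lemma F_sum:
  assumes "X \<in> Ob C" "Y \<in> Ob C" "\<And>i. i \<in> I \<Longrightarrow> arr C X Y (f i)"
  shows "morF F X Y (\<Sum>i\<in>I. f i) = (\<Sum>i\<in>I. morF F X Y (f i))"
  using assms(3)
proof (induction I rule: infinite_finite_induct)
  case (insert i I)
  then have "arr C X Y (\<Sum>i\<in>I. f i)"
    using assms by (intro C.arr_sum) auto
  then show ?case
    using insert assms(1,2) morF_add[of X Y "f i" "\<Sum>i\<in>I. f i"] by (simp add: arr_def)
qed (simp_all add: F_zero assms)

lemma F_inj: "arr C X Y f \<Longrightarrow> arr C X Y g \<Longrightarrow> morF F X Y f = morF F X Y g \<Longrightarrow> f = g"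
  using fully_faithful[of X Y] by (auto simp: arr_def bij_betw_def inj_on_def)

lemma F_lift:
  assumes "X \<in> Ob C" "Y \<in> Ob C" "arr D (obF F X) (obF F Y) g"
  obtains f where "arr C X Y f" "morF F X Y f = g"
proof -
  have "g \<in> morF F X Y ` Hom C X Y"
    using fully_faithful[OF assms(1,2)] assms(3) by (simp add: arr_def bij_betw_def)
  then show thesis
    using that assms(1,2) by (auto simp: arr_def)
qed

lemma F_inverse_pair:
  assumes "inverse_pair C X Y f g"
  shows "inverse_pair D (obF F X) (obF F Y) (morF F X Y f) (morF F Y X g)"
proof -
  have fg: "arr C X Y f" "arr C Y X g" "g \<cdot>\<^bsub>C\<^esub> f = idm C X" "f \<cdot>\<^bsub>C\<^esub> g = idm C Y"
    using assms by (auto simp: inverse_pair_def)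
  then have "X \<in> Ob C" "Y \<in> Ob C"
    by (auto simp: arr_def)
  then show ?thesis
    unfolding inverse_pair_def
    using fg F_arr F_cmp[OF fg(1,2), symmetric] F_cmp[OF fg(2,1), symmetric] by (simp add: morF_idm)
qed

lemma F_isomorphic: "isomorphic C X Y \<Longrightarrow> isomorphic D (obF F X) (obF F Y)"
  unfolding isomorphic_iff using F_inverse_pair by blast

lemma isomorphic_reflect:
  assumes XY: "X \<in> Ob C" "Y \<in> Ob C" and "isomorphic D (obF F X) (obF F Y)"
  shows "isomorphic C X Y"
proof -
  obtain p q where pq: "arr D (obF F X) (obF F Y) p" "arr D (obF F Y) (obF F X) q"
    "q \<cdot>\<^bsub>D\<^esub> p = idm D (obF F X)" "p \<cdot>\<^bsub>D\<^esub> q = idm D (obF F Y)"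
    using assms(3) by (auto simp: isomorphic_iff inverse_pair_def)
  obtain f where f: "arr C X Y f" "morF F X Y f = p"
    using F_lift[OF XY pq(1)] .
  obtain g where g: "arr C Y X g" "morF F Y X g = q"
    using F_lift[OF XY(2,1) pq(2)] .
  have "g \<cdot>\<^bsub>C\<^esub> f = idm C X"
    using F_cmp[OF f(1) g(1)] f(2) g(2) pq(3) XY
    by (intro F_inj[OF C.arr_cmp[OF f(1) g(1)] C.arr_idm]) (simp_all add: morF_idm)
  moreover have "f \<cdot>\<^bsub>C\<^esub> g = idm C Y"
    using F_cmp[OF g(1) f(1)] f(2) g(2) pq(4) XY
    by (intro F_inj[OF C.arr_cmp[OF g(1) f(1)] C.arr_idm]) (simp_all add: morF_idm)
  ultimately show ?thesis
    using f g by (auto simp: isomorphic_iff inverse_pair_def)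
qed

lemma F_connected: "X \<in> Ob C \<Longrightarrow> Y \<in> Ob C \<Longrightarrow> connected D (obF F X) (obF F Y) \<longleftrightarrow> connected C X Y"
proof
  assume XY: "X \<in> Ob C" "Y \<in> Ob C" and "connected D (obF F X) (obF F Y)"
  then obtain g where g: "arr D (obF F X) (obF F Y) g" "g \<noteq> 0"
    by (auto simp: connected_def)
  obtain f where "arr C X Y f" "morF F X Y f = g"
    using F_lift[OF XY g(1)] .
  then show "connected C X Y"
    using g F_zero[OF XY] by (auto simp: connected_def)
next
  assume XY: "X \<in> Ob C" "Y \<in> Ob C" and "connected C X Y"
  then obtain f where f: "arr C X Y f" "f \<noteq> 0"
    by (auto simp: connected_def)
  have "morF F X Y f \<noteq> 0"
    using F_inj[OF f(1) C.arr_zero[OF XY]] F_zero[OF XY] f(2) by auto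
  then show "connected D (obF F X) (obF F Y)"
    using F_arr[OF f(1)] by (auto simp: connected_def)
qed

lemma F_scalar_end:
  assumes X: "X \<in> Ob C" and "scalar_end D (obF F X)"
  shows "scalar_end C X"
proof -
  have id: "morF F X X (idm C X) = idm D (obF F X)"
    using X by (rule morF_idm)
  have "idm C X \<noteq> 0"
    using assms(2) id F_zero[OF X X] by (auto simp: scalar_end_def)
  moreover have "\<exists>c. f = scl C c (idm C X)" if f: "arr C X X f" for f
  proof -
    obtain c where c: "morF F X X f = scl D c (idm D (obF F X))"
      using assms(2) F_arr[OF f] by (auto simp: scalar_end_def)
    have "morF F X X f = morF F X X (scl C c (idm C X))"
      using X C.arr_idm[OF X] by (simp add: c morF_scl id arr_def)
    then show ?thesis
      using F_inj[OF f C.arr_scl[OF C.arr_idm[OF X]]] by blast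
  qed
  ultimately show ?thesis
    using X by (simp add: scalar_end_def)
qed

text \<open>The intermediate objects are first replaced by isomorphic ones in the image of the
  functor; fullness then lifts the morphisms and faithfulness the equation.\<close>

lemma F_factors_through:
  assumes X: "X \<in> Ob C" and "factors_through D P (obF F X)"
    and "\<And>T. P T \<Longrightarrow> T \<in> Ob D \<Longrightarrow> \<exists>T'\<in>Ob C. Q T' \<and> isomorphic D T (obF F T')"
  shows "factors_through C Q X"
proof -
  have "factors_through D (\<lambda>U. \<exists>T'\<in>Ob C. Q T' \<and> U = obF F T') (obF F X)"
    using assms(2)
  proof (rule D.factors_through_trans)
    fix T assume T: "P T" "T \<in> Ob D"
    obtain T' where T': "T' \<in> Ob C" "Q T'" "isomorphic D T (obF F T')"
      using assms(3)[OF T] by blast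
    then obtain p q where "inverse_pair D T (obF F T') p q"
      by (auto simp: isomorphic_iff)
    then show "factors_through D (\<lambda>U. \<exists>T'\<in>Ob C. Q T' \<and> U = obF F T') T"
      by (rule D.factors_through_inverse_pair) (use T' in blast)
  qed
  then obtain N U a b where U: "\<And>i. i < (N::nat) \<Longrightarrow> \<exists>T'\<in>Ob C. Q T' \<and> U i = obF F T'"
    "\<And>i. i < N \<Longrightarrow> arr D (U i) (obF F X) (a i)"
    "\<And>i. i < N \<Longrightarrow> arr D (obF F X) (U i) (b i)" "(\<Sum>i<N. a i \<cdot>\<^bsub>D\<^esub> b i) = idm D (obF F X)"
    unfolding factors_through_def by blast
  have "\<forall>i. \<exists>T a' b'. i < N \<longrightarrow> T \<in> Ob C \<and> Q T \<and> U i = obF F T \<and> arr C T X a' \<and> arr C X T b' \<and>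
      morF F T X a' = a i \<and> morF F X T b' = b i"
  proof
    fix i
    show "\<exists>T a' b'. i < N \<longrightarrow> T \<in> Ob C \<and> Q T \<and> U i = obF F T \<and> arr C T X a' \<and> arr C X T b' \<and>
      morF F T X a' = a i \<and> morF F X T b' = b i"
    proof (cases "i < N")
      case True
      obtain T where T: "T \<in> Ob C" "Q T" "U i = obF F T"
        using U(1)[OF True] by blast
      obtain a' where "arr C T X a'" "morF F T X a' = a i"
        using F_lift[OF T(1) X] U(2)[OF True] T(3) by metis
      moreover obtain b' where "arr C X T b'" "morF F X T b' = b i"
        using F_lift[OF X T(1)] U(3)[OF True] T(3) by metis
      ultimately show ?thesis
        using T by blast
    qed simp
  qed
  then obtain T a' b' where T: "\<forall>i. i < N \<longrightarrow> T i \<in> Ob C \<and> Q (T i) \<and> U i = obF F (T i) \<and> arr C (T i) X (a' i) \<and>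
      arr C X (T i) (b' i) \<and> morF F (T i) X (a' i) = a i \<and> morF F X (T i) (b' i) = b i"
    unfolding choice_iff by blast
  have ab: "arr C X X (a' i \<cdot>\<^bsub>C\<^esub> b' i)" if "i < N" for i
    using T that by (blast intro: C.arr_cmp)
  show ?thesis
  proof (rule C.factors_throughI[where I="{..<N}" and T=T and a=a' and b=b'])
    show "(\<Sum>i<N. a' i \<cdot>\<^bsub>C\<^esub> b' i) = idm C X"
    proof (rule F_inj)
      show "arr C X X (\<Sum>i<N. a' i \<cdot>\<^bsub>C\<^esub> b' i)"
        using ab X by (intro C.arr_sum) auto
      show "arr C X X (idm C X)"
        using X by (rule C.arr_idm)
      have "morF F X X (\<Sum>i<N. a' i \<cdot>\<^bsub>C\<^esub> b' i) = (\<Sum>i<N. morF F X X (a' i \<cdot>\<^bsub>C\<^esub> b' i))"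
        using ab X by (intro F_sum) auto
      also have "\<dots> = (\<Sum>i<N. a i \<cdot>\<^bsub>D\<^esub> b i)"
      proof (intro sum.cong refl)
        fix i assume "i \<in> {..<N}"
        then have i: "i < N"
          by simp
        have a: "arr C (T i) X (a' i)" and b: "arr C X (T i) (b' i)" and e: "morF F (T i) X (a' i) = a i" "morF F X (T i) (b' i) = b i"
          using T i by blast+
        show "morF F X X (a' i \<cdot>\<^bsub>C\<^esub> b' i) = a i \<cdot>\<^bsub>D\<^esub> b i"
          using F_cmp[OF b a] e by simp
      qed
      finally show "morF F X X (\<Sum>i<N. a' i \<cdot>\<^bsub>C\<^esub> b' i) = morF F X X (idm C X)"
        using U(4) morF_idm[OF X] by simp
    qed
  qed (use T in auto)
qed

end

text \<open>The source is asked only for closure of its objects under the tensor product, as an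
  equivariantization satisfies it; the bifunctor properties are taken from the target.\<close>

locale linear_tensor_equivalence = linear_equivalence C D F + D: linear_tensor D
  for C :: "('k::field, 'o, 'm::ab_group_add) moncat" and D :: "('k, 'p, 'w::ab_group_add) moncat" and F +
  assumes C_unit_Ob: "unitO C \<in> Ob C"
    and C_ten_Ob: "X \<in> Ob C \<Longrightarrow> Y \<in> Ob C \<Longrightarrow> X \<boxtimes>\<^bsub>C\<^esub> Y \<in> Ob C"
begin

lemma F_ten: "X \<in> Ob C \<Longrightarrow> Y \<in> Ob C \<Longrightarrow> isomorphic D (obF F X \<boxtimes>\<^bsub>D\<^esub> obF F Y) (obF F (X \<boxtimes>\<^bsub>C\<^esub> Y))"
  using mulF_iso by (auto simp: isomorphic_def obF_Ob D.ten_Ob C_ten_Ob)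

lemma F_unit: "isomorphic D (unitO D) (obF F (unitO C))"
  using unF_iso by (auto simp: isomorphic_def obF_Ob D.unit_Ob C_unit_Ob)

lemma C_tensor_power_Ob: "X \<in> Ob C \<Longrightarrow> tensor_power C X k \<in> Ob C"
  by (induction k) (auto simp: C_unit_Ob C_ten_Ob)

lemma F_tensor_power:
  assumes "X \<in> Ob C" "isomorphic D V (obF F X)"
  shows "isomorphic D (tensor_power D V k) (obF F (tensor_power C X k))"
proof (induction k)
  case (Suc k)
  then have "isomorphic D (tensor_power D V k \<boxtimes>\<^bsub>D\<^esub> V) (obF F (tensor_power C X k) \<boxtimes>\<^bsub>D\<^esub> obF F X)"
    using assms(2) by (rule D.isomorphic_ten)
  also have "isomorphic D \<dots> (obF F (tensor_power C X k \<boxtimes>\<^bsub>C\<^esub> X))"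
    using assms(1) C_tensor_power_Ob by (intro F_ten)
  finally (D.isomorphic_trans) show ?case
    by simp
qed (simp add: F_unit)

lemma F_invertible:
  assumes X: "X \<in> Ob C" "Y \<in> Ob C" "isomorphic C (X \<boxtimes>\<^bsub>C\<^esub> Y) (unitO C)" "isomorphic C (Y \<boxtimes>\<^bsub>C\<^esub> X) (unitO C)"
  shows "invertible_object D (obF F X)"
proof -
  have *: "isomorphic D (obF F X \<boxtimes>\<^bsub>D\<^esub> obF F Y) (unitO D)"
    if "X \<in> Ob C" "Y \<in> Ob C" "isomorphic C (X \<boxtimes>\<^bsub>C\<^esub> Y) (unitO C)" for X Y
    using D.isomorphic_trans[OF F_ten[OF that(1,2)] D.isomorphic_trans[OF F_isomorphic[OF that(3)] D.isomorphic_sym[OF F_unit]]] .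
  show ?thesis
    unfolding invertible_object_def using *[OF X(1,2,3)] *[OF X(2,1,4)] X obF_Ob by blast
qed

text \<open>The structure moves from the target of an equivalence to its source, the direction in
  which an equivariantization receives it from the member of the chain it is equivalent to.\<close>

lemma symmetric_like_transport:
  assumes "symmetric_like D d V b"
  shows "\<exists>W. symmetric_like C (\<lambda>X. d (obF F X)) W b"
proof -
  interpret S: symmetric_like D d V b
    by fact
  have V_Ob: "V \<in> Ob D"
    using S.V_scalar_end by (simp add: scalar_end_def)
  have ess: "\<exists>X\<in>Ob C. isomorphic D Z (obF F X)" if "Z \<in> Ob D" for Z
    using essentially_surjective[OF that] D.isomorphic_sym by blast
  obtain W where W: "W \<in> Ob C" "isomorphic D V (obF F W)"
    using ess[OF V_Ob] by blast
  have "symmetric_like C (\<lambda>X. d (obF F X)) W b"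
  proof
    show "d (obF F X) = d (obF F Y)" if "isomorphic C X Y" for X Y
      using S.d_iso F_isomorphic[OF that] by blast
    show "d (obF F (X \<boxtimes>\<^bsub>C\<^esub> Y)) = d (obF F X) * d (obF F Y)" if "X \<in> Ob C" "Y \<in> Ob C" for X Y
      using S.d_iso[OF F_ten[OF that]] S.d_ten[OF obF_Ob[OF that(1)] obF_Ob[OF that(2)]] by simp
    show "d (obF F (unitO C)) = 1"
      using S.d_iso[OF F_unit] S.d_unit by simp
    show "\<exists>B\<subseteq>Hom C X X. finite B \<and> C.V.independent B \<and> (d (obF F X))\<^sup>2 \<le> b * card B" if X: "X \<in> Ob C" for X
    proof -
      obtain B where B: "B \<subseteq> Hom D (obF F X) (obF F X)" "finite B" "D.V.independent B" "(d (obF F X))\<^sup>2 \<le> b * card B"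
        using S.growth[OF obF_Ob[OF X]] by blast
      let ?m = "morF F X X"
      have bij: "bij_betw ?m (Hom C X X) (Hom D (obF F X) (obF F X))"
        using fully_faithful X by blast
      \<comment> \<open>The preimage of an independent set stays independent, since the functor is
        linear and bijective on this Hom space.\<close>
      define A where "A = {f \<in> Hom C X X. ?m f \<in> B}"
      have AB: "bij_betw ?m A B"
        using bij B(1) unfolding A_def bij_betw_def by (auto simp: inj_on_def)
      then have fin: "finite A" "card A = card B"
        using B(2) bij_betw_finite bij_betw_same_card by blast+
      have "C.V.independent (id ` A)"
      proof (rule C.V.independent_family[OF fin(1)])
        fix c f assume c: "(\<Sum>f\<in>A. scl C (c f) (id f)) = 0" "f \<in> A"
        have arrA: "arr C X X f" if "f \<in> A" for f
          using that X by (simp add: A_def arr_def)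
        obtain g where g: "\<And>f. f \<in> A \<Longrightarrow> g (?m f) = f"
          using AB bij_betw_inv_into_left by metis
        have "0 = ?m (\<Sum>f\<in>A. scl C (c f) f)"
          using c F_zero[OF X X] by simp
        also have "\<dots> = (\<Sum>f\<in>A. ?m (scl C (c f) f))"
          using arrA X by (intro F_sum C.arr_scl) auto
        also have "\<dots> = (\<Sum>f\<in>A. scl D (c (g (?m f))) (?m f))"
          using arrA g X by (intro sum.cong refl) (simp add: morF_scl arr_def)
        also have "\<dots> = (\<Sum>h\<in>B. scl D (c (g h)) h)"
          by (rule sum.reindex_bij_betw[OF AB])
        finally have "(\<Sum>h\<in>B. scl D (c (g h)) h) = 0"
          by simp
        moreover have "?m f \<in> B"
          using c(2) by (simp add: A_def)
        ultimately have "c (g (?m f)) = 0"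
          by (rule D.V.independentD[OF B(3,2) order_refl, where u="\<lambda>h. c (g h)"])
        then show "c f = 0"
          using g c(2) by simp
      qed simp
      then show ?thesis
        using fin B(4) by (intro exI[of _ A]) (auto simp: A_def)
    qed
    show "isomorphic C X Y \<or> isomorphic C X Z \<or> isomorphic C Y Z"
      if "X \<in> Ob C" "Y \<in> Ob C" "Z \<in> Ob C" "d (obF F X) = 1" "d (obF F Y) = 1" "d (obF F Z) = 1" for X Y Z
      using S.one_dim[OF that(1-3)[THEN obF_Ob] that(4-6)] isomorphic_reflect that(1-3) by blast
    show "factors_through C (\<lambda>T. d (obF F T) = 1) X" if X: "X \<in> Ob C" "d (obF F X) \<le> 2" for X
    proof (rule F_factors_through[OF X(1) S.two_dim[OF obF_Ob[OF X(1)] X(2)]])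
      fix T assume T: "d T = 1" "T \<in> Ob D"
      obtain T' where "T' \<in> Ob C" "isomorphic D T (obF F T')"
        using ess[OF T(2)] by blast
      then show "\<exists>T'\<in>Ob C. d (obF F T') = 1 \<and> isomorphic D T (obF F T')"
        using S.d_iso T(1) by auto
    qed
    show "scalar_end C W"
      using F_scalar_end[OF W(1) D.scalar_end_iso[OF S.V_scalar_end W(2)]] .
    have sW: "isomorphic D (obF F W) V"
      using W(2) by (rule D.isomorphic_sym)
    have VW: "isomorphic D (V \<boxtimes>\<^bsub>D\<^esub> V) (obF F (W \<boxtimes>\<^bsub>C\<^esub> W))"
      using D.isomorphic_trans[OF D.isomorphic_ten[OF W(2) W(2)] F_ten[OF W(1) W(1)]] .
    show "connected C W (W \<boxtimes>\<^bsub>C\<^esub> W)"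
      using D.connected_iso[OF S.V_ten W(2) VW] F_connected[OF W(1) C_ten_Ob[OF W(1) W(1)]] by simp
    show "\<not> connected C W (S \<boxtimes>\<^bsub>C\<^esub> W)"
      if T: "S \<in> Ob C" "d (obF F S) = 1" "\<not> connected C (unitO C) S" for S
    proof
      assume "connected C W (S \<boxtimes>\<^bsub>C\<^esub> W)"
      then have "connected D (obF F W) (obF F (S \<boxtimes>\<^bsub>C\<^esub> W))"
        using F_connected[OF W(1) C_ten_Ob[OF T(1) W(1)]] by simp
      moreover have "isomorphic D (obF F (S \<boxtimes>\<^bsub>C\<^esub> W)) (obF F S \<boxtimes>\<^bsub>D\<^esub> V)"
        using D.isomorphic_sym[OF D.isomorphic_trans[OF D.isomorphic_ten[OF D.isomorphic_refl[OF obF_Ob[OF T(1)]] W(2)] F_ten[OF T(1) W(1)]]] .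
      ultimately have "connected D V (obF F S \<boxtimes>\<^bsub>D\<^esub> V)"
        using D.connected_iso sW by blast
      then have "connected D (unitO D) (obF F S)"
        using S.V_sign[OF obF_Ob[OF T(1)] T(2)] by blast
      then have "connected D (obF F (unitO C)) (obF F S)"
        using D.connected_iso[OF _ F_unit D.isomorphic_refl[OF obF_Ob[OF T(1)]]] by blast
      then show False
        using T F_connected[OF C_unit_Ob T(1)] by simp
    qed
    show "1 < d (obF F W)"
      using S.d_iso[OF W(2)] S.V_dim by simp
    show "factors_through C (\<lambda>T. \<exists>k. T = tensor_power C W k) X" if X: "X \<in> Ob C" for X
    proof (rule F_factors_through[OF X S.V_generates[OF obF_Ob[OF X]]])
      fix T assume "\<exists>k. T = tensor_power D V k"
      then show "\<exists>T'\<in>Ob C. (\<exists>k. T' = tensor_power C W k) \<and> isomorphic D T (obF F T')"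
        using F_tensor_power[OF W] C_tensor_power_Ob[OF W(1)] by blast
    qed
  qed
  then show ?thesis
    by blast
qed

end

section \<open>Equivariantizations\<close>

text \<open>A morphism together with its source and target. On such triples the categorical identities become
  conditional rewrite rules whose conditions the simplifier can decide.\<close>

type_synonym ('o, 'm) tarr = "'o \<times> 'm \<times> 'o"

abbreviation dm :: "('o, 'm) tarr \<Rightarrow> 'o" where "dm t \<equiv> fst t"
abbreviation mr :: "('o, 'm) tarr \<Rightarrow> 'm" where "mr t \<equiv> fst (snd t)"
abbreviation cd :: "('o, 'm) tarr \<Rightarrow> 'o" where "cd t \<equiv> snd (snd t)"

definition ok :: "('k, 'o, 'm) moncat \<Rightarrow> ('o, 'm) tarr \<Rightarrow> bool"
  where "ok C t \<longleftrightarrow> arr C (dm t) (cd t) (mr t)"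

definition tcmp :: "('k, 'o, 'm) moncat \<Rightarrow> ('o, 'm) tarr \<Rightarrow> ('o, 'm) tarr \<Rightarrow> ('o, 'm) tarr"
  where "tcmp C s t = (dm t, mr s \<cdot>\<^bsub>C\<^esub> mr t, cd s)"

definition tid :: "('k, 'o, 'm) moncat \<Rightarrow> 'o \<Rightarrow> ('o, 'm) tarr"
  where "tid C X = (X, idm C X, X)"

definition tten :: "('k, 'o, 'm) moncat \<Rightarrow> ('o, 'm) tarr \<Rightarrow> ('o, 'm) tarr \<Rightarrow> ('o, 'm) tarr"
  where "tten C s t = (dm s \<boxtimes>\<^bsub>C\<^esub> dm t, mr s \<star>\<^bsub>C\<^esub> mr t, cd s \<boxtimes>\<^bsub>C\<^esub> cd t)"

definition tfun :: "('o, 'm, 'p, 'w) monfun \<Rightarrow> ('o, 'm) tarr \<Rightarrow> ('p, 'w) tarr"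
  where "tfun F t = (obF F (dm t), morF F (dm t) (cd t) (mr t), obF F (cd t))"

definition tinv :: "('k, 'o, 'm) moncat \<Rightarrow> ('o, 'm) tarr \<Rightarrow> ('o, 'm) tarr \<Rightarrow> bool"
  where "tinv C s t \<longleftrightarrow> ok C s \<and> ok C t \<and> dm t = cd s \<and> cd t = dm s \<and>
    tcmp C t s = tid C (dm s) \<and> tcmp C s t = tid C (cd s)"

lemma tarr_simps [simp]:
  "dm (tcmp C s t) = dm t" "cd (tcmp C s t) = cd s" "dm (tid C X) = X" "cd (tid C X) = X"
  "dm (tten C s t) = dm s \<boxtimes>\<^bsub>C\<^esub> dm t" "cd (tten C s t) = cd s \<boxtimes>\<^bsub>C\<^esub> cd t"
  "dm (tfun F t) = obF F (dm t)" "cd (tfun F t) = obF F (cd t)"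
  by (simp_all add: tcmp_def tid_def tten_def tfun_def)

lemma mr_simps: "mr (tcmp C s t) = mr s \<cdot>\<^bsub>C\<^esub> mr t" "mr (tid C X) = idm C X" "mr (tten C s t) = mr s \<star>\<^bsub>C\<^esub> mr t"
    "mr (tfun F t) = morF F (dm t) (cd t) (mr t)"
  by (simp_all add: tcmp_def tid_def tten_def tfun_def)

lemma tarr_eqI: "dm s = dm t \<Longrightarrow> cd s = cd t \<Longrightarrow> mr s = mr t \<Longrightarrow> s = t"
  by (simp add: prod_eq_iff)

lemma tinv_iff: "tinv C s t \<longleftrightarrow> dm t = cd s \<and> cd t = dm s \<and> inverse_pair C (dm s) (cd s) (mr s) (mr t)"
  by (auto simp: tinv_def inverse_pair_def ok_def tcmp_def tid_def prod_eq_iff)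

lemma tinv_tarr: "inverse_pair C X Y f g \<Longrightarrow> tinv C (X, f, Y) (Y, g, X)"
  by (simp add: tinv_iff)

lemma tinv_sym: "tinv C s t \<Longrightarrow> tinv C t s"
  by (auto simp: tinv_def)

section \<open>Calculus of morphisms with source and target\<close>

context linear_category
begin

lemma ok_cmp [simp]: "ok C s \<Longrightarrow> ok C t \<Longrightarrow> cd t = dm s \<Longrightarrow> ok C (tcmp C s t)"
  by (auto simp: ok_def tcmp_def intro: arr_cmp)

lemma ok_id [simp]: "X \<in> Ob C \<Longrightarrow> ok C (tid C X)"
  by (simp add: ok_def tid_def arr_idm)

lemma ok_Ob: "ok C t \<Longrightarrow> dm t \<in> Ob C \<and> cd t \<in> Ob C"
  by (simp add: ok_def arr_def)

lemma t_assoc: "ok C r \<Longrightarrow> ok C s \<Longrightarrow> ok C t \<Longrightarrow> cd t = dm s \<Longrightarrow> cd s = dm r \<Longrightarrow>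
    tcmp C (tcmp C r s) t = tcmp C r (tcmp C s t)"
  by (auto simp: ok_def tcmp_def intro: assoc)

lemma t_idl: "ok C t \<Longrightarrow> X = cd t \<Longrightarrow> tcmp C (tid C X) t = t"
  by (auto simp: ok_def tcmp_def tid_def prod_eq_iff intro: idl)

lemma t_idr: "ok C t \<Longrightarrow> X = dm t \<Longrightarrow> tcmp C t (tid C X) = t"
  by (auto simp: ok_def tcmp_def tid_def prod_eq_iff intro: idr)

lemma tinv_cancel:
  assumes "tinv C s s'" "ok C r"
  shows "cd r = dm s \<Longrightarrow> tcmp C s' (tcmp C s r) = r" "cd r = cd s \<Longrightarrow> tcmp C s (tcmp C s' r) = r"
proof -
  note s = assms(1)[unfolded tinv_def]
  show "tcmp C s' (tcmp C s r) = r" if "cd r = dm s"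
    using s assms(2) that by (simp add: t_assoc[symmetric] t_idl)
  show "tcmp C s (tcmp C s' r) = r" if "cd r = cd s"
    using s assms(2) that by (simp add: t_assoc[symmetric] t_idl)
qed

lemma tinv_cmp:
  assumes "tinv C s s'" "tinv C t t'" "cd t = dm s"
  shows "tinv C (tcmp C s t) (tcmp C t' s')"
  using assms tinv_cancel[OF assms(1)] tinv_cancel[OF assms(2)] tinv_cancel[OF tinv_sym[OF assms(1)]] tinv_cancel[OF tinv_sym[OF assms(2)]]
  unfolding tinv_def by (simp add: t_assoc)

text \<open>Inverting two opposite sides of a commuting square. It transfers naturality and
  coherence of the structure isomorphisms of an action to their inverses, of which the equivariant
  structures are built.\<close>

lemma tinv_square:
  assumes "tcmp C p q = tcmp C r s" "tinv C p p'" "tinv C s s'" "ok C q" "ok C r"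
    "cd q = dm p" "cd s = dm r"
  shows "tcmp C q s' = tcmp C p' r"
proof -
  have o: "ok C p" "ok C p'" "dm p' = cd p" "cd p' = dm p" "ok C s" "ok C s'" "dm s' = cd s" "cd s' = dm s"
    using assms(2,3) by (auto simp: tinv_def)
  have dq: "dm q = dm s" "cd p = cd r"
    using arg_cong[OF assms(1), of dm] arg_cong[OF assms(1), of cd] by simp_all
  have "tcmp C p' r = tcmp C p' (tcmp C r (tcmp C s s'))"
    using assms(2-) o by (simp add: tinv_def t_idr)
  also have "tcmp C r (tcmp C s s') = tcmp C (tcmp C p q) s'"
    unfolding assms(1) using assms(2-) o by (simp add: t_assoc)
  also have "\<dots> = tcmp C p (tcmp C q s')"
    using assms(2-) o dq by (simp add: t_assoc)
  also have "tcmp C p' \<dots> = tcmp C q s'"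
    using assms(2-) o dq tinv_cancel(1)[OF assms(2), of "tcmp C q s'"] by simp
  finally show ?thesis ..
qed

lemma isomorphism_tinv:
  assumes "isomorphism C X Y f" "X \<in> Ob C" "Y \<in> Ob C"
  obtains g where "tinv C (X, f, Y) (Y, g, X)"
  using assms isomorphismE tinv_tarr by metis

end

context monoidal_category
begin

lemma ok_ten [simp]: "ok C s \<Longrightarrow> ok C t \<Longrightarrow> ok C (tten C s t)"
  by (auto simp: ok_def tten_def intro: arr_ten)

lemma t_ten_cmp: "ok C s \<Longrightarrow> ok C s' \<Longrightarrow> ok C t \<Longrightarrow> ok C t' \<Longrightarrow> cd s = dm s' \<Longrightarrow> cd t = dm t' \<Longrightarrow>
    tcmp C (tten C s' t') (tten C s t) = tten C (tcmp C s' s) (tcmp C t' t)"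
  by (auto simp: ok_def tcmp_def tten_def intro: ten_cmp)

lemma t_ten_id: "X \<in> Ob C \<Longrightarrow> Y \<in> Ob C \<Longrightarrow> tten C (tid C X) (tid C Y) = tid C (X \<boxtimes> Y)"
  by (simp add: tten_def tid_def ten_idm)

lemma tinv_ten: "tinv C s s' \<Longrightarrow> tinv C t t' \<Longrightarrow> tinv C (tten C s t) (tten C s' t')"
  using ok_Ob unfolding tinv_def by (auto simp: t_ten_cmp t_ten_id)

end

locale equivariant = group_action_on_category G D A + D: monoidal_category D
  for G :: "'g monoid" (structure) and D :: "('k::field, 'o, 'm::ab_group_add) moncat" and A
begin

abbreviation tc (infixr "\<odot>" 75) where "s \<odot> t \<equiv> tcmp D s t"
abbreviation tt (infixr "\<oslash>" 80) where "s \<oslash> t \<equiv> tten D s t"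
abbreviation "\<rho> g X \<equiv> obF (rho A g) X"
abbreviation "FF g t \<equiv> tfun (rho A g) t"
abbreviation "MM g h X \<equiv> (\<rho> g (\<rho> h X), mulA A g h X, \<rho> (g \<otimes> h) X)"
abbreviation "UU X \<equiv> (X, unA A X, \<rho> \<one> X)"
abbreviation "TT g X Y \<equiv> (\<rho> g X \<boxtimes>\<^bsub>D\<^esub> \<rho> g Y, mulF (rho A g) X Y, \<rho> g (X \<boxtimes>\<^bsub>D\<^esub> Y))"
abbreviation "u g \<equiv> (unitO D, unF (rho A g), \<rho> g (unitO D))"

section \<open>The structure isomorphisms of a group action\<close>

lemma rho_linear: "g \<in> carrier G \<Longrightarrow> linear_equivalence D D (rho A g)"
  by (intro linear_equivalence.intro rho D.linear_category_axioms)

lemma \<rho>_Ob [simp]: "g \<in> carrier G \<Longrightarrow> X \<in> Ob D \<Longrightarrow> \<rho> g X \<in> Ob D"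
  using rho_linear linear_equivalence.axioms(3) tensor_equivalence.axioms(1) tensor_functor.obF_Ob by metis

lemma ten_Ob [simp]: "X \<in> Ob D \<Longrightarrow> Y \<in> Ob D \<Longrightarrow> X \<boxtimes>\<^bsub>D\<^esub> Y \<in> Ob D"
  by (rule D.ten_Ob)

lemma unit_Ob [simp]: "unitO D \<in> Ob D"
  by (rule D.unit_Ob)

lemma FF_ok [simp]: "g \<in> carrier G \<Longrightarrow> ok D t \<Longrightarrow> ok D (FF g t)"
  using linear_equivalence.F_arr[OF rho_linear] by (simp add: ok_def tfun_def)

lemma FF_cmp: "g \<in> carrier G \<Longrightarrow> ok D s \<Longrightarrow> ok D t \<Longrightarrow> cd t = dm s \<Longrightarrow> FF g (s \<odot> t) = FF g s \<odot> FF g t"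
  using linear_equivalence.F_cmp[OF rho_linear, of g "dm t" "cd t" "mr t" "cd s" "mr s"]
  by (simp add: ok_def tfun_def tcmp_def)

lemma FF_id: "g \<in> carrier G \<Longrightarrow> X \<in> Ob D \<Longrightarrow> FF g (tid D X) = tid D (\<rho> g X)"
  using tensor_functor.morF_idm[OF tensor_equivalence.axioms(1)[OF rho]] by (simp add: tfun_def tid_def)

lemma FF_tinv: "g \<in> carrier G \<Longrightarrow> tinv D s t \<Longrightarrow> tinv D (FF g s) (FF g t)"
  using D.ok_Ob unfolding tinv_def by (auto simp: FF_cmp[symmetric] FF_id)

lemma tinv_mulA: "g \<in> carrier G \<Longrightarrow> h \<in> carrier G \<Longrightarrow> X \<in> Ob D \<Longrightarrow> \<exists>t. tinv D (MM g h X) t"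
  using D.isomorphism_tinv[OF mulA_iso] by (metis \<rho>_Ob m_closed)

lemma tinv_unA: "X \<in> Ob D \<Longrightarrow> \<exists>t. tinv D (UU X) t"
  using D.isomorphism_tinv[OF unA_iso] by (metis \<rho>_Ob one_closed)

lemma tinv_mulF: "g \<in> carrier G \<Longrightarrow> X \<in> Ob D \<Longrightarrow> Y \<in> Ob D \<Longrightarrow> \<exists>t. tinv D (TT g X Y) t"
  using D.isomorphism_tinv[OF tensor_functor.mulF_iso[OF tensor_equivalence.axioms(1)[OF rho]]] by (metis \<rho>_Ob ten_Ob)

lemma tinv_unF: "g \<in> carrier G \<Longrightarrow> \<exists>t. tinv D (u g) t"
  using D.isomorphism_tinv[OF tensor_functor.unF_iso[OF tensor_equivalence.axioms(1)[OF rho]]] by (metis \<rho>_Ob unit_Ob)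

lemma MM_ok [simp]: "g \<in> carrier G \<Longrightarrow> h \<in> carrier G \<Longrightarrow> X \<in> Ob D \<Longrightarrow> ok D (MM g h X)"
  using tinv_mulA by (auto simp: tinv_def)

lemma UU_ok [simp]: "X \<in> Ob D \<Longrightarrow> ok D (UU X)"
  using tinv_unA by (auto simp: tinv_def)

lemma TT_ok [simp]: "g \<in> carrier G \<Longrightarrow> X \<in> Ob D \<Longrightarrow> Y \<in> Ob D \<Longrightarrow> ok D (TT g X Y)"
  using tinv_mulF by (auto simp: tinv_def)

lemma u_ok [simp]: "g \<in> carrier G \<Longrightarrow> ok D (u g)"
  using tinv_unF by (auto simp: tinv_def)

lemma MM_nat: "g \<in> carrier G \<Longrightarrow> h \<in> carrier G \<Longrightarrow> ok D t \<Longrightarrow> X = dm t \<Longrightarrow> Y = cd t \<Longrightarrow>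
    MM g h Y \<odot> FF g (FF h t) = FF (g \<otimes> h) t \<odot> MM g h X"
  using mulA_natural[of g h "dm t" "cd t" "mr t"] by (simp add: ok_def arr_def tcmp_def tfun_def)

lemma UU_nat: "ok D t \<Longrightarrow> X = dm t \<Longrightarrow> Y = cd t \<Longrightarrow> UU Y \<odot> t = FF \<one> t \<odot> UU X"
  using unA_natural[of "dm t" "cd t" "mr t"] by (simp add: ok_def arr_def tcmp_def tfun_def)

lemma TT_nat: "g \<in> carrier G \<Longrightarrow> ok D s \<Longrightarrow> ok D t \<Longrightarrow> X = dm s \<Longrightarrow> Y = dm t \<Longrightarrow> X' = cd s \<Longrightarrow> Y' = cd t \<Longrightarrow>
    TT g X' Y' \<odot> (FF g s \<oslash> FF g t) = FF g (s \<oslash> t) \<odot> TT g X Y"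
  using tensor_functor.mulF_natural[OF tensor_equivalence.axioms(1)[OF rho], of g "dm s" "cd s" "dm t" "cd t" "mr s" "mr t"]
  by (simp add: ok_def arr_def tcmp_def tfun_def tten_def)

lemma MM_tensor: "g \<in> carrier G \<Longrightarrow> h \<in> carrier G \<Longrightarrow> X \<in> Ob D \<Longrightarrow> Y \<in> Ob D \<Longrightarrow>
    MM g h (X \<boxtimes>\<^bsub>D\<^esub> Y) \<odot> FF g (TT h X Y) \<odot> TT g (\<rho> h X) (\<rho> h Y) = TT (g \<otimes> h) X Y \<odot> (MM g h X \<oslash> MM g h Y)"
  using mulA_tensor[of g h X Y] by (simp add: tcmp_def tfun_def tten_def)

lemma MM_unit: "g \<in> carrier G \<Longrightarrow> h \<in> carrier G \<Longrightarrow> MM g h (unitO D) \<odot> FF g (u h) \<odot> u g = u (g \<otimes> h)"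
  using mulA_unit[of g h] by (simp add: tcmp_def tfun_def)

lemma UU_tensor: "X \<in> Ob D \<Longrightarrow> Y \<in> Ob D \<Longrightarrow> UU (X \<boxtimes>\<^bsub>D\<^esub> Y) = TT \<one> X Y \<odot> (UU X \<oslash> UU Y)"
  using unA_tensor[of X Y] by (simp add: tcmp_def tten_def)

lemma MM_assoc: "g \<in> carrier G \<Longrightarrow> h \<in> carrier G \<Longrightarrow> l \<in> carrier G \<Longrightarrow> X \<in> Ob D \<Longrightarrow>
    MM (g \<otimes> h) l X \<odot> MM g h (\<rho> l X) = MM g (h \<otimes> l) X \<odot> FF g (MM h l X)"
  using mulA_assoc[of g h l X] by (simp add: tcmp_def tfun_def m_assoc)

lemma MM_UU: "g \<in> carrier G \<Longrightarrow> X \<in> Ob D \<Longrightarrow> MM \<one> g X \<odot> UU (\<rho> g X) = tid D (\<rho> g X)"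
  using mulA_unA_left[of g X] by (simp add: tcmp_def tid_def)

section \<open>Objects, morphisms and tensor products of the equivariantization\<close>

abbreviation E where "E \<equiv> equivariantization G D A"

text \<open>Membership in \<open>Ob E\<close> in the language of morphisms with source and target,
  with an explicit inverse in place of \<open>isomorphism\<close>.\<close>

definition equi :: "'o \<Rightarrow> ('g \<Rightarrow> 'm) \<Rightarrow> bool"
  where "equi X \<mu> \<longleftrightarrow> X \<in> Ob D \<and> (\<forall>g\<in>carrier G. \<exists>t. tinv D (\<rho> g X, \<mu> g, X) t) \<and>
    (\<forall>g\<in>carrier G. \<forall>h\<in>carrier G. (\<rho> g X, \<mu> g, X) \<odot> FF g (\<rho> h X, \<mu> h, X) = (\<rho> (g \<otimes> h) X, \<mu> (g \<otimes> h), X) \<odot> MM g h X) \<and>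
    (\<rho> \<one> X, \<mu> \<one>, X) \<odot> UU X = tid D X"

lemma equiD:
  assumes "equi X \<mu>"
  shows "X \<in> Ob D" "g \<in> carrier G \<Longrightarrow> ok D (\<rho> g X, \<mu> g, X)" "g \<in> carrier G \<Longrightarrow> \<exists>t. tinv D (\<rho> g X, \<mu> g, X) t"
    "g \<in> carrier G \<Longrightarrow> h \<in> carrier G \<Longrightarrow> (\<rho> g X, \<mu> g, X) \<odot> FF g (\<rho> h X, \<mu> h, X) = (\<rho> (g \<otimes> h) X, \<mu> (g \<otimes> h), X) \<odot> MM g h X"
    "(\<rho> \<one> X, \<mu> \<one>, X) \<odot> UU X = tid D X"
  using assms unfolding equi_def by (auto simp: tinv_def)

lemma E_simps [simp]: "cmp E = cmp D" "scl E = scl D" "tenM E = tenM D" "idm E P = idm D (fst P)"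
  "fst (P \<boxtimes>\<^bsub>E\<^esub> Q) = fst P \<boxtimes>\<^bsub>D\<^esub> fst Q" "fst (unitO E) = unitO D"
  by (simp_all add: equivariantization_def case_prod_unfold)

lemma isomorphism_iff_tinv: "X \<in> Ob D \<Longrightarrow> Y \<in> Ob D \<Longrightarrow> isomorphism D X Y f \<longleftrightarrow> (\<exists>t. tinv D (X, f, Y) t)"
proof
  assume "X \<in> Ob D" "Y \<in> Ob D" "isomorphism D X Y f"
  then show "\<exists>t. tinv D (X, f, Y) t"
    using D.isomorphism_tinv by blast
next
  assume "X \<in> Ob D" "Y \<in> Ob D" "\<exists>t. tinv D (X, f, Y) t"
  then show "isomorphism D X Y f"
    unfolding tinv_iff using D.isomorphism_iff by fastforce
qed

lemma Ob_E: "P \<in> Ob E \<longleftrightarrow> equi (fst P) (snd P)"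
  by (cases P) (auto simp: equivariantization_def equi_def isomorphism_iff_tinv tcmp_def tfun_def tid_def)

lemma arr_E: "arr E P Q f \<longleftrightarrow> P \<in> Ob E \<and> Q \<in> Ob E \<and> arr D (fst P) (fst Q) f \<and>
    (\<forall>g\<in>carrier G. (fst P, f, fst Q) \<odot> (\<rho> g (fst P), snd P g, fst P) = (\<rho> g (fst Q), snd Q g, fst Q) \<odot> FF g (fst P, f, fst Q))"
proof -
  have "f \<in> Hom E P Q \<longleftrightarrow> f \<in> Hom D (fst P) (fst Q) \<and>
      (\<forall>g\<in>carrier G. (fst P, f, fst Q) \<odot> (\<rho> g (fst P), snd P g, fst P) = (\<rho> g (fst Q), snd Q g, fst Q) \<odot> FF g (fst P, f, fst Q))"
    by (simp add: equivariantization_def case_prod_unfold tcmp_def tfun_def)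
  moreover have "fst P \<in> Ob D" if "P \<in> Ob E" for P
    using that equiD(1) unfolding Ob_E by blast
  ultimately show ?thesis
    unfolding arr_def by blast
qed

lemma arr_ED:
  assumes "arr E P Q f"
  shows "P \<in> Ob E" "Q \<in> Ob E" "equi (fst P) (snd P)" "equi (fst Q) (snd Q)" "arr D (fst P) (fst Q) f" "ok D (fst P, f, fst Q)"
    "g \<in> carrier G \<Longrightarrow> (fst P, f, fst Q) \<odot> (\<rho> g (fst P), snd P g, fst P) = (\<rho> g (fst Q), snd Q g, fst Q) \<odot> FF g (fst P, f, fst Q)"
  using assms Ob_E unfolding arr_E ok_def by simp_all

lemma arr_E_raw:
  "arr E P Q f \<longleftrightarrow> P \<in> Ob E \<and> Q \<in> Ob E \<and> arr D (fst P) (fst Q) f \<and>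
    (\<forall>g\<in>carrier G. f \<cdot>\<^bsub>D\<^esub> snd P g = snd Q g \<cdot>\<^bsub>D\<^esub> morF (rho A g) (fst P) (fst Q) f)"
  unfolding arr_E by (simp add: tcmp_def tfun_def)

lemma Ob_E_arr:
  assumes "P \<in> Ob E" "g \<in> carrier G"
  shows "fst P \<in> Ob D" "arr D (\<rho> g (fst P)) (fst P) (snd P g)"
  using assms equiD unfolding Ob_E ok_def by fastforce+

lemma linear_category_E: "linear_category E"
proof (rule linear_category.intro)
  show "vector_space (scl E)"
    by (simp add: D.vector_space)
  then interpret V: vector_space "scl E" .
  have H: "f \<in> Hom E X Y \<longleftrightarrow> arr E X Y f" if "X \<in> Ob E" "Y \<in> Ob E" for X Y f
    using that by (simp add: arr_def)
  have DD: "arr D (fst X) (fst Y) f" if "arr E X Y f" for X Y f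
    using arr_ED(5)[OF that] .
  show "V.subspace (Hom E X Y)" if X: "X \<in> Ob E" and Y: "Y \<in> Ob E" for X Y
    unfolding V.subspace_def H[OF that]
  proof (intro conjI ballI allI; (unfold H[OF that])?)
    have ob: "fst X \<in> Ob D" "fst Y \<in> Ob D"
      using X Y equiD(1) unfolding Ob_E by blast+
    note Fz = linear_equivalence.F_zero[OF rho_linear]
    show "arr E X Y 0"
      unfolding arr_E_raw
      using X Y ob Fz D.cmp_zero_l[OF Ob_E_arr(2)[OF X]] D.cmp_zero_r[OF Ob_E_arr(2)[OF Y]] by (simp add: D.arr_zero)
    show "arr E X Y (f + f')" if f: "arr E X Y f" and f': "arr E X Y f'" for f f'
      unfolding arr_E_raw
    proof (intro conjI ballI X Y)
      show "arr D (fst X) (fst Y) (f + f')"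
        using DD[OF f] DD[OF f'] by (rule D.arr_add)
      fix g assume g: "g \<in> carrier G"
      interpret L: linear_equivalence D D "rho A g"
        using rho_linear[OF g] .
      show "(f + f') \<cdot>\<^bsub>D\<^esub> snd X g = snd Y g \<cdot>\<^bsub>D\<^esub> morF (rho A g) (fst X) (fst Y) (f + f')"
        using D.cmp_add_l[OF Ob_E_arr(2)[OF X g] DD[OF f] DD[OF f']]
          D.cmp_add_r[OF L.F_arr[OF DD[OF f]] L.F_arr[OF DD[OF f']] Ob_E_arr(2)[OF Y g]]
          L.morF_add[of "fst X" "fst Y" f f'] f f' g DD[OF f] DD[OF f'] unfolding arr_E_raw by (simp add: arr_def)
    qed
    show "arr E X Y (scl E c f)" if f: "arr E X Y f" for c f
      unfolding arr_E_raw
    proof (intro conjI ballI X Y)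
      show "arr D (fst X) (fst Y) (scl E c f)"
        using DD[OF f] by (simp add: D.arr_scl)
      fix g assume g: "g \<in> carrier G"
      interpret L: linear_equivalence D D "rho A g"
        using rho_linear[OF g] .
      show "scl E c f \<cdot>\<^bsub>D\<^esub> snd X g = snd Y g \<cdot>\<^bsub>D\<^esub> morF (rho A g) (fst X) (fst Y) (scl E c f)"
        using D.cmp_scl_l[OF Ob_E_arr(2)[OF X g] DD[OF f]]
          D.cmp_scl_r[OF L.F_arr[OF DD[OF f]] Ob_E_arr(2)[OF Y g]]
          L.morF_scl[of "fst X" "fst Y" f c] f g DD[OF f] unfolding arr_E_raw by (simp add: arr_def)
    qed
  qed
  have id: "arr E X X (idm E X)" if X: "X \<in> Ob E" for X
  proof -
    have "equi (fst X) (snd X)"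
      using X by (simp add: Ob_E)
    note X' = equiD[OF this]
    have "tid D (fst X) \<odot> (\<rho> g (fst X), snd X g, fst X) = (\<rho> g (fst X), snd X g, fst X) \<odot> FF g (tid D (fst X))"
      if "g \<in> carrier G" for g
      using X' that by (simp add: FF_id D.t_idl D.t_idr)
    then show ?thesis
      unfolding arr_E using X X' by (simp add: D.arr_idm tid_def)
  qed
  then show "idm E X \<in> Hom E X X" if "X \<in> Ob E" for X
    using that by (simp add: arr_def)
  show "g \<cdot>\<^bsub>E\<^esub> f \<in> Hom E X Z" if ob: "X \<in> Ob E" "Y \<in> Ob E" "Z \<in> Ob E" and fg: "f \<in> Hom E X Y" "g \<in> Hom E Y Z" for X Y Z f g
  proof -
    have f: "arr E X Y f" and g: "arr E Y Z g"
      using fg ob by (simp_all add: H)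
    note f' = arr_ED[OF f] and g' = arr_ED[OF g]
    have gf: "(fst X, g \<cdot>\<^bsub>D\<^esub> f, fst Z) = (fst Y, g, fst Z) \<odot> (fst X, f, fst Y)"
      by (simp add: tcmp_def)
    have "((fst Y, g, fst Z) \<odot> (fst X, f, fst Y)) \<odot> (\<rho> x (fst X), snd X x, fst X) =
        (\<rho> x (fst Z), snd Z x, fst Z) \<odot> FF x ((fst Y, g, fst Z) \<odot> (fst X, f, fst Y))" if x: "x \<in> carrier G" for x
    proof -
      note oks = equiD(2)[OF f'(3) x] equiD(2)[OF f'(4) x] equiD(2)[OF g'(4) x] f'(6) g'(6)
      have "((fst Y, g, fst Z) \<odot> (fst X, f, fst Y)) \<odot> (\<rho> x (fst X), snd X x, fst X)
          = (fst Y, g, fst Z) \<odot> (\<rho> x (fst Y), snd Y x, fst Y) \<odot> FF x (fst X, f, fst Y)"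
        using oks x by (simp add: D.t_assoc f'(7)[OF x])
      also have "\<dots> = ((fst Y, g, fst Z) \<odot> (\<rho> x (fst Y), snd Y x, fst Y)) \<odot> FF x (fst X, f, fst Y)"
        using oks x by (simp add: D.t_assoc)
      also have "\<dots> = (\<rho> x (fst Z), snd Z x, fst Z) \<odot> FF x ((fst Y, g, fst Z) \<odot> (fst X, f, fst Y))"
        unfolding g'(7)[OF x] using oks x by (simp add: D.t_assoc FF_cmp)
      finally show ?thesis .
    qed
    then have "arr E X Z (g \<cdot>\<^bsub>D\<^esub> f)"
      unfolding arr_E gf using ob D.arr_cmp[OF f'(5) g'(5)] by simp
    then show ?thesis
      by (simp add: arr_def)
  qed
  show "f \<cdot>\<^bsub>E\<^esub> idm E X = f" if "X \<in> Ob E" "Y \<in> Ob E" "f \<in> Hom E X Y" for X Y f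
    using that by (simp add: H D.idr[OF DD])
  show "idm E Y \<cdot>\<^bsub>E\<^esub> f = f" if "X \<in> Ob E" "Y \<in> Ob E" "f \<in> Hom E X Y" for X Y f
    using that by (simp add: H D.idl[OF DD])
  show "(h \<cdot>\<^bsub>E\<^esub> g) \<cdot>\<^bsub>E\<^esub> f = h \<cdot>\<^bsub>E\<^esub> g \<cdot>\<^bsub>E\<^esub> f"
    if "W \<in> Ob E" "X \<in> Ob E" "Y \<in> Ob E" "Z \<in> Ob E" "f \<in> Hom E W X" "g \<in> Hom E X Y" "h \<in> Hom E Y Z" for W X Y Z f g h
    using that by (simp add: H D.assoc[OF DD DD DD])
  show "(g + g') \<cdot>\<^bsub>E\<^esub> f = g \<cdot>\<^bsub>E\<^esub> f + g' \<cdot>\<^bsub>E\<^esub> f"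
    if "X \<in> Ob E" "Y \<in> Ob E" "Z \<in> Ob E" "f \<in> Hom E X Y" "g \<in> Hom E Y Z" "g' \<in> Hom E Y Z" for X Y Z f g g'
    using that by (simp add: H D.cmp_add_l[OF DD DD DD])
  show "g \<cdot>\<^bsub>E\<^esub> (f + f') = g \<cdot>\<^bsub>E\<^esub> f + g \<cdot>\<^bsub>E\<^esub> f'"
    if "X \<in> Ob E" "Y \<in> Ob E" "Z \<in> Ob E" "f \<in> Hom E X Y" "f' \<in> Hom E X Y" "g \<in> Hom E Y Z" for X Y Z f f' g
    using that by (simp add: H D.cmp_add_r[OF DD DD DD])
  show "scl E a g \<cdot>\<^bsub>E\<^esub> f = scl E a (g \<cdot>\<^bsub>E\<^esub> f)"
    if "X \<in> Ob E" "Y \<in> Ob E" "Z \<in> Ob E" "f \<in> Hom E X Y" "g \<in> Hom E Y Z" for X Y Z f g a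
    using that by (simp add: H D.cmp_scl_l[OF DD DD])
  show "g \<cdot>\<^bsub>E\<^esub> scl E a f = scl E a (g \<cdot>\<^bsub>E\<^esub> f)"
    if "X \<in> Ob E" "Y \<in> Ob E" "Z \<in> Ob E" "f \<in> Hom E X Y" "g \<in> Hom E Y Z" for X Y Z f g a
    using that by (simp add: H D.cmp_scl_r[OF DD DD])
qed

abbreviation "NN P g \<equiv> (\<rho> g (fst P), snd P g, fst P)"

lemma Ob_E_equi: "P \<in> Ob E \<Longrightarrow> equi (fst P) (snd P)"
  by (simp add: Ob_E)

lemmas Ob_E_fst = equiD(1)[OF Ob_E_equi] and NN_ok = equiD(2)[OF Ob_E_equi] and NN_tinv = equiD(3)[OF Ob_E_equi]
  and NN_cmp = equiD(4)[OF Ob_E_equi] and NN_unit = equiD(5)[OF Ob_E_equi]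

text \<open>Inverting the two copies of an equivariant isomorphism in its equivariance square gives
  the square for the inverse.\<close>

lemma inverse_pair_E:
  assumes f: "arr E P Q f" and fg: "inverse_pair D (fst P) (fst Q) f g"
  shows "inverse_pair E P Q f g"
proof -
  note f' = arr_ED[OF f]
  have fi: "tinv D (fst P, f, fst Q) (fst Q, g, fst P)"
    using fg by (rule tinv_tarr)
  have "NN P x \<odot> FF x (fst Q, g, fst P) = (fst Q, g, fst P) \<odot> NN Q x" if x: "x \<in> carrier G" for x
    by (rule D.tinv_square[OF f'(7)[OF x] fi FF_tinv[OF x fi] NN_ok[OF f'(1) x] NN_ok[OF f'(2) x]]) simp_all
  then have "arr E Q P g"
    unfolding arr_E using f' fg by (simp add: inverse_pair_def)
  then show ?thesis
    using f fg by (simp add: inverse_pair_def)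
qed

text \<open>The structure of the unit is the inverse of the unit isomorphism of each tensor functor,
  so the required identities are the unit coherences of the action, inverted.\<close>

lemma unit_E_Ob: "unitO E \<in> Ob E"
  and NN_unit_tinv: "g \<in> carrier G \<Longrightarrow> tinv D (u g) (NN (unitO E) g)"
proof -
  show ti: "tinv D (u g) (NN (unitO E) g)" if g: "g \<in> carrier G" for g
  proof -
    obtain t where t: "tinv D (u g) t"
      using tinv_unF[OF g] by blast
    then have "t = NN (unitO E) g"
      using D.inverse_of_eq[of "unitO D" "\<rho> g (unitO D)" "unF (rho A g)" "mr t"]
      by (auto simp: tinv_iff equivariantization_def prod_eq_iff)
    then show ?thesis
      using t by simp
  qed
  show "unitO E \<in> Ob E"
    unfolding Ob_E equi_def
  proof (intro conjI ballI)
    show "fst (unitO E) \<in> Ob D"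
      by simp
    show "\<exists>t. tinv D (NN (unitO E) g) t" if "g \<in> carrier G" for g
      using ti[OF that] tinv_sym by blast
    show "NN (unitO E) g \<odot> FF g (NN (unitO E) h) = NN (unitO E) (g \<otimes> h) \<odot> MM g h (fst (unitO E))"
      if g: "g \<in> carrier G" and h: "h \<in> carrier G" for g h
    proof -
      have s: "tinv D (FF g (u h) \<odot> u g) (NN (unitO E) g \<odot> FF g (NN (unitO E) h))"
        by (rule D.tinv_cmp[OF FF_tinv[OF g ti[OF h]] ti[OF g]]) simp
      have "tid D (unitO D) \<odot> (NN (unitO E) g \<odot> FF g (NN (unitO E) h)) = NN (unitO E) (g \<otimes> h) \<odot> MM g h (unitO D)"
        by (rule D.tinv_square[OF _ ti s]) (use g h MM_unit[OF g h] in \<open>simp_all add: D.t_idr\<close>)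
      moreover have "ok D (NN (unitO E) g)" "ok D (NN (unitO E) h)"
        using ti[OF g] ti[OF h] by (auto simp: tinv_def)
      ultimately show ?thesis
        using g by (simp add: D.t_idl)
    qed
    show "NN (unitO E) \<one> \<odot> UU (fst (unitO E)) = tid D (fst (unitO E))"
      using ti[OF one_closed] unA_unit by (simp add: tinv_def)
  qed
qed

lemma NN_ten:
  assumes "g \<in> carrier G" "tinv D (TT g (fst P) (fst Q)) t"
  shows "NN (P \<boxtimes>\<^bsub>E\<^esub> Q) g = (NN P g \<oslash> NN Q g) \<odot> t"
  using assms D.inverse_of_eq[of "\<rho> g (fst P) \<boxtimes>\<^bsub>D\<^esub> \<rho> g (fst Q)" "\<rho> g (fst P \<boxtimes>\<^bsub>D\<^esub> fst Q)" "mulF (rho A g) (fst P) (fst Q)" "mr t"]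
  by (simp add: tinv_iff equivariantization_def case_prod_unfold tcmp_def tten_def)

text \<open>The structure on a product involves the inverse of the tensor isomorphism
  \<open>TT\<close>. It is moved past the structures of the factors by naturality and past the
  multiplication of the action by its compatibility with tensor products, after which the factors
  can be treated separately.\<close>

lemma ten_E_Ob:
  assumes P: "P \<in> Ob E" and Q: "Q \<in> Ob E"
  shows "P \<boxtimes>\<^bsub>E\<^esub> Q \<in> Ob E"
proof -
  have ob [simp]: "fst P \<in> Ob D" "fst Q \<in> Ob D"
    using P Q Ob_E_fst by blast+
  note [simp] = NN_ok[OF P] NN_ok[OF Q]
  show ?thesis
    unfolding Ob_E equi_def
  proof (intro conjI ballI)
    show "fst (P \<boxtimes>\<^bsub>E\<^esub> Q) \<in> Ob D"
      by simp
    show "\<exists>t. tinv D (NN (P \<boxtimes>\<^bsub>E\<^esub> Q) g) t" if g: "g \<in> carrier G" for g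
    proof -
      obtain t p q where t: "tinv D (TT g (fst P) (fst Q)) t" and pq: "tinv D (NN P g) p" "tinv D (NN Q g) q"
        using tinv_mulF[OF g ob] NN_tinv[OF P g] NN_tinv[OF Q g] by blast
      show ?thesis
        unfolding NN_ten[OF g t] by (rule exI, rule D.tinv_cmp[OF D.tinv_ten[OF pq] tinv_sym[OF t]])
          (use t in \<open>simp add: tinv_def\<close>)
    qed
    show "NN (P \<boxtimes>\<^bsub>E\<^esub> Q) g \<odot> FF g (NN (P \<boxtimes>\<^bsub>E\<^esub> Q) h) = NN (P \<boxtimes>\<^bsub>E\<^esub> Q) (g \<otimes> h) \<odot> MM g h (fst (P \<boxtimes>\<^bsub>E\<^esub> Q))"
      if g: "g \<in> carrier G" and h: "h \<in> carrier G" for g h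
    proof -
      have gh: "g \<otimes> h \<in> carrier G"
        using g h by simp
      obtain t where t: "tinv D (TT g (fst P) (fst Q)) t"
        using tinv_mulF[OF g ob] by blast
      obtain t' where t': "tinv D (TT h (fst P) (fst Q)) t'"
        using tinv_mulF[OF h ob] by blast
      obtain t'' where t'': "tinv D (TT (g \<otimes> h) (fst P) (fst Q)) t''"
        using tinv_mulF[OF gh ob] by blast
      obtain r where r: "tinv D (TT g (\<rho> h (fst P)) (\<rho> h (fst Q))) r"
        using tinv_mulF[OF g \<rho>_Ob[OF h ob(1)] \<rho>_Ob[OF h ob(2)]] by blast
      note oks = t[unfolded tinv_def] t'[unfolded tinv_def] t''[unfolded tinv_def] r[unfolded tinv_def]
      have [simp]: "ok D t" "ok D t'" "ok D t''" "ok D r"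
          "dm t = \<rho> g (fst P \<boxtimes>\<^bsub>D\<^esub> fst Q)" "cd t = \<rho> g (fst P) \<boxtimes>\<^bsub>D\<^esub> \<rho> g (fst Q)"
          "dm t' = \<rho> h (fst P \<boxtimes>\<^bsub>D\<^esub> fst Q)" "cd t' = \<rho> h (fst P) \<boxtimes>\<^bsub>D\<^esub> \<rho> h (fst Q)"
          "dm t'' = \<rho> (g \<otimes> h) (fst P \<boxtimes>\<^bsub>D\<^esub> fst Q)" "cd t'' = \<rho> (g \<otimes> h) (fst P) \<boxtimes>\<^bsub>D\<^esub> \<rho> (g \<otimes> h) (fst Q)"
          "dm r = \<rho> g (\<rho> h (fst P) \<boxtimes>\<^bsub>D\<^esub> \<rho> h (fst Q))" "cd r = \<rho> g (\<rho> h (fst P)) \<boxtimes>\<^bsub>D\<^esub> \<rho> g (\<rho> h (fst Q))"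
        using oks by simp_all
      note [simp] = g h gh
      \<comment> \<open>Naturality of \<open>TT\<close>, inverted.\<close>
      have 1: "t \<odot> FF g (NN P h \<oslash> NN Q h) = (FF g (NN P h) \<oslash> FF g (NN Q h)) \<odot> r"
        by (rule D.tinv_square[OF _ t r, symmetric]) (simp_all add: TT_nat)
      have "tinv D (FF g (TT h (fst P) (fst Q)) \<odot> TT g (\<rho> h (fst P)) (\<rho> h (fst Q))) (r \<odot> FF g t')"
        by (rule D.tinv_cmp[OF FF_tinv[OF g t'] r]) simp
      then have ri: "tinv D (FF g (TT h (fst P) (fst Q)) \<odot> TT g (\<rho> h (fst P)) (\<rho> h (fst Q))) (r \<odot> FF g t')" .
      \<comment> \<open>Compatibility of the multiplication of the action with \<open>TT\<close>,
        inverted.\<close>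
      have 2: "(MM g h (fst P) \<oslash> MM g h (fst Q)) \<odot> r \<odot> FF g t' = t'' \<odot> MM g h (fst P \<boxtimes>\<^bsub>D\<^esub> fst Q)"
        by (rule D.tinv_square[OF _ t'' ri]) (simp_all add: MM_tensor)
      have 3: "(NN P g \<oslash> NN Q g) \<odot> (FF g (NN P h) \<oslash> FF g (NN Q h)) =
          (NN P (g \<otimes> h) \<oslash> NN Q (g \<otimes> h)) \<odot> (MM g h (fst P) \<oslash> MM g h (fst Q))"
        by (simp add: D.t_ten_cmp NN_cmp[OF P] NN_cmp[OF Q])
      have "NN (P \<boxtimes>\<^bsub>E\<^esub> Q) g \<odot> FF g (NN (P \<boxtimes>\<^bsub>E\<^esub> Q) h) =
          (NN P g \<oslash> NN Q g) \<odot> (t \<odot> FF g (NN P h \<oslash> NN Q h)) \<odot> FF g t'"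
        unfolding NN_ten[OF g t] NN_ten[OF h t'] by (simp add: FF_cmp D.t_assoc)
      also have "\<dots> = ((NN P g \<oslash> NN Q g) \<odot> (FF g (NN P h) \<oslash> FF g (NN Q h))) \<odot> r \<odot> FF g t'"
        unfolding 1 by (simp add: D.t_assoc)
      also have "\<dots> = (NN P (g \<otimes> h) \<oslash> NN Q (g \<otimes> h)) \<odot> (MM g h (fst P) \<oslash> MM g h (fst Q)) \<odot> r \<odot> FF g t'"
        unfolding 3 by (simp add: D.t_assoc)
      also have "\<dots> = NN (P \<boxtimes>\<^bsub>E\<^esub> Q) (g \<otimes> h) \<odot> MM g h (fst P \<boxtimes>\<^bsub>D\<^esub> fst Q)"
        unfolding 2 NN_ten[OF gh t''] by (simp add: D.t_assoc)
      finally show ?thesis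
        by simp
    qed
    show "NN (P \<boxtimes>\<^bsub>E\<^esub> Q) \<one> \<odot> UU (fst (P \<boxtimes>\<^bsub>E\<^esub> Q)) = tid D (fst (P \<boxtimes>\<^bsub>E\<^esub> Q))"
    proof -
      obtain t where t: "tinv D (TT \<one> (fst P) (fst Q)) t"
        using tinv_mulF[OF one_closed ob] by blast
      then have [simp]: "ok D t" "dm t = \<rho> \<one> (fst P \<boxtimes>\<^bsub>D\<^esub> fst Q)" "cd t = \<rho> \<one> (fst P) \<boxtimes>\<^bsub>D\<^esub> \<rho> \<one> (fst Q)"
        by (simp_all add: tinv_def)
      have "NN (P \<boxtimes>\<^bsub>E\<^esub> Q) \<one> \<odot> UU (fst P \<boxtimes>\<^bsub>D\<^esub> fst Q) = (NN P \<one> \<oslash> NN Q \<one>) \<odot> (UU (fst P) \<oslash> UU (fst Q))"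
        unfolding NN_ten[OF one_closed t] UU_tensor[OF ob]
        by (simp add: D.t_assoc D.tinv_cancel(1)[OF t])
      also have "\<dots> = tid D (fst P \<boxtimes>\<^bsub>D\<^esub> fst Q)"
        by (simp add: D.t_ten_cmp NN_unit[OF P] NN_unit[OF Q] D.t_ten_id)
      finally show ?thesis
        by simp
    qed
  qed
qed

section \<open>Twisting an equivariant structure by a character\<close>

definition twist :: "('g \<Rightarrow> 'k) \<Rightarrow> 'o \<times> ('g \<Rightarrow> 'm) \<Rightarrow> 'o \<times> ('g \<Rightarrow> 'm)"
  where "twist \<chi> P = (fst P, \<lambda>g. scl D (\<chi> g) (snd P g))"

text \<open>Nonvanishing at every element of the type, not only in the carrier, makes a character
  and its pointwise inverse multiply to the constant function 1, so that twisting by both restores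
  an object literally.\<close>

definition linear_character :: "('g \<Rightarrow> 'k) \<Rightarrow> bool"
  where "linear_character \<chi> \<longleftrightarrow> (\<forall>g. \<chi> g \<noteq> 0) \<and> (\<forall>g\<in>carrier G. \<forall>h\<in>carrier G. \<chi> (g \<otimes> h) = \<chi> g * \<chi> h)"

lemma fst_twist [simp]: "fst (twist \<chi> P) = fst P" and snd_twist: "snd (twist \<chi> P) g = scl D (\<chi> g) (snd P g)"
  by (simp_all add: twist_def)

lemma character_one:
  assumes "linear_character \<chi>"
  shows "\<chi> \<one> = 1"
proof -
  have "\<chi> (\<one> \<otimes> \<one>) = \<chi> \<one> * \<chi> \<one>" "\<chi> \<one> \<noteq> 0"
    using assms unfolding linear_character_def by blast+
  then show ?thesis
    by simp
qed

definition "tscl a t = (dm t, scl D a (mr t), cd t)"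

lemma tscl_simps [simp]: "dm (tscl a t) = dm t" "cd (tscl a t) = cd t" "tscl 1 t = t"
  by (simp_all add: tscl_def)

lemma tscl_ok [simp]: "ok D t \<Longrightarrow> ok D (tscl a t)"
  by (simp add: ok_def tscl_def D.arr_scl)

lemma tscl_cmp: "ok D s \<Longrightarrow> ok D t \<Longrightarrow> cd t = dm s \<Longrightarrow> tscl a s \<odot> tscl b t = tscl (a * b) (s \<odot> t)"
  using D.cmp_scl_l[of "dm t" "cd t" "scl D b (mr t)" "cd s" "mr s"] D.cmp_scl_r[of "dm t" "cd t" "mr t" "cd s" "mr s" b]
  by (simp add: ok_def tcmp_def tscl_def D.arr_scl)

lemma tscl_cmp_l: "ok D s \<Longrightarrow> ok D t \<Longrightarrow> cd t = dm s \<Longrightarrow> tscl a s \<odot> t = tscl a (s \<odot> t)"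
  using tscl_cmp[of s t a 1] by simp

lemma tscl_cmp_r: "ok D s \<Longrightarrow> ok D t \<Longrightarrow> cd t = dm s \<Longrightarrow> s \<odot> tscl a t = tscl a (s \<odot> t)"
  using tscl_cmp[of s t 1 a] by simp

lemma FF_tscl: "g \<in> carrier G \<Longrightarrow> ok D t \<Longrightarrow> FF g (tscl a t) = tscl a (FF g t)"
  using tensor_functor.morF_scl[OF tensor_equivalence.axioms(1)[OF rho]] by (simp add: ok_def arr_def tfun_def tscl_def)

lemma tinv_tscl: "a \<noteq> 0 \<Longrightarrow> tinv D s t \<Longrightarrow> tinv D (tscl a s) (tscl (1 / a) t)"
  by (simp add: tinv_def tscl_cmp)

lemma NN_twist: "NN (twist \<chi> P) g = tscl (\<chi> g) (NN P g)"
  by (simp add: snd_twist tscl_def)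

lemma twist_Ob:
  assumes \<chi>: "linear_character \<chi>" and P: "P \<in> Ob E"
  shows "twist \<chi> P \<in> Ob E"
proof -
  note [simp] = NN_ok[OF P] Ob_E_fst[OF P]
  show ?thesis
    unfolding Ob_E equi_def
  proof (intro conjI ballI; (unfold NN_twist)?)
    show "\<exists>t. tinv D (tscl (\<chi> g) (NN P g)) t" if "g \<in> carrier G" for g
      using NN_tinv[OF P that] tinv_tscl \<chi> by (metis linear_character_def)
    show "tscl (\<chi> g) (NN P g) \<odot> FF g (tscl (\<chi> h) (NN P h)) = tscl (\<chi> (g \<otimes> h)) (NN P (g \<otimes> h)) \<odot> MM g h (fst (twist \<chi> P))"
      if "g \<in> carrier G" "h \<in> carrier G" for g h
    proof -
      have "tscl (\<chi> g) (NN P g) \<odot> FF g (tscl (\<chi> h) (NN P h)) = tscl (\<chi> g * \<chi> h) (NN P g \<odot> FF g (NN P h))"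
        using that unfolding FF_tscl[OF that(1) NN_ok[OF P that(2)]] by (intro tscl_cmp) simp_all
      also have "\<dots> = tscl (\<chi> (g \<otimes> h)) (NN P (g \<otimes> h) \<odot> MM g h (fst P))"
        using \<chi> that unfolding linear_character_def NN_cmp[OF P that] by simp
      also have "\<dots> = tscl (\<chi> (g \<otimes> h)) (NN P (g \<otimes> h)) \<odot> MM g h (fst P)"
        using that by (intro tscl_cmp_l[symmetric]) simp_all
      finally show ?thesis
        by simp
    qed
    show "tscl (\<chi> \<one>) (NN P \<one>) \<odot> UU (fst (twist \<chi> P)) = tid D (fst (twist \<chi> P))"
      using NN_unit[OF P] by (simp add: character_one[OF \<chi>])
  qed simp
qed

text \<open>The twisted units are the one-dimensional representations of \<open>G\<close> inside the
  equivariantization, and tensoring with them is twisting. The isomorphism is the left unit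
  constraint of \<open>D\<close>, equivariant because the action is by tensor functors; the scalar
  sits on the first factor and is pulled out.\<close>

lemma twist_isomorphic:
  assumes \<chi>: "linear_character \<chi>" and P: "P \<in> Ob E"
  shows "isomorphic E (twist \<chi> (unitO E) \<boxtimes>\<^bsub>E\<^esub> P) (twist \<chi> P)"
proof -
  note [simp] = NN_ok[OF P] Ob_E_fst[OF P]
  let ?T = "twist \<chi> (unitO E)" and ?X = "fst P"
  let ?l = "\<lambda>X. (unitO D \<boxtimes>\<^bsub>D\<^esub> X, lun D X, X)"
  have T: "?T \<in> Ob E"
    using twist_Ob[OF \<chi> unit_E_Ob] .
  have lok [simp]: "ok D (?l X)" if "X \<in> Ob D" for X
    using D.isomorphism_tinv[OF D.lun_iso[OF that]] that by (auto simp: tinv_def)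
  obtain l' where l': "inverse_pair D (unitO D \<boxtimes>\<^bsub>D\<^esub> ?X) ?X (lun D ?X) l'"
    using D.isomorphismE[OF D.lun_iso[of ?X]] by auto
  have "?l ?X \<odot> NN (?T \<boxtimes>\<^bsub>E\<^esub> P) g = NN (twist \<chi> P) g \<odot> FF g (?l ?X)" if g [simp]: "g \<in> carrier G" for g
  proof -
    obtain t where t: "tinv D (TT g (unitO D) ?X) t"
      using tinv_mulF[OF g unit_Ob Ob_E_fst[OF P]] by blast
    then have [simp]: "ok D t" "dm t = \<rho> g (unitO D \<boxtimes>\<^bsub>D\<^esub> ?X)" "cd t = \<rho> g (unitO D) \<boxtimes>\<^bsub>D\<^esub> \<rho> g ?X"
      by (simp_all add: tinv_def)
    let ?v = "(\<rho> g (unitO D), snd (unitO E) g, unitO D)"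
    have vi: "tinv D (u g) ?v"
      using NN_unit_tinv[OF g] by simp
    then have [simp]: "ok D ?v"
      by (simp add: tinv_def)
    have idi: "tinv D (tid D (\<rho> g ?X)) (tid D (\<rho> g ?X))"
      by (simp add: tinv_def D.t_idl)
    have si: "tinv D (TT g (unitO D) ?X \<odot> (u g \<oslash> tid D (\<rho> g ?X))) ((?v \<oslash> tid D (\<rho> g ?X)) \<odot> t)"
      by (rule D.tinv_cmp[OF t D.tinv_ten[OF vi idi]]) simp
    \<comment> \<open>The unit coherence of the tensor functor, which is then solved for the image
      of the left unit constraint.\<close>
    have L: "FF g (?l ?X) \<odot> TT g (unitO D) ?X \<odot> (u g \<oslash> tid D (\<rho> g ?X)) = ?l (\<rho> g ?X)"
      using tensor_functor.unF_left[OF tensor_equivalence.axioms(1)[OF rho[OF g]], of ?X]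
      by (simp add: tcmp_def tfun_def tten_def tid_def)
    have "FF g (?l ?X) = FF g (?l ?X) \<odot> (TT g (unitO D) ?X \<odot> (u g \<oslash> tid D (\<rho> g ?X))) \<odot> ((?v \<oslash> tid D (\<rho> g ?X)) \<odot> t)"
      using si by (simp add: tinv_def D.t_idr)
    also have "\<dots> = (FF g (?l ?X) \<odot> TT g (unitO D) ?X \<odot> (u g \<oslash> tid D (\<rho> g ?X))) \<odot> ((?v \<oslash> tid D (\<rho> g ?X)) \<odot> t)"
      by (simp add: D.t_assoc)
    finally have F: "FF g (?l ?X) = ?l (\<rho> g ?X) \<odot> (?v \<oslash> tid D (\<rho> g ?X)) \<odot> t"
      unfolding L .
    have N: "?l ?X \<odot> (tid D (unitO D) \<oslash> NN P g) = NN P g \<odot> ?l (\<rho> g ?X)"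
      using D.lun_natural[of "\<rho> g ?X" ?X "snd P g"] Ob_E_arr(2)[OF P g] by (simp add: arr_def tcmp_def tten_def tid_def)
    have "NN (twist \<chi> P) g \<odot> FF g (?l ?X) = tscl (\<chi> g) (NN P g \<odot> FF g (?l ?X))"
      unfolding NN_twist by (rule tscl_cmp_l) simp_all
    also have "NN P g \<odot> FF g (?l ?X) = (NN P g \<odot> ?l (\<rho> g ?X)) \<odot> (?v \<oslash> tid D (\<rho> g ?X)) \<odot> t"
      unfolding F by (simp add: D.t_assoc)
    also have "\<dots> = ?l ?X \<odot> ((tid D (unitO D) \<oslash> NN P g) \<odot> (?v \<oslash> tid D (\<rho> g ?X))) \<odot> t"
      unfolding N[symmetric] by (simp add: D.t_assoc)
    also have "(tid D (unitO D) \<oslash> NN P g) \<odot> (?v \<oslash> tid D (\<rho> g ?X)) = ?v \<oslash> NN P g"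
      by (simp add: D.t_ten_cmp D.t_idl D.t_idr)
    also have "tscl (\<chi> g) (?l ?X \<odot> (?v \<oslash> NN P g) \<odot> t) = ?l ?X \<odot> tscl (\<chi> g) ((?v \<oslash> NN P g) \<odot> t)"
      by (rule tscl_cmp_r[symmetric]) simp_all
    also have "tscl (\<chi> g) ((?v \<oslash> NN P g) \<odot> t) = tscl (\<chi> g) (?v \<oslash> NN P g) \<odot> t"
      by (rule tscl_cmp_l[symmetric]) simp_all
    also have "tscl (\<chi> g) (?v \<oslash> NN P g) = NN ?T g \<oslash> NN P g"
      using D.tenM_scl_left[of "\<rho> g (unitO D)" "unitO D" "\<rho> g ?X" ?X "snd (unitO E) g" "snd P g" "\<chi> g"]
        \<open>ok D ?v\<close> Ob_E_arr(2)[OF P g] by (simp add: tten_def snd_twist ok_def arr_def tscl_def)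
    also have "(NN ?T g \<oslash> NN P g) \<odot> t = NN (?T \<boxtimes>\<^bsub>E\<^esub> P) g"
      by (rule NN_ten[OF g, symmetric]) (use t in simp)
    finally show ?thesis ..
  qed
  then have "arr E (?T \<boxtimes>\<^bsub>E\<^esub> P) (twist \<chi> P) (lun D ?X)"
    unfolding arr_E using ten_E_Ob[OF T P] twist_Ob[OF \<chi> P] l' by (simp add: inverse_pair_def)
  then have "inverse_pair E (?T \<boxtimes>\<^bsub>E\<^esub> P) (twist \<chi> P) (lun D ?X) l'"
    by (rule inverse_pair_E) (use l' in simp)
  then show ?thesis
    unfolding isomorphic_iff by blast
qed

end

lemma (in linear_equivalence) F_direct_sum:
  assumes "direct_sum C I S X \<iota> \<pi>"
  shows "direct_sum D I (\<lambda>i. obF F (S i)) (obF F X) (\<lambda>i. morF F (S i) X (\<iota> i)) (\<lambda>i. morF F X (S i) (\<pi> i))"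
proof -
  have ds: "finite I" "X \<in> Ob C" "\<And>i. i \<in> I \<Longrightarrow> arr C (S i) X (\<iota> i)" "\<And>i. i \<in> I \<Longrightarrow> arr C X (S i) (\<pi> i)"
      "\<And>i j. i \<in> I \<Longrightarrow> j \<in> I \<Longrightarrow> \<pi> i \<cdot>\<^bsub>C\<^esub> \<iota> j = (if i = j then idm C (S i) else 0)"
      "(\<Sum>i\<in>I. \<iota> i \<cdot>\<^bsub>C\<^esub> \<pi> i) = idm C X"
    using assms by (auto simp: C.direct_sum_iff)
  have S: "S i \<in> Ob C" if "i \<in> I" for i
    using ds(3)[OF that] by (simp add: arr_def)
  have "morF F X (S i) (\<pi> i) \<cdot>\<^bsub>D\<^esub> morF F (S j) X (\<iota> j) = (if i = j then idm D (obF F (S i)) else 0)"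
    if "i \<in> I" "j \<in> I" for i j
    using F_cmp[OF ds(3)[OF that(2)] ds(4)[OF that(1)]] S that by (simp add: ds(5) F_zero morF_idm split: if_splits)
  moreover have "(\<Sum>i\<in>I. morF F (S i) X (\<iota> i) \<cdot>\<^bsub>D\<^esub> morF F X (S i) (\<pi> i)) = morF F X X (\<Sum>i\<in>I. \<iota> i \<cdot>\<^bsub>C\<^esub> \<pi> i)"
    using F_sum[OF ds(2,2), of I "\<lambda>i. \<iota> i \<cdot>\<^bsub>C\<^esub> \<pi> i"] C.arr_cmp[OF ds(4) ds(3)]
    by (simp add: F_cmp[OF ds(4) ds(3)])
  ultimately show ?thesis
    unfolding D.direct_sum_iff using ds F_arr[OF ds(3)] F_arr[OF ds(4)] obF_Ob morF_idm by simp
qed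

context equivariant
begin

lemma twist_twist: "twist \<chi> (twist \<psi> P) = twist (\<lambda>g. \<chi> g * \<psi> g) P"
  by (simp add: twist_def)

lemma twist_1: "twist (\<lambda>g. 1) P = P"
  by (simp add: twist_def)

text \<open>An endomorphism of the unit is a scalar \<open>c\<close>, and equivariance at
  \<open>g\<close> reads \<open>c * \<chi> g = \<psi> g * c\<close>.\<close>

lemma hom_twist_unit:
  assumes D: "scalar_end D (unitO D)" and f: "arr E (twist \<chi> (unitO E)) (twist \<psi> (unitO E)) f"
    and g: "g \<in> carrier G" "\<chi> g \<noteq> \<psi> g"
  shows "f = 0"
proof -
  let ?v = "snd (unitO E) g"
  have f': "arr D (unitO D) (unitO D) f"
    and e: "f \<cdot>\<^bsub>D\<^esub> scl D (\<chi> g) ?v = scl D (\<psi> g) ?v \<cdot>\<^bsub>D\<^esub> morF (rho A g) (unitO D) (unitO D) f"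
    using f g(1) unfolding arr_E_raw by (simp_all add: snd_twist)
  obtain c where c: "f = scl D c (idm D (unitO D))"
    using D f' unfolding scalar_end_def by blast
  have v: "arr D (\<rho> g (unitO D)) (unitO D) ?v"
    using Ob_E_arr(2)[OF unit_E_Ob g(1)] by simp
  have i: "arr D (unitO D) (unitO D) (idm D (unitO D))" "arr D (\<rho> g (unitO D)) (\<rho> g (unitO D)) (idm D (\<rho> g (unitO D)))"
    using g(1) by (simp_all add: D.arr_idm)
  have "morF (rho A g) (unitO D) (unitO D) f = scl D c (idm D (\<rho> g (unitO D)))"
    using tensor_functor.morF_scl[OF tensor_equivalence.axioms(1)[OF rho[OF g(1)]], of "unitO D" "unitO D" "idm D (unitO D)" c]
      tensor_functor.morF_idm[OF tensor_equivalence.axioms(1)[OF rho[OF g(1)]], of "unitO D"] i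
    by (simp add: c arr_def)
  then have "scl D (c * \<chi> g) ?v = scl D (\<psi> g * c) ?v"
    using e D.cmp_scl_l[OF D.arr_scl[OF v] i(1)] D.cmp_scl_r[OF i(2) D.arr_scl[OF v]] D.idl[OF D.arr_scl[OF v]]
      D.idr[OF D.arr_scl[OF v]] by (simp add: c)
  moreover have "?v \<noteq> 0"
  proof
    assume "?v = 0"
    then have "idm D (unitO D) = 0 \<cdot>\<^bsub>D\<^esub> unF (rho A g)"
      using NN_unit_tinv[OF g(1)] by (simp add: tinv_def tcmp_def tid_def)
    then show False
      using D D.cmp_zero_l[of "unitO D" "\<rho> g (unitO D)" "unF (rho A g)"] u_ok[OF g(1)]
      by (simp add: ok_def scalar_end_def)
  qed
  ultimately have "c = 0"
    using g(2) by (simp add: mult.commute)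
  then show ?thesis
    by (simp add: c)
qed

lemma not_connected_twist_unit:
  assumes "scalar_end D (unitO D)" "g \<in> carrier G" "\<chi> g \<noteq> \<psi> g"
  shows "\<not> connected E (twist \<chi> (unitO E)) (twist \<psi> (unitO E))"
  using hom_twist_unit[where \<chi> = \<chi> and \<psi> = \<psi> and g = g] assms unfolding connected_def by blast

text \<open>The structure at the neutral element is the inverse of the unit isomorphism of the
  action, and the latter is natural. Thus equivariance at the neutral element holds for all
  morphisms.\<close>

lemma NN_one_natural:
  assumes P: "P \<in> Ob E" and Q: "Q \<in> Ob E" and f: "arr D (fst P) (fst Q) f"
  shows "(fst P, f, fst Q) \<odot> NN P \<one> = NN Q \<one> \<odot> FF \<one> (fst P, f, fst Q)"
proof -
  have N: "tinv D (UU (fst R)) (NN R \<one>)" if R: "R \<in> Ob E" for R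
  proof -
    obtain t where t: "tinv D (UU (fst R)) t"
      using tinv_unA[OF Ob_E_fst[OF R]] by blast
    then have [simp]: "ok D t" "dm t = \<rho> \<one> (fst R)" "cd t = fst R" "UU (fst R) \<odot> t = tid D (\<rho> \<one> (fst R))"
      by (simp_all add: tinv_def)
    note [simp] = NN_ok[OF R] Ob_E_fst[OF R]
    have "NN R \<one> = NN R \<one> \<odot> UU (fst R) \<odot> t"
      by (simp add: D.t_idr)
    also have "\<dots> = (NN R \<one> \<odot> UU (fst R)) \<odot> t"
      by (simp add: D.t_assoc)
    also have "\<dots> = t"
      unfolding NN_unit[OF R] by (simp add: D.t_idl)
    finally show ?thesis
      using t by simp
  qed
  have "ok D (fst P, f, fst Q)"
    using f by (simp add: ok_def)
  then show ?thesis
    by (intro D.tinv_square[OF UU_nat N[OF Q] N[OF P]]) simp_all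
qed

text \<open>If \<open>\<nu>\<close> is the equivariant structure at the involution \<open>g\<close>, then \<open>t = \<nu> F(f) \<nu>\<^sup>-\<^sup>1\<close> makes \<open>f - t\<close> a
  morphism to the twist by the sign, whence \<open>f = t\<close>.\<close>

lemma endomorphisms_equivariant:
  assumes P: "P \<in> Ob E" and g: "carrier G = {\<one>, g}" "g \<otimes> g = \<one>" and \<chi>: "linear_character \<chi>" "\<chi> g = -1"
    and no_hom: "\<not> connected E P (twist \<chi> P)" and f: "arr D (fst P) (fst P) f"
  shows "arr E P P f"
proof -
  have gG [simp]: "g \<in> carrier G"
    using g(1) by simp
  note [simp] = NN_ok[OF P] Ob_E_fst[OF P]
  let ?X = "fst P" and ?f = "(fst P, f, fst P)" and ?N = "NN P g"
  have [simp]: "ok D ?f"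
    using f by (simp add: ok_def)
  obtain N' where N': "tinv D ?N N'"
    using NN_tinv[OF P gG] by blast
  then have [simp]: "ok D N'" "dm N' = ?X" "cd N' = \<rho> g ?X"
    by (simp_all add: tinv_def)
  \<comment> \<open>The conjugate of \<open>f\<close> by the structure at \<open>g\<close>;
    equivariance of \<open>f\<close> at \<open>g\<close> amounts to \<open>f = t\<close>.\<close>
  define t where "t = mr (?N \<odot> FF g ?f \<odot> N')"
  have t: "?N \<odot> FF g ?f \<odot> N' = (?X, t, ?X)"
    by (rule tarr_eqI) (simp_all add: t_def)
  have t_ok: "ok D (?X, t, ?X)"
    unfolding t[symmetric] by simp
  have "(?N \<odot> FF g ?f \<odot> N') \<odot> ?N = ?N \<odot> FF g ?f"
    using D.tinv_cancel[OF N'] N' by (simp add: D.t_assoc tinv_def D.t_idr)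
  then have tN: "(?X, t, ?X) \<odot> ?N = ?N \<odot> FF g ?f"
    unfolding t .
  let ?S = "NN P \<one> \<odot> MM g g ?X"
  have S: "?N \<odot> FF g ?N = ?S"
    using NN_cmp[OF P gG gG] unfolding g(2) .
  have [simp]: "ok D (\<rho> g (\<rho> g ?X), mulA A g g ?X, \<rho> \<one> ?X)"
    using MM_ok[OF gG gG, of ?X] g(2) by simp
  have "?S \<odot> FF g (FF g ?f) = NN P \<one> \<odot> MM g g ?X \<odot> FF g (FF g ?f)"
    using g(2) by (simp add: D.t_assoc)
  also have "MM g g ?X \<odot> FF g (FF g ?f) = FF \<one> ?f \<odot> MM g g ?X"
    using MM_nat[OF gG gG \<open>ok D ?f\<close>, of ?X ?X] g(2) by simp
  also have "NN P \<one> \<odot> FF \<one> ?f \<odot> MM g g ?X = (NN P \<one> \<odot> FF \<one> ?f) \<odot> MM g g ?X"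
    using g(2) by (simp add: D.t_assoc)
  also have "\<dots> = ?f \<odot> ?S"
    unfolding NN_one_natural[OF P P f, symmetric] using g(2) by (simp add: D.t_assoc)
  finally have Sf: "?S \<odot> FF g (FF g ?f) = ?f \<odot> ?S" .
  \<comment> \<open>Conjugating twice amounts to conjugating by the structure at the neutral
    element, which commutes with every morphism; so the conjugate of \<open>t\<close> is
    \<open>f\<close> again.\<close>
  have "(?N \<odot> FF g (?X, t, ?X)) \<odot> FF g ?N = ?N \<odot> FF g ((?X, t, ?X) \<odot> ?N)"
    using t_ok by (simp add: FF_cmp D.t_assoc)
  also have "\<dots> = (?N \<odot> FF g ?N) \<odot> FF g (FF g ?f)"
    unfolding tN by (simp add: FF_cmp D.t_assoc)
  also have "\<dots> = ?f \<odot> ?N \<odot> FF g ?N"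
    unfolding S Sf ..
  also have "\<dots> = (?f \<odot> ?N) \<odot> FF g ?N"
    by (simp add: D.t_assoc)
  finally have "((?N \<odot> FF g (?X, t, ?X)) \<odot> FF g ?N) \<odot> FF g N' = ((?f \<odot> ?N) \<odot> FF g ?N) \<odot> FF g N'"
    by simp
  moreover have "FF g ?N \<odot> FF g N' = tid D (\<rho> g ?X)"
    using FF_tinv[OF gG N'] by (simp add: tinv_def)
  ultimately have Nt: "?N \<odot> FF g (?X, t, ?X) = ?f \<odot> ?N"
    using t_ok by (simp add: D.t_assoc D.t_idr)
  let ?\<nu> = "snd P g" and ?F = "morF (rho A g) ?X ?X"
  have raw: "t \<cdot>\<^bsub>D\<^esub> ?\<nu> = ?\<nu> \<cdot>\<^bsub>D\<^esub> ?F f" "f \<cdot>\<^bsub>D\<^esub> ?\<nu> = ?\<nu> \<cdot>\<^bsub>D\<^esub> ?F t"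
    using tN Nt by (simp_all add: tcmp_def tfun_def)
  have ta: "arr D ?X ?X t"
    using t_ok by (simp add: ok_def)
  have \<nu>: "arr D (\<rho> g ?X) ?X ?\<nu>"
    by (rule Ob_E_arr(2)[OF P gG])
  interpret L: linear_equivalence D D "rho A g"
    using rho_linear[OF gG] .
  have d: "arr D ?X ?X (f - t)"
    using f ta by (rule D.arr_diff)
  have "?F f = ?F (f - t) + ?F t"
    using L.morF_add[of ?X ?X "f - t" t] d ta by (simp add: arr_def)
  then have "?\<nu> \<cdot>\<^bsub>D\<^esub> ?F f = ?\<nu> \<cdot>\<^bsub>D\<^esub> ?F (f - t) + ?\<nu> \<cdot>\<^bsub>D\<^esub> ?F t"
    using D.cmp_add_r[OF L.F_arr[OF d] L.F_arr[OF ta] \<nu>] by simp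
  \<comment> \<open>The difference anticommutes with the structure at \<open>g\<close>, which is
    equivariance towards the twist by the sign.\<close>
  then have "(f - t) \<cdot>\<^bsub>D\<^esub> ?\<nu> = - (?\<nu> \<cdot>\<^bsub>D\<^esub> ?F (f - t))"
    unfolding D.cmp_diff_l[OF \<nu> f ta] raw by simp
  also have "\<dots> = scl D (\<chi> g) ?\<nu> \<cdot>\<^bsub>D\<^esub> ?F (f - t)"
    using D.cmp_scl_l[OF L.F_arr[OF d] \<nu>, of "-1"] \<chi>(2) by simp
  finally have 1: "(f - t) \<cdot>\<^bsub>D\<^esub> snd P g = snd (twist \<chi> P) g \<cdot>\<^bsub>D\<^esub> ?F (f - t)"
    by (simp add: snd_twist)
  have one: "h \<cdot>\<^bsub>D\<^esub> snd P \<one> = snd P \<one> \<cdot>\<^bsub>D\<^esub> morF (rho A \<one>) ?X ?X h" if "arr D ?X ?X h" for h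
    using NN_one_natural[OF P P that] by (simp add: tcmp_def tfun_def)
  have "arr E P (twist \<chi> P) (f - t)"
    unfolding arr_E_raw using P twist_Ob[OF \<chi>(1) P] d 1 one[OF d] character_one[OF \<chi>(1)] g(1)
    by (simp add: snd_twist)
  then have "f - t = 0"
    using no_hom unfolding connected_def by blast
  then show ?thesis
    unfolding arr_E_raw using P f raw(2) one[OF f] g(1) by simp
qed

text \<open>The group permutes the summands: \<open>h\<close> sends the image of the summand
  \<open>g\<close> to the summand \<open>h \<otimes> g\<close> by the multiplication of the action.
  All identities are tested on summands, because the inclusions are jointly epimorphic and the
  functors of the action preserve direct sums.\<close>

lemma direct_sum_induced:
  assumes ds: "direct_sum D (carrier G) (\<lambda>g. \<rho> g Y) N \<iota> \<pi>" and Y [simp]: "Y \<in> Ob D"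
  shows "\<exists>\<mu>. (N, \<mu>) \<in> Ob E"
proof -
  have N [simp]: "N \<in> Ob D" and \<iota>: "\<And>g. g \<in> carrier G \<Longrightarrow> arr D (\<rho> g Y) N (\<iota> g)"
    using ds by (auto simp: D.direct_sum_iff)
  let ?I = "\<lambda>g. (\<rho> g Y, \<iota> g, N)"
  have I [simp]: "ok D (?I g)" if "g \<in> carrier G" for g
    using \<iota>[OF that] by (simp add: ok_def)
  have joint: "s = t" if "ok D s" "ok D t" "dm s = N" "dm t = N" "cd s = cd t"
      "\<And>g. g \<in> carrier G \<Longrightarrow> s \<odot> ?I g = t \<odot> ?I g" for s t
  proof -
    have "mr s = mr t"
      by (rule D.direct_sum_joint_epi[OF ds, of "cd s"])
        (use that(1-5) that(6)[THEN arg_cong[of _ _ mr]] in \<open>simp_all add: ok_def tcmp_def\<close>)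
    then show ?thesis
      using that by (intro tarr_eqI) simp_all
  qed
  have jointF: "s = t" if h: "h \<in> carrier G" and st: "ok D s" "ok D t" "dm s = \<rho> h N" "dm t = \<rho> h N" "cd s = cd t"
      and e: "\<And>g. g \<in> carrier G \<Longrightarrow> s \<odot> FF h (?I g) = t \<odot> FF h (?I g)" for h s t
  proof -
    have "mr s = mr t"
      by (rule D.direct_sum_joint_epi[OF linear_equivalence.F_direct_sum[OF rho_linear[OF h] ds], of "cd s"])
        (use st e[THEN arg_cong[of _ _ mr]] in \<open>simp_all add: ok_def tcmp_def tfun_def\<close>)
    then show ?thesis
      using st by (intro tarr_eqI) simp_all
  qed
  \<comment> \<open>The image of \<open>N\<close> is the direct sum of the images of the summands,
    which defines the structure at \<open>h\<close>.\<close>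
  have "\<exists>m. ok D (\<rho> h N, m, N) \<and> (\<forall>g\<in>carrier G. (\<rho> h N, m, N) \<odot> FF h (?I g) = ?I (h \<otimes> g) \<odot> MM h g Y)"
    if h: "h \<in> carrier G" for h
  proof -
    have "arr D (\<rho> h (\<rho> g Y)) N (\<iota> (h \<otimes> g) \<cdot>\<^bsub>D\<^esub> mulA A h g Y)" if "g \<in> carrier G" for g
      using D.arr_cmp[of "\<rho> h (\<rho> g Y)" "\<rho> (h \<otimes> g) Y" "mulA A h g Y" N] MM_ok[OF h that Y] \<iota>[OF m_closed[OF h that]]
      by (simp add: ok_def)
    then show ?thesis
      using D.direct_sum_copair[OF linear_equivalence.F_direct_sum[OF rho_linear[OF h] ds] N, of "\<lambda>g. \<iota> (h \<otimes> g) \<cdot>\<^bsub>D\<^esub> mulA A h g Y"]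
      by (simp add: ok_def tcmp_def tfun_def)
  qed
  then obtain \<mu> where \<mu>: "\<And>h. h \<in> carrier G \<Longrightarrow> ok D (\<rho> h N, \<mu> h, N)"
      "\<And>h g. h \<in> carrier G \<Longrightarrow> g \<in> carrier G \<Longrightarrow> (\<rho> h N, \<mu> h, N) \<odot> FF h (?I g) = ?I (h \<otimes> g) \<odot> MM h g Y"
    by metis
  note [simp] = \<mu>(1)
  let ?M = "\<lambda>h. (\<rho> h N, \<mu> h, N)"
  have "equi N \<mu>"
    unfolding equi_def
  proof (intro conjI ballI N)
    show "\<exists>t. tinv D (?M h) t" if h [simp]: "h \<in> carrier G" for h
    proof -
      \<comment> \<open>The inverse sends the summand \<open>g\<close> back to the image of the
        summand \<open>inv h \<otimes> g\<close>.\<close>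
      have "\<forall>g\<in>carrier G. \<exists>t. tinv D (MM h (inv h \<otimes> g) Y) t"
        using tinv_mulA[OF h _ Y] by simp
      then obtain m where m: "\<And>g. g \<in> carrier G \<Longrightarrow> tinv D (MM h (inv h \<otimes> g) Y) (m g)"
        by metis
      have hg: "h \<otimes> (inv h \<otimes> g) = g" "inv h \<otimes> (h \<otimes> g) = g" if "g \<in> carrier G" for g
        using that by (simp_all add: m_assoc[symmetric])
      have m' [simp]: "ok D (m g)" "dm (m g) = \<rho> g Y" "cd (m g) = \<rho> h (\<rho> (inv h \<otimes> g) Y)" if "g \<in> carrier G" for g
        using m[OF that] hg[OF that] by (simp_all add: tinv_def)
      have "arr D (\<rho> g Y) (\<rho> h N) (mr (FF h (?I (inv h \<otimes> g)) \<odot> m g))" if "g \<in> carrier G" for g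
      proof -
        have "ok D (FF h (?I (inv h \<otimes> g)) \<odot> m g)"
          using that by simp
        then show ?thesis
          using that by (simp add: ok_def)
      qed
      then obtain k where k: "arr D N (\<rho> h N) k" "\<And>g. g \<in> carrier G \<Longrightarrow> k \<cdot>\<^bsub>D\<^esub> \<iota> g = mr (FF h (?I (inv h \<otimes> g)) \<odot> m g)"
        using D.direct_sum_copair[OF ds, of "\<rho> h N" "\<lambda>g. mr (FF h (?I (inv h \<otimes> g)) \<odot> m g)"] by auto
      let ?K = "(N, k, \<rho> h N)"
      have [simp]: "ok D ?K"
        using k(1) by (simp add: ok_def)
      have K: "?K \<odot> ?I g = FF h (?I (inv h \<otimes> g)) \<odot> m g" if "g \<in> carrier G" for g
        by (rule tarr_eqI) (use that k(2)[OF that] in \<open>simp_all add: tcmp_def[of D ?K]\<close>)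
      have "?M h \<odot> ?K = tid D N"
      proof (rule joint)
        fix g assume g [simp]: "g \<in> carrier G"
        have [simp]: "ok D (\<rho> h (\<rho> (inv h \<otimes> g) Y), mulA A h (inv h \<otimes> g) Y, \<rho> g Y)"
          using MM_ok[OF h, of "inv h \<otimes> g" Y] hg by simp
        have "(?M h \<odot> ?K) \<odot> ?I g = ?M h \<odot> FF h (?I (inv h \<otimes> g)) \<odot> m g"
          by (simp add: D.t_assoc K)
        also have "\<dots> = (?M h \<odot> FF h (?I (inv h \<otimes> g))) \<odot> m g"
          by (simp add: D.t_assoc)
        also have "\<dots> = ?I g \<odot> MM h (inv h \<otimes> g) Y \<odot> m g"
          by (simp add: \<mu>(2) D.t_assoc hg)
        also have "MM h (inv h \<otimes> g) Y \<odot> m g = tid D (\<rho> g Y)"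
          using m[OF g] by (simp add: tinv_def hg)
        finally show "(?M h \<odot> ?K) \<odot> ?I g = tid D N \<odot> ?I g"
          by (simp add: D.t_idl D.t_idr)
      qed simp_all
      moreover have "?K \<odot> ?M h = tid D (\<rho> h N)"
      proof (rule jointF[OF h])
        fix g assume g [simp]: "g \<in> carrier G"
        have "(?K \<odot> ?M h) \<odot> FF h (?I g) = ?K \<odot> ?I (h \<otimes> g) \<odot> MM h g Y"
          by (simp add: D.t_assoc \<mu>(2))
        also have "\<dots> = (?K \<odot> ?I (h \<otimes> g)) \<odot> MM h g Y"
          by (simp add: D.t_assoc)
        also have "\<dots> = FF h (?I g) \<odot> m (h \<otimes> g) \<odot> MM h g Y"
          by (simp add: K D.t_assoc hg)
        also have "m (h \<otimes> g) \<odot> MM h g Y = tid D (\<rho> h (\<rho> g Y))"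
          using m[OF m_closed[OF h g]] by (simp add: tinv_def hg)
        finally show "(?K \<odot> ?M h) \<odot> FF h (?I g) = tid D (\<rho> h N) \<odot> FF h (?I g)"
          by (simp add: D.t_idl D.t_idr)
      qed simp_all
      ultimately have "tinv D (?M h) ?K"
        by (simp add: tinv_def)
      then show ?thesis
        by blast
    qed
    show "?M g \<odot> FF g (?M h) = ?M (g \<otimes> h) \<odot> MM g h N" if [simp]: "g \<in> carrier G" "h \<in> carrier G" for g h
    proof -
      \<comment> \<open>The cocycle identity has the twofold image of \<open>N\<close> as source, so
        it is tested on the twofold images of the summands; there it is associativity of the
        action.\<close>
      have dsF: "direct_sum D (carrier G) (\<lambda>l. \<rho> g (\<rho> h (\<rho> l Y))) (\<rho> g (\<rho> h N)) (\<lambda>l. mr (FF g (FF h (?I l))))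
          (\<lambda>l. morF (rho A g) (\<rho> h N) (\<rho> h (\<rho> l Y)) (morF (rho A h) N (\<rho> l Y) (\<pi> l)))"
        using linear_equivalence.F_direct_sum[OF rho_linear[of g] linear_equivalence.F_direct_sum[OF rho_linear[of h] ds]]
        by (simp add: tfun_def)
      have "(?M g \<odot> FF g (?M h)) \<odot> FF g (FF h (?I l)) = (?M (g \<otimes> h) \<odot> MM g h N) \<odot> FF g (FF h (?I l))"
        if [simp]: "l \<in> carrier G" for l
      proof -
        have "(?M g \<odot> FF g (?M h)) \<odot> FF g (FF h (?I l)) = ?M g \<odot> FF g (?M h \<odot> FF h (?I l))"
          by (simp add: D.t_assoc FF_cmp)
        also have "\<dots> = (?M g \<odot> FF g (?I (h \<otimes> l))) \<odot> FF g (MM h l Y)"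
          by (simp add: D.t_assoc FF_cmp \<mu>(2)[of h l])
        also have "\<dots> = ?I (g \<otimes> (h \<otimes> l)) \<odot> MM g (h \<otimes> l) Y \<odot> FF g (MM h l Y)"
          by (simp add: D.t_assoc \<mu>(2))
        also have "MM g (h \<otimes> l) Y \<odot> FF g (MM h l Y) = MM (g \<otimes> h) l Y \<odot> MM g h (\<rho> l Y)"
          by (rule MM_assoc[symmetric]) simp_all
        also have "?I (g \<otimes> (h \<otimes> l)) \<odot> MM (g \<otimes> h) l Y \<odot> MM g h (\<rho> l Y) = (?M (g \<otimes> h) \<odot> FF (g \<otimes> h) (?I l)) \<odot> MM g h (\<rho> l Y)"
          using MM_ok[of "g \<otimes> h" l Y] by (simp add: D.t_assoc \<mu>(2) m_assoc)
        also have "\<dots> = ?M (g \<otimes> h) \<odot> MM g h N \<odot> FF g (FF h (?I l))"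
          by (subst MM_nat) (simp_all add: D.t_assoc)
        finally show ?thesis
          by (simp add: D.t_assoc)
      qed
      note e = this
      have "ok D (?M g \<odot> FF g (?M h))" "ok D (?M (g \<otimes> h) \<odot> MM g h N)"
        by simp_all
      then have o: "arr D (\<rho> g (\<rho> h N)) N (mr (?M g \<odot> FF g (?M h)))" "arr D (\<rho> g (\<rho> h N)) N (mr (?M (g \<otimes> h) \<odot> MM g h N))"
        by (simp_all add: ok_def)
      have "mr (?M g \<odot> FF g (?M h)) = mr (?M (g \<otimes> h) \<odot> MM g h N)"
        by (rule D.direct_sum_joint_epi[OF dsF o]) (use e[THEN arg_cong[of _ _ mr]] in \<open>simp add: mr_simps(1)\<close>)
      then show ?thesis
        by (intro tarr_eqI) simp_all
    qed
    show "?M \<one> \<odot> UU N = tid D N"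
    proof (rule joint)
      fix g assume g [simp]: "g \<in> carrier G"
      have "(?M \<one> \<odot> UU N) \<odot> ?I g = (?M \<one> \<odot> FF \<one> (?I g)) \<odot> UU (\<rho> g Y)"
        by (simp add: D.t_assoc UU_nat)
      also have "\<dots> = ?I g \<odot> MM \<one> g Y \<odot> UU (\<rho> g Y)"
        using MM_ok[of \<one> g Y] by (simp add: D.t_assoc \<mu>(2))
      also have "\<dots> = tid D N \<odot> ?I g"
        using MM_UU[of g Y] by (simp add: D.t_idl D.t_idr)
      finally show "(?M \<one> \<odot> UU N) \<odot> ?I g = tid D N \<odot> ?I g" .
    qed simp_all
  qed
  then show ?thesis
    unfolding Ob_E by auto
qed

end

section \<open>Non-solvability\<close>

lemma (in schur_tensor) unit_scalar_end: "scalar_end C (unitO C)"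
  by (rule simple_scalar_end[OF unit_simple])

text \<open>A nonzero map \<open>u\<close> out of a simple object splits. The resulting idempotent
  of \<open>Y\<close> is a scalar that fixes \<open>u\<close>, so it is the identity.\<close>

lemma (in schur_category) scalar_end_isomorphic:
  assumes S: "simple_object C S" and Y: "scalar_end C Y" and "connected C S Y"
  shows "isomorphic C S Y"
proof -
  obtain u where u: "arr C S Y u" "u \<noteq> 0"
    using assms(3) unfolding connected_def by blast
  obtain v where v: "arr C Y S v" "v \<cdot> u = idm C S"
    using simple_retract[OF S u] by blast
  obtain c where c: "u \<cdot> v = scl C c (idm C Y)"
    using Y arr_cmp[OF v(1) u(1)] unfolding scalar_end_def by blast
  have Yo: "Y \<in> Ob C"
    using u(1) by (simp add: arr_def)
  have "u = (u \<cdot> v) \<cdot> u"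
    using assoc[OF u(1) v(1) u(1)] idr[OF u(1)] v(2) by simp
  also have "\<dots> = scl C c u"
    unfolding c using cmp_scl_l[OF u(1) arr_idm[OF Yo]] idl[OF u(1)] by simp
  finally have "scl C 1 u = scl C c u"
    by simp
  then have "c = 1"
    using u(2) by (metis V.scale_right_imp_eq)
  then have "inverse_pair C S Y u v"
    using u v c by (simp add: inverse_pair_def)
  then show ?thesis
    unfolding isomorphic_iff by blast
qed

text \<open>An object with scalar endomorphisms that embeds into its square is homogeneous of degree \<open>g = g\<^sup>2\<close>.\<close>

lemma graded_contradiction:
  fixes E :: "('k::alg_closed_field, 'o, 'm::ab_group_add) moncat"
    and A :: "('k, 'p, 'm) moncat"
  assumes E: "schur_tensor E" "monoidal_category E" and ext: "is_extension G D E" and G: "x \<in> carrier G" "x \<noteq> \<one>\<^bsub>G\<^esub>"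
    and A: "symmetric_like A d V b"
    and \<phi>: "\<And>X Y f. arr A X Y f \<Longrightarrow> arr E (\<phi> X) (\<phi> Y) f" "\<And>X Y. \<phi> (X \<boxtimes>\<^bsub>A\<^esub> Y) = \<phi> X \<boxtimes>\<^bsub>E\<^esub> \<phi> Y" "\<phi> (unitO A) = unitO E"
      "cmp A = cmp E" "\<And>X. idm A X = idm E (\<phi> X)"
    and V: "scalar_end E (\<phi> V)"
    and dominant: "\<And>Y. Y \<in> Ob E \<Longrightarrow> idm E Y \<noteq> 0 \<Longrightarrow> \<exists>X\<in>Ob A. connected E Y (\<phi> X)"
  shows False
proof -
  interpret E: schur_tensor E
    by fact
  interpret E': monoidal_category E
    by fact
  interpret A: symmetric_like A d V b
    by fact
  interpret G: group G
    using ext by (simp add: is_extension_def)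
  obtain \<E> where \<E>: "graded_decomposition E (carrier G) \<E>" "\<And>g. g \<in> carrier G \<Longrightarrow> \<exists>X\<in>\<E> g. \<not> zero_object E X"
      "\<And>g h X Y. g \<in> carrier G \<Longrightarrow> h \<in> carrier G \<Longrightarrow> X \<in> \<E> g \<Longrightarrow> Y \<in> \<E> h \<Longrightarrow> X \<boxtimes>\<^bsub>E\<^esub> Y \<in> \<E> (g \<otimes>\<^bsub>G\<^esub> h)"
    using ext unfolding is_extension_def by blast
  have sub: "X \<in> Ob E" if "g \<in> carrier G" "X \<in> \<E> g" for g X
    using \<E>(1) that unfolding graded_decomposition_def by blast
  have iso: "Y \<in> \<E> g" if "g \<in> carrier G" "X \<in> \<E> g" "isomorphic E X Y" for g X Y
    using \<E>(1) that unfolding graded_decomposition_def by blast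
  have orth: "g = h" if "g \<in> carrier G" "h \<in> carrier G" "X \<in> \<E> g" "Y \<in> \<E> h" "connected E X Y" for g h X Y
    using \<E>(1) that unfolding graded_decomposition_def connected_def arr_def by blast
  \<comment> \<open>Each composite of a projection onto a homogeneous component with its inclusion
    is a scalar idempotent; a nonzero one is the identity, so \<open>X\<close> is isomorphic to that
    component.\<close>
  have neutral: "X \<in> \<E> \<one>\<^bsub>G\<^esub>" if X: "scalar_end E X" and XX: "connected E X (X \<boxtimes>\<^bsub>E\<^esub> X)" for X
  proof -
    have Xo: "X \<in> Ob E" "idm E X \<noteq> 0"
      using X by (simp_all add: scalar_end_def)
    obtain S \<iota> \<pi> where S: "\<And>g. g \<in> carrier G \<Longrightarrow> S g \<in> \<E> g" and ds: "direct_sum E (carrier G) S X \<iota> \<pi>"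
      using \<E>(1) Xo(1) unfolding graded_decomposition_def by metis
    have ar: "arr E (S g) X (\<iota> g)" "arr E X (S g) (\<pi> g)" "\<pi> g \<cdot>\<^bsub>E\<^esub> \<iota> g = idm E (S g)" if "g \<in> carrier G" for g
      using ds that by (simp_all add: E.direct_sum_iff)
    have "(\<Sum>g\<in>carrier G. \<iota> g \<cdot>\<^bsub>E\<^esub> \<pi> g) \<noteq> 0"
      using ds Xo(2) by (simp add: E.direct_sum_iff)
    then obtain g where g: "g \<in> carrier G" "\<iota> g \<cdot>\<^bsub>E\<^esub> \<pi> g \<noteq> 0"
      by (rule sum.not_neutral_contains_not_neutral)
    note ag = ar[OF g(1)]
    obtain c where c: "\<iota> g \<cdot>\<^bsub>E\<^esub> \<pi> g = scl E c (idm E X)"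
      using X E.arr_cmp[OF ag(2,1)] unfolding scalar_end_def by blast
    have "\<pi> g = (\<pi> g \<cdot>\<^bsub>E\<^esub> \<iota> g) \<cdot>\<^bsub>E\<^esub> \<pi> g"
      using E.idl[OF ag(2)] ag(3) by simp
    also have "\<dots> = scl E c (\<pi> g)"
      using E.assoc[OF ag(2,1,2)] c E.cmp_scl_r[OF E.arr_idm[OF Xo(1)] ag(2)] E.idr[OF ag(2)] by simp
    finally have "scl E 1 (\<pi> g) = scl E c (\<pi> g)"
      by simp
    moreover have "\<pi> g \<noteq> 0"
      using g(2) E.cmp_zero_r[OF ag(1)] by auto
    ultimately have "c = 1"
      by (metis E.V.scale_right_imp_eq)
    then have "inverse_pair E (S g) X (\<iota> g) (\<pi> g)"
      using ag c by (simp add: inverse_pair_def)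
    then have "isomorphic E (S g) X"
      unfolding isomorphic_iff by blast
    then have Xg: "X \<in> \<E> g"
      using iso[OF g(1) S[OF g(1)]] by simp
    then have "g = g \<otimes>\<^bsub>G\<^esub> g"
      using orth[OF g(1) _ Xg \<E>(3)[OF g(1) g(1) Xg Xg] XX] g(1) by simp
    then have "g = \<one>\<^bsub>G\<^esub>"
      using g(1) G.l_cancel_one by metis
    then show ?thesis
      using Xg by simp
  qed
  have unit: "unitO E \<in> \<E> \<one>\<^bsub>G\<^esub>"
  proof (rule neutral[OF E.unit_scalar_end])
    show "connected E (unitO E) (unitO E \<boxtimes>\<^bsub>E\<^esub> unitO E)"
      using E.connected_iso[OF E.scalar_end_connected[OF E.unit_scalar_end] E.isomorphic_refl
          E.isomorphic_sym[OF E'.isomorphic_lun]] E.unit_Ob by simp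
  qed
  have V1: "\<phi> V \<in> \<E> \<one>\<^bsub>G\<^esub>"
    using neutral[OF V] A.V_ten \<phi>(1,2) unfolding connected_def by metis
  have power: "\<phi> (tensor_power A V k) \<in> \<E> \<one>\<^bsub>G\<^esub>" for k
    using unit V1 \<E>(3)[of "\<one>\<^bsub>G\<^esub>" "\<one>\<^bsub>G\<^esub>"] by (induction k) (simp_all add: \<phi>)
  obtain Y where Y: "Y \<in> \<E> x" "\<not> zero_object E Y"
    using \<E>(2)[OF G(1)] by blast
  then have "Y \<in> Ob E" "idm E Y \<noteq> 0"
    using sub[OF G(1)] E.zero_object_iff by auto
  then obtain X where X: "X \<in> Ob A" "connected E Y (\<phi> X)"
    using dominant by blast
  obtain N :: nat and T a c where f: "\<forall>i<N. (\<exists>k. T i = tensor_power A V k) \<and> arr A (T i) X (a i) \<and> arr A X (T i) (c i)"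
      "(\<Sum>i<N. a i \<cdot>\<^bsub>A\<^esub> c i) = idm A X"
    using A.V_generates[OF X(1)] unfolding factors_through_def by blast
  \<comment> \<open>\<open>\<phi>\<close> is the identity, or the forgetful functor of an
    equivariantization; it does not change morphisms and carries the factorization from
    \<open>A\<close> to \<open>E\<close>.\<close>
  have "factors_through E (\<lambda>T. \<exists>k. T = \<phi> (tensor_power A V k)) (\<phi> X)"
  proof (rule E.factors_throughI)
    show "\<exists>k. \<phi> (T i) = \<phi> (tensor_power A V k)" "arr E (\<phi> (T i)) (\<phi> X) (a i)" "arr E (\<phi> X) (\<phi> (T i)) (c i)"
      if "i \<in> {..<N}" for i
      using f(1) that \<phi>(1) by (metis lessThan_iff)+
    show "(\<Sum>i<N. a i \<cdot>\<^bsub>E\<^esub> c i) = idm E (\<phi> X)"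
      using f(2) unfolding \<phi>(4,5) .
  qed simp
  moreover obtain u where u: "arr E Y (\<phi> X) u" "u \<noteq> 0"
    using X(2) unfolding connected_def by blast
  ultimately show False
  proof (rule E.factors_through_nonzero)
    fix T v assume T: "\<exists>k. T = \<phi> (tensor_power A V k)" and v: "arr E (\<phi> X) T v" "v \<cdot>\<^bsub>E\<^esub> u \<noteq> 0"
    have "connected E Y T"
      using E.arr_cmp[OF u(1) v(1)] v(2) unfolding connected_def by blast
    then show False
      using orth[OF G(1) _ Y(1) power] T G(2) by auto
  qed
qed

text \<open>With \<open>d > N\<close>, the powers of \<open>N\<^sup>2 + 1\<close> would stay within
  a constant factor of those of \<open>N\<^sup>2\<close>, but their quotient is unbounded.\<close>

lemma power_growth:
  fixes d N b :: nat
  assumes "\<And>k. (d ^ k)\<^sup>2 \<le> b * (N ^ k)\<^sup>2"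
  shows "d \<le> N"
proof (rule ccontr)
  assume "\<not> d \<le> N"
  then have "Suc N \<le> d"
    by simp
  define c where "c = N\<^sup>2"
  have "Suc c \<le> (Suc N)\<^sup>2"
    by (simp add: c_def power2_eq_square)
  also have "\<dots> \<le> d\<^sup>2"
    using \<open>Suc N \<le> d\<close> by (rule power_mono) simp
  finally have cd: "Suc c \<le> d\<^sup>2" .
  \<comment> \<open>Bernoulli's inequality for (1 + 1/c)^k with the denominators cleared.\<close>
  have lower: "c ^ k * (c + k) \<le> Suc c ^ k * c" for k
  proof (induction k)
    case (Suc k)
    have "c ^ Suc k * (c + Suc k) = c * (c ^ k * (c + k)) + c ^ k * c"
      by (simp add: algebra_simps)
    also have "\<dots> \<le> c * (c ^ k * (c + k)) + c ^ k * (c + k)"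
      by simp
    also have "\<dots> = Suc c * (c ^ k * (c + k))"
      by (simp add: algebra_simps)
    also have "\<dots> \<le> Suc c * (Suc c ^ k * c)"
      using Suc by (rule mult_left_mono) simp
    also have "\<dots> = Suc c ^ Suc k * c"
      by (simp only: power_Suc mult.assoc)
    finally show ?case .
  qed simp
  have up: "Suc c ^ k \<le> b * c ^ k" for k
  proof -
    have "Suc c ^ k \<le> (d\<^sup>2) ^ k"
      using cd by (rule power_mono) simp
    also have "\<dots> = (d ^ k)\<^sup>2"
      by (simp add: power_mult[symmetric] mult.commute)
    also have "\<dots> \<le> b * c ^ k"
      using assms[of k] by (simp add: c_def power_mult[symmetric] mult.commute)
    finally show ?thesis .
  qed
  show False
  proof (cases "c = 0")
    case True
    then show False
      using up[of 1] by simp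
  next
    case False
    \<comment> \<open>The first exponent beyond \<open>b * c\<close>, so that \<open>c + ?k\<close>
      exceeds \<open>b * c\<close>.\<close>
    let ?k = "Suc (b * c)"
    have "c ^ ?k * (c + ?k) \<le> b * c ^ ?k * c"
      using order_trans[OF lower mult_right_mono[OF up, of c]] by blast
    then have "c ^ ?k * (c + ?k) \<le> c ^ ?k * (b * c)"
      by (simp add: mult_ac)
    then show False
      using False by (simp only: mult_le_cancel1 power_eq_0_iff zero_less_power neq0_conv) simp
  qed
qed

section \<open>Dimensions and characters in an equivariantization\<close>

locale schur_equivariant = equivariant G D A + S: schur_tensor D
  for G :: "'g monoid" (structure) and D :: "('k::alg_closed_field, 'o, 'm::ab_group_add) moncat" and A
begin

lemma fst_tensor_power: "fst (tensor_power E P k) = tensor_power D (fst P) k"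
  by (induction k) simp_all

text \<open>The endomorphism spaces of the tensor powers of a sum of \<open>N\<close> invertible objects grow like \<open>N\<^sup>2\<^sup>k\<close>, those
  of the tensor powers of \<open>X\<close> like \<open>(d X)\<^sup>2\<^sup>k\<close>.\<close>

lemma dimension_le_invertibles:
  assumes sl: "symmetric_like E d V b"
    and X: "X \<in> Ob E" and ds: "direct_sum D I S (fst X) \<iota> \<pi>" and S: "\<And>i. i \<in> I \<Longrightarrow> invertible_object D (S i)"
  shows "d X \<le> card I"
proof -
  interpret sl: symmetric_like E d V b
    by fact
  let ?N = "card I"
  let ?P = "tensor_power D (fst X)"
  have XD: "fst X \<in> Ob D"
    by (rule Ob_E_fst[OF X])
  have PE: "tensor_power E X k \<in> Ob E" for k
    by (induction k) (simp_all add: unit_E_Ob ten_E_Ob X)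
  have dP: "d (tensor_power E X k) = d X ^ k" for k
    using PE X by (induction k) (simp_all add: sl.d_unit sl.d_ten)
  \<comment> \<open>Products of invertible objects are invertible, so a power of a sum of
    invertibles is again a sum of invertibles.\<close>
  have dec: "\<exists>T \<kappa> \<omega>. direct_sum D {..<?N ^ k} T (?P k) \<kappa> \<omega> \<and> (\<forall>i<?N ^ k. invertible_object D (T i))" for k
  proof (induction k)
    case 0
    have "direct_sum D {..<1::nat} (\<lambda>_. unitO D) (unitO D) (\<lambda>_. idm D (unitO D)) (\<lambda>_. idm D (unitO D))"
      using D.idl[OF D.arr_idm[OF unit_Ob]] by (auto simp: D.direct_sum_iff D.arr_idm)
    then show ?case
      using D.invertible_unit by auto
  next
    case (Suc k)
    then obtain T \<kappa> \<omega> where T: "direct_sum D {..<?N ^ k} T (?P k) \<kappa> \<omega>" "\<And>i. i < ?N ^ k \<Longrightarrow> invertible_object D (T i)"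
      by blast
    have "finite I"
      using ds by (simp add: direct_sum_def)
    then have "card ({..<?N ^ k} \<times> I) = card {..<?N ^ Suc k}" "finite ({..<?N ^ k} \<times> I)"
      by simp_all
    then obtain h where h: "bij_betw h {..<?N ^ Suc k} ({..<?N ^ k} \<times> I)"
      using finite_same_card_bij[of "{..<?N ^ Suc k}" "{..<?N ^ k} \<times> I"] by auto
    have "invertible_object D (case h j of (i, j) \<Rightarrow> T i \<boxtimes>\<^bsub>D\<^esub> S j)" if "j < ?N ^ Suc k" for j
    proof -
      have "h j \<in> {..<?N ^ k} \<times> I"
        using h that by (auto simp: bij_betw_def)
      then show ?thesis
        by (auto intro!: D.invertible_ten T(2) S)
    qed
    then show ?case
      using D.direct_sum_reindex[OF D.direct_sum_ten[OF T(1) ds] h] by auto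
  qed
  have "(d X ^ k)\<^sup>2 \<le> b * (?N ^ k)\<^sup>2" for k
  proof -
    let ?J = "{..<?N ^ k}"
    obtain T \<kappa> \<omega> where T: "direct_sum D ?J T (?P k) \<kappa> \<omega>" and inv: "\<And>i. i \<in> ?J \<Longrightarrow> invertible_object D (T i)"
      using dec[of k] by auto
    have ar: "arr D (T i) (?P k) (\<kappa> i)" "arr D (?P k) (T i) (\<omega> i)" if "i \<in> ?J" for i
      using T that by (simp_all add: D.direct_sum_iff)
    have sum: "(\<Sum>i\<in>?J. \<kappa> i \<cdot>\<^bsub>D\<^esub> \<omega> i) = idm D (?P k)"
      using T by (simp add: D.direct_sum_iff)
    \<comment> \<open>Between two invertible objects the Hom space is at most one-dimensional; one
      generator is chosen for each pair.\<close>
    have "\<exists>u. \<forall>i\<in>?J. \<forall>j\<in>?J. \<forall>f. arr D (T i) (T j) f \<longrightarrow> arr D (T i) (T j) (u i j) \<and> (\<exists>c. f = scl D c (u i j))"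
    proof -
      have "\<exists>u. \<forall>f. arr D (T i) (T j) f \<longrightarrow> arr D (T i) (T j) u \<and> (\<exists>c. f = scl D c u)" if ij: "i \<in> ?J" "j \<in> ?J" for i j
      proof -
        obtain u where "arr D (T i) (T j) u" "\<And>f. arr D (T i) (T j) f \<Longrightarrow> \<exists>c. f = scl D c u"
          using S.hom_scalar_end D.invertible_scalar_end[OF S.unit_scalar_end] inv ij by metis
        then show ?thesis
          by blast
      qed
      then show ?thesis
        by metis
    qed
    then obtain u where u: "\<And>i j f. i \<in> ?J \<Longrightarrow> j \<in> ?J \<Longrightarrow> arr D (T i) (T j) f \<Longrightarrow> arr D (T i) (T j) (u i j) \<and> (\<exists>c. f = scl D c (u i j))"
      by blast
    let ?U = "(\<lambda>(i, j). \<kappa> j \<cdot>\<^bsub>D\<^esub> u i j \<cdot>\<^bsub>D\<^esub> \<omega> i) ` (?J \<times> ?J)"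
    \<comment> \<open>Inserting the decomposed identity on both sides leaves one spanning element
      for each pair of summands. Equivariant endomorphisms are among these, which bounds the
      independent set supplied by \<open>growth\<close>.\<close>
    have span: "f \<in> D.V.span ?U" if f: "arr D (?P k) (?P k) f" for f
    proof -
      have summand: "\<kappa> j \<cdot>\<^bsub>D\<^esub> (\<omega> j \<cdot>\<^bsub>D\<^esub> f \<cdot>\<^bsub>D\<^esub> \<kappa> i) \<cdot>\<^bsub>D\<^esub> \<omega> i \<in> D.V.span ?U" if i: "i \<in> ?J" and j: "j \<in> ?J" for i j
      proof -
        have g: "arr D (T i) (T j) (\<omega> j \<cdot>\<^bsub>D\<^esub> f \<cdot>\<^bsub>D\<^esub> \<kappa> i)"
          using D.arr_cmp[OF D.arr_cmp[OF ar(1)[OF i] f] ar(2)[OF j]] .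
        obtain c where c: "\<omega> j \<cdot>\<^bsub>D\<^esub> f \<cdot>\<^bsub>D\<^esub> \<kappa> i = scl D c (u i j)" and uij: "arr D (T i) (T j) (u i j)"
          using u[OF i j g] by blast
        have "\<kappa> j \<cdot>\<^bsub>D\<^esub> (\<omega> j \<cdot>\<^bsub>D\<^esub> f \<cdot>\<^bsub>D\<^esub> \<kappa> i) \<cdot>\<^bsub>D\<^esub> \<omega> i = scl D c (\<kappa> j \<cdot>\<^bsub>D\<^esub> u i j \<cdot>\<^bsub>D\<^esub> \<omega> i)"
          unfolding c D.cmp_scl_l[OF ar(2)[OF i] uij] D.cmp_scl_r[OF D.arr_cmp[OF ar(2)[OF i] uij] ar(1)[OF j]] ..
        also have "\<dots> \<in> D.V.span ?U"
          using i j by (intro D.V.span_scale D.V.span_base) auto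
        finally show ?thesis .
      qed
      have PO: "?P k \<in> Ob D"
        using f by (simp add: arr_def)
      have fk: "arr D (?P k) (?P k) (f \<cdot>\<^bsub>D\<^esub> \<kappa> i \<cdot>\<^bsub>D\<^esub> \<omega> i)" "arr D (?P k) (?P k) (\<kappa> i \<cdot>\<^bsub>D\<^esub> \<omega> i)" if "i \<in> ?J" for i
        using D.arr_cmp[OF D.arr_cmp[OF ar(2)[OF that] ar(1)[OF that]] f] D.arr_cmp[OF ar(2)[OF that] ar(1)[OF that]] by simp_all
      have "f = idm D (?P k) \<cdot>\<^bsub>D\<^esub> f \<cdot>\<^bsub>D\<^esub> idm D (?P k)"
        using D.idl[OF f] D.idr[OF f] by simp
      also have "\<dots> = (\<Sum>j\<in>?J. \<Sum>i\<in>?J. (\<kappa> j \<cdot>\<^bsub>D\<^esub> \<omega> j) \<cdot>\<^bsub>D\<^esub> f \<cdot>\<^bsub>D\<^esub> \<kappa> i \<cdot>\<^bsub>D\<^esub> \<omega> i)"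
      proof -
        have 1: "f \<cdot>\<^bsub>D\<^esub> idm D (?P k) = (\<Sum>i\<in>?J. f \<cdot>\<^bsub>D\<^esub> \<kappa> i \<cdot>\<^bsub>D\<^esub> \<omega> i)"
          unfolding sum[symmetric] by (rule D.cmp_sum_r[OF f fk(2)])
        have s: "arr D (?P k) (?P k) (\<Sum>i\<in>?J. f \<cdot>\<^bsub>D\<^esub> \<kappa> i \<cdot>\<^bsub>D\<^esub> \<omega> i)"
          by (rule D.arr_sum[OF PO PO fk(1)])
        have "idm D (?P k) \<cdot>\<^bsub>D\<^esub> (\<Sum>i\<in>?J. f \<cdot>\<^bsub>D\<^esub> \<kappa> i \<cdot>\<^bsub>D\<^esub> \<omega> i) = (\<Sum>j\<in>?J. (\<kappa> j \<cdot>\<^bsub>D\<^esub> \<omega> j) \<cdot>\<^bsub>D\<^esub> (\<Sum>i\<in>?J. f \<cdot>\<^bsub>D\<^esub> \<kappa> i \<cdot>\<^bsub>D\<^esub> \<omega> i))"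
          unfolding sum[symmetric] by (rule D.cmp_sum_l[OF s fk(2)])
        also have "\<dots> = (\<Sum>j\<in>?J. \<Sum>i\<in>?J. (\<kappa> j \<cdot>\<^bsub>D\<^esub> \<omega> j) \<cdot>\<^bsub>D\<^esub> f \<cdot>\<^bsub>D\<^esub> \<kappa> i \<cdot>\<^bsub>D\<^esub> \<omega> i)"
          by (rule sum.cong[OF refl D.cmp_sum_r[OF fk(2) fk(1)]])
        finally show ?thesis
          unfolding 1 .
      qed
      also have "\<dots> = (\<Sum>j\<in>?J. \<Sum>i\<in>?J. \<kappa> j \<cdot>\<^bsub>D\<^esub> (\<omega> j \<cdot>\<^bsub>D\<^esub> f \<cdot>\<^bsub>D\<^esub> \<kappa> i) \<cdot>\<^bsub>D\<^esub> \<omega> i)"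
      proof (intro sum.cong refl)
        fix i j assume i: "i \<in> ?J" and j: "j \<in> ?J"
        note a = ar[OF i] and a' = ar[OF j]
        show "(\<kappa> j \<cdot>\<^bsub>D\<^esub> \<omega> j) \<cdot>\<^bsub>D\<^esub> f \<cdot>\<^bsub>D\<^esub> \<kappa> i \<cdot>\<^bsub>D\<^esub> \<omega> i = \<kappa> j \<cdot>\<^bsub>D\<^esub> (\<omega> j \<cdot>\<^bsub>D\<^esub> f \<cdot>\<^bsub>D\<^esub> \<kappa> i) \<cdot>\<^bsub>D\<^esub> \<omega> i"
          using D.assoc[OF fk(1)[OF i] a'(2) a'(1)] D.assoc[OF a(2) D.arr_cmp[OF a(1) f] a'(2)] D.assoc[OF a(2) a(1) f]
          by simp
      qed
      finally have "f = (\<Sum>j\<in>?J. \<Sum>i\<in>?J. \<kappa> j \<cdot>\<^bsub>D\<^esub> (\<omega> j \<cdot>\<^bsub>D\<^esub> f \<cdot>\<^bsub>D\<^esub> \<kappa> i) \<cdot>\<^bsub>D\<^esub> \<omega> i)" .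
      moreover have "\<dots> \<in> D.V.span ?U"
        by (intro D.V.span_sum summand)
      ultimately show ?thesis
        by simp
    qed
    obtain B where B: "B \<subseteq> Hom E (tensor_power E X k) (tensor_power E X k)" "finite B" "\<not> D.V.dependent B"
        "(d (tensor_power E X k))\<^sup>2 \<le> b * card B"
      using sl.growth[OF PE[of k]] by auto
    have "arr D (?P k) (?P k) f" if "f \<in> B" for f
    proof -
      have "arr E (tensor_power E X k) (tensor_power E X k) f"
        using B(1) that PE by (auto simp: arr_def)
      then show ?thesis
        using arr_ED(5) fst_tensor_power by metis
    qed
    then have "B \<subseteq> D.V.span ?U"
      using span by blast
    then have "card B \<le> card ?U"
      using D.V.independent_span_bound[of ?U B] B(3) by auto
    also have "\<dots> \<le> card (?J \<times> ?J)"
      by (rule card_image_le) simp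
    also have "\<dots> = (?N ^ k)\<^sup>2"
      by (simp add: power2_eq_square)
    finally have "b * card B \<le> b * (?N ^ k)\<^sup>2"
      by simp
    then show ?thesis
      using B(4) unfolding dP by (rule order_trans[rotated])
  qed
  then show ?thesis
    by (rule power_growth)
qed

text \<open>Twisting multiplies \<open>d\<close> by the value at the twisted unit. The units twisted
  by a character and by its inverse have values with product 1, and both are natural
  numbers.\<close>

lemma d_twist:
  assumes sl: "symmetric_like E d V b" and \<chi>: "linear_character \<chi>" and P: "P \<in> Ob E"
  shows "d (twist \<chi> P) = d P"
proof -
  interpret sl: symmetric_like E d V b
    by fact
  let ?T = "\<lambda>\<chi>. twist \<chi> (unitO E)"
  have d: "d (twist \<psi> Q) = d (?T \<psi>) * d Q" if "linear_character \<psi>" "Q \<in> Ob E" for \<psi> Q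
    using sl.d_iso[OF twist_isomorphic[OF that]] sl.d_ten[OF twist_Ob[OF that(1) unit_E_Ob] that(2)] by simp
  let ?\<psi> = "\<lambda>g. 1 / \<chi> g"
  have \<psi>: "linear_character ?\<psi>"
    using \<chi> by (simp add: linear_character_def)
  have "twist \<chi> (?T ?\<psi>) = unitO E"
    using \<chi> unfolding twist_twist by (simp add: linear_character_def twist_1)
  then have "d (?T \<chi>) * d (?T ?\<psi>) = 1"
    using d[OF \<chi> twist_Ob[OF \<psi> unit_E_Ob]] sl.d_unit by simp
  then show ?thesis
    using d[OF \<chi> P] by simp
qed

lemma unit_not_isomorphic_twist:
  assumes "g \<in> carrier G" "\<chi> g \<noteq> \<psi> g"
  shows "\<not> isomorphic E (twist \<chi> (unitO E)) (twist \<psi> (unitO E))"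
proof
  assume "isomorphic E (twist \<chi> (unitO E)) (twist \<psi> (unitO E))"
  then obtain f h where fh: "inverse_pair E (twist \<chi> (unitO E)) (twist \<psi> (unitO E)) f h"
    unfolding isomorphic_iff by blast
  then have "f = 0"
    using hom_twist_unit[where \<chi> = \<chi> and \<psi> = \<psi> and g = g] S.unit_scalar_end assms by (simp add: inverse_pair_def)
  moreover have "h \<cdot>\<^bsub>D\<^esub> f = idm D (unitO D)" "arr D (unitO D) (unitO D) h"
    using fh arr_ED(5)[of "twist \<psi> (unitO E)" "twist \<chi> (unitO E)" h] by (simp_all add: inverse_pair_def)
  ultimately show False
    using D.cmp_zero_r S.unit_scalar_end by (simp add: scalar_end_def)
qed

text \<open>Otherwise the units twisted by 1, \<open>\<chi>\<close> and its square would be three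
  pairwise nonisomorphic objects of dimension 1.\<close>

lemma no_third_character:
  assumes sl: "symmetric_like E d V b" and \<chi>: "linear_character \<chi>"
    and g: "g \<in> carrier G" "\<chi> g \<noteq> 1" "(\<chi> g)\<^sup>2 \<noteq> 1"
  shows False
proof -
  interpret sl: symmetric_like E d V b
    by fact
  let ?T = "\<lambda>\<chi>. twist \<chi> (unitO E)" and ?\<chi>2 = "\<lambda>g. \<chi> g * \<chi> g"
  have \<chi>2: "linear_character ?\<chi>2" and one: "linear_character (\<lambda>g. 1)"
    using \<chi> by (auto simp: linear_character_def)
  have ne: "\<chi> g \<noteq> \<chi> g * \<chi> g"
    using g(2) \<chi> by (auto simp: linear_character_def)
  have "isomorphic E (?T (\<lambda>g. 1)) (?T \<chi>) \<or> isomorphic E (?T (\<lambda>g. 1)) (?T ?\<chi>2) \<or> isomorphic E (?T \<chi>) (?T ?\<chi>2)"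
    using \<chi> \<chi>2 one by (intro sl.one_dim) (simp_all add: twist_Ob unit_E_Ob d_twist[OF sl] sl.d_unit)
  then show False
    using unit_not_isomorphic_twist[OF g(1), of "\<lambda>g. 1" \<chi>] unit_not_isomorphic_twist[OF g(1), of "\<lambda>g. 1" ?\<chi>2]
      unit_not_isomorphic_twist[OF g(1), of \<chi> ?\<chi>2] g(2,3) ne by (simp add: power2_eq_square)
qed

end

section \<open>Equivariantization by a group of order two\<close>

locale sign_equivariant = schur_equivariant G D A
  for G :: "'g monoid" (structure) and D :: "('k::alg_closed_field, 'o, 'm::ab_group_add) moncat" and A +
  fixes g and \<chi> and d V b
  assumes carrier: "carrier G = {\<one>, g}" and g: "g \<noteq> \<one>" "g \<otimes> g = \<one>"
    and \<chi>: "linear_character \<chi>" "\<chi> g = -1" "(-1::'k) \<noteq> 1"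
    and sl: "symmetric_like E d V b"
    and biproducts: "\<lbrakk>X \<in> Ob D; Y \<in> Ob D\<rbrakk>
      \<Longrightarrow> \<exists>P \<iota> \<pi>. direct_sum D (UNIV :: bool set) (\<lambda>b. if b then X else Y) P \<iota> \<pi>"
begin

sublocale sl: symmetric_like E d V b
  by (rule sl)

lemma gG [simp]: "g \<in> carrier G"
  by (simp add: carrier)

text \<open>There is no nonzero map from the unit to its sign twist, so \<open>V_sign\<close>
  excludes nonzero maps from \<open>V\<close> to its own twist. Then every endomorphism of the
  underlying object is equivariant, hence a scalar.\<close>

lemma V_fst_scalar_end: "scalar_end D (fst V)"
proof -
  let ?T = "twist \<chi> (unitO E)"
  interpret E: linear_category E
    by (rule linear_category_E)
  have V: "V \<in> Ob E" "idm D (fst V) \<noteq> 0"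
    using sl.V_scalar_end by (simp_all add: scalar_end_def)
  have T: "?T \<in> Ob E" "d ?T = 1"
    using twist_Ob[OF \<chi>(1) unit_E_Ob] d_twist[OF sl \<chi>(1) unit_E_Ob] sl.d_unit by simp_all
  have "\<not> connected E (unitO E) ?T"
    using not_connected_twist_unit[OF S.unit_scalar_end gG, of "\<lambda>_. 1" \<chi>] \<chi>(2,3) by (simp add: twist_1)
  then have "\<not> connected E V (?T \<boxtimes>\<^bsub>E\<^esub> V)"
    using sl.V_sign T by blast
  then have "\<not> connected E V (twist \<chi> V)"
    using E.connected_iso[OF _ E.isomorphic_refl[OF V(1)] E.isomorphic_sym[OF twist_isomorphic[OF \<chi>(1) V(1)]]] by blast
  then have "arr E V V f" if "arr D (fst V) (fst V) f" for f
    using endomorphisms_equivariant[OF V(1) carrier g(2) \<chi>(1,2) _ that] by blast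
  then show ?thesis
    using sl.V_scalar_end Ob_E_fst[OF V(1)] by (simp add: scalar_end_def)
qed

lemma induced:
  assumes Y: "Y \<in> Ob D"
  obtains X \<iota> \<pi> where "X \<in> Ob E" "direct_sum D (carrier G) (\<lambda>g. \<rho> g Y) (fst X) \<iota> \<pi>"
proof -
  obtain P \<iota> \<pi> where P: "direct_sum D (UNIV :: bool set) (\<lambda>b. if b then \<rho> \<one> Y else \<rho> g Y) P \<iota> \<pi>"
    using biproducts[OF \<rho>_Ob[OF one_closed Y] \<rho>_Ob[OF gG Y]] by blast
  \<comment> \<open>Matches the two elements of the group with the Boolean indices of a
    biproduct.\<close>
  let ?h = "\<lambda>x. x = \<one>"
  have "bij_betw ?h (carrier G) UNIV"
    using g(1) by (auto simp: bij_betw_def inj_on_def carrier)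
  from D.direct_sum_reindex[OF P this]
  have "direct_sum D (carrier G) (\<lambda>x. if x = \<one> then \<rho> \<one> Y else \<rho> g Y) P (\<lambda>x. \<iota> (x = \<one>)) (\<lambda>x. \<pi> (x = \<one>))" .
  then have "direct_sum D (carrier G) (\<lambda>x. \<rho> x Y) P (\<lambda>x. \<iota> (x = \<one>)) (\<lambda>x. \<pi> (x = \<one>))"
    using g(1) by (simp add: direct_sum_def carrier)
  moreover from this obtain \<mu> where "(P, \<mu>) \<in> Ob E"
    using direct_sum_induced[OF _ Y] by blast
  ultimately show thesis
    using that[of "(P, \<mu>)"] by simp
qed

text \<open>The summand at the neutral element is isomorphic to \<open>Y\<close> by the unit
  isomorphism of the action. So every nonzero object maps nontrivially to one that underlies an
  equivariant object.\<close>

lemma induced_connected: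
  assumes Y: "Y \<in> Ob D" "idm D Y \<noteq> 0" and ds: "direct_sum D (carrier G) (\<lambda>g. \<rho> g Y) N \<iota> \<pi>"
  shows "connected D Y N" "isomorphic D Y (\<rho> \<one> Y)" "arr D (\<rho> \<one> Y) N (\<iota> \<one>)" "\<iota> \<one> \<noteq> 0"
proof -
  show iso: "isomorphic D Y (\<rho> \<one> Y)"
    using tinv_unA[OF Y(1)] unfolding isomorphic_iff tinv_iff by auto
  have ar: "arr D (\<rho> \<one> Y) N (\<iota> \<one>)" "arr D N (\<rho> \<one> Y) (\<pi> \<one>)" "\<pi> \<one> \<cdot>\<^bsub>D\<^esub> \<iota> \<one> = idm D (\<rho> \<one> Y)"
    using ds by (simp_all add: D.direct_sum_iff carrier)
  then show "arr D (\<rho> \<one> Y) N (\<iota> \<one>)"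
    by simp
  have "connected D Y Y"
    using Y D.arr_idm unfolding connected_def by blast
  then have "connected D (\<rho> \<one> Y) Y"
    using D.connected_iso[OF _ iso D.isomorphic_refl[OF Y(1)]] by blast
  then have "idm D (\<rho> \<one> Y) \<noteq> 0"
    using D.idr D.cmp_zero_r unfolding connected_def by metis
  then show nz: "\<iota> \<one> \<noteq> 0"
    using ar D.cmp_zero_r by metis
  then have "connected D (\<rho> \<one> Y) N"
    using ar(1) unfolding connected_def by blast
  then show "connected D Y N"
    using D.connected_iso[OF _ D.isomorphic_sym[OF iso] D.isomorphic_refl] ar(1) unfolding arr_def by blast
qed

text \<open>The object induced from an invertible object has dimension at most 2, so it is covered by the two
  one-dimensional objects, whose underlying object is the unit.\<close>

lemma invertible_connected_unit:
  assumes L: "invertible_object D L" "idm D L \<noteq> 0"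
  shows "connected D L (unitO D)"
proof -
  have Lo: "L \<in> Ob D"
    using L(1) by (simp add: invertible_object_def)
  obtain X \<iota> \<pi> where X: "X \<in> Ob E" and ds: "direct_sum D (carrier G) (\<lambda>g. \<rho> g L) (fst X) \<iota> \<pi>"
    using induced[OF Lo] .
  have inv: "invertible_object D (\<rho> x L)" if "x \<in> carrier G" for x
  proof -
    interpret linear_tensor_equivalence D D "rho A x"
      by (intro linear_tensor_equivalence.intro linear_tensor_equivalence_axioms.intro rho_linear that
          D.linear_tensor_axioms unit_Ob ten_Ob)
    show ?thesis
      using L(1) F_invertible unfolding invertible_object_def by metis
  qed
  have "card (carrier G) = 2"
    using g(1) by (simp add: carrier)
  then have "d X \<le> 2"
    using dimension_le_invertibles[OF sl X ds inv] by simp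
  then have "factors_through E (\<lambda>T. d T = 1) X"
    by (rule sl.two_dim[OF X])
  \<comment> \<open>Of the unit, its sign twist and \<open>T\<close>, two are isomorphic, and these
    are not the first two; so \<open>T\<close> has the unit as underlying object.\<close>
  moreover have "isomorphic D (fst T) (unitO D)" if T: "T \<in> Ob E" "d T = 1" for T
  proof -
    let ?T = "\<lambda>\<chi>. twist \<chi> (unitO E)"
    have "isomorphic E (?T (\<lambda>_. 1)) (?T \<chi>) \<or> isomorphic E (?T (\<lambda>_. 1)) T \<or> isomorphic E (?T \<chi>) T"
      using T \<chi>(1) by (intro sl.one_dim) (simp_all add: twist_1 twist_Ob unit_E_Ob d_twist[OF sl] sl.d_unit)
    then obtain \<psi> where "isomorphic E (?T \<psi>) T"
      using unit_not_isomorphic_twist[OF gG, of "\<lambda>_. 1" \<chi>] \<chi>(2,3) by auto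
    then obtain f h where "inverse_pair E (?T \<psi>) T f h"
      unfolding isomorphic_iff by blast
    then have "inverse_pair D (unitO D) (fst T) f h"
      using arr_ED(5)[of "?T \<psi>" T f] arr_ED(5)[of T "?T \<psi>" h] by (simp add: inverse_pair_def)
    then show ?thesis
      using D.isomorphic_sym unfolding isomorphic_iff by blast
  qed
  ultimately have ft: "factors_through D (\<lambda>T. isomorphic D T (unitO D)) (fst X)"
  proof -
    obtain N :: nat and T a c where f: "\<forall>i<N. d (T i) = 1 \<and> arr E (T i) X (a i) \<and> arr E X (T i) (c i)"
        "(\<Sum>i<N. a i \<cdot>\<^bsub>D\<^esub> c i) = idm D (fst X)"
      using \<open>factors_through E (\<lambda>T. d T = 1) X\<close> unfolding factors_through_def by auto
    show ?thesis
    proof (rule D.factors_throughI[of "{..<N}"])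
      fix i assume i: "i \<in> {..<N}"
      then show "arr D (fst (T i)) (fst X) (a i)" "arr D (fst X) (fst (T i)) (c i)"
        using f(1) arr_ED(5) by blast+
      show "isomorphic D (fst (T i)) (unitO D)"
        using f(1) i \<open>\<And>T. T \<in> Ob E \<Longrightarrow> d T = 1 \<Longrightarrow> isomorphic D (fst T) (unitO D)\<close> unfolding arr_def by blast
    qed (use f in simp_all)
  qed
  note ic = induced_connected[OF Lo L(2) ds]
  obtain T v where T: "isomorphic D T (unitO D)" and v: "arr D (fst X) T v" "v \<cdot>\<^bsub>D\<^esub> \<iota> \<one> \<noteq> 0"
    using D.factors_through_nonzero[OF ft ic(3,4)] by metis
  have "connected D (\<rho> \<one> L) T"
    using D.arr_cmp[OF ic(3) v(1)] v(2) unfolding connected_def by blast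
  then show ?thesis
    using D.connected_iso D.isomorphic_sym[OF ic(2)] T by blast
qed

end

text \<open>A root of 1 + x + ... + x^(p-1). It is not 1, where the sum has the value p, nonzero in
  characteristic 0.\<close>

lemma nontrivial_root_of_unity:
  assumes "prime (p::nat)"
  obtains \<zeta> :: "'k::{alg_closed_field, field_char_0}" where "\<zeta> ^ p = 1" "\<zeta> \<noteq> 1"
proof -
  have p: "p \<ge> 2"
    using assms by (rule prime_ge_2_nat)
  then obtain \<zeta> :: 'k where "(\<Sum>k\<le>p - 1. 1 * \<zeta> ^ k) = 0"
    using alg_closed[of "p - 1" "\<lambda>_. 1 :: 'k"] by auto
  moreover have "{..p - 1} = {..<p}"
    using p by auto
  ultimately have z: "(\<Sum>k<p. \<zeta> ^ k) = 0"
    by simp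
  have "\<zeta> \<noteq> 1"
  proof
    assume "\<zeta> = 1"
    then show False
      using z p by simp
  qed
  moreover have "\<zeta> ^ p - 1 = 0"
    unfolding power_diff_1_eq z by simp
  ultimately show thesis
    using that by simp
qed

section \<open>The members of a solvable chain\<close>

lemma schur_equivariantI:
  fixes D :: "('k::alg_closed_field, 'o, 'm::ab_group_add) moncat"
  assumes "fusion_category D" "group_action_on_category G D A"
  shows "schur_equivariant G D A"
  using assms fusion_category.axioms(2) fusion_schur_tensor
  by (intro schur_equivariant.intro equivariant.intro) auto

lemma fusion_tensor_equivalence:
  fixes D :: "('k::alg_closed_field, 'p, 'w::ab_group_add) moncat" and E :: "('k, 'o, 'm::ab_group_add) moncat"
  assumes "linear_category E" "unitO E \<in> Ob E" "\<And>X Y. X \<in> Ob E \<Longrightarrow> Y \<in> Ob E \<Longrightarrow> X \<boxtimes>\<^bsub>E\<^esub> Y \<in> Ob E"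
    and "fusion_category D" "tensor_equivalence E D F"
  shows "linear_tensor_equivalence E D F"
proof -
  interpret schur_tensor D
    using assms(4) by (rule fusion_schur_tensor)
  show ?thesis
    by (intro linear_tensor_equivalence.intro linear_equivalence.intro linear_tensor_equivalence_axioms.intro
        assms linear_category_axioms linear_tensor_axioms)
qed

lemma fusion_tensor_equivalence':
  fixes C :: "('k::alg_closed_field, 'p, 'w::ab_group_add) moncat" and D :: "('k, 'o, 'm::ab_group_add) moncat"
  assumes "fusion_category C" "fusion_category D" "tensor_equivalence C D F"
  shows "linear_tensor_equivalence C D F"
proof -
  interpret schur_tensor C
    using assms(1) by (rule fusion_schur_tensor)
  show ?thesis
    using fusion_tensor_equivalence[OF linear_category_axioms unit_Ob ten_Ob assms(2,3)] .
qed

lemma (in schur_equivariant) equivariantization_equivalence: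
  assumes "fusion_category D'" "tensor_equivalence E D' F"
  shows "linear_tensor_equivalence E D' F"
  by (rule fusion_tensor_equivalence[OF linear_category_E unit_E_Ob ten_E_Ob assms])

text \<open>A nonzero object corresponds to a nonempty basis, and each basis vector is a nonzero map
  from the unit.\<close>

lemma connected_unit_Vect:
  fixes D :: "('k::alg_closed_field, 'o, 'm::ab_group_add) moncat"
  assumes D: "fusion_category D" and F: "tensor_equivalent D (Vect :: ('k, nat set, nat \<Rightarrow> nat \<Rightarrow> 'k) moncat)"
    and Y: "Y \<in> Ob D" "idm D Y \<noteq> 0"
  shows "connected D (unitO D) Y"
proof -
  interpret S: schur_tensor D
    using D by (rule fusion_schur_tensor)
  obtain F where "tensor_equivalence D (Vect :: ('k, nat set, nat \<Rightarrow> nat \<Rightarrow> 'k) moncat) F"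
    using assms(2) unfolding tensor_equivalent_def by blast
  then interpret L: linear_tensor_equivalence D "Vect :: ('k, nat set, nat \<Rightarrow> nat \<Rightarrow> 'k) moncat" F
    by (intro linear_tensor_equivalence.intro linear_equivalence.intro linear_tensor_equivalence_axioms.intro
        S.linear_category_axioms linear_tensor_Vect linear_category_Vect S.unit_Ob S.ten_Ob)
  let ?B = "obF F Y"
  have B: "finite ?B"
    using L.obF_Ob[OF Y(1)] by simp
  have "idm Vect ?B \<noteq> (0 :: nat \<Rightarrow> nat \<Rightarrow> 'k)"
  proof
    assume "idm Vect ?B = (0 :: nat \<Rightarrow> nat \<Rightarrow> 'k)"
    then have "morF F Y Y (idm D Y) = morF F Y Y 0"
      using L.morF_idm[OF Y(1)] L.F_zero[OF Y(1) Y(1)] by simp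
    then show False
      using L.F_inj[OF S.arr_idm[OF Y(1)] S.arr_zero[OF Y(1) Y(1)]] Y(2) by simp
  qed
  then have "?B \<noteq> {}"
    by (auto simp: fun_eq_iff idm_Vect)
  then obtain b where b: "b \<in> ?B"
    by blast
  let ?f = "\<lambda>i j. if i = b \<and> j = (0::nat) then 1 else 0 :: 'k"
  have "arr Vect {0} ?B ?f"
    using b B by (auto simp: arr_Vect_iff)
  moreover have "?f \<noteq> 0"
    by (auto simp: fun_eq_iff)
  ultimately have "connected (Vect :: ('k, nat set, nat \<Rightarrow> nat \<Rightarrow> 'k) moncat) {0} ?B"
    unfolding connected_def by blast
  moreover have "unitO (Vect :: ('k, nat set, nat \<Rightarrow> nat \<Rightarrow> 'k) moncat) = {0}"
    by (simp add: Vect_def)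
  ultimately have "connected (Vect :: ('k, nat set, nat \<Rightarrow> nat \<Rightarrow> 'k) moncat) (obF F (unitO D)) ?B"
    using Vect.connected_iso[OF _ L.F_unit Vect.isomorphic_refl[of ?B]] B by simp
  then show ?thesis
    using L.F_connected[OF S.unit_Ob Y(1)] by simp
qed

lemma Vect_scalar_end:
  fixes D :: "('k::alg_closed_field, 'o, 'm::ab_group_add) moncat"
  assumes "fusion_category D" "tensor_equivalent D (Vect :: ('k, nat set, nat \<Rightarrow> nat \<Rightarrow> 'k) moncat)"
    and Y: "scalar_end D Y"
  shows "isomorphic D (unitO D) Y"
proof -
  interpret S: schur_tensor D
    using assms(1) by (rule fusion_schur_tensor)
  show ?thesis
    using S.scalar_end_isomorphic[OF S.unit_simple Y] connected_unit_Vect[OF assms(1,2)] Y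
    by (simp add: scalar_end_def)
qed

text \<open>The character of the cyclic group sending the generator 1 to \<open>\<zeta>\<close>; the
  elements of the group are the integers from 0 to p - 1, and negative integers get the value
  1.\<close>

definition root_character :: "'k::field \<Rightarrow> int \<Rightarrow> 'k"
  where "root_character \<zeta> x = \<zeta> ^ nat x"

lemma root_character_mult:
  assumes "\<zeta> ^ p = 1" "p > 0" "x \<in> carrier (integer_mod_group p)" "y \<in> carrier (integer_mod_group p)"
  shows "root_character \<zeta> (x \<otimes>\<^bsub>integer_mod_group p\<^esub> y) = root_character \<zeta> x * root_character \<zeta> y"
proof -
  have xy: "x \<ge> 0" "y \<ge> 0"
    using assms by (simp_all add: carrier_integer_mod_group)
  have "nat ((x + y) mod int p) = (nat x + nat y) mod p"
    using xy by (simp add: nat_mod_distrib nat_add_distrib)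
  moreover have "\<zeta> ^ (k mod p) = \<zeta> ^ k" for k
  proof -
    have "\<zeta> ^ k = (\<zeta> ^ p) ^ (k div p) * \<zeta> ^ (k mod p)"
      by (simp add: power_mult[symmetric] power_add[symmetric])
    then show ?thesis
      using assms(1) by simp
  qed
  ultimately show ?thesis
    by (simp add: root_character_def power_add)
qed

lemma (in schur_equivariant) twist_unit_invertible:
  assumes "linear_character \<chi>"
  shows "\<exists>Y\<in>Ob E. isomorphic E (twist \<chi> (unitO E) \<boxtimes>\<^bsub>E\<^esub> Y) (unitO E) \<and> isomorphic E (Y \<boxtimes>\<^bsub>E\<^esub> twist \<chi> (unitO E)) (unitO E)"
proof -
  let ?T = "\<lambda>\<chi>. twist \<chi> (unitO E)"
  let ?\<psi> = "\<lambda>g. 1 / \<chi> g"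
  have \<psi>: "linear_character ?\<psi>"
    using assms by (simp add: linear_character_def)
  have "twist \<chi> (?T ?\<psi>) = unitO E" "twist ?\<psi> (?T \<chi>) = unitO E"
    using assms unfolding twist_twist by (simp_all add: linear_character_def twist_1)
  then show ?thesis
    using twist_isomorphic[OF assms twist_Ob[OF \<psi> unit_E_Ob]] twist_isomorphic[OF \<psi> twist_Ob[OF assms unit_E_Ob]]
      twist_Ob[OF \<psi> unit_E_Ob] by auto
qed

text \<open>The contradiction is already reached in the last two steps of the chain: each kind of
  step, as well as a chain ending at \<open>Vect\<close> too early, is excluded.\<close>

lemma symmetric_like_not_solvable:
  fixes D :: "nat \<Rightarrow> ('k::{alg_closed_field, field_char_0}, 'p, 'w::ab_group_add) moncat"
  assumes fus: "\<And>i. i \<le> n \<Longrightarrow> fusion_category (D i)"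
    and D0: "tensor_equivalent (D 0) (Vect :: ('k, nat set, nat \<Rightarrow> nat \<Rightarrow> 'k) moncat)"
    and chain: "\<And>i. i < n \<Longrightarrow> \<exists>p::nat. prime p \<and>
      (is_equivariantization (integer_mod_group p) (D i) (D (Suc i)) \<or>
       is_extension (integer_mod_group p) (D i) (D (Suc i)))"
    and sl: "symmetric_like (D n) d V b"
  shows False
proof (cases n)
  case 0
  interpret sl: symmetric_like "D 0" d V b
    using sl 0 by simp
  have "isomorphic (D 0) (unitO (D 0)) V"
    using Vect_scalar_end[OF fus D0 sl.V_scalar_end] by simp
  then show False
    using sl.d_iso sl.d_unit sl.V_dim by fastforce
next
  case (Suc m)
  have fm: "fusion_category (D m)" and fn: "fusion_category (D n)"
    using fus Suc by simp_all
  have nontriv: "1 \<in> carrier (integer_mod_group p)" "1 \<noteq> \<one>\<^bsub>integer_mod_group p\<^esub>" if "prime p" for p :: nat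
    using prime_ge_2_nat[OF that] by (simp_all add: carrier_integer_mod_group)
  obtain p :: nat where p: "prime p" and step: "is_equivariantization (integer_mod_group p) (D m) (D n) \<or>
      is_extension (integer_mod_group p) (D m) (D n)"
    using chain[of m] Suc by auto
  let ?G = "integer_mod_group p"
  show False
  proof (cases "is_extension ?G (D m) (D n)")
    case True
    interpret S: schur_tensor "D n"
      using fn by (rule fusion_schur_tensor)
    interpret sl: symmetric_like "D n" d V b
      by fact
    show False
    proof (rule graded_contradiction[OF S.schur_tensor_axioms fusion_category.axioms(2)[OF fn] True nontriv[OF p] sl, of "\<lambda>X. X"])
      show "\<exists>X\<in>Ob (D n). connected (D n) Y X" if "Y \<in> Ob (D n)" "idm (D n) Y \<noteq> 0" for Y
        using that S.arr_idm unfolding connected_def by blast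
    qed (simp_all add: sl.V_scalar_end)
  next
    case False
    then obtain A F where A: "group_action_on_category ?G (D m) A"
      and F: "tensor_equivalence (equivariantization ?G (D m) A) (D n) F"
      using step unfolding is_equivariantization_def tensor_equivalent_def by blast
    interpret X: schur_equivariant ?G "D m" A
      using fm A by (rule schur_equivariantI)
    obtain d' V' where sl': "symmetric_like X.E d' V' b"
      using linear_tensor_equivalence.symmetric_like_transport[OF X.equivariantization_equivalence[OF fn F] sl] by blast
    interpret sl': symmetric_like X.E d' V' b
      by fact
    obtain \<zeta> :: 'k where \<zeta>: "\<zeta> ^ p = 1" "\<zeta> \<noteq> 1"
      using nontrivial_root_of_unity[OF p] .
    have p0: "p > 0"
      using p by (rule prime_gt_0_nat)
    have "\<zeta> \<noteq> 0"
      using \<zeta>(1) p0 by (auto simp: power_0_left)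
    then have \<chi>: "X.linear_character (root_character \<zeta>)"
      using root_character_mult[OF \<zeta>(1) p0] by (simp add: X.linear_character_def root_character_def)
    have \<chi>1: "root_character \<zeta> 1 = \<zeta>"
      by (simp add: root_character_def)
    have "\<zeta>\<^sup>2 = 1"
      using X.no_third_character[OF sl' \<chi> nontriv(1)[OF p]] \<zeta>(2) \<chi>1 by auto
    \<comment> \<open>An odd power of \<open>\<zeta>\<close> equals \<open>\<zeta>\<close> since its
      square is 1, so an odd p would give \<open>\<zeta> = 1\<close>.\<close>
    have "p = 2"
    proof (rule ccontr)
      assume "p \<noteq> 2"
      then have "odd p"
        using p prime_odd_nat[of p] prime_ge_2_nat[OF p] by auto
      then obtain k where "p = Suc (2 * k)"
        by (auto elim: oddE)
      then have "\<zeta> ^ p = \<zeta> * (\<zeta>\<^sup>2) ^ k"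
        by (simp add: power_mult)
      then show False
        using \<zeta> \<open>\<zeta>\<^sup>2 = 1\<close> by simp
    qed
    have \<zeta>m: "\<zeta> = -1"
      using \<open>\<zeta>\<^sup>2 = 1\<close> \<zeta>(2) by (simp add: power2_eq_1_iff)
    interpret Y: sign_equivariant ?G "D m" A 1 "root_character \<zeta>" d' V' b
    proof (intro sign_equivariant.intro sign_equivariant_axioms.intro X.schur_equivariant_axioms \<chi> sl')
      show "carrier ?G = {\<one>\<^bsub>?G\<^esub>, 1}"
        using \<open>p = 2\<close> by (auto simp: carrier_integer_mod_group)
      show "1 \<noteq> \<one>\<^bsub>?G\<^esub>" "1 \<otimes>\<^bsub>?G\<^esub> 1 = \<one>\<^bsub>?G\<^esub>"
        using \<open>p = 2\<close> by simp_all
      show "root_character \<zeta> 1 = -1" "(-1 :: 'k) \<noteq> 1"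
        using \<chi>1 \<zeta>m \<zeta>(2) by simp_all
      show "\<exists>P \<iota> \<pi>. direct_sum (D m) (UNIV :: bool set) (\<lambda>b. if b then X else Y) P \<iota> \<pi>"
        if "X \<in> Ob (D m)" "Y \<in> Ob (D m)" for X Y
        using abelian_category.biproducts[OF semisimple_category.axioms(1)[OF fusion_category.axioms(1)[OF fm]] that] .
    qed
    have V: "V' \<in> Ob X.E" "scalar_end (D m) (fst V')"
      using sl'.V_scalar_end Y.V_fst_scalar_end by (simp_all add: scalar_end_def)
    show False
    proof (cases m)
      case 0
      then have "isomorphic (D m) (unitO (D m)) (fst V')"
        using Vect_scalar_end[OF fm _ V(2)] D0 by simp
      then have inv: "invertible_object (D m) (fst V')"
        by (rule X.D.invertible_iso[OF X.D.invertible_unit])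
      have Vo: "fst V' \<in> Ob (D m)"
        using V(2) by (simp add: scalar_end_def)
      \<comment> \<open>The object underlying \<open>V'\<close> is a sum of a single invertible
        object, so comparison of growth bounds its dimension by 1.\<close>
      have "direct_sum (D m) {()} (\<lambda>_. fst V') (fst V') (\<lambda>_. idm (D m) (fst V')) (\<lambda>_. idm (D m) (fst V'))"
        using Vo X.D.idl[OF X.D.arr_idm[OF Vo]] by (simp add: X.D.direct_sum_iff X.D.arr_idm)
      then have "d' V' \<le> 1"
        using X.dimension_le_invertibles[OF sl' V(1)] inv by fastforce
      then show False
        using sl'.V_dim by simp
    next
      case (Suc j)
      have fj: "fusion_category (D j)"
        using fus Suc \<open>n = Suc m\<close> by simp
      obtain q :: nat where q: "prime q" and step: "is_equivariantization (integer_mod_group q) (D j) (D m) \<or>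
          is_extension (integer_mod_group q) (D j) (D m)"
        using chain[of j] Suc \<open>n = Suc m\<close> by auto
      let ?Q = "integer_mod_group q"
      show False
      proof (cases "is_extension ?Q (D j) (D m)")
        case True
        show False
        proof (rule graded_contradiction[OF X.S.schur_tensor_axioms X.D.monoidal_category_axioms True nontriv[OF q] sl', of fst])
          \<comment> \<open>Induction shows that the forgetful functor reaches every nonzero object
            by a nonzero morphism.\<close>
          show "\<exists>X\<in>Ob X.E. connected (D m) Y (fst X)" if "Y \<in> Ob (D m)" "idm (D m) Y \<noteq> 0" for Y
            using Y.induced[OF that(1)] Y.induced_connected(1)[OF that] by metis
        qed (use V(2) X.arr_ED(5) in simp_all)
      next
        case False
        then obtain B H where B: "group_action_on_category ?Q (D j) B"
          and H: "tensor_equivalence (equivariantization ?Q (D j) B) (D m) H"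
          using step unfolding is_equivariantization_def tensor_equivalent_def by blast
        interpret Z: schur_equivariant ?Q "D j" B
          using fj B by (rule schur_equivariantI)
        interpret H: linear_tensor_equivalence Z.E "D m" H
          using Z.equivariantization_equivalence[OF fm H] .
        obtain \<xi> :: 'k where \<xi>: "\<xi> ^ q = 1" "\<xi> \<noteq> 1"
          using nontrivial_root_of_unity[OF q] .
        have q0: "q > 0"
          using q by (rule prime_gt_0_nat)
        have "\<xi> \<noteq> 0"
          using \<xi>(1) q0 by (auto simp: power_0_left)
        then have \<psi>: "Z.linear_character (root_character \<xi>)"
          using root_character_mult[OF \<xi>(1) q0] by (simp add: Z.linear_character_def root_character_def)
        let ?T = "Z.twist (root_character \<xi>) (unitO Z.E)"
        let ?L = "obF H ?T"
        have T: "?T \<in> Ob Z.E"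
          by (rule Z.twist_Ob[OF \<psi> Z.unit_E_Ob])
        \<comment> \<open>A nontrivial character of the second cyclic group provides an invertible
          object of \<open>D m\<close> with no nonzero map to the unit, whereas the sign
          equivariantization above forces such a map.\<close>
        have L: "invertible_object (D m) ?L"
          using H.F_invertible[OF T] Z.twist_unit_invertible[OF \<psi>] by blast
        have "idm (D m) ?L \<noteq> 0"
          using X.D.invertible_scalar_end[OF X.S.unit_scalar_end L] by (simp add: scalar_end_def)
        then have "connected (D m) ?L (unitO (D m))"
          using Y.invertible_connected_unit[OF L] by simp
        then have "connected (D m) ?L (obF H (unitO Z.E))"
          using X.D.connected_iso[OF _ X.D.isomorphic_refl H.F_unit] L by (simp add: invertible_object_def)
        then have "connected Z.E ?T (unitO Z.E)"
          using H.F_connected[OF T Z.unit_E_Ob] by simp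
        then show False
          using Z.not_connected_twist_unit[OF Z.S.unit_scalar_end nontriv(1)[OF q], of "root_character \<xi>" "\<lambda>_. 1"] \<xi>(2)
          by (simp add: Z.twist_1 root_character_def)
      qed
    qed
  qed
qed

theorem corollary3p7:
  fixes C :: "('k::{alg_closed_field, field_char_0}, 'o, 'm::ab_group_add) moncat"
    and n :: nat
  assumes "n \<ge> 5"
    and "fusion_category C"
    and "Grothendieck_equivalent C (Rep (sym_group n) ::
      ('k, nat set \<times> ((nat \<Rightarrow> nat) \<Rightarrow> nat \<Rightarrow> nat \<Rightarrow> 'k), nat \<Rightarrow> nat \<Rightarrow> 'k) moncat)"
  shows "\<not> solvable_category TYPE('p \<times> 'w::ab_group_add) C"
proof
  assume "solvable_category TYPE('p \<times> 'w) C"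
  then obtain N and D :: "nat \<Rightarrow> ('k, 'p, 'w) moncat" where D: "\<And>i. i \<le> N \<Longrightarrow> fusion_category (D i)"
      "tensor_equivalent (D 0) (Vect :: ('k, nat set, nat \<Rightarrow> nat \<Rightarrow> 'k) moncat)"
      "\<And>i. i < N \<Longrightarrow> \<exists>p::nat. prime p \<and>
        (is_equivariantization (integer_mod_group p) (D i) (D (Suc i)) \<or>
         is_extension (integer_mod_group p) (D i) (D (Suc i)))"
      "tensor_equivalent (D N) C"
    unfolding solvable_category_def by blast
  obtain d V b where "symmetric_like C d V b"
    using Grothendieck_symmetric_like[OF assms] by blast
  moreover obtain F where "tensor_equivalence (D N) C F"
    using D(4) unfolding tensor_equivalent_def by blast
  \<comment> \<open>The equivalence goes from the last member of the chain to \<open>C\<close>, so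
    the structure is pulled back along it.\<close>
  ultimately obtain d' W where "symmetric_like (D N) d' W b"
    using linear_tensor_equivalence.symmetric_like_transport[OF fusion_tensor_equivalence'[OF D(1)[OF order_refl] assms(2)]]
    by blast
  from D(1-3) this show False
    by (rule symmetric_like_not_solvable)
qed

end
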